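(* Let $\kappa$ be differentiable with $\kappa'\in W^{1,1}(\mathbb R)$ and suppose there are constants $c_1,c_0>0$ such that $|\kappa''(y)|\le c_1|y|^\varrho+c_0$ for all $y\in\mathbb R$, where $\varrho$ is a fixed value with $\varrho\in[1,\infty)$ if $N=2$ and $\varrho\in[1,3]$ if $N=3$. For given $M>0$ and $q_1,q_2\in H^1(0,T;H^1(\Omega))$ with $\|q_i\|_{H^1(0,T;H^1(\Omega))}\le M$, $i=1,2$, it holds $$\int_0^t-\big\langle(\kappa\circ\mathcal H)(q_2)(s)-(\kappa\circ\mathcal H)(q_1)(s),\,\dot q_2(s)-\dot q_1(s)\big\rangle_{H^1(\Omega)}\,ds\le\frac\alpha4\|(q_2-q_1)(t)\|^2_{L^2(\Omega)}+c\int_0^t\|(q_2-q_1)(s)\|^2_{L^6(\Omega)}\,ds$$ for all $t\in[0,T]$, where $c>0$ is a constant depending only on $L_\kappa,\alpha,T,\varrho$ and $M$ (and the fixed data of the problem).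
   Context: $T>0$ is fixed, $\Omega\subset\mathbb R^N$, $N\in\{2,3\}$, is a bounded Lipschitz domain; $\alpha>0$ is a fixed constant (in the paper, the uniform convexity constant of the energy). $\kappa:\mathbb R\to[0,\infty)$ is Lipschitz continuous with Lipschitz constant $L_\kappa>0$; the associated Nemytskii operator is denoted by the same symbol. The history operator is $\mathcal H:L^1(0,T;H^1(\Omega))\to W^{1,1}(0,T;H^1(\Omega))$, $\mathcal H(y)(t):=\int_0^ty(s)\,ds+y_0$, with fixed $y_0\in H^1(\Omega)$. $(\kappa\circ\mathcal H)(q)(s)=\kappa(\mathcal H(q)(s))\in L^2(\Omega)$ is viewed as an element of $H^1(\Omega)^*$, so that the pairing $\langle\cdot,\cdot\rangle_{H^1(\Omega)}$ is the $L^2(\Omega)$ inner product here. "Fixed data" are $\Omega$, $N$, $y_0$ and the growth constants $c_1,c_0$; $c$ does not depend on $q_1,q_2$ or $t$. *)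

theory Defs
  imports "HOL-Analysis.Analysis"
begin

section \<open>Square-integrable functions modulo equality almost everywhere\<close>

definition square_integrable :: "('a::euclidean_space \<Rightarrow> 'b::euclidean_space) \<Rightarrow> bool" where
  "square_integrable f \<longleftrightarrow> f \<in> borel_measurable lborel \<and> integrable lborel (\<lambda>x. (norm (f x))\<^sup>2)"

lemma square_integrable_measurable [measurable_dest]:
  "square_integrable f \<Longrightarrow> f \<in> borel_measurable lborel"
  by (simp add: square_integrable_def)

lemma square_integrable_iff_nn:
  "square_integrable f \<longleftrightarrow> f \<in> borel_measurable lborel \<and> (\<integral>\<^sup>+x. ennreal ((norm (f x))\<^sup>2) \<partial>lborel) < \<infinity>"
  by (auto simp: square_integrable_def integrable_iff_bounded)

lemma square_integrable_zero: "square_integrable (\<lambda>x. 0)"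
  by (simp add: square_integrable_def)

lemma norm_add_sq_le: "(norm (a + b))\<^sup>2 \<le> 2 * (norm a)\<^sup>2 + 2 * (norm (b::'b::real_normed_vector))\<^sup>2"
proof -
  have "(norm (a + b))\<^sup>2 \<le> (norm a + norm b)\<^sup>2"
    by (intro power_mono norm_triangle_ineq) simp
  also have "\<dots> \<le> 2 * (norm a)\<^sup>2 + 2 * (norm b)\<^sup>2"
    using sum_squares_bound[of "norm a" "norm b"] unfolding power2_sum by linarith
  finally show ?thesis .
qed

lemma square_integrable_add:
  assumes "square_integrable f" "square_integrable g"
  shows "square_integrable (\<lambda>x. f x + g x)"
proof -
  have [measurable]: "f \<in> borel_measurable lborel" "g \<in> borel_measurable lborel"
    using assms by (auto simp: square_integrable_def)
  have "integrable lborel (\<lambda>x. (norm (f x + g x))\<^sup>2)"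
  proof (rule Bochner_Integration.integrable_bound)
    show "integrable lborel (\<lambda>x. 2 * (norm (f x))\<^sup>2 + 2 * (norm (g x))\<^sup>2)"
      using assms by (simp add: square_integrable_def)
  qed (simp_all add: norm_add_sq_le)
  then show ?thesis by (simp add: square_integrable_def)
qed

lemma square_integrable_scaleR:
  "square_integrable f \<Longrightarrow> square_integrable (\<lambda>x. c *\<^sub>R f x)"
  by (auto simp: square_integrable_def power_mult_distrib)

lemma square_integrable_uminus:
  "square_integrable f \<Longrightarrow> square_integrable (\<lambda>x. - f x)"
  by (auto simp: square_integrable_def)

lemma square_integrable_diff:
  assumes "square_integrable f" "square_integrable g"
  shows "square_integrable (\<lambda>x. f x - g x)"
  using square_integrable_add[OF assms(1) square_integrable_uminus[OF assms(2)]] by simp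

lemma square_integrable_inner:
  assumes "square_integrable f" "square_integrable g"
  shows "integrable lborel (\<lambda>x. f x \<bullet> g x)"
proof -
  have [measurable]: "f \<in> borel_measurable lborel" "g \<in> borel_measurable lborel"
    using assms by (auto simp: square_integrable_def)
  show ?thesis
  proof (rule Bochner_Integration.integrable_bound)
    show "integrable lborel (\<lambda>x. (norm (f x))\<^sup>2 + (norm (g x))\<^sup>2)"
      using assms by (simp add: square_integrable_def)
    show "AE x in lborel. norm (f x \<bullet> g x) \<le> norm ((norm (f x))\<^sup>2 + (norm (g x))\<^sup>2)"
    proof (rule AE_I2)
      fix x
      have "\<bar>f x \<bullet> g x\<bar> \<le> norm (f x) * norm (g x)"
        by (rule Cauchy_Schwarz_ineq2)
      also have "\<dots> \<le> 2 * norm (f x) * norm (g x)" by simp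
      also have "\<dots> \<le> (norm (f x))\<^sup>2 + (norm (g x))\<^sup>2"
        by (rule sum_squares_bound)
      finally show "norm (f x \<bullet> g x) \<le> norm ((norm (f x))\<^sup>2 + (norm (g x))\<^sup>2)" by simp
    qed
  qed measurable
qed

text \<open>Lebesgue measurable functions agree almost everywhere with Borel measurable ones, so working
  over \<^const>\<open>lborel\<close> yields the usual space \<open>L\<^sup>2\<close>. The instances for \<^class>\<open>banach\<close> and
  \<^class>\<open>second_countable_topology\<close> below make the library's Bochner integral available for
  functions with values in this space.\<close>

quotient_type (overloaded) ('a, 'b) L2 = "'a::euclidean_space \<Rightarrow> 'b::euclidean_space" / partial:
  "\<lambda>f g. square_integrable f \<and> square_integrable g \<and> (AE x in lborel. f x = g x)"
proof (rule part_equivpI)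
  show "\<exists>f::'a \<Rightarrow> 'b. square_integrable f \<and> square_integrable f \<and> (AE x in lborel. f x = f x)"
    using square_integrable_zero by auto
qed (auto intro!: sympI transpI)

instantiation L2 :: (euclidean_space, euclidean_space) real_inner
begin

lift_definition zero_L2 :: "('a, 'b) L2" is "\<lambda>x. 0"
  by (simp add: square_integrable_zero)

lift_definition plus_L2 :: "('a, 'b) L2 \<Rightarrow> ('a, 'b) L2 \<Rightarrow> ('a, 'b) L2" is "\<lambda>f g x. f x + g x"
  by (auto simp: square_integrable_add)

lift_definition uminus_L2 :: "('a, 'b) L2 \<Rightarrow> ('a, 'b) L2" is "\<lambda>f x. - f x"
  by (auto simp: square_integrable_uminus)

lift_definition minus_L2 :: "('a, 'b) L2 \<Rightarrow> ('a, 'b) L2 \<Rightarrow> ('a, 'b) L2" is "\<lambda>f g x. f x - g x"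
  by (auto simp: square_integrable_diff)

lift_definition scaleR_L2 :: "real \<Rightarrow> ('a, 'b) L2 \<Rightarrow> ('a, 'b) L2" is "\<lambda>c f x. c *\<^sub>R f x"
  by (auto simp: square_integrable_scaleR)

lift_definition inner_L2 :: "('a, 'b) L2 \<Rightarrow> ('a, 'b) L2 \<Rightarrow> real" is "\<lambda>f g. LINT x|lborel. f x \<bullet> g x"
  by (rule integral_cong_AE) (auto simp: square_integrable_def)

definition norm_L2 :: "('a, 'b) L2 \<Rightarrow> real" where "norm_L2 u = sqrt (u \<bullet> u)"
definition dist_L2 :: "('a, 'b) L2 \<Rightarrow> ('a, 'b) L2 \<Rightarrow> real" where "dist_L2 u v = norm (u - v)"
definition sgn_L2 :: "('a, 'b) L2 \<Rightarrow> ('a, 'b) L2" where "sgn_L2 u = inverse (norm u) *\<^sub>R u"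
definition uniformity_L2 :: "(('a, 'b) L2 \<times> ('a, 'b) L2) filter" where
  "uniformity_L2 = (INF e\<in>{0<..}. principal {(x, y). dist x y < e})"
definition open_L2 :: "('a, 'b) L2 set \<Rightarrow> bool" where
  "open_L2 U = (\<forall>x\<in>U. \<forall>\<^sub>F (x', y) in uniformity. x' = x \<longrightarrow> y \<in> U)"

instance
proof
  fix u v w :: "('a, 'b) L2" and r s :: real
  show "u + v + w = u + (v + w)" by transfer (auto intro!: square_integrable_add simp: add.assoc)
  show "u + v = v + u" by transfer (auto intro!: square_integrable_add simp: add.commute)
  show "0 + u = u" by transfer auto
  show "- u + u = 0" by transfer (auto simp: square_integrable_zero)
  show "u - v = u + - v" by transfer (auto intro!: square_integrable_diff square_integrable_add square_integrable_uminus)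
  show "r *\<^sub>R (u + v) = r *\<^sub>R u + r *\<^sub>R v"
    by transfer (auto intro!: square_integrable_add square_integrable_scaleR simp: scaleR_add_right)
  show "(r + s) *\<^sub>R u = r *\<^sub>R u + s *\<^sub>R u"
    by transfer (auto intro!: square_integrable_add square_integrable_scaleR simp: scaleR_add_left)
  show "r *\<^sub>R s *\<^sub>R u = (r * s) *\<^sub>R u" by transfer (auto intro!: square_integrable_scaleR)
  show "1 *\<^sub>R u = u" by transfer auto
  show "u \<bullet> v = v \<bullet> u" by transfer (simp add: inner_commute)
  show "(u + v) \<bullet> w = u \<bullet> w + v \<bullet> w"
    by transfer (auto simp: inner_add_left square_integrable_inner)
  show "r *\<^sub>R u \<bullet> v = r * (u \<bullet> v)" by transfer simp
  show "0 \<le> u \<bullet> u" by transfer simp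
  show "u \<bullet> u = 0 \<longleftrightarrow> u = 0"
  proof transfer
    fix f :: "'a \<Rightarrow> 'b"
    assume f: "square_integrable f \<and> square_integrable f \<and> (AE x in lborel. f x = f x)"
    then show "((LINT x|lborel. f x \<bullet> f x) = 0) =
      (square_integrable f \<and> square_integrable (\<lambda>x. 0::'b) \<and> (AE x in lborel. f x = 0))"
      using integral_nonneg_eq_0_iff_AE[OF square_integrable_inner[of f f]]
      by (simp add: square_integrable_zero)
  qed
qed (simp_all add: norm_L2_def dist_L2_def sgn_L2_def uniformity_L2_def open_L2_def)

end

lemma square_integrable_rep: "square_integrable (rep_L2 u)"
  using Quotient3_rep_reflp[OF Quotient3_L2, of u] by simp

lemma abs_rep_L2: "abs_L2 (rep_L2 u) = u"
  by (rule Quotient3_abs_rep[OF Quotient3_L2])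

lemma rep_abs_L2: "square_integrable f \<Longrightarrow> AE x in lborel. rep_L2 (abs_L2 f) x = f x"
  using Quotient3_rep_abs[OF Quotient3_L2, of f] by simp

lemma L2_eqI: "(AE x in lborel. rep_L2 u x = rep_L2 v x) \<Longrightarrow> u = v"
  using Quotient3_rel_rep[OF Quotient3_L2, of u v] by (simp add: square_integrable_rep)

lemma rep_zero_L2: "AE x in lborel. rep_L2 0 x = 0"
  unfolding zero_L2_def by (rule rep_abs_L2[OF square_integrable_zero])

lemma rep_plus_L2: "AE x in lborel. rep_L2 (u + v) x = rep_L2 u x + rep_L2 v x"
  using rep_abs_L2[OF square_integrable_add[OF square_integrable_rep[of u] square_integrable_rep[of v]]]
  by (simp add: plus_L2_def)

lemma rep_minus_L2: "AE x in lborel. rep_L2 (u - v) x = rep_L2 u x - rep_L2 v x"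
  using rep_abs_L2[OF square_integrable_diff[OF square_integrable_rep[of u] square_integrable_rep[of v]]]
  by (simp add: minus_L2_def)

lemma rep_scaleR_L2: "AE x in lborel. rep_L2 (c *\<^sub>R u) x = c *\<^sub>R rep_L2 u x"
  using rep_abs_L2[OF square_integrable_scaleR[OF square_integrable_rep[of u], of c]]
  by (simp add: scaleR_L2_def)

lemma inner_L2_eq: "u \<bullet> v = (LINT x|lborel. rep_L2 u x \<bullet> rep_L2 v x)"
  by (simp add: inner_L2_def)

lemma norm_L2_eq: "(norm u)\<^sup>2 = (LINT x|lborel. (norm (rep_L2 u x))\<^sup>2)"
  by (simp add: power2_norm_eq_inner inner_L2_eq)

lemma norm_L2_eq_nn: "ennreal ((norm u)\<^sup>2) = (\<integral>\<^sup>+x. ennreal ((norm (rep_L2 u x))\<^sup>2) \<partial>lborel)"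
  unfolding norm_L2_eq using square_integrable_rep[of u]
  by (subst nn_integral_eq_integral) (auto simp: square_integrable_def)

lemma norm_diff_L2_eq_nn:
  "ennreal ((norm (u - v))\<^sup>2) = (\<integral>\<^sup>+x. ennreal ((norm (rep_L2 u x - rep_L2 v x))\<^sup>2) \<partial>lborel)"
  unfolding norm_L2_eq_nn by (rule nn_integral_cong_AE) (use rep_minus_L2[of u v] in auto)

lemma norm_abs_L2_nn:
  assumes "square_integrable f"
  shows "ennreal ((norm (abs_L2 f))\<^sup>2) = (\<integral>\<^sup>+x. ennreal ((norm (f x))\<^sup>2) \<partial>lborel)"
  unfolding norm_L2_eq_nn by (rule nn_integral_cong_AE) (use rep_abs_L2[OF assms] in auto)

lemma norm_diff_abs_L2_nn:
  assumes "square_integrable f"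
  shows "ennreal ((norm (u - abs_L2 f))\<^sup>2) = (\<integral>\<^sup>+x. ennreal ((norm (rep_L2 u x - f x))\<^sup>2) \<partial>lborel)"
  unfolding norm_diff_L2_eq_nn by (rule nn_integral_cong_AE) (use rep_abs_L2[OF assms] in auto)

lemma ennreal_term_le_suminf: "f k \<le> suminf f" for f :: "nat \<Rightarrow> ennreal"
  using sum_le_suminf[of f "{k}"] by simp

instance L2 :: (euclidean_space, euclidean_space) banach
proof
  fix X :: "nat \<Rightarrow> ('a, 'b) L2"
  assume X: "Cauchy X"
  have ex: "\<exists>N. \<forall>m\<ge>N. \<forall>n\<ge>N. norm (X m - X n) < e" if "e > 0" for e
    using CauchyD[OF X that] .
  have "\<exists>N. \<forall>k. \<forall>m\<ge>N k. \<forall>n\<ge>N k. norm (X m - X n) < (1/8)^k"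
    by (intro choice allI ex) simp
  then obtain N where N: "\<And>k m n. m \<ge> N k \<Longrightarrow> n \<ge> N k \<Longrightarrow> norm (X m - X n) < (1/8)^k"
    by blast
  define r where "r k = k + (\<Sum>i\<le>k. N i)" for k
  have rN: "N k \<le> r k" for k
    unfolding r_def using member_le_sum[of k "{..k}" N] by simp
  have rS: "N k \<le> r (Suc k)" for k
    unfolding r_def using member_le_sum[of k "{..Suc k}" N] by simp
  have rk: "k \<le> r k" for k by (simp add: r_def)
  define G where "G k = rep_L2 (X (r k))" for k
  have sqG: "square_integrable (G k)" for k
    by (simp add: G_def square_integrable_rep)
  then have G [measurable]: "G k \<in> borel_measurable lborel" for k
    by (simp add: square_integrable_def)
  define f where "f x = lim (\<lambda>k. G k x)" for x
  have f [measurable]: "f \<in> borel_measurable lborel"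
    unfolding f_def by measurable
  let ?h = "\<lambda>k x. ennreal (4^k * (norm (G (Suc k) x - G k x))\<^sup>2)"
  have int: "(\<integral>\<^sup>+x. ?h k x \<partial>lborel) \<le> ennreal ((1/16)^k)" for k
  proof -
    have "(\<integral>\<^sup>+x. ?h k x \<partial>lborel) = ennreal (4^k) * (\<integral>\<^sup>+x. ennreal ((norm (G (Suc k) x - G k x))\<^sup>2) \<partial>lborel)"
      by (subst nn_integral_cmult[symmetric]) (auto simp: ennreal_mult)
    also have "\<dots> = ennreal (4^k * (norm (X (r (Suc k)) - X (r k)))\<^sup>2)"
      by (simp add: norm_diff_L2_eq_nn G_def ennreal_mult)
    also have "\<dots> \<le> ennreal (4^k * ((1/8)^k)\<^sup>2)"
      using N[OF rS rN, of k] by (intro ennreal_leI mult_left_mono power_mono) auto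
    also have "4^k * ((1/8)^k)\<^sup>2 = (1/16::real)^k"
      by (simp add: power2_eq_square flip: power_mult_distrib)
    finally show ?thesis .
  qed
  have "(\<integral>\<^sup>+x. (\<Sum>k. ?h k x) \<partial>lborel) = (\<Sum>k. \<integral>\<^sup>+x. ?h k x \<partial>lborel)"
    by (rule nn_integral_suminf) measurable
  also have "\<dots> \<le> (\<Sum>k. ennreal ((1/16)^k))"
    by (rule suminf_le) (use int in auto)
  also have "\<dots> = ennreal (\<Sum>k. (1/16)^k)"
    by (rule suminf_ennreal2) (auto intro: summable_geometric)
  finally have "(\<integral>\<^sup>+x. (\<Sum>k. ?h k x) \<partial>lborel) \<noteq> \<infinity>"
    by (metis ennreal_less_top infinity_ennreal_def linorder_not_less top.not_eq_extremum top_greatest)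
  then have "AE x in lborel. (\<Sum>k. ?h k x) \<noteq> \<infinity>"
    by (intro nn_integral_PInf_AE) measurable
  then have conv: "AE x in lborel. (\<lambda>k. G k x) \<longlonglongrightarrow> f x"
  proof eventually_elim
    case (elim x)
    have "\<exists>C\<ge>0. S = ennreal C" if "S \<noteq> \<infinity>" for S :: ennreal
      using that by (cases S) auto
    from this[OF elim] obtain C where C: "C \<ge> 0" "(\<Sum>k. ?h k x) = ennreal C"
      by blast
    have le: "4^k * (norm (G (Suc k) x - G k x))\<^sup>2 \<le> C" for k
    proof -
      have "?h k x \<le> (\<Sum>k. ?h k x)"
        by (rule ennreal_term_le_suminf)
      then show ?thesis unfolding C(2) using C(1) by (simp only: ennreal_le_iff)
    qed
    have "norm (G (Suc k) x - G k x) \<le> sqrt C * (1/2)^k" for k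
    proof -
      have "(2^k * norm (G (Suc k) x - G k x))\<^sup>2 \<le> C"
        using le[of k] by (simp add: power_mult_distrib power_mult[symmetric] mult.commute[of k 2])
          (simp add: power_mult)
      then have "2^k * norm (G (Suc k) x - G k x) \<le> sqrt C"
        by (rule real_le_rsqrt)
      then show ?thesis by (simp add: field_simps)
    qed
    note bd = this
    have "summable (\<lambda>k. sqrt C * (1/2)^k)"
      by (intro summable_mult summable_geometric) simp
    then have "summable (\<lambda>k. G (Suc k) x - G k x)"
      by (rule summable_comparison_test'[where N = 0]) (rule bd)
    then have "convergent (\<lambda>n. \<Sum>k<n. G (Suc k) x - G k x)"
      by (simp add: summable_iff_convergent)
    then have "convergent (\<lambda>n. G n x - G 0 x)"
      by (simp only: sum_lessThan_telescope[of "\<lambda>k. G k x"])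
    from convergent_add[OF this convergent_const[of "G 0 x"]]
    have "convergent (\<lambda>n. G n x)" by simp
    then show ?case by (simp add: f_def convergent_LIMSEQ_iff)
  qed
  have fatou: "(\<integral>\<^sup>+x. ennreal ((norm (rep_L2 (X n) x - f x))\<^sup>2) \<partial>lborel) \<le> ennreal (e\<^sup>2)"
    if e: "e > 0" and M: "\<And>m n. m \<ge> M \<Longrightarrow> n \<ge> M \<Longrightarrow> norm (X m - X n) < e" and n: "n \<ge> M" for e M n
  proof -
    have [measurable]: "rep_L2 (X n) \<in> borel_measurable lborel"
      using square_integrable_rep by (rule square_integrable_measurable)
    have "(\<integral>\<^sup>+x. ennreal ((norm (rep_L2 (X n) x - f x))\<^sup>2) \<partial>lborel)
        = (\<integral>\<^sup>+x. liminf (\<lambda>k. ennreal ((norm (rep_L2 (X n) x - G k x))\<^sup>2)) \<partial>lborel)"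
    proof (rule nn_integral_cong_AE, use conv in eventually_elim)
      case (elim x)
      then have "(\<lambda>k. ennreal ((norm (rep_L2 (X n) x - G k x))\<^sup>2))
          \<longlonglongrightarrow> ennreal ((norm (rep_L2 (X n) x - f x))\<^sup>2)"
        by (intro tendsto_intros tendsto_ennrealI)
      then show ?case by (rule lim_imp_Liminf[OF sequentially_bot, symmetric])
    qed
    also have "\<dots> \<le> liminf (\<lambda>k. \<integral>\<^sup>+x. ennreal ((norm (rep_L2 (X n) x - G k x))\<^sup>2) \<partial>lborel)"
      by (rule nn_integral_liminf) measurable
    also have "\<dots> = liminf (\<lambda>k. ennreal ((norm (X n - X (r k)))\<^sup>2))"
      by (simp add: G_def norm_diff_L2_eq_nn)
    also have "\<dots> \<le> liminf (\<lambda>k. ennreal (e\<^sup>2))"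
    proof (rule Liminf_mono)
      show "\<forall>\<^sub>F k in sequentially. ennreal ((norm (X n - X (r k)))\<^sup>2) \<le> ennreal (e\<^sup>2)"
        using eventually_ge_at_top[of M]
      proof eventually_elim
        case (elim k)
        then have "norm (X n - X (r k)) < e"
          using M[of n "r k"] n rk[of k] by simp
        then show ?case by (intro ennreal_leI power_mono) auto
      qed
    qed
    finally show ?thesis by (simp add: Liminf_const)
  qed
  obtain M1 where M1: "\<And>m n. m \<ge> M1 \<Longrightarrow> n \<ge> M1 \<Longrightarrow> norm (X m - X n) < 1"
    using ex[of 1] by auto
  have "square_integrable (\<lambda>x. rep_L2 (X M1) x - f x)"
    unfolding square_integrable_iff_nn
  proof
    show "(\<lambda>x. rep_L2 (X M1) x - f x) \<in> borel_measurable lborel"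
      using square_integrable_measurable[OF square_integrable_rep[of "X M1"]] by simp
    have "(\<integral>\<^sup>+x. ennreal ((norm (rep_L2 (X M1) x - f x))\<^sup>2) \<partial>lborel) \<le> ennreal (1\<^sup>2)"
      using fatou[of 1 M1 M1] M1 by simp
    then show "(\<integral>\<^sup>+x. ennreal ((norm (rep_L2 (X M1) x - f x))\<^sup>2) \<partial>lborel) < \<infinity>"
      by (rule le_less_trans) simp
  qed
  from square_integrable_diff[OF square_integrable_rep[of "X M1"] this]
  have sqf: "square_integrable f" by simp
  have "X \<longlonglongrightarrow> abs_L2 f"
  proof (rule LIMSEQ_I)
    fix e :: real assume e: "e > 0"
    then obtain M where M: "\<And>m n. m \<ge> M \<Longrightarrow> n \<ge> M \<Longrightarrow> norm (X m - X n) < e/2"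
      using ex[of "e/2"] by auto
    have "norm (X n - abs_L2 f) < e" if "n \<ge> M" for n
    proof -
      have "ennreal ((norm (X n - abs_L2 f))\<^sup>2) \<le> ennreal ((e/2)\<^sup>2)"
        unfolding norm_diff_abs_L2_nn[OF sqf] using fatou[of "e/2" M n] M e that by auto
      then have "norm (X n - abs_L2 f) \<le> e/2"
        using e by (simp add: ennreal_le_iff)
      then show ?thesis using e by linarith
    qed
    then show "\<exists>no. \<forall>n\<ge>no. norm (X n - abs_L2 f) < e" by blast
  qed
  then show "convergent X" by (auto simp: convergent_def)
qed

lemma abs_plus_L2:
  assumes "square_integrable f" "square_integrable g"
  shows "abs_L2 (\<lambda>x. f x + g x) = abs_L2 f + abs_L2 g"
  by (rule L2_eqI)
     (use rep_abs_L2[OF square_integrable_add[OF assms]] rep_plus_L2[of "abs_L2 f" "abs_L2 g"]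
        rep_abs_L2[OF assms(1)] rep_abs_L2[OF assms(2)] in eventually_elim, simp)

lemma square_integrable_sum:
  assumes "\<And>i. i \<in> I \<Longrightarrow> square_integrable (f i)"
  shows "square_integrable (\<lambda>x. \<Sum>i\<in>I. f i x)"
  using assms
  by (induction I rule: infinite_finite_induct)
     (simp_all add: square_integrable_zero square_integrable_add)

lemma abs_sum_L2:
  assumes "\<And>i. i \<in> I \<Longrightarrow> square_integrable (f i)"
  shows "abs_L2 (\<lambda>x. \<Sum>i\<in>I. f i x) = (\<Sum>i\<in>I. abs_L2 (f i))"
  using assms
proof (induction I rule: infinite_finite_induct)
  case (insert i I)
  have "abs_L2 (\<lambda>x. f i x + (\<Sum>j\<in>I. f j x)) = abs_L2 (f i) + abs_L2 (\<lambda>x. \<Sum>j\<in>I. f j x)"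
    using insert by (intro abs_plus_L2 square_integrable_sum) simp_all
  then show ?case using insert by simp
qed (simp_all add: zero_L2_def)

lemma square_integrable_indicator:
  assumes "E \<in> sets lborel" "emeasure lborel E < \<infinity>"
  shows "square_integrable (\<lambda>x. indicator E x *\<^sub>R c)"
proof -
  have "integrable lborel (\<lambda>x. indicator E x * (norm c)\<^sup>2)"
    using assms by (intro integrable_mult_left) (simp add: integrable_indicator_iff)
  moreover have "(norm (indicator E x *\<^sub>R c))\<^sup>2 = indicator E x * (norm c)\<^sup>2" for x :: 'a
    by (simp add: indicator_def)
  moreover have "(\<lambda>x. indicator E x *\<^sub>R c) \<in> borel_measurable lborel"
    using assms by simp
  ultimately show ?thesis
    by (simp add: square_integrable_def)
qed

lemma approx_indicator_L2:
  fixes E V :: "'a::euclidean_space set" and c c' :: "'b::euclidean_space"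
  assumes [measurable]: "E \<in> sets lborel" and E: "emeasure lborel E < \<infinity>"
    and [measurable]: "V \<in> sets lborel" and V: "emeasure lborel V < \<infinity>"
  shows "ennreal ((norm (abs_L2 (\<lambda>x. indicator E x *\<^sub>R c) - abs_L2 (\<lambda>x. indicator V x *\<^sub>R c')))\<^sup>2)
    \<le> ennreal (2 * (norm (c - c'))\<^sup>2) * emeasure lborel E
      + ennreal (2 * (norm c')\<^sup>2) * emeasure lborel ((E - V) \<union> (V - E))"
proof -
  let ?f = "\<lambda>x. indicator E x *\<^sub>R c" and ?g = "\<lambda>x. indicator V x *\<^sub>R c'"
  let ?h = "\<lambda>x. ennreal (2 * (norm (c - c'))\<^sup>2) * indicator E x
      + ennreal (2 * (norm c')\<^sup>2) * indicator ((E - V) \<union> (V - E)) x"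
  have c: "(norm c)\<^sup>2 \<le> 2 * (norm (c - c'))\<^sup>2 + 2 * (norm c')\<^sup>2"
    using norm_add_sq_le[of "c - c'" c'] by simp
  have le: "ennreal ((norm (?f x - ?g x))\<^sup>2) \<le> ?h x" for x
  proof -
    consider "x \<in> E" "x \<in> V" | "x \<in> E" "x \<notin> V" | "x \<notin> E" "x \<in> V" | "x \<notin> E" "x \<notin> V" by blast
    then show ?thesis
    proof cases
      case 1
      have "ennreal ((norm (c - c'))\<^sup>2) \<le> ennreal (2 * (norm (c - c'))\<^sup>2)"
        by (intro ennreal_leI) simp
      with 1 show ?thesis by simp
    next
      case 2
      have "ennreal ((norm c)\<^sup>2) \<le> ennreal (2 * (norm (c - c'))\<^sup>2 + 2 * (norm c')\<^sup>2)"
        by (intro ennreal_leI c)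
      also have "\<dots> = ennreal (2 * (norm (c - c'))\<^sup>2) + ennreal (2 * (norm c')\<^sup>2)"
        by (rule ennreal_plus) simp_all
      finally show ?thesis using 2 by simp
    next
      case 3
      have "ennreal ((norm c')\<^sup>2) \<le> ennreal (2 * (norm c')\<^sup>2)"
        by (intro ennreal_leI) simp
      with 3 show ?thesis by simp
    qed simp
  qed
  have "ennreal ((norm (abs_L2 ?f - abs_L2 ?g))\<^sup>2)
      = (\<integral>\<^sup>+x. ennreal ((norm (rep_L2 (abs_L2 ?f) x - ?g x))\<^sup>2) \<partial>lborel)"
    by (rule norm_diff_abs_L2_nn[OF square_integrable_indicator[OF assms(3,4)]])
  also have "\<dots> = (\<integral>\<^sup>+x. ennreal ((norm (?f x - ?g x))\<^sup>2) \<partial>lborel)"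
    by (rule nn_integral_cong_AE)
       (use rep_abs_L2[OF square_integrable_indicator[OF assms(1,2)], of c] in eventually_elim, simp)
  also have "\<dots> \<le> (\<integral>\<^sup>+x. ?h x \<partial>lborel)"
    by (rule nn_integral_mono) (rule le)
  also have "\<dots> = ennreal (2 * (norm (c - c'))\<^sup>2) * emeasure lborel E
      + ennreal (2 * (norm c')\<^sup>2) * emeasure lborel ((E - V) \<union> (V - E))"
    using assms(1,3) by (subst nn_integral_add) (simp_all add: nn_integral_cmult_indicator)
  finally show ?thesis .
qed

lemma finite_measure_approx_countable:
  obtains \<V> :: "'a::euclidean_space set set" where "countable \<V>"
    "\<And>V. V \<in> \<V> \<Longrightarrow> V \<in> sets lborel \<and> emeasure lborel V < \<infinity>"
    "\<And>E e. E \<in> sets lborel \<Longrightarrow> emeasure lborel E < \<infinity> \<Longrightarrow> e > 0 \<Longrightarrow>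
      \<exists>V\<in>\<V>. emeasure lborel ((E - V) \<union> (V - E)) < ennreal e"
proof -
  obtain B0 :: "'a set set" where B0: "countable B0" "topological_basis B0"
    using ex_countable_basis by blast
  define B where "B = {b \<in> B0. emeasure lborel b < \<infinity>}"
  have cB: "countable B" using B0 by (simp add: B_def)
  have oB: "open b" if "b \<in> B" for b
    using that B0 by (auto simp: B_def topological_basis_open)
  define \<V> where "\<V> = Union ` {F. finite F \<and> F \<subseteq> B}"
  have "countable \<V>"
    unfolding \<V>_def by (intro countable_image countable_Collect_finite_subset cB)
  moreover have "V \<in> sets lborel \<and> emeasure lborel V < \<infinity>" if V: "V \<in> \<V>" for V
  proof -
    obtain F where F: "finite F" "F \<subseteq> B" "V = \<Union>F" using V unfolding \<V>_def by blast
    have FB: "b \<in> sets lborel" if "b \<in> F" for b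
      using F that oB by (auto intro: borel_open)
    have "emeasure lborel (\<Union>b\<in>F. b) \<le> (\<Sum>b\<in>F. emeasure lborel b)"
      by (rule emeasure_subadditive_finite) (use F FB in auto)
    also have "\<dots> < \<infinity>"
      using F by (auto simp: B_def)
    finally show ?thesis using F FB by auto
  qed
  moreover have "\<exists>V\<in>\<V>. emeasure lborel ((E - V) \<union> (V - E)) < ennreal e"
    if E: "E \<in> sets lborel" "emeasure lborel E < \<infinity>" and e: "e > 0" for E e
  proof -
    obtain U where U: "open U" "E \<subseteq> U" "emeasure lborel (U - E) < ennreal (e/2)"
      using outer_regular_lborel[of E "e/2"] E e by auto
    have mU: "emeasure lborel U < \<infinity>"
    proof -
      have "emeasure lborel (E \<union> (U - E)) \<le> emeasure lborel E + emeasure lborel (U - E)"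
        using E U by (intro emeasure_subadditive) auto
      also have "\<dots> < \<infinity>" using E U
        by (simp add: ennreal_add_less_top) (meson U(3) ennreal_less_top less_trans)
      finally show ?thesis using U(2) by (simp add: Un_absorb1)
    qed
    define S where "S = insert {} {b \<in> B. b \<subseteq> U}"
    have cS: "countable S" "S \<noteq> {}" using cB by (auto simp: S_def)
    have US: "\<Union>S = U"
    proof
      show "U \<subseteq> \<Union>S"
      proof
        fix x assume x: "x \<in> U"
        have "open (U \<inter> ball x 1)" using U by auto
        from topological_basisE[OF B0(2) this, of x] x
        obtain b where b: "b \<in> B0" "x \<in> b" "b \<subseteq> U \<inter> ball x 1" by auto
        have "emeasure lborel b \<le> emeasure lborel (ball x 1)"
          using b by (intro emeasure_mono) auto
        also have "\<dots> < \<infinity>" by (rule emeasure_bounded_finite) simp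
        finally have "b \<in> S" using b by (auto simp: S_def B_def)
        then show "x \<in> \<Union>S" using b by blast
      qed
    qed (auto simp: S_def)
    define A where "A n = (\<Union>i\<in>{..<n}. from_nat_into S i)" for n
    have fS: "from_nat_into S i \<in> S" for i
      using cS by (simp add: from_nat_into)
    have oS: "open b" if "b \<in> S" for b using that oB by (auto simp: S_def)
    have oA: "open (A n)" for n unfolding A_def using fS oS by (intro open_UN) auto
    have AU: "(\<Union>n. A n) = U"
    proof -
      have "(\<Union>n. A n) = (\<Union>i. from_nat_into S i)" unfolding A_def by auto
      also have "\<dots> = \<Union>S" using cS by (simp add: range_from_nat_into)
      finally show ?thesis using US by simp
    qed
    have AV: "A n \<in> \<V>" for n
    proof -
      have "A n = \<Union>((from_nat_into S ` {..<n}) - {{}})" by (auto simp: A_def)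
      moreover have "finite ((from_nat_into S ` {..<n}) - {{}})" by simp
      moreover have "(from_nat_into S ` {..<n}) - {{}} \<subseteq> B" using fS by (auto simp: S_def)
      ultimately show ?thesis unfolding \<V>_def by blast
    qed
    have "(\<lambda>n. emeasure lborel (U - A n)) \<longlonglongrightarrow> emeasure lborel (\<Inter>n. U - A n)"
    proof (rule Lim_emeasure_decseq)
      show "range (\<lambda>n. U - A n) \<subseteq> sets lborel" using U oA by auto
      show "decseq (\<lambda>n. U - A n)" unfolding decseq_def A_def by force
      fix n
      have "emeasure lborel (U - A n) \<le> emeasure lborel U"
        using U by (intro emeasure_mono) auto
      then show "emeasure lborel (U - A n) \<noteq> \<infinity>" using mU by (metis infinity_ennreal_def leD)
    qed
    moreover have "(\<Inter>n. U - A n) = {}" using AU by blast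
    ultimately have "(\<lambda>n. emeasure lborel (U - A n)) \<longlonglongrightarrow> 0"
      by (simp only: emeasure_empty)
    then have "\<forall>\<^sub>F n in sequentially. emeasure lborel (U - A n) < ennreal (e/2)"
      by (rule order_tendstoD) (use e in simp)
    then obtain n where n: "emeasure lborel (U - A n) < ennreal (e/2)"
      by (auto simp: eventually_sequentially)
    have "emeasure lborel ((E - A n) \<union> (A n - E)) \<le> emeasure lborel ((U - A n) \<union> (U - E))"
      using U oA AU E by (intro emeasure_mono) auto
    also have "\<dots> \<le> emeasure lborel (U - A n) + emeasure lborel (U - E)"
      using U oA E by (intro emeasure_subadditive) auto
    also have "\<dots> < ennreal (e/2) + ennreal (e/2)"
      by (rule add_strict_mono) (use n U in auto)
    also have "\<dots> = ennreal (e/2 + e/2)"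
      using e by (intro ennreal_plus[symmetric]) simp_all
    also have "e/2 + e/2 = e" by simp
    finally show ?thesis using AV by blast
  qed
  ultimately show ?thesis using that by blast
qed

lemma L2_countable_dense: "\<exists>D :: ('a::euclidean_space, 'b::euclidean_space) L2 set. countable D \<and> closure D = UNIV"
proof -
  obtain \<V> :: "'a set set" where \<V>: "countable \<V>"
    "\<And>V. V \<in> \<V> \<Longrightarrow> V \<in> sets lborel \<and> emeasure lborel V < \<infinity>"
    "\<And>E e. E \<in> sets lborel \<Longrightarrow> emeasure lborel E < \<infinity> \<Longrightarrow> e > 0 \<Longrightarrow>
      \<exists>V\<in>\<V>. emeasure lborel ((E - V) \<union> (V - E)) < ennreal e"
    using finite_measure_approx_countable by blast
  obtain Q :: "'b set" where Q: "countable Q" "\<And>X. open X \<Longrightarrow> X \<noteq> {} \<Longrightarrow> \<exists>d\<in>Q. d \<in> X"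
    using countable_dense_setE by blast
  define ind where "ind V c = abs_L2 (\<lambda>x. indicator V x *\<^sub>R c)" for V :: "'a set" and c :: 'b
  define D where "D = (\<lambda>l. sum_list (map (\<lambda>(V, c). ind V c) l)) ` lists (\<V> \<times> Q)"
  have cD: "countable D" unfolding D_def using \<V> Q by auto
  have D0: "0 \<in> closure D"
  proof -
    have "sum_list (map (\<lambda>(V, c). ind V c) []) \<in> D" unfolding D_def by (rule imageI) simp
    then show ?thesis using closure_subset by auto
  qed
  have Dplus: "u + v \<in> D" if uv: "u \<in> D" "v \<in> D" for u v
  proof -
    obtain l m where "l \<in> lists (\<V> \<times> Q)" "m \<in> lists (\<V> \<times> Q)"
      "u = sum_list (map (\<lambda>(V, c). ind V c) l)" "v = sum_list (map (\<lambda>(V, c). ind V c) m)"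
      using uv by (auto simp: D_def)
    then show ?thesis unfolding D_def
      by (intro image_eqI[of _ _ "l @ m"]) simp_all
  qed
  have Cplus: "u + v \<in> closure D" if uv: "u \<in> closure D" "v \<in> closure D" for u v
  proof -
    obtain f g where fg: "\<And>n. f n \<in> D" "f \<longlonglongrightarrow> u" "\<And>n. g n \<in> D" "g \<longlonglongrightarrow> v"
      using uv unfolding closure_sequential by blast
    have "(\<lambda>n. f n + g n) \<longlonglongrightarrow> u + v" using fg by (intro tendsto_add)
    moreover have "f n + g n \<in> D" for n by (intro Dplus fg)
    ultimately show ?thesis unfolding closure_sequential
      by (intro exI[of _ "\<lambda>n. f n + g n"] conjI allI)
  qed
  have Csum: "(\<Sum>i\<in>I. f i) \<in> closure D" if "\<And>i. i \<in> I \<Longrightarrow> f i \<in> closure D" for I :: "'b set" and f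
    using that
  proof (induction I rule: infinite_finite_induct)
    case (insert i I)
    show ?case unfolding sum.insert[OF insert(1,2)]
      by (rule Cplus) (use insert in auto)
  qed (simp_all add: D0)
  have Cind: "ind E c \<in> closure D" if E: "E \<in> sets lborel" "emeasure lborel E < \<infinity>" for E c
    unfolding closure_approachable
  proof (intro allI impI)
    fix e :: real assume e: "e > 0"
    define m where "m = measure lborel E"
    have m: "emeasure lborel E = ennreal m" "m \<ge> 0"
      using E by (simp_all add: m_def emeasure_eq_ennreal_measure)
    define d where "d = e / (2 * sqrt (m + 1))"
    have d: "d > 0" "2 * d\<^sup>2 * m \<le> e\<^sup>2 / 2"
    proof -
      show "d > 0" using e m by (simp add: d_def)
      have "2 * d\<^sup>2 * m = e\<^sup>2 / 2 * (m / (m + 1))"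
        using m(2) by (simp add: d_def power_divide power_mult_distrib) (simp add: field_simps)
      also have "\<dots> \<le> e\<^sup>2 / 2 * 1"
        using m by (intro mult_left_mono) simp_all
      finally show "2 * d\<^sup>2 * m \<le> e\<^sup>2 / 2" by simp
    qed
    obtain c' where c': "c' \<in> Q" "c' \<in> ball c d"
      using Q(2)[of "ball c d"] d by auto
    have nc: "norm (c - c') \<le> d" using c' by (simp add: dist_norm)
    define k where "k = 2 * (norm c')\<^sup>2"
    have k: "k \<ge> 0" by (simp add: k_def)
    obtain V where V: "V \<in> \<V>" "emeasure lborel ((E - V) \<union> (V - E)) < ennreal (e\<^sup>2 / (4 * (k + 1)))"
      using \<V>(3)[OF E, of "e\<^sup>2 / (4 * (k + 1))"] e k by auto
    have mV: "V \<in> sets lborel" "emeasure lborel V < \<infinity>" using \<V>(2)[OF V(1)] by auto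
    have ke: "k * (e\<^sup>2 / (4 * (k + 1))) \<le> e\<^sup>2 / 4"
    proof -
      have "k * (e\<^sup>2 / (4 * (k + 1))) = e\<^sup>2 / 4 * (k / (k + 1))" by simp
      also have "\<dots> \<le> e\<^sup>2 / 4 * 1" using k by (intro mult_left_mono) simp_all
      finally show ?thesis by simp
    qed
    have "ennreal ((norm (ind E c - ind V c'))\<^sup>2)
        \<le> ennreal (2 * (norm (c - c'))\<^sup>2) * emeasure lborel E
          + ennreal k * emeasure lborel ((E - V) \<union> (V - E))"
      unfolding ind_def k_def by (rule approx_indicator_L2[OF E mV])
    also have "\<dots> \<le> ennreal (2 * d\<^sup>2) * ennreal m + ennreal k * ennreal (e\<^sup>2 / (4 * (k + 1)))"
      unfolding m(1) using nc V(2)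
      by (intro add_mono mult_mono ennreal_leI power_mono) auto
    also have "\<dots> = ennreal (2 * d\<^sup>2 * m) + ennreal (k * (e\<^sup>2 / (4 * (k + 1))))"
      using ennreal_mult'[of "2 * d\<^sup>2" m] ennreal_mult'[of k "e\<^sup>2 / (4 * (k + 1))"] m k
      by (simp only: zero_le_power2 mult_nonneg_nonneg zero_le_numeral)
    also have "\<dots> = ennreal (2 * d\<^sup>2 * m + k * (e\<^sup>2 / (4 * (k + 1))))"
      using m k by (intro ennreal_plus[symmetric]) simp_all
    also have "\<dots> \<le> ennreal (e\<^sup>2 / 2 + e\<^sup>2 / 4)"
      using d ke by (intro ennreal_leI add_mono)
    finally have "(norm (ind E c - ind V c'))\<^sup>2 \<le> e\<^sup>2 / 2 + e\<^sup>2 / 4"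
      by (subst (asm) ennreal_le_iff) simp_all
    moreover have "e\<^sup>2 / 2 + e\<^sup>2 / 4 < e\<^sup>2" using e by simp
    ultimately have "(norm (ind E c - ind V c'))\<^sup>2 < e\<^sup>2" by linarith
    then have "norm (ind E c - ind V c') < e"
      using power_less_imp_less_base[of _ 2 e] e by simp
    moreover have "ind V c' \<in> D"
      unfolding D_def using V(1) c'(1) by (intro image_eqI[of _ _ "[(V, c')]"]) simp_all
    ultimately show "\<exists>y\<in>D. dist y (ind E c) < e"
      by (metis dist_norm norm_minus_commute)
  qed
  have Csimple: "abs_L2 s \<in> closure D"
    if s: "simple_function lborel s" "square_integrable s" for s :: "'a \<Rightarrow> 'b"
  proof -
    have fin: "finite (range s)" using s(1) by (simp add: simple_function_def)
    have lev: "s -` {y} \<in> sets lborel" for y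
      using s(1) simple_functionD(2)[of lborel s "{y}"] by simp
    have levfin: "emeasure lborel (s -` {y}) < \<infinity>" if y: "y \<noteq> 0" for y
    proof -
      have "ennreal ((norm y)\<^sup>2) * emeasure lborel (s -` {y})
          = (\<integral>\<^sup>+x. ennreal ((norm y)\<^sup>2) * indicator (s -` {y}) x \<partial>lborel)"
        using lev by (simp add: nn_integral_cmult_indicator)
      also have "\<dots> \<le> (\<integral>\<^sup>+x. ennreal ((norm (s x))\<^sup>2) \<partial>lborel)"
        by (rule nn_integral_mono) (auto simp: indicator_def)
      also have "\<dots> < \<infinity>" using s(2) by (simp add: square_integrable_iff_nn)
      finally show ?thesis
        using y by (auto simp: ennreal_mult_less_top)
    qed
    have "s = (\<lambda>x. \<Sum>y\<in>range s - {0}. indicator (s -` {y}) x *\<^sub>R y)"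
    proof
      fix x
      have "(\<Sum>y\<in>range s - {0}. indicator (s -` {y}) x *\<^sub>R y)
          = (\<Sum>y\<in>range s - {0}. if s x = y then y else 0)"
        by (intro sum.cong) (auto simp: indicator_def)
      also have "\<dots> = s x" using fin by (auto simp: sum.delta')
      finally show "s x = (\<Sum>y\<in>range s - {0}. indicator (s -` {y}) x *\<^sub>R y)" by simp
    qed
    then have "abs_L2 s = abs_L2 (\<lambda>x. \<Sum>y\<in>range s - {0}. indicator (s -` {y}) x *\<^sub>R y)"
      by (rule arg_cong)
    also have "\<dots> = (\<Sum>y\<in>range s - {0}. ind (s -` {y}) y)"
      unfolding ind_def
      by (rule abs_sum_L2) (use lev levfin in \<open>auto intro: square_integrable_indicator\<close>)
    also have "\<dots> \<in> closure D"
      by (rule Csum, rule Cind) (use lev levfin in auto)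
    finally show ?thesis .
  qed
  have "u \<in> closure D" for u :: "('a, 'b) L2"
  proof -
    define f where "f = rep_L2 u"
    have f: "square_integrable f" "f \<in> borel_measurable lborel"
      using square_integrable_rep[of u] by (auto simp: f_def square_integrable_def)
    from borel_measurable_implies_sequence_metric[OF f(2), of 0]
    obtain s where s: "\<And>i. simple_function lborel (s i)"
      "\<And>x. (\<lambda>i. s i x) \<longlonglongrightarrow> f x" "\<And>i x. norm (s i x) \<le> 2 * norm (f x)"
      by (auto simp: space_lborel)
    have sm: "s i \<in> borel_measurable lborel" for i
      using s(1) by (rule borel_measurable_simple_function)
    have sq4: "(norm (s i x))\<^sup>2 \<le> 4 * (norm (f x))\<^sup>2" for i x
      using power_mono[OF s(3)[of i x] norm_ge_zero, of 2] by (simp add: power_mult_distrib)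
    have sqs: "square_integrable (s i)" for i
      unfolding square_integrable_def
    proof
      show "integrable lborel (\<lambda>x. (norm (s i x))\<^sup>2)"
      proof (rule Bochner_Integration.integrable_bound)
        show "integrable lborel (\<lambda>x. 4 * (norm (f x))\<^sup>2)"
          using f(1) by (simp add: square_integrable_def)
      qed (use sm sq4 in auto)
    qed (rule sm)
    have "(\<lambda>i. \<integral>\<^sup>+x. ennreal ((norm (f x - s i x))\<^sup>2) \<partial>lborel) \<longlonglongrightarrow> (\<integral>\<^sup>+x. ennreal ((norm (f x - f x))\<^sup>2) \<partial>lborel)"
    proof (rule nn_integral_dominated_convergence)
      show "(\<lambda>x. ennreal ((norm (f x - s i x))\<^sup>2)) \<in> borel_measurable lborel" for i
        using f(2) sm[of i] by simp
      show "(\<lambda>x. ennreal (10 * (norm (f x))\<^sup>2)) \<in> borel_measurable lborel"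
        using f(2) by simp
      show "AE x in lborel. ennreal ((norm (f x - s i x))\<^sup>2) \<le> ennreal (10 * (norm (f x))\<^sup>2)" for i
      proof (rule AE_I2, rule ennreal_leI)
        fix x
        show "(norm (f x - s i x))\<^sup>2 \<le> 10 * (norm (f x))\<^sup>2"
          using norm_add_sq_le[of "f x" "- s i x"] sq4[of i x] by simp
      qed
      have "(\<integral>\<^sup>+x. ennreal (10 * (norm (f x))\<^sup>2) \<partial>lborel) = 10 * (\<integral>\<^sup>+x. ennreal ((norm (f x))\<^sup>2) \<partial>lborel)"
        using f(2) by (simp add: ennreal_mult nn_integral_cmult)
      also have "\<dots> < \<infinity>"
        using f(1) by (simp add: square_integrable_iff_nn ennreal_mult_less_top)
      finally show "(\<integral>\<^sup>+x. ennreal (10 * (norm (f x))\<^sup>2) \<partial>lborel) < \<infinity>" .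
      show "AE x in lborel. (\<lambda>i. ennreal ((norm (f x - s i x))\<^sup>2)) \<longlonglongrightarrow> ennreal ((norm (f x - f x))\<^sup>2)"
        by (rule AE_I2) (intro tendsto_ennrealI tendsto_intros s(2))
    qed (use f(2) in simp)
    then have lim: "(\<lambda>i. ennreal ((norm (u - abs_L2 (s i)))\<^sup>2)) \<longlonglongrightarrow> 0"
      by (simp add: norm_diff_abs_L2_nn[OF sqs] f_def)
    have "u \<in> closure (closure D)"
      unfolding closure_approachable[of _ "closure D"]
    proof (intro allI impI)
      fix e :: real assume e: "e > 0"
      have "\<forall>\<^sub>F i in sequentially. ennreal ((norm (u - abs_L2 (s i)))\<^sup>2) < ennreal (e\<^sup>2)"
        using lim by (rule order_tendstoD) (use e in simp)
      then obtain i where "ennreal ((norm (u - abs_L2 (s i)))\<^sup>2) < ennreal (e\<^sup>2)"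
        by (auto simp: eventually_sequentially)
      then have "(norm (u - abs_L2 (s i)))\<^sup>2 < e\<^sup>2"
        by (subst (asm) ennreal_less_iff) simp_all
      then have "norm (u - abs_L2 (s i)) < e"
        using power_less_imp_less_base[of _ 2 e] e by simp
      then show "\<exists>y\<in>closure D. dist y u < e"
        using Csimple[OF s(1) sqs] by (metis dist_norm norm_minus_commute)
    qed
    then show ?thesis by simp
  qed
  then show ?thesis using cD by blast
qed

instance L2 :: (euclidean_space, euclidean_space) second_countable_topology
proof
  obtain D :: "('a, 'b) L2 set" where D: "countable D" "closure D = UNIV"
    using L2_countable_dense by blast
  define B where "B = (\<lambda>(d, n). ball d (1 / Suc n)) ` (D \<times> (UNIV :: nat set))"
  have "countable B" unfolding B_def using D by auto
  moreover have "topological_basis B"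
  proof (rule topological_basisI)
    fix U x assume U: "open U" "x \<in> (U :: ('a, 'b) L2 set)"
    then obtain e where e: "e > 0" "ball x e \<subseteq> U" by (meson open_contains_ball)
    obtain n where n: "1 / Suc n < e / 2" using nat_approx_posE[of "e/2"] e by auto
    have "x \<in> closure D" using D by simp
    then obtain d where d: "d \<in> D" "dist d x < 1 / Suc n"
      unfolding closure_approachable by (metis of_nat_0_less_iff zero_less_Suc zero_less_divide_1_iff)
    have "ball d (1 / Suc n) \<subseteq> ball x e"
    proof
      fix y assume "y \<in> ball d (1 / Suc n)"
      then show "y \<in> ball x e"
        using d n dist_triangle[of x y d] by (simp add: dist_commute)
    qed
    then show "\<exists>b\<in>B. x \<in> b \<and> b \<subseteq> U"
      using d e by (intro bexI[of _ "ball d (1 / Suc n)"]) (auto simp: B_def)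
  qed (auto simp: B_def)
  ultimately show "\<exists>B :: ('a, 'b) L2 set set. countable B \<and> open = generate_topology B"
    using topological_basis_imp_subbasis by blast
qed

section \<open>Weak derivatives and Sobolev spaces\<close>

primrec Ck :: "nat \<Rightarrow> ('a::euclidean_space \<Rightarrow> real) \<Rightarrow> bool" where
  "Ck 0 f \<longleftrightarrow> continuous_on UNIV f"
| "Ck (Suc k) f \<longleftrightarrow> f differentiable_on UNIV \<and>
     (\<forall>b\<in>Basis. Ck k (\<lambda>x. frechet_derivative f (at x) b))"

definition test_function :: "'a::euclidean_space set \<Rightarrow> ('a \<Rightarrow> real) \<Rightarrow> bool" where
  "test_function \<Omega> \<phi> \<longleftrightarrow> (\<forall>k. Ck k \<phi>) \<and>
     compact (closure {x. \<phi> x \<noteq> 0}) \<and> closure {x. \<phi> x \<noteq> 0} \<subseteq> \<Omega>"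

text \<open>The locally integrable function \<open>g\<close> is the weak derivative of the locally integrable function
  \<open>u\<close> on the open set \<open>\<Omega>\<close> in direction \<open>b\<close>. The values may lie in a separable Banach space; on
  an interval, with \<open>b = 1\<close>, this is the weak derivative of a Banach-space-valued function.\<close>

definition weak_partial ::
  "'a::euclidean_space set \<Rightarrow> 'a \<Rightarrow> ('a \<Rightarrow> 'b::{banach, second_countable_topology}) \<Rightarrow> ('a \<Rightarrow> 'b) \<Rightarrow> bool" where
  "weak_partial \<Omega> b u g \<longleftrightarrow>
     (\<forall>K. compact K \<and> K \<subseteq> \<Omega> \<longrightarrow> set_integrable lborel K u \<and> set_integrable lborel K g) \<and>
     (\<forall>\<phi>. test_function \<Omega> \<phi> \<longrightarrow>
        (LINT x:\<Omega>|lborel. frechet_derivative \<phi> (at x) b *\<^sub>R u x) = - (LINT x:\<Omega>|lborel. \<phi> x *\<^sub>R g x))"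

text \<open>\<open>f \<in> W\<^sup>1\<^sup>,\<^sup>1(\<real>)\<close> with weak derivative \<open>g\<close>.\<close>

definition has_W11_derivative :: "(real \<Rightarrow> real) \<Rightarrow> (real \<Rightarrow> real) \<Rightarrow> bool" where
  "has_W11_derivative f g \<longleftrightarrow> integrable lborel f \<and> integrable lborel g \<and> weak_partial UNIV 1 f g"

text \<open>\<open>\<Omega>\<close> is an argument of \<open>H1\<close> and not part of its type, so \<open>H\<^sup>1(\<Omega>)\<close> is realised as a closed
  subspace of a fixed Hilbert space: \<open>u\<close> is represented by \<open>(u, \<nabla>u)\<close>, extended by \<open>0\<close> outside
  \<open>\<Omega>\<close>. The norm inherited from \<open>L\<^sup>2\<close> is the \<open>H\<^sup>1(\<Omega>)\<close> norm, see \<open>norm_h1\<close>.\<close>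

type_synonym 'a h1 = "('a, real \<times> 'a) L2"

definition h1_fun :: "'a::euclidean_space h1 \<Rightarrow> 'a \<Rightarrow> real" where
  "h1_fun U x = fst (rep_L2 U x)"

definition h1_grad :: "'a::euclidean_space h1 \<Rightarrow> 'a \<Rightarrow> 'a" where
  "h1_grad U x = snd (rep_L2 U x)"

definition H1 :: "'a::euclidean_space set \<Rightarrow> 'a h1 set" where
  "H1 \<Omega> = {U. (AE x in lborel. x \<notin> \<Omega> \<longrightarrow> h1_fun U x = 0 \<and> h1_grad U x = 0) \<and>
             (\<forall>b\<in>Basis. weak_partial \<Omega> b (h1_fun U) (\<lambda>x. h1_grad U x \<bullet> b))}"

lemma norm_h1: "(norm U)\<^sup>2 = (LINT x|lborel. (h1_fun U x)\<^sup>2 + (norm (h1_grad U x))\<^sup>2)"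
  by (simp add: norm_L2_eq h1_fun_def h1_grad_def norm_prod_def)

definition Lp_norm :: "real \<Rightarrow> 'a::euclidean_space set \<Rightarrow> ('a \<Rightarrow> real) \<Rightarrow> real" where
  "Lp_norm p \<Omega> f = (LINT x:\<Omega>|lborel. \<bar>f x\<bar> powr p) powr (1 / p)"

definition L2_pairing :: "'a::euclidean_space set \<Rightarrow> ('a \<Rightarrow> real) \<Rightarrow> ('a \<Rightarrow> real) \<Rightarrow> real" where
  "L2_pairing \<Omega> f g = (LINT x:\<Omega>|lborel. f x * g x)"


section \<open>Bounded Lipschitz domains\<close>

text \<open>Near each boundary point, \<open>\<Omega>\<close> is the strict epigraph, in some direction \<open>v\<close>, of a Lipschitz
  function on the hyperplane orthogonal to \<open>v\<close>.\<close>

definition bounded_lipschitz_domain :: "'a::euclidean_space set \<Rightarrow> bool" where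
  "bounded_lipschitz_domain \<Omega> \<longleftrightarrow>
     open \<Omega> \<and> connected \<Omega> \<and> \<Omega> \<noteq> {} \<and> bounded \<Omega> \<and>
     (\<forall>x\<in>frontier \<Omega>. \<exists>r>0. \<exists>v. norm v = 1 \<and>
        (\<exists>\<gamma> C. C-lipschitz_on {y. y \<bullet> v = 0} \<gamma> \<and>
           \<Omega> \<inter> ball x r = {y \<in> ball x r. y \<bullet> v > \<gamma> (y - (y \<bullet> v) *\<^sub>R v)}))"


section \<open>Bochner and Bochner--Sobolev spaces in time, history operator\<close>

text \<open>\<open>X\<close> stands for a closed subspace of the ambient Banach space.\<close>

definition L2_time :: "real \<Rightarrow> 'b::{banach, second_countable_topology} set \<Rightarrow> (real \<Rightarrow> 'b) \<Rightarrow> bool" where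
  "L2_time T X f \<longleftrightarrow>
     set_borel_measurable lborel {0<..<T} f \<and>
     (AE t in lborel. t \<in> {0<..<T} \<longrightarrow> f t \<in> X) \<and>
     set_integrable lborel {0<..<T} (\<lambda>t. (norm (f t))\<^sup>2)"

text \<open>Each element of \<open>H\<^sup>1(0,T;X)\<close> is represented by its continuous representative on \<open>[0,T]\<close>, so
  that point values are meaningful.\<close>

definition H1_time :: "real \<Rightarrow> 'b::{banach, second_countable_topology} set \<Rightarrow> (real \<Rightarrow> 'b) set" where
  "H1_time T X = {q. continuous_on {0..T} q \<and> (\<forall>t\<in>{0..T}. q t \<in> X) \<and> L2_time T X q \<and>
                    (\<exists>g. L2_time T X g \<and> weak_partial {0<..<T} 1 q g)}"

definition time_deriv ::
  "real \<Rightarrow> 'b::{banach, second_countable_topology} set \<Rightarrow> (real \<Rightarrow> 'b) \<Rightarrow> real \<Rightarrow> 'b" where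
  "time_deriv T X q = (SOME g. L2_time T X g \<and> weak_partial {0<..<T} 1 q g)"

definition norm_H1_time ::
  "real \<Rightarrow> 'b::{banach, second_countable_topology} set \<Rightarrow> (real \<Rightarrow> 'b) \<Rightarrow> real" where
  "norm_H1_time T X q =
     sqrt ((LINT t:{0<..<T}|lborel. (norm (q t))\<^sup>2) +
           (LINT t:{0<..<T}|lborel. (norm (time_deriv T X q t))\<^sup>2))"

definition history ::
  "'b::{banach, second_countable_topology} \<Rightarrow> (real \<Rightarrow> 'b) \<Rightarrow> real \<Rightarrow> 'b" where
  "history y0 q t = (LINT s:{0..t}|lborel. q s) + y0"

definition kappa_history ::
  "(real \<Rightarrow> real) \<Rightarrow> 'a::euclidean_space h1 \<Rightarrow> (real \<Rightarrow> 'a h1) \<Rightarrow> real \<Rightarrow> 'a \<Rightarrow> real" where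
  "kappa_history \<kappa> y0 q s x = \<kappa> (h1_fun (history y0 q s) x)"

end

(* Writing u = q2 - q1, the left-hand side is integrated by parts in time. Instead of differentiating
   \<kappa> \<circ> \<H>, only its increments are used: a mean value argument bounds the mixed second difference of
   \<kappa> by L times the increment of u plus a term controlled by \<kappa>'', and Hoelder's inequality with
   exponents 6, 6, 6, 2 together with the embedding of H^1(\<Omega>) into L^6(\<Omega>) and L^{2\<rho>}(\<Omega>) bounds its
   pairing with u. Summing over fine partitions gives the integral estimate, and Young's inequality
   absorbs the boundary term into \<alpha>/4 ||u(t)||^2.

   The Sobolev embedding is obtained without an extension operator: near every point of the closure
   of \<Omega> there are N linearly independent directions along which short segments starting in \<Omega> stay in
   \<Omega>. Averaging along these segments bounds F(u) by N line integrals, and Gagliardo's product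
   inequality applies to them. *)

theory Submission
  imports Defs
begin

section \<open>Smooth bump functions\<close>

text \<open>Three obstacles shape the details. Weak derivatives are known only almost everywhere,
  with exceptional sets that depend on the shift; testing with translated test functions yields the
  increment along a segment, and this one fact serves u in space, q in time and \<kappa>' on the
  line. Quantities without a pointwise derivative (F(u) along a segment, \<kappa> after the history
  operator) are compared with integrals through a defect that is subadditive in the interval and of
  higher order on short intervals; bisection then makes it nonpositive. Finally c must not see q1
  and q2: the bound M in H^1 in time gives a sup bound B for the values in H^1(\<Omega>), hence a
  radius R for the histories, hence a bound g in L^2 for the growth factor of \<kappa>''. Increments
  have a further benefit: in the second-order term one factor is linear in the time step, and the
  remaining factors are quadratic in q2 - q1, as the right-hand side demands. The restriction \<rho>
  \<le> 3 for N = 3 says that 2 \<rho> does not exceed the Sobolev exponent 6.\<close>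

definition flat :: "real poly \<Rightarrow> real \<Rightarrow> real" where
  "flat p t = (if t > 0 then poly p (1 / t) * exp (- (1 / t)) else 0)"

lemma poly_exp_tendsto_0: "((\<lambda>y. poly p y * exp (- y)) \<longlongrightarrow> (0::real)) at_top"
proof -
  have "((\<lambda>y. \<Sum>i\<le>degree p. coeff p i * (y ^ i / exp y)) \<longlongrightarrow> (\<Sum>i\<le>degree p. coeff p i * 0)) at_top"
    by (intro tendsto_intros tendsto_power_div_exp_0)
  then show ?thesis
    by (simp add: poly_altdef sum_distrib_right sum_divide_distrib exp_minus field_simps)
qed

lemma flat_at_right_0: "(flat p \<longlongrightarrow> 0) (at_right 0)"
proof -
  have "((\<lambda>t. poly p (inverse t) * exp (- inverse t)) \<longlongrightarrow> 0) (at_right 0)"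
    by (rule filterlim_compose[OF poly_exp_tendsto_0 filterlim_inverse_at_top_right])
  moreover have "\<forall>\<^sub>F t in at_right 0. poly p (inverse t) * exp (- inverse t) = flat p t"
    unfolding eventually_at_filter by (auto simp: flat_def inverse_eq_divide intro!: always_eventually)
  ultimately show ?thesis by (rule Lim_transform_eventually)
qed

text \<open>With s = 1/t the derivative of p(s) exp(-s) is s^2 (p(s) - p'(s)) exp(-s), again a
  polynomial times exp(-s). The family \<open>flat\<close> is thus closed under differentiation, and
  at 0 only the first difference quotient has to be examined.\<close>

lemma has_derivative_flat:
  "(flat p has_real_derivative flat ([:0, 0, 1:] * (p - pderiv p)) t) (at t)"
proof -
  consider "t > 0" | "t < 0" | "t = 0" by linarith
  then show ?thesis
  proof cases
    case 1
    have "((\<lambda>t. poly p (1 / t) * exp (- (1 / t))) has_real_derivative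
        flat ([:0, 0, 1:] * (p - pderiv p)) t) (at t)"
      using 1 by (auto intro!: derivative_eq_intros poly_DERIV[THEN DERIV_chain2]
          simp: flat_def field_simps power2_eq_square)
    then show ?thesis
      by (rule has_field_derivative_transform_within_open[where S = "{0<..}"])
        (use 1 in \<open>auto simp: flat_def\<close>)
  next
    case 2
    have "((\<lambda>t. 0) has_real_derivative flat ([:0, 0, 1:] * (p - pderiv p)) t) (at t)"
      using 2 by (simp add: flat_def)
    then show ?thesis
      by (rule has_field_derivative_transform_within_open[where S = "{..<0}"])
        (use 2 in \<open>auto simp: flat_def\<close>)
  next
    case 3
    \<comment> \<open>Dividing by h multiplies the polynomial in 1/h by its variable, which is
      \<open>pCons 0 p\<close>; the quotient is therefore itself a flat function.\<close>
    have "((\<lambda>h. flat p h / h) \<longlongrightarrow> 0) (at_right 0)"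
      by (rule Lim_transform_eventually[OF flat_at_right_0[of "pCons 0 p"]])
        (auto simp: eventually_at_filter flat_def intro!: always_eventually)
    moreover have "((\<lambda>h. flat p h / h) \<longlongrightarrow> 0) (at_left 0)"
      by (rule tendsto_eventually) (auto simp: eventually_at_filter flat_def intro!: always_eventually)
    ultimately have "((\<lambda>h. flat p h / h) \<longlongrightarrow> 0) (at 0)"
      by (simp add: filterlim_split_at_real)
    then show ?thesis
      using 3 by (simp add: DERIV_def flat_def)
  qed
qed

text \<open>An algebra of functions that contains its own directional derivatives: membership is a
  matter of syntax, and every order of \<open>Ck\<close> follows by induction on the order. The
  polynomial parameter of \<open>flat\<close> is what closes the class under
  differentiation.\<close>

inductive smooth_alg :: "('a::euclidean_space \<Rightarrow> real) \<Rightarrow> bool" where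
  smooth_const: "smooth_alg (\<lambda>x. c)"
| smooth_flat: "smooth_alg (\<lambda>x. flat p (x \<bullet> v + m))"
| smooth_add: "smooth_alg f \<Longrightarrow> smooth_alg g \<Longrightarrow> smooth_alg (\<lambda>x. f x + g x)"
| smooth_mult: "smooth_alg f \<Longrightarrow> smooth_alg g \<Longrightarrow> smooth_alg (\<lambda>x. f x * g x)"

lemma smooth_alg_has_derivative:
  "smooth_alg f \<Longrightarrow> \<exists>D. (\<forall>x. (f has_derivative D x) (at x)) \<and> (\<forall>w. smooth_alg (\<lambda>x. D x w))"
proof (induction rule: smooth_alg.induct)
  case (smooth_const c)
  show ?case by (rule exI[of _ "\<lambda>x w. 0"]) (auto intro: smooth_alg.smooth_const)
next
  case (smooth_flat p v m)
  let ?q = "[:0, 0, 1:] * (p - pderiv p)"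
  have "((\<lambda>x. flat p (x \<bullet> v + m)) has_derivative (\<lambda>w. (w \<bullet> v) * flat ?q (x \<bullet> v + m))) (at x)" for x
    by (rule DERIV_compose_FDERIV[OF has_derivative_flat]) (auto intro!: derivative_eq_intros)
  moreover have "smooth_alg (\<lambda>x. (w \<bullet> v) * flat ?q (x \<bullet> v + m))" for w
    by (intro smooth_alg.intros)
  ultimately show ?case by (intro exI[of _ "\<lambda>x w. (w \<bullet> v) * flat ?q (x \<bullet> v + m)"]) blast
next
  case (smooth_add f g)
  then obtain D E where "\<forall>x. (f has_derivative D x) (at x)" "\<forall>w. smooth_alg (\<lambda>x. D x w)"
    "\<forall>x. (g has_derivative E x) (at x)" "\<forall>w. smooth_alg (\<lambda>x. E x w)" by blast
  then show ?case
    by (intro exI[of _ "\<lambda>x w. D x w + E x w"])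
      (auto intro!: derivative_eq_intros smooth_alg.smooth_add)
next
  case (smooth_mult f g)
  then obtain D E where "\<forall>x. (f has_derivative D x) (at x)" "\<forall>w. smooth_alg (\<lambda>x. D x w)"
    "\<forall>x. (g has_derivative E x) (at x)" "\<forall>w. smooth_alg (\<lambda>x. E x w)" by blast
  then show ?case using smooth_mult
    by (intro exI[of _ "\<lambda>x w. f x * E x w + D x w * g x"])
      (auto intro!: derivative_eq_intros smooth_alg.smooth_add smooth_alg.smooth_mult)
qed

lemma smooth_alg_imp_Ck: "smooth_alg f \<Longrightarrow> Ck k f"
proof (induction k arbitrary: f)
  case 0
  then show ?case
    using smooth_alg_has_derivative[OF 0] 
    by (auto intro!: continuous_at_imp_continuous_on dest: has_derivative_continuous)
next
  case (Suc k)
  obtain D where D: "\<And>x. (f has_derivative D x) (at x)" "\<And>w. smooth_alg (\<lambda>x. D x w)"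
    using smooth_alg_has_derivative[OF Suc.prems] by blast
  have "frechet_derivative f (at x) = D x" for x
    using frechet_derivative_at[OF D(1)] by simp
  moreover have "f differentiable_on UNIV"
    unfolding differentiable_on_def using D(1) differentiable_def by blast
  ultimately show ?case using Suc.IH[OF D(2)] by simp
qed

text \<open>Each factor is exp(-1/(k t)) with t the signed distance to one face and k = n + 1. It
  tends to 1 for t > 0 and vanishes for t \<le> 0, so the bumps approximate the indicator of the
  open box from below.\<close>

definition box_bump :: "nat \<Rightarrow> 'a \<Rightarrow> 'a \<Rightarrow> 'a::euclidean_space \<Rightarrow> real" where
  "box_bump n a b x = (\<Prod>i\<in>Basis. flat 1 (real (Suc n) * (x \<bullet> i - a \<bullet> i)) * flat 1 (real (Suc n) * (b \<bullet> i - x \<bullet> i)))"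

lemma smooth_alg_prod: "(\<And>i. i \<in> I \<Longrightarrow> smooth_alg (f i)) \<Longrightarrow> smooth_alg (\<lambda>x. \<Prod>i\<in>I. f i x)"
  by (induction I rule: infinite_finite_induct) (auto intro: smooth_alg.intros)

lemma smooth_alg_box_bump: "smooth_alg (box_bump n a b)"
proof -
  have "smooth_alg (\<lambda>x. flat 1 (real (Suc n) * (x \<bullet> i - a \<bullet> i)))" for i :: 'a
    using smooth_flat[of 1 "real (Suc n) *\<^sub>R i" "- real (Suc n) * (a \<bullet> i)"] by (simp add: algebra_simps)
  moreover have "smooth_alg (\<lambda>x. flat 1 (real (Suc n) * (b \<bullet> i - x \<bullet> i)))" for i :: 'a
    using smooth_flat[of 1 "- real (Suc n) *\<^sub>R i" "real (Suc n) * (b \<bullet> i)"] by (simp add: algebra_simps)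
  ultimately show ?thesis
    unfolding box_bump_def by (intro smooth_alg_prod smooth_alg.smooth_mult)
qed

lemma flat_1_bounds: "0 \<le> flat 1 t" "flat 1 t \<le> 1"
  by (auto simp: flat_def)

lemma box_bump_bounds: "0 \<le> box_bump n a b x" "box_bump n a b x \<le> 1"
  unfolding box_bump_def
  by (auto intro!: prod_nonneg prod_le_1 mult_nonneg_nonneg mult_le_one flat_1_bounds)

lemma box_bump_outside:
  assumes "x \<notin> box a b" shows "box_bump n a b x = 0"
proof -
  obtain i where "i \<in> Basis" "x \<bullet> i \<le> a \<bullet> i \<or> b \<bullet> i \<le> x \<bullet> i"
    using assms by (auto simp: mem_box not_less)
  then show ?thesis
    unfolding box_bump_def by (intro prod_zero bexI[of _ i]) (auto simp: flat_def zero_less_mult_iff)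
qed

lemma box_bump_tendsto: "(\<lambda>n. box_bump n a b x) \<longlonglongrightarrow> indicator (box a b) x"
proof (cases "x \<in> box a b")
  case True
  have flat: "(\<lambda>n. flat 1 (real (Suc n) * t)) \<longlonglongrightarrow> 1" if "t > 0" for t
  proof -
    have "(\<lambda>n. exp (- (inverse t * inverse (real (Suc n))))) \<longlonglongrightarrow> exp (- (inverse t * 0))"
      by (intro tendsto_intros LIMSEQ_inverse_real_of_nat)
    then show ?thesis using that by (simp add: flat_def divide_simps zero_less_mult_iff mult.commute del: of_nat_Suc)
  qed
  have "(\<lambda>n. box_bump n a b x) \<longlonglongrightarrow> (\<Prod>i\<in>(Basis::'a set). 1 * 1)"
    unfolding box_bump_def using True
    by (intro tendsto_prod tendsto_mult flat) (auto simp: mem_box)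
  then show ?thesis using True by simp
qed (simp add: box_bump_outside)

lemma test_function_box_bump:
  assumes "cbox a b \<subseteq> \<Omega>"
  shows "test_function \<Omega> (box_bump n a b)"
proof -
  have "closure {x. box_bump n a b x \<noteq> 0} \<subseteq> cbox a b"
    by (rule closure_minimal) (use box_bump_outside[of _ a b n] box_subset_cbox[of a b] in auto)
  moreover from this have "compact (closure {x. box_bump n a b x \<noteq> 0})"
    using compact_cbox closed_closure compact_Int_closed by (metis inf.absorb_iff2)
  ultimately show ?thesis
    unfolding test_function_def using assms smooth_alg_imp_Ck[OF smooth_alg_box_bump] by blast
qed

section \<open>The fundamental lemma of the calculus of variations\<close>

lemma integral_box_test_zero:
  fixes H :: "'a::euclidean_space \<Rightarrow> real"
  assumes H: "integrable lborel H" and ab: "cbox a b \<subseteq> V"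
    and test: "\<And>\<phi>. test_function V \<phi> \<Longrightarrow> (LINT x|lborel. \<phi> x * H x) = 0"
  shows "(LINT x|lborel. indicator (box a b) x * H x) = 0"
proof -
  have [measurable]: "H \<in> borel_measurable borel" using H by auto
  have [measurable]: "box_bump n a b \<in> borel_measurable borel" for n
    using smooth_alg_imp_Ck[OF smooth_alg_box_bump, of 0] by (auto intro: borel_measurable_continuous_onI)
  have "(\<lambda>n. LINT x|lborel. box_bump n a b x * H x) \<longlonglongrightarrow> (LINT x|lborel. indicator (box a b) x * H x)"
  proof (rule integral_dominated_convergence[where w = "\<lambda>x. \<bar>H x\<bar>"])
    show "AE x in lborel. (\<lambda>n. box_bump n a b x * H x) \<longlonglongrightarrow> indicator (box a b) x * H x"
      by (intro AE_I2 tendsto_mult_right box_bump_tendsto)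
    show "AE x in lborel. norm (box_bump n a b x * H x) \<le> \<bar>H x\<bar>" for n
      using box_bump_bounds[of n a b] by (intro AE_I2) (simp add: abs_mult mult_left_le_one_le)
  qed (use H in auto)
  then show ?thesis
    using LIMSEQ_unique[OF _ tendsto_const[of "0 :: real"]]
    by (simp add: test[OF test_function_box_bump[OF ab]])
qed

text \<open>The bumps show that H integrates to zero over boxes whose closure lies in V. Boxes are
  stable under intersection and generate the Borel sets, so Dynkin's argument reaches all Borel
  subsets of such a box. Uniqueness of densities and a countable cover of V by boxes finish.\<close>

lemma AE_zero_if_orthogonal_test_functions:
  fixes H :: "'a::euclidean_space \<Rightarrow> real"
  assumes H: "integrable lborel H" and V: "open V"
    and test: "\<And>\<phi>. test_function V \<phi> \<Longrightarrow> (LINT x|lborel. \<phi> x * H x) = 0"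
  shows "AE x in lborel. x \<in> V \<longrightarrow> H x = 0"
proof -
  have [measurable]: "H \<in> borel_measurable borel" using H by auto
  have box: "AE x in lborel. x \<in> box c d \<longrightarrow> H x = 0" if cd: "cbox c d \<subseteq> V" for c d
  proof -
    \<comment> \<open>Cutting H off outside the box turns a statement about subsets of the box into
      one about all Borel sets, which is the form the generator argument works with.\<close>
    let ?f = "\<lambda>x. indicator (box c d) x * H x"
    have f: "integrable lborel ?f"
      using integrable_mult_indicator[OF _ H, of "box c d"] by simp
    have Af: "integrable lborel (\<lambda>x. indicator A x * ?f x)" if "A \<in> sets borel" for A
      using integrable_mult_indicator[OF _ f, of A] that by simp
    have f0: "(LINT x|lborel. ?f x) = 0"
      by (rule integral_box_test_zero[OF H cd test])
    have "(LINT x|lborel. indicator A x * ?f x) = 0" if "A \<in> sets borel" for A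
    proof -
      have "Int_stable (range (\<lambda>(a, b). box a (b::'a)))"
        by (auto simp: Int_stable_def box_Int_box image_iff)
      moreover have "range (\<lambda>(a, b). box a (b::'a)) \<subseteq> Pow UNIV" by simp
      moreover have "A \<in> sigma_sets UNIV (range (\<lambda>(a, b). box a b))"
        using that by (simp add: borel_eq_box sets_measure_of)
      ultimately show ?thesis
      proof (induction rule: sigma_sets_induct_disjoint)
        case (basic A)
        then obtain a b where A: "A = box a b" by auto
        obtain a' b' where ab': "box a b \<inter> box c d = box a' b'"
          using box_Int_box by blast
        show ?case
        proof (cases "box a' b' = {}")
          case True
          then have "indicator A x * ?f x = 0" for x using A ab' by (auto simp: indicator_def)
          then show ?thesis by (intro integral_eq_zero_AE AE_I2)
        next
          \<comment> \<open>A nonempty open box determines its corners, so its closed version stays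
            inside \<open>cbox c d\<close> as well; the corners of an empty box could lie
            anywhere.\<close>
          case False
          moreover have "box a' b' \<subseteq> box c d" using ab' by blast
          ultimately have "cbox a' b' \<subseteq> cbox c d"
            by (simp add: subset_box box_ne_empty)
          then have "(LINT x|lborel. indicator (box a' b') x * H x) = 0"
            using cd by (intro integral_box_test_zero[OF H _ test]) auto
          then show ?thesis
            unfolding A ab'[symmetric] by (simp add: indicator_inter_arith mult.assoc)
        qed
      next
        case empty
        then show ?case by simp
      next
        case (compl A)
        have A: "A \<in> sets borel" using compl by (simp add: borel_eq_box sets_measure_of)
        have "(LINT x|lborel. indicator (UNIV - A) x * ?f x) = (LINT x|lborel. ?f x - indicator A x * ?f x)"
          by (rule Bochner_Integration.integral_cong) (auto simp: indicator_def)
        also have "\<dots> = 0"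
          using f0 compl by (subst Bochner_Integration.integral_diff[OF f Af[OF A]]) simp
        finally show ?case .
      next
        case (union A)
        have A: "A i \<in> sets borel" for i using union by (auto simp: borel_eq_box sets_measure_of)
        have "(LINT x:(\<Union>i. A i)|lborel. ?f x) = (\<Sum>i. (LINT x:(A i)|lborel. ?f x))"
        proof (rule lebesgue_integral_countable_add)
          show "set_integrable lborel (\<Union> (range A)) ?f"
            unfolding set_integrable_def using Af[of "\<Union> (range A)"] A by simp
        qed (use A union in \<open>auto simp: disjoint_family_on_def\<close>)
        then show ?case using union by (simp add: set_lebesgue_integral_def)
      qed
    qed
    then have "AE x in lborel. ?f x = 0"
      using f by (intro density_unique_real) (auto simp: set_lebesgue_integral_def)
    then show ?thesis by eventually_elim (auto simp: indicator_def)
  qed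
  obtain \<D> where \<D>: "countable \<D>" "\<D> \<subseteq> Pow V" "\<And>X. X \<in> \<D> \<Longrightarrow> \<exists>a b. X = cbox a b" "\<Union>\<D> = V"
    using open_countable_Union_open_cbox[OF V] by metis
  have "AE x in lborel. \<forall>X\<in>\<D>. x \<in> X \<longrightarrow> H x = 0"
    unfolding AE_ball_countable[OF \<D>(1)]
  proof
    fix X assume X: "X \<in> \<D>"
    then obtain a b where ab: "X = cbox a b" using \<D> by blast
    \<comment> \<open>V is covered by closed boxes, whereas \<open>box\<close> speaks of open ones;
      the faces in between are null.\<close>
    have "cbox a b - box a b \<in> null_sets lborel"
      using negligible_frontier_interval[of a b]
      by (simp add: negligible_iff_null_sets null_sets_completion_iff)
    then have "AE x in lborel. x \<notin> cbox a b - box a b" by (rule AE_not_in)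
    moreover have "AE x in lborel. x \<in> box a b \<longrightarrow> H x = 0"
      using X ab \<D> by (intro box) auto
    ultimately show "AE x in lborel. x \<in> X \<longrightarrow> H x = 0"
      unfolding ab by eventually_elim auto
  qed
  then show ?thesis
    by eventually_elim (use \<D>(4) in blast)
qed

section \<open>Weak derivatives along segments\<close>

lemma frechet_derivative_translate:
  assumes "f differentiable (at (x - c))"
  shows "frechet_derivative (\<lambda>x. f (x - c)) (at x) = frechet_derivative f (at (x - c))"
proof -
  have "((\<lambda>x. f (x - c)) has_derivative frechet_derivative f (at (x - c))) (at x)"
    by (rule has_derivative_compose[of "\<lambda>x. x - c" "\<lambda>h. h" x UNIV f])
      (use frechet_derivative_works[THEN iffD1, OF assms] in \<open>auto intro!: derivative_eq_intros\<close>)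
  then show ?thesis by (rule frechet_derivative_at[symmetric])
qed

lemma Ck_translate: "Ck k f \<Longrightarrow> Ck k (\<lambda>x. f (x - c))"
proof (induction k arbitrary: f)
  case 0
  then show ?case by (auto intro!: continuous_on_compose2[of UNIV f] continuous_intros)
next
  case (Suc k)
  then have f: "f differentiable (at x)" for x by (auto simp: differentiable_on_def)
  have "(\<lambda>x. f (x - c)) differentiable_on UNIV"
    unfolding differentiable_on_def
    using f differentiable_chain_at[of "\<lambda>x. x - c" _ f] by (auto simp: o_def)
  then show ?case
    using Suc.IH[of "\<lambda>x. frechet_derivative f (at x) b" for b] Suc.prems
    by (simp add: frechet_derivative_translate[OF f])
qed

lemma test_function_translate:
  assumes \<phi>: "test_function V \<phi>" and V: "\<And>x. x \<in> V \<Longrightarrow> x + c \<in> \<Omega>"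
  shows "test_function \<Omega> (\<lambda>x. \<phi> (x - c))"
proof -
  have "{x. \<phi> (x - c) \<noteq> 0} = (+) c ` {x. \<phi> x \<noteq> 0}"
    by (auto simp: image_iff intro!: exI[of _ "x - c" for x])
  then have cl: "closure {x. \<phi> (x - c) \<noteq> 0} = (+) c ` closure {x. \<phi> x \<noteq> 0}"
    by (simp add: closure_translation)
  show ?thesis
    using \<phi> V compact_translation[of "closure {x. \<phi> x \<noteq> 0}" c] unfolding test_function_def cl
    by (auto simp del: compact_closure simp: Ck_translate add.commute)
qed

lemma test_function_differentiable: "test_function \<Omega> \<phi> \<Longrightarrow> \<phi> differentiable (at x)"
  by (auto simp: test_function_def differentiable_on_def dest: spec[of _ "Suc 0"])

lemma continuous_on_test_function: "test_function \<Omega> \<phi> \<Longrightarrow> continuous_on UNIV \<phi>"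
  using differentiable_imp_continuous_within[OF test_function_differentiable]
  by (auto intro: continuous_at_imp_continuous_on)

lemma continuous_on_deriv_test_function:
  assumes "test_function \<Omega> \<phi>"
  shows "continuous_on UNIV (\<lambda>x. frechet_derivative \<phi> (at x) d)"
proof -
  have lin: "linear (frechet_derivative \<phi> (at x))" for x
    by (intro linear_frechet_derivative test_function_differentiable[OF assms])
  have "frechet_derivative \<phi> (at x) (\<Sum>b\<in>Basis. (d \<bullet> b) *\<^sub>R b)
      = (\<Sum>b\<in>Basis. (d \<bullet> b) * frechet_derivative \<phi> (at x) b)" for x
    by (simp add: linear_sum[OF lin] linear_cmul[OF lin])
  moreover have "continuous_on UNIV (\<lambda>x. frechet_derivative \<phi> (at x) b)" if "b \<in> Basis" for b
    using assms that by (auto simp: test_function_def dest: spec[of _ "Suc 0"])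
  ultimately show ?thesis
    by (auto simp: euclidean_representation intro!: continuous_intros)
qed

lemma bounded_of_continuous_compact_support:
  fixes f :: "'a::euclidean_space \<Rightarrow> real"
  assumes "continuous_on UNIV f" "compact K" "\<And>x. x \<notin> K \<Longrightarrow> f x = 0"
  obtains B where "B \<ge> 0" "\<And>x. \<bar>f x\<bar> \<le> B"
proof -
  have "bounded (f ` K)"
    using assms by (intro compact_imp_bounded compact_continuous_image) (auto intro: continuous_on_subset)
  then obtain B where B: "\<And>x. x \<in> K \<Longrightarrow> \<bar>f x\<bar> \<le> B" by (auto simp: bounded_iff)
  have "\<bar>f x\<bar> \<le> max B 0" for x using B[of x] assms(3)[of x] by (cases "x \<in> K") auto
  then show ?thesis using that[of "max B 0"] by auto
qed

lemma test_function_outside: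
  assumes "test_function \<Omega> \<phi>" "x \<notin> \<Omega>"
  shows "\<phi> x = 0" "frechet_derivative \<phi> (at x) d = 0"
proof -
  let ?K = "closure {x. \<phi> x \<noteq> 0}"
  have x: "x \<notin> ?K" using assms by (auto simp: test_function_def)
  then show "\<phi> x = 0" using closure_subset[of "{x. \<phi> x \<noteq> 0}"] by blast
  have "((\<lambda>x. 0) has_derivative (\<lambda>h. 0)) (at x)" by simp
  then have "(\<phi> has_derivative (\<lambda>h. 0)) (at x)"
    by (rule has_derivative_transform_within_open[of _ _ _ _ "- ?K"])
      (use x closure_subset[of "{x. \<phi> x \<noteq> 0}"] in auto)
  then show "frechet_derivative \<phi> (at x) d = 0"
    using frechet_derivative_at by metis
qed

lemma test_function_bounded:
  assumes \<phi>: "test_function \<Omega> \<phi>"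
  obtains B where "B \<ge> 0" "\<And>x. \<bar>\<phi> x\<bar> \<le> B" "\<And>x. \<bar>frechet_derivative \<phi> (at x) d\<bar> \<le> B"
proof -
  let ?K = "closure {x. \<phi> x \<noteq> 0}"
  \<comment> \<open>The support itself may play the role of the domain. The statements about
    vanishing outside the domain then give vanishing outside a compact set, and continuity yields
    bounds.\<close>
  have K: "compact ?K" "test_function ?K \<phi>" using \<phi> unfolding test_function_def by blast+
  obtain B1 where "B1 \<ge> 0" "\<And>x. \<bar>\<phi> x\<bar> \<le> B1"
    using bounded_of_continuous_compact_support[OF continuous_on_test_function[OF \<phi>] K(1) test_function_outside(1)[OF K(2)]]
    by blast
  moreover obtain B2 where "B2 \<ge> 0" "\<And>x. \<bar>frechet_derivative \<phi> (at x) d\<bar> \<le> B2"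
    using bounded_of_continuous_compact_support[OF continuous_on_deriv_test_function[OF \<phi>] K(1) test_function_outside(2)[OF K(2)]]
    by blast
  ultimately show ?thesis
    by (intro that[of "B1 + B2"]) (auto intro: add_increasing add_increasing2)
qed

lemma integral_lborel_translate:
  fixes f :: "'a::euclidean_space \<Rightarrow> 'b::{banach, second_countable_topology}"
  shows "(LINT x|lborel. f (x + c)) = (LINT x|lborel. f x)"
    and "integrable lborel (\<lambda>x. f (x + c)) \<longleftrightarrow> integrable lborel f"
proof -
  have eq: "distr lborel lborel (\<lambda>x. x + c) = (lborel :: 'a measure)" for c
  proof -
    have "distr lborel lborel (\<lambda>x. x + c) = distr lborel borel ((+) c)"
      by (rule distr_cong) (auto simp: add.commute)
    then show ?thesis by (simp add: lborel_distr_plus)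
  qed
  have int: "integrable lborel (\<lambda>x. f (x + c))" if "integrable lborel f" for f :: "'a \<Rightarrow> 'b" and c
    by (rule integrable_distr[where M' = lborel]) (use that in \<open>simp_all add: eq\<close>)
  show *: "integrable lborel (\<lambda>x. f (x + c)) \<longleftrightarrow> integrable lborel f"
    using int[of f c] int[of "\<lambda>x. f (x + c)" "- c"] by auto
  show "(LINT x|lborel. f (x + c)) = (LINT x|lborel. f x)"
  proof (cases "integrable lborel f")
    case True
    then have "f \<in> borel_measurable lborel" by simp
    then show ?thesis
      using integral_distr[of "\<lambda>x. x + c" lborel lborel f] by (simp add: eq)
  next
    case False
    then show ?thesis using * by (simp add: not_integrable_integral_eq)
  qed
qed

text \<open>The integral of |g(x + \<tau> d)| over x does not depend on \<tau>, so the double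
  integral is finite. This licenses the exchange of the x and \<tau> integrals in the next
  lemma.\<close>

lemma integrable_shift_pair:
  fixes g :: "'a::euclidean_space \<Rightarrow> real"
  assumes g: "integrable lborel g"
  shows "integrable (lborel \<Otimes>\<^sub>M lborel) (\<lambda>(\<tau>, x). indicator {0..s} \<tau> * g (x + \<tau> *\<^sub>R d))"
proof -
  have [measurable]: "g \<in> borel_measurable borel" using g by auto
  show ?thesis
  proof (rule lborel_pair.Fubini_integrable)
    have "(\<lambda>\<tau>. LINT x|lborel. norm (indicator {0..s} \<tau> * g (x + \<tau> *\<^sub>R d)))
        = (\<lambda>\<tau>. indicator {0..s} \<tau> * (LINT x|lborel. \<bar>g x\<bar>))"
      by (simp add: abs_mult integral_lborel_translate(1)[of "\<lambda>x. \<bar>g x\<bar>"])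
    then show "integrable lborel (\<lambda>\<tau>. LINT x|lborel. norm (case (\<tau>, x) of (\<tau>, x) \<Rightarrow> indicator {0..s} \<tau> * g (x + \<tau> *\<^sub>R d)))"
      by (auto simp: emeasure_lborel_Icc_eq intro!: integrable_mult_left)
    show "AE \<tau> in lborel. integrable lborel (\<lambda>x. case (\<tau>, x) of (\<tau>, x) \<Rightarrow> indicator {0..s} \<tau> * g (x + \<tau> *\<^sub>R d))"
      using g by (simp add: integral_lborel_translate(2)[of g])
  qed measurable
qed

text \<open>Testing with the translates of \<open>\<phi>\<close> and integrating over the translation parameter turns the
  weak derivative into a difference quotient, so that no mollification of \<open>u\<close> is needed.\<close>

lemma weak_derivative_on_segments:
  fixes u g :: "'a::euclidean_space \<Rightarrow> real"
  assumes u: "integrable lborel u" and g: "integrable lborel g"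
    and weak: "\<And>\<phi>. test_function \<Omega> \<phi> \<Longrightarrow>
      (LINT x|lborel. frechet_derivative \<phi> (at x) d * u x) = - (LINT x|lborel. \<phi> x * g x)"
    and V: "open V" "\<And>x \<tau>. x \<in> V \<Longrightarrow> 0 \<le> \<tau> \<Longrightarrow> \<tau> \<le> s \<Longrightarrow> x + \<tau> *\<^sub>R d \<in> \<Omega>"
    and s: "0 \<le> s"
  shows "AE x in lborel. x \<in> V \<longrightarrow> u (x + s *\<^sub>R d) - u x = (LINT \<tau>:{0..s}|lborel. g (x + \<tau> *\<^sub>R d))"
proof -
  have [measurable]: "g \<in> borel_measurable borel" "u \<in> borel_measurable borel" using u g by auto
  define G where "G x = (LINT \<tau>|lborel. indicator {0..s} \<tau> * g (x + \<tau> *\<^sub>R d))" for x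
  let ?H = "\<lambda>x. u (x + s *\<^sub>R d) - u x - G x"
  have gp: "integrable (lborel \<Otimes>\<^sub>M lborel) (\<lambda>(\<tau>, x). indicator {0..s} \<tau> * g (x + \<tau> *\<^sub>R d))"
    by (rule integrable_shift_pair[OF g])
  have Gint: "integrable lborel G"
    unfolding G_def using lborel_pair.integrable_snd[OF gp] by simp
  have us: "integrable lborel (\<lambda>x. u (x + s *\<^sub>R d))"
    using u by (simp add: integral_lborel_translate(2)[of u])
  have "AE x in lborel. x \<in> V \<longrightarrow> ?H x = 0"
  proof (rule AE_zero_if_orthogonal_test_functions[OF _ V(1)])
    show "integrable lborel ?H"
      using u us Gint by (intro Bochner_Integration.integrable_diff)
    fix \<phi> assume \<phi>: "test_function V \<phi>"
    define D where "D x = frechet_derivative \<phi> (at x) d" for x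
    have [measurable]: "\<phi> \<in> borel_measurable borel" "D \<in> borel_measurable borel"
      unfolding D_def[abs_def]
      using continuous_on_test_function[OF \<phi>] continuous_on_deriv_test_function[OF \<phi>]
      by (auto intro: borel_measurable_continuous_onI)
    obtain B where B: "B \<ge> 0" "\<And>x. \<bar>\<phi> x\<bar> \<le> B" "\<And>x. \<bar>D x\<bar> \<le> B"
      unfolding D_def using test_function_bounded[OF \<phi>, of d] by blast
    \<comment> \<open>The segment condition keeps the support of every translate of \<phi> inside
      \<Omega>, so each of them is admissible in the weak formulation.\<close>
    have tr: "(LINT x|lborel. D (x - \<tau> *\<^sub>R d) * u x) = - (LINT x|lborel. \<phi> x * g (x + \<tau> *\<^sub>R d))"
      if \<tau>: "\<tau> \<in> {0..s}" for \<tau>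
    proof -
      have "test_function \<Omega> (\<lambda>x. \<phi> (x - \<tau> *\<^sub>R d))"
        using \<tau> V(2) by (intro test_function_translate[OF \<phi>]) auto
      from weak[OF this] have "(LINT x|lborel. D (x - \<tau> *\<^sub>R d) * u x) = - (LINT x|lborel. \<phi> (x - \<tau> *\<^sub>R d) * g x)"
        by (simp add: frechet_derivative_translate[OF test_function_differentiable[OF \<phi>]] D_def)
      then show ?thesis
        using integral_lborel_translate(1)[of "\<lambda>x. \<phi> (x - \<tau> *\<^sub>R d) * g x" "\<tau> *\<^sub>R d"] by simp
    qed
    have ftc: "\<phi> (x - s *\<^sub>R d) - \<phi> x = (LINT \<tau>|lborel. - (indicator {0..s} \<tau> * D (x - \<tau> *\<^sub>R d)))" for x
    proof -
      have "(LINT \<tau>|lborel. indicator {0..s} \<tau> *\<^sub>R (- D (x - \<tau> *\<^sub>R d))) = \<phi> (x - s *\<^sub>R d) - \<phi> (x - 0 *\<^sub>R d)"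
      proof (rule integral_FTC_Icc[OF s])
        fix \<tau> :: real
        have fd: "(\<phi> has_derivative frechet_derivative \<phi> (at (x - \<tau> *\<^sub>R d))) (at (x - \<tau> *\<^sub>R d))"
          using test_function_differentiable[OF \<phi>] frechet_derivative_works by blast
        have "((\<lambda>\<tau>. x - \<tau> *\<^sub>R d) has_vector_derivative - d) (at \<tau> within {0..s})"
          by (auto intro!: derivative_eq_intros)
        from vector_derivative_diff_chain_within[OF this has_derivative_at_withinI[OF fd]]
        have "(\<phi> \<circ> (\<lambda>\<tau>. x - \<tau> *\<^sub>R d) has_vector_derivative frechet_derivative \<phi> (at (x - \<tau> *\<^sub>R d)) (- d)) (at \<tau> within {0..s})" .
        then show "((\<lambda>\<tau>. \<phi> (x - \<tau> *\<^sub>R d)) has_vector_derivative - D (x - \<tau> *\<^sub>R d)) (at \<tau> within {0..s})"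
          using linear_neg[OF linear_frechet_derivative[OF test_function_differentiable[OF \<phi>]]]
          by (simp add: o_def D_def)
      next
        show "continuous_on {0..s} (\<lambda>\<tau>. - D (x - \<tau> *\<^sub>R d))"
          unfolding D_def
          by (intro continuous_intros continuous_on_compose2[OF continuous_on_deriv_test_function[OF \<phi>]]) auto
      qed
      then show ?thesis by simp
    qed
    have p1: "integrable (lborel \<Otimes>\<^sub>M lborel) (\<lambda>(\<tau>, x). indicator {0..s} \<tau> * D (x - \<tau> *\<^sub>R d) * u x)"
    proof (rule Bochner_Integration.integrable_bound)
      show "integrable (lborel \<Otimes>\<^sub>M lborel) (\<lambda>p. B * (case p of (\<tau>, x) \<Rightarrow> indicator {0..s} \<tau> * u (x + \<tau> *\<^sub>R 0)))"
        by (intro integrable_mult_right integrable_shift_pair[OF u])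
      show "AE p in lborel \<Otimes>\<^sub>M lborel. norm (case p of (\<tau>, x) \<Rightarrow> indicator {0..s} \<tau> * D (x - \<tau> *\<^sub>R d) * u x)
          \<le> norm (B * (case p of (\<tau>, x) \<Rightarrow> indicator {0..s} \<tau> * u (x + \<tau> *\<^sub>R 0)))"
        using B by (intro AE_I2) (auto simp: abs_mult indicator_def intro!: mult_right_mono)
    qed measurable
    have p2: "integrable (lborel \<Otimes>\<^sub>M lborel) (\<lambda>(\<tau>, x). \<phi> x * (indicator {0..s} \<tau> * g (x + \<tau> *\<^sub>R d)))"
    proof (rule Bochner_Integration.integrable_bound)
      show "integrable (lborel \<Otimes>\<^sub>M lborel) (\<lambda>p. B * (case p of (\<tau>, x) \<Rightarrow> indicator {0..s} \<tau> * g (x + \<tau> *\<^sub>R d)))"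
        by (intro integrable_mult_right gp)
      show "AE p in lborel \<Otimes>\<^sub>M lborel. norm (case p of (\<tau>, x) \<Rightarrow> \<phi> x * (indicator {0..s} \<tau> * g (x + \<tau> *\<^sub>R d)))
          \<le> norm (B * (case p of (\<tau>, x) \<Rightarrow> indicator {0..s} \<tau> * g (x + \<tau> *\<^sub>R d)))"
        using B by (intro AE_I2) (auto simp: abs_mult intro!: mult_right_mono)
    qed measurable
    have bi: "integrable lborel (\<lambda>x. \<phi> (x - c) * h x)" if h: "integrable lborel h" for h :: "'a \<Rightarrow> real" and c
    proof (rule Bochner_Integration.integrable_bound)
      show "integrable lborel (\<lambda>x. B * h x)" using h by simp
      show "AE x in lborel. norm (\<phi> (x - c) * h x) \<le> norm (B * h x)"
        using B by (intro AE_I2) (auto simp: abs_mult intro!: mult_right_mono)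
    qed (use h in measurable)
    \<comment> \<open>The shift moves from u to \<phi>; by \<open>ftc\<close> the increment of
      \<phi> is an integral of its derivative over the shifts; after exchanging the integrals,
      \<open>tr\<close> applies for each fixed \<tau>.\<close>
    have "(LINT x|lborel. \<phi> x * (u (x + s *\<^sub>R d) - u x))
        = (LINT x|lborel. \<phi> x * u (x + s *\<^sub>R d)) - (LINT x|lborel. \<phi> x * u x)"
      using bi[OF us, of 0] bi[OF u, of 0] by (simp add: right_diff_distrib)
    also have "(LINT x|lborel. \<phi> x * u (x + s *\<^sub>R d)) = (LINT x|lborel. \<phi> (x - s *\<^sub>R d) * u x)"
      using integral_lborel_translate(1)[of "\<lambda>x. \<phi> (x - s *\<^sub>R d) * u x" "s *\<^sub>R d"] by simp
    also have "\<dots> - (LINT x|lborel. \<phi> x * u x) = (LINT x|lborel. (\<phi> (x - s *\<^sub>R d) - \<phi> x) * u x)"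
      using bi[OF u, of 0] bi[OF u] by (simp add: left_diff_distrib)
    also have "\<dots> = - (LINT x|lborel. (LINT \<tau>|lborel. indicator {0..s} \<tau> * D (x - \<tau> *\<^sub>R d) * u x))"
      by (simp add: ftc)
    also have "\<dots> = - (LINT \<tau>|lborel. (LINT x|lborel. indicator {0..s} \<tau> * D (x - \<tau> *\<^sub>R d) * u x))"
      using lborel_pair.Fubini_integral[OF p1] by simp
    also have "\<dots> = (LINT \<tau>|lborel. - (LINT x|lborel. indicator {0..s} \<tau> * D (x - \<tau> *\<^sub>R d) * u x))"
      by (rule Bochner_Integration.integral_minus[symmetric])
    also have "\<dots> = (LINT \<tau>|lborel. (LINT x|lborel. \<phi> x * (indicator {0..s} \<tau> * g (x + \<tau> *\<^sub>R d))))"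
    proof (rule Bochner_Integration.integral_cong[OF refl])
      fix \<tau> :: real
      show "- (LINT x|lborel. indicator {0..s} \<tau> * D (x - \<tau> *\<^sub>R d) * u x)
          = (LINT x|lborel. \<phi> x * (indicator {0..s} \<tau> * g (x + \<tau> *\<^sub>R d)))"
        using tr[of \<tau>] by (cases "\<tau> \<in> {0..s}") auto
    qed
    also have "\<dots> = (LINT x|lborel. \<phi> x * G x)"
      using lborel_pair.Fubini_integral[OF p2] by (simp add: G_def)
    finally show "(LINT x|lborel. \<phi> x * ?H x) = 0"
      using bi[OF Bochner_Integration.integrable_diff[OF us u], of 0] bi[OF Gint, of 0]
      by (simp add: right_diff_distrib)
  qed
  then show ?thesis
    by (simp add: G_def set_lebesgue_integral_def)
qed

section \<open>A local-to-global principle and the chain rule\<close>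

text \<open>This stands in for summing over fine partitions: bisection upgrades the local bounds to
  D a b \<le> \<epsilon> (m b - m a), and \<epsilon> is arbitrary. It is used for the chain rule,
  for moving a seminorm under an integral, and for integration by parts.\<close>

lemma subadditive_local_to_global:
  fixes D :: "real \<Rightarrow> real \<Rightarrow> real"
  assumes ab: "a \<le> b"
    and sub: "\<And>s t u. a \<le> s \<Longrightarrow> s \<le> t \<Longrightarrow> t \<le> u \<Longrightarrow> u \<le> b \<Longrightarrow> D s u \<le> D s t + D t u"
    and loc: "\<And>\<epsilon> x. \<epsilon> > 0 \<Longrightarrow> a \<le> x \<Longrightarrow> x \<le> b \<Longrightarrow>
      \<exists>\<delta>>0. \<forall>s t. a \<le> s \<and> s \<le> x \<and> x \<le> t \<and> t \<le> b \<and> t - s < \<delta> \<longrightarrow> D s t \<le> \<epsilon> * (m t - m s)"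
  shows "D a b \<le> 0"
proof -
  have le: "D a b \<le> \<epsilon> * (m b - m a)" if \<epsilon>: "\<epsilon> > 0" for \<epsilon>
  proof -
    define P where "P s t \<longleftrightarrow> (a \<le> s \<and> t \<le> b \<longrightarrow> D s t \<le> \<epsilon> * (m t - m s))" for s t
    have "P a b"
      using ab
    proof (induction rule: Bolzano)
      case (trans s t u)
      show ?case
        unfolding P_def
      proof
        assume su: "a \<le> s \<and> u \<le> b"
        then have "D s u \<le> D s t + D t u" using trans by (intro sub) auto
        also have "\<dots> \<le> \<epsilon> * (m t - m s) + \<epsilon> * (m u - m t)"
          using trans su unfolding P_def by (intro add_mono) auto
        finally show "D s u \<le> \<epsilon> * (m u - m s)" by (simp add: algebra_simps)
      qed
    next
      case (local x)
      then show ?case using loc[OF \<epsilon>, of x] unfolding P_def by blast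
    qed
    then show ?thesis by (simp add: P_def)
  qed
  show ?thesis
  \<comment> \<open>The total increment of \<open>m\<close> may have either sign; only a positive
    one has to be scaled away by the choice of \<epsilon>.\<close>
  proof (cases "m b - m a \<le> 0")
    case True
    then show ?thesis using le[of 1] by simp
  next
    case False
    show ?thesis
    proof (rule field_le_epsilon)
      fix e :: real assume "e > 0"
      then show "D a b \<le> 0 + e" using le[of "e / (m b - m a)"] False by simp
    qed
  qed
qed

lemma set_integral_Icc_combine:
  fixes f :: "real \<Rightarrow> 'b::{banach, second_countable_topology}"
  assumes f: "set_integrable lborel {a..c} f" and "a \<le> b" "b \<le> c"
  shows "(LINT x:{a..c}|lborel. f x) = (LINT x:{a..b}|lborel. f x) + (LINT x:{b..c}|lborel. f x)"
proof -
  have "{a..c} = {a..b} \<union> {b<..c}" using assms by auto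
  then have "(LINT x:{a..c}|lborel. f x) = (LINT x:{a..b}|lborel. f x) + (LINT x:{b<..c}|lborel. f x)"
    using assms by (auto intro!: set_integral_Un set_integrable_subset[OF f])
  also have "(LINT x:{b<..c}|lborel. f x) = (LINT x:{b..c}|lborel. f x)"
  proof -
    have [measurable]: "(\<lambda>x. indicator {b..c} x *\<^sub>R f x) \<in> borel_measurable lborel"
      "(\<lambda>x. indicator {b<..c} x *\<^sub>R f x) \<in> borel_measurable lborel"
      using assms set_integrable_subset[OF f, of "{b..c}"] set_integrable_subset[OF f, of "{b<..c}"]
      by (fastforce simp: set_integrable_def)+
    have "AE x in lborel. indicator {b<..c} x *\<^sub>R f x = indicator {b..c} x *\<^sub>R f x"
      using AE_lborel_singleton[of b] by eventually_elim (auto simp: indicator_def)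
    then show ?thesis
      unfolding set_lebesgue_integral_def by (intro integral_cong_AE) auto
  qed
  finally show ?thesis .
qed

lemma set_integral_norm_le:
  fixes f :: "real \<Rightarrow> 'b::{banach, second_countable_topology}"
  assumes "set_integrable lborel A f"
  shows "norm (LINT x:A|lborel. f x) \<le> (LINT x:A|lborel. norm (f x))"
  using assms integral_norm_bound[of lborel "\<lambda>x. indicator A x *\<^sub>R f x"]
  by (simp add: set_lebesgue_integral_def)

lemma indefinite_integral_real_continuous:
  fixes f :: "real \<Rightarrow> real"
  assumes "set_integrable lborel {a..b} f"
  shows "continuous_on {a..b} (\<lambda>t. LINT x:{a..t}|lborel. f x)"
proof -
  have "continuous_on {a..b} (\<lambda>t. integral {a..t} f)"
    using set_borel_integral_eq_integral(1)[OF assms] by (rule indefinite_integral_continuous_1)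
  moreover have "integral {a..t} f = (LINT x:{a..t}|lborel. f x)" if "t \<in> {a..b}" for t
    using that by (intro set_borel_integral_eq_integral(2)[symmetric] set_integrable_subset[OF assms]) auto
  ultimately show ?thesis
    by (rule continuous_on_eq)
qed

lemma set_integrable_mult_bounded:
  fixes f g :: "real \<Rightarrow> real"
  assumes g: "set_integrable lborel {a..b} g" and f: "continuous_on {a..b} f"
  shows "set_integrable lborel {a..b} (\<lambda>x. f x * g x)"
proof -
  have "bounded (f ` {a..b})"
    by (intro compact_imp_bounded compact_continuous_image f) simp
  then obtain B where B: "\<And>x. x \<in> {a..b} \<Longrightarrow> \<bar>f x\<bar> \<le> B" unfolding bounded_iff by fastforce
  have m: "(\<lambda>x. indicator {a..b} x *\<^sub>R f x) \<in> borel_measurable lborel"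
    using borel_measurable_continuous_on_indicator[OF _ f] by simp
  have eq: "indicator {a..b} x *\<^sub>R (f x * g x) = (indicator {a..b} x *\<^sub>R f x) * (indicator {a..b} x *\<^sub>R g x)" for x
    by (simp add: indicator_def)
  show ?thesis
    unfolding set_integrable_def
  proof (rule Bochner_Integration.integrable_bound)
    show "integrable lborel (\<lambda>x. B * (indicator {a..b} x *\<^sub>R g x))"
      using g unfolding set_integrable_def by simp
    show "(\<lambda>x. indicator {a..b} x *\<^sub>R (f x * g x)) \<in> borel_measurable lborel"
      unfolding eq using m g unfolding set_integrable_def by (intro borel_measurable_times) auto
    show "AE x in lborel. norm (indicator {a..b} x *\<^sub>R (f x * g x)) \<le> norm (B * (indicator {a..b} x *\<^sub>R g x))"
      using B by (intro AE_I2) (fastforce simp: indicator_def abs_mult intro!: mult_right_mono)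
  qed
qed

text \<open>Since g is merely integrable, v is absolutely continuous but need not be differentiable
  everywhere. On a short interval the mean value theorem gives the increment of F(v) as F'(\<xi>)
  times the integral of g, and F'(\<xi>) differs from F'(v) by at most \<epsilon>. The error is at
  most \<epsilon> times the integral of |g|, whose primitive serves as \<open>m\<close>.\<close>

lemma chain_rule_indefinite_integral:
  fixes F F' g v :: "real \<Rightarrow> real"
  assumes ab: "a \<le> b" and g: "set_integrable lborel {a..b} g"
    and F: "\<And>x. (F has_real_derivative F' x) (at x)" and F': "continuous_on UNIV F'"
    and v: "\<And>t. t \<in> {a..b} \<Longrightarrow> v t = c + (LINT x:{a..t}|lborel. g x)"
  shows "F (v b) - F (v a) = (LINT x:{a..b}|lborel. F' (v x) * g x)"
proof -
  have vcont: "continuous_on {a..b} v"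
    by (subst continuous_on_cong[OF refl v]) (simp, intro continuous_intros indefinite_integral_real_continuous[OF g])
  have F'v: "continuous_on {a..b} (\<lambda>x. F' (v x))"
    by (rule continuous_on_compose2[OF F' vcont]) auto
  have F'vg: "set_integrable lborel {a..b} (\<lambda>x. F' (v x) * g x)"
    by (rule set_integrable_mult_bounded[OF g F'v])
  have gn: "set_integrable lborel {a..b} (\<lambda>x. \<bar>g x\<bar>)"
    using g by (rule set_integrable_abs)
  define I where "I s t = (LINT x:{s..t}|lborel. F' (v x) * g x)" for s t
  define m where "m t = (LINT x:{a..t}|lborel. \<bar>g x\<bar>)" for t
  have sub: "set_integrable lborel {s..t} f" if "set_integrable lborel {a..b} f" "a \<le> s" "t \<le> b"
    for f :: "real \<Rightarrow> real" and s t
    using that by (intro set_integrable_subset[OF that(1)]) auto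
  have vst: "v t - v s = (LINT x:{s..t}|lborel. g x)" if "a \<le> s" "s \<le> t" "t \<le> b" for s t
    using set_integral_Icc_combine[OF sub[OF g order_refl], of t s] v[of s] v[of t] that by simp
  have "\<bar>F (v b) - F (v a) - I a b\<bar> \<le> 0"
  proof (rule subadditive_local_to_global[OF ab, where m = m])
    fix s t u assume stu: "a \<le> s" "s \<le> t" "t \<le> u" "u \<le> b"
    have "I s u = I s t + I t u"
      unfolding I_def using stu by (intro set_integral_Icc_combine sub[OF F'vg]) auto
    then show "\<bar>F (v u) - F (v s) - I s u\<bar> \<le> \<bar>F (v t) - F (v s) - I s t\<bar> + \<bar>F (v u) - F (v t) - I t u\<bar>"
      by linarith
  next
    fix \<epsilon> x :: real assume \<epsilon>: "\<epsilon> > 0" and x: "a \<le> x" "x \<le> b"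
    obtain \<eta> where \<eta>: "\<eta> > 0" "\<And>y. \<bar>y - v x\<bar> < \<eta> \<Longrightarrow> \<bar>F' y - F' (v x)\<bar> < \<epsilon> / 2"
      using F' \<epsilon> unfolding continuous_on_iff dist_real_def by (metis UNIV_I half_gt_zero)
    obtain \<delta> where \<delta>: "\<delta> > 0" "\<And>\<tau>. \<tau> \<in> {a..b} \<Longrightarrow> \<bar>\<tau> - x\<bar> < \<delta> \<Longrightarrow> \<bar>v \<tau> - v x\<bar> < \<eta>"
      using vcont x \<eta>(1) unfolding continuous_on_iff dist_real_def by (metis atLeastAtMost_iff)
    have "\<bar>F (v t) - F (v s) - I s t\<bar> \<le> \<epsilon> * (m t - m s)"
      if st: "a \<le> s" "s \<le> x" "x \<le> t" "t \<le> b" "t - s < \<delta>" for s t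
    proof -
      have near: "\<bar>v \<tau> - v x\<bar> < \<eta>" if "\<tau> \<in> {s..t}" for \<tau>
        using that st by (intro \<delta>(2)) auto
      \<comment> \<open>The mean value theorem wants distinct ordered arguments, whereas v may rise,
        fall or return to the same value between s and t. In each case \<xi> is close to v
        x.\<close>
      obtain \<xi> where \<xi>: "F (v t) - F (v s) = F' \<xi> * (v t - v s)" "\<bar>\<xi> - v x\<bar> < \<eta>"
      proof -
        have ns: "\<bar>v s - v x\<bar> < \<eta>" and nt: "\<bar>v t - v x\<bar> < \<eta>" using near st by auto
        consider "v s < v t" | "v s = v t" | "v t < v s" by linarith
        then show ?thesis
        proof cases
          case 1
          from MVT2[OF this, of F F'] F obtain z where "v s < z" "z < v t" "F (v t) - F (v s) = (v t - v s) * F' z"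
            by blast
          then show ?thesis using ns nt by (intro that[of z]) auto
        next
          case 2
          then show ?thesis using ns by (intro that[of "v s"]) auto
        next
          case 3
          from MVT2[OF this, of F F'] F obtain z where "v t < z" "z < v s" "F (v s) - F (v t) = (v s - v t) * F' z"
            by blast
          then show ?thesis using ns nt by (intro that[of z]) (auto simp: algebra_simps)
        qed
      qed
      have gst: "set_integrable lborel {s..t} g" using st by (intro sub[OF g]) auto
      have "F (v t) - F (v s) - I s t = (LINT x:{s..t}|lborel. F' \<xi> * g x) - I s t"
        using vst[of s t] st \<xi>(1) by simp
      also have "\<dots> = (LINT x:{s..t}|lborel. F' \<xi> * g x - F' (v x) * g x)"
        unfolding I_def using st gst sub[OF F'vg, of s t] by (intro set_integral_diff(2)[symmetric]) auto
      finally have "\<bar>F (v t) - F (v s) - I s t\<bar> \<le> (LINT x:{s..t}|lborel. \<bar>F' \<xi> * g x - F' (v x) * g x\<bar>)"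
        using set_integral_norm_le[of "{s..t}" "\<lambda>x. F' \<xi> * g x - F' (v x) * g x"] gst sub[OF F'vg, of s t] st
        by auto
      also have "\<dots> \<le> (LINT x:{s..t}|lborel. \<epsilon> * \<bar>g x\<bar>)"
      proof (rule set_integral_mono)
        show "set_integrable lborel {s..t} (\<lambda>x. \<bar>F' \<xi> * g x - F' (v x) * g x\<bar>)"
          using st gst sub[OF F'vg, of s t] by (intro set_integrable_abs set_integral_diff(1)) auto
        show "set_integrable lborel {s..t} (\<lambda>x. \<epsilon> * \<bar>g x\<bar>)"
          using gst by (intro set_integrable_mult_right set_integrable_abs) auto
        fix y assume "y \<in> {s..t}"
        then have "\<bar>F' (v y) - F' (v x)\<bar> < \<epsilon> / 2" "\<bar>F' \<xi> - F' (v x)\<bar> < \<epsilon> / 2"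
          using near \<xi>(2) \<eta>(2) by auto
        then have "\<bar>F' \<xi> - F' (v y)\<bar> \<le> \<epsilon>" by linarith
        then show "\<bar>F' \<xi> * g y - F' (v y) * g y\<bar> \<le> \<epsilon> * \<bar>g y\<bar>"
          unfolding left_diff_distrib[symmetric] abs_mult by (intro mult_right_mono) auto
      qed
      also have "\<dots> = \<epsilon> * (m t - m s)"
        unfolding m_def using set_integral_Icc_combine[OF sub[OF gn order_refl], of t s] st by simp
      finally show ?thesis .
    qed
    then show "\<exists>\<delta>>0. \<forall>s t. a \<le> s \<and> s \<le> x \<and> x \<le> t \<and> t \<le> b \<and> t - s < \<delta> \<longrightarrow>
        \<bar>F (v t) - F (v s) - I s t\<bar> \<le> \<epsilon> * (m t - m s)"
      using \<delta>(1) by blast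
  qed
  then show ?thesis by (simp add: I_def)
qed

text \<open>For every t the value |F(v 0)| is at most |F(v t)| plus the integral of |F'(v) g|.
  Averaging over t in [0, \<delta>] removes the end value, so a segment of fixed length inside the
  domain suffices and u may be nonzero at the boundary.\<close>

lemma chain_rule_average_bound:
  fixes F F' g v :: "real \<Rightarrow> real"
  assumes \<delta>: "\<delta> > 0" and g: "set_integrable lborel {0..\<delta>} g"
    and F: "\<And>x. (F has_real_derivative F' x) (at x)" and F': "continuous_on UNIV F'"
    and v: "\<And>t. t \<in> {0..\<delta>} \<Longrightarrow> v t = c + (LINT x:{0..t}|lborel. g x)"
  shows "ennreal \<bar>F (v 0)\<bar> \<le> (\<integral>\<^sup>+t. indicator {0..\<delta>} t * ennreal (\<bar>F (v t)\<bar> / \<delta> + \<bar>F' (v t)\<bar> * \<bar>g t\<bar>) \<partial>lborel)"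
proof -
  have vcont: "continuous_on {0..\<delta>} v"
    by (subst continuous_on_cong[OF refl v]) (simp, intro continuous_intros indefinite_integral_real_continuous[OF g])
  have Fc: "continuous_on UNIV F"
    using F by (intro continuous_at_imp_continuous_on) (auto intro: DERIV_isCont)
  have F'vg: "set_integrable lborel {0..\<delta>} (\<lambda>x. \<bar>F' (v x)\<bar> * \<bar>g x\<bar>)"
    by (intro set_integrable_mult_bounded set_integrable_abs g continuous_intros continuous_on_compose2[OF F' vcont]) auto
  have Fv: "set_integrable lborel {0..\<delta>} (\<lambda>x. \<bar>F (v x)\<bar>)"
    unfolding set_integrable_def
    by (intro borel_integrable_compact continuous_intros continuous_on_compose2[OF Fc vcont]) auto
  define J where "J = (LINT x:{0..\<delta>}|lborel. \<bar>F' (v x)\<bar> * \<bar>g x\<bar>)"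
  have pt: "\<bar>F (v 0)\<bar> \<le> \<bar>F (v t)\<bar> + J" if t: "t \<in> {0..\<delta>}" for t
  proof -
    have gt: "set_integrable lborel {0..t} g"
      using t by (intro set_integrable_subset[OF g]) auto
    have "set_integrable lborel {0..t} (\<lambda>x. F' (v x) * g x)"
      using t by (intro set_integrable_mult_bounded gt continuous_on_compose2[OF F'])
        (auto intro: continuous_on_subset[OF vcont])
    moreover have "F (v t) - F (v 0) = (LINT x:{0..t}|lborel. F' (v x) * g x)"
      using t by (intro chain_rule_indefinite_integral[OF _ gt F F', of v c]) (auto intro: v)
    ultimately have "\<bar>F (v t) - F (v 0)\<bar> \<le> (LINT x:{0..t}|lborel. \<bar>F' (v x)\<bar> * \<bar>g x\<bar>)"
      using set_integral_norm_le[of "{0..t}" "\<lambda>x. F' (v x) * g x"] by (simp add: abs_mult)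
    also have "\<dots> \<le> J"
      unfolding J_def set_lebesgue_integral_def
      using t F'vg set_integrable_subset[OF F'vg, of "{0..t}"]
      by (intro integral_mono) (auto simp: set_integrable_def indicator_def)
    finally show ?thesis by linarith
  qed
  have "\<bar>F (v 0)\<bar> = (LINT t:{0..\<delta>}|lborel. \<bar>F (v 0)\<bar> / \<delta>)"
    using \<delta> by (simp add: set_lebesgue_integral_def)
  also have "\<dots> \<le> (LINT t:{0..\<delta>}|lborel. (\<bar>F (v t)\<bar> + J) / \<delta>)"
    using \<delta> Fv pt by (intro set_integral_mono set_integrable_divide set_integral_add(1))
      (auto simp: set_integrable_def divide_right_mono integrable_indicator_iff)
  also have "\<dots> = (LINT t:{0..\<delta>}|lborel. \<bar>F (v t)\<bar> / \<delta>) + J"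
    using \<delta> Fv unfolding add_divide_distrib
    by (subst set_integral_add(2)) (auto simp: set_integrable_def set_lebesgue_integral_def)
  also have "\<dots> = (LINT t:{0..\<delta>}|lborel. \<bar>F (v t)\<bar> / \<delta> + \<bar>F' (v t)\<bar> * \<bar>g t\<bar>)"
    using Fv F'vg unfolding J_def by (subst set_integral_add(2)) auto
  finally have "ennreal \<bar>F (v 0)\<bar> \<le> ennreal (LINT t:{0..\<delta>}|lborel. \<bar>F (v t)\<bar> / \<delta> + \<bar>F' (v t)\<bar> * \<bar>g t\<bar>)"
    by (rule ennreal_leI)
  also have "\<dots> = (\<integral>\<^sup>+t. ennreal (indicator {0..\<delta>} t *\<^sub>R (\<bar>F (v t)\<bar> / \<delta> + \<bar>F' (v t)\<bar> * \<bar>g t\<bar>)) \<partial>lborel)"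
    unfolding set_lebesgue_integral_def
    using \<delta> set_integral_add(1)[OF set_integrable_divide[OF Fv, of \<delta>] F'vg]
    by (intro nn_integral_eq_integral[symmetric]) (auto simp: set_integrable_def)
  also have "\<dots> = (\<integral>\<^sup>+t. indicator {0..\<delta>} t * ennreal (\<bar>F (v t)\<bar> / \<delta> + \<bar>F' (v t)\<bar> * \<bar>g t\<bar>) \<partial>lborel)"
    by (rule nn_integral_cong) (simp add: indicator_def)
  finally show ?thesis .
qed

text \<open>For almost every x in V the function t \<mapsto> u(x + t d) agrees for almost every t
  with an indefinite integral starting at u x. Agreement for almost every t is enough, because the
  right-hand side is an integral over t.\<close>

lemma weak_derivative_average_bound:
  fixes u g :: "'a::euclidean_space \<Rightarrow> real" and F F' :: "real \<Rightarrow> real"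
  assumes u: "integrable lborel u" and g: "integrable lborel g"
    and weak: "\<And>\<phi>. test_function \<Omega> \<phi> \<Longrightarrow>
      (LINT x|lborel. frechet_derivative \<phi> (at x) d * u x) = - (LINT x|lborel. \<phi> x * g x)"
    and V: "open V" "\<And>x \<tau>. x \<in> V \<Longrightarrow> 0 \<le> \<tau> \<Longrightarrow> \<tau> \<le> \<delta> \<Longrightarrow> x + \<tau> *\<^sub>R d \<in> \<Omega>"
    and \<delta>: "\<delta> > 0"
    and F: "\<And>x. (F has_real_derivative F' x) (at x)" and F': "continuous_on UNIV F'"
  shows "AE x in lborel. x \<in> V \<longrightarrow> ennreal \<bar>F (u x)\<bar> \<le>
    (\<integral>\<^sup>+t. indicator {0..\<delta>} t * ennreal (\<bar>F (u (x + t *\<^sub>R d))\<bar> / \<delta> + \<bar>F' (u (x + t *\<^sub>R d))\<bar> * \<bar>g (x + t *\<^sub>R d)\<bar>) \<partial>lborel)"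
proof -
  have [measurable]: "g \<in> borel_measurable borel" "u \<in> borel_measurable borel" using u g by auto
  have [measurable]: "V \<in> sets borel" using V by simp
  define G where "G t x = (LINT \<tau>|lborel. indicator {0..t} \<tau> * g (x + \<tau> *\<^sub>R d))" for t x
  \<comment> \<open>Joint measurability in (t, x) is what permits the exchange of the two
    almost-everywhere quantifiers further down.\<close>
  have G [measurable]: "case_prod G \<in> borel_measurable (lborel \<Otimes>\<^sub>M lborel)"
  proof -
    have "Measurable.pred ((borel \<Otimes>\<^sub>M borel) \<Otimes>\<^sub>M borel) (\<lambda>p :: (real \<times> 'a) \<times> real. 0 \<le> snd p \<and> snd p \<le> fst (fst p))"
      by measurable
    then have "(\<lambda>p :: (real \<times> 'a) \<times> real. (if 0 \<le> snd p \<and> snd p \<le> fst (fst p) then 1 else 0) * g (snd (fst p) + snd p *\<^sub>R d))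
        \<in> borel_measurable ((borel \<Otimes>\<^sub>M borel) \<Otimes>\<^sub>M borel)"
      by measurable
    moreover have "(\<lambda>p :: (real \<times> 'a) \<times> real. (if 0 \<le> snd p \<and> snd p \<le> fst (fst p) then 1 else 0) * g (snd (fst p) + snd p *\<^sub>R d))
      = (\<lambda>p. indicator {0..fst (fst p)} (snd p) * g (snd (fst p) + snd p *\<^sub>R d))"
      by (auto simp: indicator_def)
    ultimately have "(\<lambda>(p :: real \<times> 'a, \<tau> :: real). indicator {0..fst p} \<tau> * g (snd p + \<tau> *\<^sub>R d))
        \<in> borel_measurable ((lborel \<Otimes>\<^sub>M lborel) \<Otimes>\<^sub>M lborel)"
      by (simp add: case_prod_beta' cong: measurable_cong_sets)
    then have "(\<lambda>p :: real \<times> 'a. LINT \<tau>|lborel. indicator {0..fst p} \<tau> * g (snd p + \<tau> *\<^sub>R d)) \<in> borel_measurable (lborel \<Otimes>\<^sub>M lborel)"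
      by (intro lborel.borel_measurable_lebesgue_integral) simp
    then show ?thesis by (simp add: G_def case_prod_beta')
  qed
  have "AE t in lborel. AE x in lborel. t \<in> {0..\<delta>} \<and> x \<in> V \<longrightarrow> u (x + t *\<^sub>R d) - u x = G t x"
  proof (rule AE_I2)
    fix t :: real
    show "AE x in lborel. t \<in> {0..\<delta>} \<and> x \<in> V \<longrightarrow> u (x + t *\<^sub>R d) - u x = G t x"
    proof (cases "t \<in> {0..\<delta>}")
      case True
      then have "AE x in lborel. x \<in> V \<longrightarrow> u (x + t *\<^sub>R d) - u x = (LINT \<tau>:{0..t}|lborel. g (x + \<tau> *\<^sub>R d))"
        using V by (intro weak_derivative_on_segments[OF u g weak V(1)]) auto
      then show ?thesis
        by eventually_elim (simp add: G_def set_lebesgue_integral_def)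
    qed (auto intro!: AE_I2)
  qed
  \<comment> \<open>The exceptional set of x depends on t; Fubini turns this into an exceptional set
    of t for almost every fixed x.\<close>
  then have "AE x in lborel. AE t in lborel. t \<in> {0..\<delta>} \<and> x \<in> V \<longrightarrow> u (x + t *\<^sub>R d) - u x = G t x"
    by (subst lborel_pair.AE_commute[symmetric]) measurable
  moreover have "AE x in lborel. integrable lborel (\<lambda>\<tau>. indicator {0..\<delta>} \<tau> * g (x + \<tau> *\<^sub>R d))"
    using lborel_pair.AE_integrable_fst'[OF lborel_pair.integrable_product_swap[OF integrable_shift_pair[OF g, of \<delta> d]]]
    by simp
  ultimately show ?thesis
  proof eventually_elim
    case (elim x)
    show ?case
    proof
      assume x: "x \<in> V"
      \<comment> \<open>The continuous version of u along the segment, normalised to start at the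
        value u x itself.\<close>
      define v where "v t = u x + (LINT \<tau>:{0..t}|lborel. g (x + \<tau> *\<^sub>R d))" for t
      have "v 0 = u x"
        using AE_lborel_singleton[of "0::real"]
        by (auto simp: v_def set_lebesgue_integral_def indicator_def intro!: integral_eq_zero_AE elim: eventually_mono)
      moreover have "set_integrable lborel {0..\<delta>} (\<lambda>\<tau>. g (x + \<tau> *\<^sub>R d))"
        using elim(2) by (simp add: set_integrable_def)
      from chain_rule_average_bound[OF \<delta> this F F', of v "u x"]
      have "ennreal \<bar>F (v 0)\<bar> \<le> (\<integral>\<^sup>+t. indicator {0..\<delta>} t * ennreal (\<bar>F (v t)\<bar> / \<delta> + \<bar>F' (v t)\<bar> * \<bar>g (x + t *\<^sub>R d)\<bar>) \<partial>lborel)"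
        by (simp add: v_def)
      moreover have "\<dots> = (\<integral>\<^sup>+t. indicator {0..\<delta>} t * ennreal (\<bar>F (u (x + t *\<^sub>R d))\<bar> / \<delta> + \<bar>F' (u (x + t *\<^sub>R d))\<bar> * \<bar>g (x + t *\<^sub>R d)\<bar>) \<partial>lborel)"
      proof (rule nn_integral_cong_AE, use elim(1) in eventually_elim)
        case (elim t)
        then have "t \<in> {0..\<delta>} \<Longrightarrow> v t = u (x + t *\<^sub>R d)"
          using x by (auto simp: v_def G_def set_lebesgue_integral_def)
        then show ?case by (auto simp: indicator_def)
      qed
      ultimately show "ennreal \<bar>F (u x)\<bar> \<le> (\<integral>\<^sup>+t. indicator {0..\<delta>} t * ennreal (\<bar>F (u (x + t *\<^sub>R d))\<bar> / \<delta> + \<bar>F' (u (x + t *\<^sub>R d))\<bar> * \<bar>g (x + t *\<^sub>R d)\<bar>) \<partial>lborel)"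
        by simp
    qed
  qed
qed

section \<open>Gagliardo's inequality\<close>

text \<open>The hypothesis in terms of W^2 allows weights that are products of extended reals
  without taking square roots. The roots are formed only in the case where both integrals on the
  right are finite, so that b and c are finite almost everywhere.\<close>

lemma nn_integral_Cauchy_Schwarz_le:
  fixes W b c :: "'a \<Rightarrow> ennreal"
  assumes [measurable]: "W \<in> borel_measurable M" "b \<in> borel_measurable M" "c \<in> borel_measurable M"
    and le: "\<And>x. W x ^ 2 \<le> b x * c x"
  shows "(\<integral>\<^sup>+x. W x \<partial>M) ^ 2 \<le> (\<integral>\<^sup>+x. b x \<partial>M) * (\<integral>\<^sup>+x. c x \<partial>M)"
proof -
  have zero: "(\<integral>\<^sup>+x. W x \<partial>M) = 0" if "(\<integral>\<^sup>+x. f x \<partial>M) = 0" "f \<in> borel_measurable M" "\<And>x. W x ^ 2 \<le> f x * g x" for f g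
  proof -
    have "AE x in M. f x = 0" using that by (simp add: nn_integral_0_iff_AE)
    then have "AE x in M. W x = 0"
    proof eventually_elim
      case (elim x)
      then show ?case using that(3)[of x] by (simp add: power2_eq_square)
    qed
    then show ?thesis by (simp add: nn_integral_0_iff_AE)
  qed
  \<comment> \<open>Because 0 times infinity is 0 here, a vanishing factor has to be treated first,
    by showing that W vanishes almost everywhere; only then is an infinite factor harmless.\<close>
  consider "(\<integral>\<^sup>+x. b x \<partial>M) = 0" | "(\<integral>\<^sup>+x. c x \<partial>M) = 0"
    | "(\<integral>\<^sup>+x. b x \<partial>M) \<noteq> 0" "(\<integral>\<^sup>+x. c x \<partial>M) \<noteq> 0" "(\<integral>\<^sup>+x. b x \<partial>M) = \<infinity> \<or> (\<integral>\<^sup>+x. c x \<partial>M) = \<infinity>"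
    | "(\<integral>\<^sup>+x. b x \<partial>M) \<noteq> \<infinity>" "(\<integral>\<^sup>+x. c x \<partial>M) \<noteq> \<infinity>" by blast
  then show ?thesis
  proof cases
    case 1
    then show ?thesis using zero[of b c] le by simp
  next
    case 2
    then show ?thesis using zero[of c b] le by (simp add: mult.commute)
  next
    case 3
    then have "(\<integral>\<^sup>+x. b x \<partial>M) * (\<integral>\<^sup>+x. c x \<partial>M) = \<infinity>" by (auto simp: ennreal_mult_eq_top_iff)
    then show ?thesis by simp
  next
    case 4
    define f where "f x = ennreal (sqrt (enn2real (b x)))" for x
    define g where "g x = ennreal (sqrt (enn2real (c x)))" for x
    have [measurable]: "f \<in> borel_measurable M" "g \<in> borel_measurable M"
      unfolding f_def[abs_def] g_def[abs_def] by measurable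
    have b: "AE x in M. b x \<noteq> \<infinity>" and c: "AE x in M. c x \<noteq> \<infinity>"
      using nn_integral_PInf_AE[of b M] nn_integral_PInf_AE[of c M] 4 by auto
    have "AE x in M. W x \<le> f x * g x"
      using b c
    proof eventually_elim
      case (elim x)
      obtain \<beta> \<gamma> where r: "b x = ennreal \<beta>" "\<beta> \<ge> 0" "c x = ennreal \<gamma>" "\<gamma> \<ge> 0"
        using elim by (cases "b x"; cases "c x") auto
      have "W x \<noteq> \<infinity>" using le[of x] r by (auto simp: ennreal_mult[symmetric] power2_eq_square ennreal_top_mult top_unique)
      then obtain w where w: "W x = ennreal w" "w \<ge> 0" by (cases "W x") auto
      have "w\<^sup>2 \<le> \<beta> * \<gamma>" using le[of x] r w by (simp add: ennreal_mult[symmetric] ennreal_power)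
      then have "w \<le> sqrt (\<beta> * \<gamma>)" using w by (simp add: real_le_rsqrt)
      then show ?case using r w by (simp add: f_def g_def ennreal_mult[symmetric] real_sqrt_mult)
    qed
    then have "(\<integral>\<^sup>+x. W x \<partial>M) \<le> (\<integral>\<^sup>+x. f x * g x \<partial>M)" by (rule nn_integral_mono_AE)
    then have "(\<integral>\<^sup>+x. W x \<partial>M) ^ 2 \<le> (\<integral>\<^sup>+x. f x * g x \<partial>M) ^ 2" by (rule power_mono) simp
    also have "\<dots> \<le> (\<integral>\<^sup>+x. f x ^ 2 \<partial>M) * (\<integral>\<^sup>+x. g x ^ 2 \<partial>M)"
      by (rule Cauchy_Schwarz_nn_integral) measurable
    also have "(\<integral>\<^sup>+x. f x ^ 2 \<partial>M) = (\<integral>\<^sup>+x. b x \<partial>M)"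
      using b by (intro nn_integral_cong_AE) (auto elim!: eventually_mono simp: f_def ennreal_power less_top)
    also have "(\<integral>\<^sup>+x. g x ^ 2 \<partial>M) = (\<integral>\<^sup>+x. c x \<partial>M)"
      using c by (intro nn_integral_cong_AE) (auto elim!: eventually_mono simp: g_def ennreal_power less_top)
    finally show ?thesis .
  qed
qed

lemma nn_integral_lborel_translate:
  fixes f :: "'a::euclidean_space \<Rightarrow> ennreal"
  assumes "f \<in> borel_measurable borel"
  shows "(\<integral>\<^sup>+x. f (c + x) \<partial>lborel) = (\<integral>\<^sup>+x. f x \<partial>lborel)"
proof -
  have "(\<integral>\<^sup>+x. f x \<partial>lborel) = (\<integral>\<^sup>+x. f x \<partial>distr lborel borel ((+) c))"
    by (simp add: lborel_distr_plus)
  also have "\<dots> = (\<integral>\<^sup>+x. f (c + x) \<partial>lborel)"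
    using assms by (intro nn_integral_distr) auto
  finally show ?thesis by simp
qed

section \<open>Iterated integrals over coordinates and linear changes of variables\<close>

lemma Basis_vec_axis: "(Basis :: (real ^ 'n) set) = (\<lambda>i. axis i 1) ` UNIV"
  by (auto simp: Basis_vec_def)

lemma nn_integral_vec_PiM:
  fixes f :: "real ^ 'n \<Rightarrow> ennreal"
  assumes [measurable]: "f \<in> borel_measurable borel"
  shows "(\<integral>\<^sup>+x. f x \<partial>lborel) = (\<integral>\<^sup>+g. f (\<Sum>b\<in>Basis. g b *\<^sub>R b) \<partial>(\<Pi>\<^sub>M b\<in>Basis. lborel))"
  by (subst lborel_eq) (rule nn_integral_distr; measurable)

lemma nn_integral_vec2:
  fixes f :: "real ^ 'n \<Rightarrow> ennreal"
  assumes [measurable]: "f \<in> borel_measurable borel" and ij: "i \<noteq> j" "(UNIV :: 'n set) = {i, j}"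
  shows "(\<integral>\<^sup>+x. f x \<partial>lborel) = (\<integral>\<^sup>+a. \<integral>\<^sup>+b. f (a *\<^sub>R axis i 1 + b *\<^sub>R axis j 1) \<partial>lborel \<partial>lborel)"
proof -
  interpret product_sigma_finite "\<lambda>_ :: real ^ 'n. lborel :: real measure"
    by (simp add: product_sigma_finite_def lborel.sigma_finite_measure_axioms)
  let ?e = "\<lambda>i. axis i (1::real) :: real ^ 'n"
  have B: "Basis = insert (?e i) {?e j}" using ij by (auto simp: Basis_vec_axis)
  have ne: "?e i \<noteq> ?e j" using ij by (simp add: axis_eq_axis)
  show ?thesis
    unfolding nn_integral_vec_PiM[OF assms(1)] B
    by (subst product_nn_integral_insert_rev)
      (use ne product_nn_integral_singleton[of "\<lambda>b. f (y *\<^sub>R ?e i + b *\<^sub>R ?e j)" "?e j" for y] in simp_all)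
qed

lemma nn_integral_vec3:
  fixes f :: "real ^ 'n \<Rightarrow> ennreal"
  assumes [measurable]: "f \<in> borel_measurable borel"
    and ij: "i \<noteq> j" "i \<noteq> k" "j \<noteq> k" "(UNIV :: 'n set) = {i, j, k}"
  shows "(\<integral>\<^sup>+x. f x \<partial>lborel) =
    (\<integral>\<^sup>+a. \<integral>\<^sup>+b. \<integral>\<^sup>+c. f (a *\<^sub>R axis i 1 + b *\<^sub>R axis j 1 + c *\<^sub>R axis k 1) \<partial>lborel \<partial>lborel \<partial>lborel)"
proof -
  interpret product_sigma_finite "\<lambda>_ :: real ^ 'n. lborel :: real measure"
    by (simp add: product_sigma_finite_def lborel.sigma_finite_measure_axioms)
  let ?e = "\<lambda>i. axis i (1::real) :: real ^ 'n"
  have B: "Basis = insert (?e i) (insert (?e j) {?e k})" using ij by (auto simp: Basis_vec_axis)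
  have ne: "?e i \<noteq> ?e j" "?e i \<noteq> ?e k" "?e j \<noteq> ?e k" using ij by (auto simp: axis_eq_axis)
  show ?thesis
    unfolding nn_integral_vec_PiM[OF assms(1)] B
    by (subst product_nn_integral_insert_rev)
      (use ne product_nn_integral_insert_rev[of "{?e k}" "?e j" "\<lambda>x. f (y *\<^sub>R ?e i + (x (?e j) *\<^sub>R ?e j + x (?e k) *\<^sub>R ?e k))" for y]
        product_nn_integral_singleton[of "\<lambda>c. f (y *\<^sub>R ?e i + (z *\<^sub>R ?e j + c *\<^sub>R ?e k))" "?e k" for y z]
        in \<open>simp_all add: add.assoc\<close>)
qed

text \<open>The uniqueness argument for Haar measure: the double integral of f(x) g(x - A s) is
  evaluated in both orders, using translation invariance once in the target and once in the source
  of A.\<close>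

lemma nn_integral_linear_substitution_aux:
  fixes A :: "'b::euclidean_space \<Rightarrow> 'a::euclidean_space" and f g :: "'a \<Rightarrow> ennreal"
  assumes A: "linear A" "bij A" and [measurable]: "f \<in> borel_measurable borel" "g \<in> borel_measurable borel"
  shows "(\<integral>\<^sup>+x. f x \<partial>lborel) * (\<integral>\<^sup>+s. g (- A s) \<partial>lborel) = (\<integral>\<^sup>+s. f (A s) \<partial>lborel) * (\<integral>\<^sup>+x. g x \<partial>lborel)"
proof -
  have [measurable]: "A \<in> borel_measurable borel"
    using A by (intro borel_measurable_continuous_onI linear_continuous_on) (simp add: linear_conv_bounded_linear)
  have shift: "(\<integral>\<^sup>+s. h (x + A s) \<partial>lborel) = (\<integral>\<^sup>+s. h (A s) \<partial>lborel)"
    if [measurable]: "h \<in> borel_measurable borel" for h :: "'a \<Rightarrow> ennreal" and x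
  proof -
    \<comment> \<open>Surjectivity of A turns a translation in the target into one in the
      source.\<close>
    obtain y where "x = A y" using A(2) by (metis bij_pointE)
    then show ?thesis
      using nn_integral_lborel_translate[of "\<lambda>s. h (A s)" y] by (simp add: linear_add[OF A(1)])
  qed
  have "(\<integral>\<^sup>+x. f x \<partial>lborel) * (\<integral>\<^sup>+s. g (- A s) \<partial>lborel)
      = (\<integral>\<^sup>+x. f x * (\<integral>\<^sup>+s. g (- A s) \<partial>lborel) \<partial>lborel)"
    by (simp add: nn_integral_multc)
  also have "\<dots> = (\<integral>\<^sup>+x. f x * (\<integral>\<^sup>+s. g (x - A s) \<partial>lborel) \<partial>lborel)"
    using shift[of "\<lambda>y. g (- y)" "- x" for x] by (simp add: algebra_simps)
  also have "\<dots> = (\<integral>\<^sup>+x. \<integral>\<^sup>+s. f x * g (x - A s) \<partial>lborel \<partial>lborel)"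
    by (simp add: nn_integral_cmult)
  also have "\<dots> = (\<integral>\<^sup>+s. \<integral>\<^sup>+x. f x * g (x - A s) \<partial>lborel \<partial>lborel)"
    by (rule lborel_pair.Fubini') measurable
  also have "\<dots> = (\<integral>\<^sup>+s. \<integral>\<^sup>+x. f (x + A s) * g x \<partial>lborel \<partial>lborel)"
    using nn_integral_lborel_translate[of "\<lambda>x. f x * g (x - A s)" "A s" for s]
    by (simp add: add.commute)
  also have "\<dots> = (\<integral>\<^sup>+x. \<integral>\<^sup>+s. f (x + A s) * g x \<partial>lborel \<partial>lborel)"
    by (rule lborel_pair.Fubini') measurable
  also have "\<dots> = (\<integral>\<^sup>+x. (\<integral>\<^sup>+s. f (A s) \<partial>lborel) * g x \<partial>lborel)"
    by (simp add: nn_integral_multc shift)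
  also have "\<dots> = (\<integral>\<^sup>+s. f (A s) \<partial>lborel) * (\<integral>\<^sup>+x. g x \<partial>lborel)"
    by (simp add: nn_integral_cmult)
  finally show ?thesis .
qed

text \<open>Taking the unit ball's indicator for g in the previous identity gives the constant as
  the volume of the unit ball divided by the volume of its preimage under -A. Only its positivity
  and its independence of f matter later.\<close>

lemma nn_integral_linear_substitution:
  fixes A :: "'b::euclidean_space \<Rightarrow> 'a::euclidean_space"
  assumes A: "linear A" "bij A"
  obtains c :: real where "c > 0"
    "\<And>f. f \<in> borel_measurable borel \<Longrightarrow> (\<integral>\<^sup>+x. f x \<partial>lborel) = ennreal c * (\<integral>\<^sup>+s. f (A s) \<partial>lborel)"
proof -
  have bl: "bounded_linear A" using A by (simp add: linear_conv_bounded_linear)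
  let ?g = "indicator (ball 0 1) :: 'a \<Rightarrow> ennreal"
  \<comment> \<open>This preimage is open, contains 0 and is bounded by means of a linear left
    inverse of A. Its measure is therefore positive and finite, so dividing by it is
    legitimate.\<close>
  let ?U = "(\<lambda>s. - A s) -` ball 0 1"
  have oU: "open ?U"
    using bl by (intro open_vimage open_ball continuous_intros linear_continuous_on)
  have "0 \<in> ?U" using linear_0[OF A(1)] by simp
  obtain B where B: "linear B" "B \<circ> A = id" using linear_injective_left_inverse[OF A(1)] A(2) by (auto simp: bij_def)
  have "?U \<subseteq> B ` ball 0 1"
  proof
    fix s assume s: "s \<in> ?U"
    have "B (A s) = s" using B(2) by (metis comp_apply id_apply)
    then show "s \<in> B ` ball 0 1" using s by (intro image_eqI[of _ _ "A s"]) (auto simp: dist_norm)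
  qed
  moreover have "bounded (B ` ball 0 1)"
    using B(1) bounded_linear_image bounded_ball linear_conv_bounded_linear by blast
  ultimately have bdd: "bounded ?U" by (rule bounded_subset[rotated])
  have pos: "emeasure lborel S = ennreal (measure lborel S) \<and> 0 < measure lborel S"
    if S: "open S" "0 \<in> S" "bounded S" for S :: "'z::euclidean_space set"
  proof -
    have "emeasure lborel S < \<infinity>" using S by (intro emeasure_bounded_finite) auto
    then have eq: "emeasure lborel S = ennreal (measure lborel S)"
      by (intro emeasure_eq_ennreal_measure) auto
    have "S \<noteq> {}" using S(2) by blast
    then have "emeasure lborel S \<noteq> 0"
      using open_not_negligible[OF S(1)] S(1)
      by (auto simp: negligible_iff_null_sets null_sets_completion_iff null_sets_def)
    then have "measure lborel S \<noteq> 0" using eq by auto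
    then show ?thesis using eq by (simp add: zero_less_measure_iff)
  qed
  define L where "L = measure lborel (ball 0 1 :: 'a set)"
  define M where "M = measure lborel ?U"
  have L: "L > 0" "emeasure lborel (ball 0 1 :: 'a set) = ennreal L"
    using pos[of "ball 0 1 :: 'a set"] unfolding L_def by simp_all
  have M: "M > 0" "emeasure lborel ?U = ennreal M"
    using pos[OF oU \<open>0 \<in> ?U\<close> bdd] unfolding M_def by blast+
  show ?thesis
  proof (rule that[of "L / M"])
    show "L / M > 0" using L M by simp
    fix f :: "'a \<Rightarrow> ennreal" assume f: "f \<in> borel_measurable borel"
    have g: "?g \<in> borel_measurable borel" by (rule borel_measurable_indicator) simp
    have "(\<integral>\<^sup>+s. ?g (- A s) \<partial>lborel) = (\<integral>\<^sup>+s. indicator ?U s \<partial>lborel)"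
      by (rule nn_integral_cong) (simp add: indicator_def)
    also have "\<dots> = ennreal M" using oU M by simp
    finally have eq: "(\<integral>\<^sup>+x. f x \<partial>lborel) * ennreal M = (\<integral>\<^sup>+s. f (A s) \<partial>lborel) * ennreal L"
      using nn_integral_linear_substitution_aux[OF A f g] L by simp
    have "(\<integral>\<^sup>+x. f x \<partial>lborel) = (\<integral>\<^sup>+x. f x \<partial>lborel) * ennreal M * ennreal (1 / M)"
      using M(1) by (simp add: mult.assoc ennreal_mult[symmetric])
    also have "\<dots> = ennreal (L / M) * (\<integral>\<^sup>+s. f (A s) \<partial>lborel)"
      unfolding eq using M(1) L(1) ennreal_mult[of L "1 / M"] by (simp add: ac_simps)
    finally show "(\<integral>\<^sup>+x. f x \<partial>lborel) = ennreal (L / M) * (\<integral>\<^sup>+s. f (A s) \<partial>lborel)" .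
  qed
qed

text \<open>Each line integral is constant along its own direction, so the bound for W is a function
  of one coordinate times a function of the other. The double integral factors, and each factor is
  the full integral of h.\<close>

lemma gagliardo_2:
  fixes h W :: "real ^ 'n \<Rightarrow> ennreal"
  assumes ij: "i \<noteq> j" "(UNIV :: 'n set) = {i, j}"
    and [measurable]: "h \<in> borel_measurable borel" "W \<in> borel_measurable borel"
    and le: "\<And>s. W s \<le> (\<integral>\<^sup>+t. h (s + t *\<^sub>R axis i 1) \<partial>lborel) * (\<integral>\<^sup>+t. h (s + t *\<^sub>R axis j 1) \<partial>lborel)"
  shows "(\<integral>\<^sup>+s. W s \<partial>lborel) \<le> (\<integral>\<^sup>+s. h s \<partial>lborel) ^ 2"
proof -
  let ?H = "\<lambda>a b. h (a *\<^sub>R axis i 1 + b *\<^sub>R axis j 1)"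
  have shi: "(\<integral>\<^sup>+t. h (a *\<^sub>R axis i 1 + b *\<^sub>R axis j 1 + t *\<^sub>R axis i 1) \<partial>lborel) = (\<integral>\<^sup>+t. ?H t b \<partial>lborel)" for a b
    using nn_integral_lborel_translate[of "\<lambda>t. ?H t b" a] by (simp add: algebra_simps)
  have shj: "(\<integral>\<^sup>+t. h (a *\<^sub>R axis i 1 + b *\<^sub>R axis j 1 + t *\<^sub>R axis j 1) \<partial>lborel) = (\<integral>\<^sup>+t. ?H a t \<partial>lborel)" for a b
    using nn_integral_lborel_translate[of "\<lambda>t. ?H a t" b] by (simp add: algebra_simps)
  have "(\<integral>\<^sup>+s. W s \<partial>lborel) = (\<integral>\<^sup>+a. \<integral>\<^sup>+b. W (a *\<^sub>R axis i 1 + b *\<^sub>R axis j 1) \<partial>lborel \<partial>lborel)"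
    by (rule nn_integral_vec2[OF _ ij]) measurable
  also have "\<dots> \<le> (\<integral>\<^sup>+a. \<integral>\<^sup>+b. (\<integral>\<^sup>+t. ?H t b \<partial>lborel) * (\<integral>\<^sup>+t. ?H a t \<partial>lborel) \<partial>lborel \<partial>lborel)"
    using le[of "a *\<^sub>R axis i 1 + b *\<^sub>R axis j 1" for a b] unfolding shi shj by (intro nn_integral_mono)
  also have "\<dots> = (\<integral>\<^sup>+b. \<integral>\<^sup>+t. ?H t b \<partial>lborel \<partial>lborel) * (\<integral>\<^sup>+a. \<integral>\<^sup>+t. ?H a t \<partial>lborel \<partial>lborel)"
    by (simp add: nn_integral_multc nn_integral_cmult)
  also have "(\<integral>\<^sup>+b. \<integral>\<^sup>+t. ?H t b \<partial>lborel \<partial>lborel) = (\<integral>\<^sup>+a. \<integral>\<^sup>+t. ?H a t \<partial>lborel \<partial>lborel)"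
    by (rule lborel_pair.Fubini'[symmetric]) measurable
  also have "\<dots> = (\<integral>\<^sup>+s. h s \<partial>lborel)"
    by (rule nn_integral_vec2[OF _ ij, symmetric]) measurable
  finally show ?thesis by (simp add: power2_eq_square)
qed

text \<open>Cauchy-Schwarz is applied once per coordinate, in the order first, third, second. At
  each stage one factor is independent of the integration variable and comes out, and what remains
  splits into two factors; in the end each of the three has become the full integral of h.\<close>

lemma gagliardo_3:
  fixes h W :: "real ^ 'n \<Rightarrow> ennreal"
  assumes ij: "i \<noteq> j" "i \<noteq> k" "j \<noteq> k" "(UNIV :: 'n set) = {i, j, k}"
    and [measurable]: "h \<in> borel_measurable borel" "W \<in> borel_measurable borel"
    and le: "\<And>s. W s ^ 2 \<le> (\<integral>\<^sup>+t. h (s + t *\<^sub>R axis i 1) \<partial>lborel) * (\<integral>\<^sup>+t. h (s + t *\<^sub>R axis j 1) \<partial>lborel)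
      * (\<integral>\<^sup>+t. h (s + t *\<^sub>R axis k 1) \<partial>lborel)"
  shows "(\<integral>\<^sup>+s. W s \<partial>lborel) ^ 2 \<le> (\<integral>\<^sup>+s. h s \<partial>lborel) ^ 3"
proof -
  let ?p = "\<lambda>a b c. a *\<^sub>R axis i 1 + b *\<^sub>R axis j 1 + c *\<^sub>R axis k 1 :: real ^ 'n"
  let ?H = "\<lambda>a b c. h (?p a b c)"
  have shi: "(\<integral>\<^sup>+t. h (?p a b c + t *\<^sub>R axis i 1) \<partial>lborel) = (\<integral>\<^sup>+t. ?H t b c \<partial>lborel)" for a b c
    using nn_integral_lborel_translate[of "\<lambda>t. ?H t b c" a] by (simp add: algebra_simps)
  have shj: "(\<integral>\<^sup>+t. h (?p a b c + t *\<^sub>R axis j 1) \<partial>lborel) = (\<integral>\<^sup>+t. ?H a t c \<partial>lborel)" for a b c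
    using nn_integral_lborel_translate[of "\<lambda>t. ?H a t c" b] by (simp add: algebra_simps)
  have shk: "(\<integral>\<^sup>+t. h (?p a b c + t *\<^sub>R axis k 1) \<partial>lborel) = (\<integral>\<^sup>+t. ?H a b t \<partial>lborel)" for a b c
    using nn_integral_lborel_translate[of "\<lambda>t. ?H a b t" c] by (simp add: algebra_simps)
  define I where "I = (\<integral>\<^sup>+s. h s \<partial>lborel)"
  have I1: "I = (\<integral>\<^sup>+a. \<integral>\<^sup>+b. \<integral>\<^sup>+c. ?H a b c \<partial>lborel \<partial>lborel \<partial>lborel)"
    unfolding I_def by (rule nn_integral_vec3[OF _ ij]) measurable
  have swap: "(\<integral>\<^sup>+b. \<integral>\<^sup>+c. F b c \<partial>lborel \<partial>lborel) = (\<integral>\<^sup>+c. \<integral>\<^sup>+b. F b c \<partial>lborel \<partial>lborel)"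
    if "case_prod F \<in> borel_measurable (lborel \<Otimes>\<^sub>M lborel)" for F :: "real \<Rightarrow> real \<Rightarrow> ennreal"
    using that by (rule lborel_pair.Fubini'[symmetric])
  have I2: "I = (\<integral>\<^sup>+b. \<integral>\<^sup>+a. \<integral>\<^sup>+c. ?H a b c \<partial>lborel \<partial>lborel \<partial>lborel)"
    unfolding I1 by (rule swap) measurable
  have I3: "I = (\<integral>\<^sup>+c. \<integral>\<^sup>+a. \<integral>\<^sup>+b. ?H a b c \<partial>lborel \<partial>lborel \<partial>lborel)"
  proof -
    have "I = (\<integral>\<^sup>+a. \<integral>\<^sup>+c. \<integral>\<^sup>+b. ?H a b c \<partial>lborel \<partial>lborel \<partial>lborel)"
      unfolding I1 by (intro nn_integral_cong swap) measurable
    also have "\<dots> = (\<integral>\<^sup>+c. \<integral>\<^sup>+a. \<integral>\<^sup>+b. ?H a b c \<partial>lborel \<partial>lborel \<partial>lborel)"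
      by (rule swap) measurable
    finally show ?thesis .
  qed
  define Q where "Q b c = (\<integral>\<^sup>+t. ?H t b c \<partial>lborel)" for b c
  define R where "R c = (\<integral>\<^sup>+a. \<integral>\<^sup>+t. ?H a t c \<partial>lborel \<partial>lborel)" for c
  define S where "S b = (\<integral>\<^sup>+a. \<integral>\<^sup>+t. ?H a b t \<partial>lborel \<partial>lborel)" for b
  define X where "X b c = (\<integral>\<^sup>+a. W (?p a b c) \<partial>lborel)" for b c
  have [measurable]: "case_prod Q \<in> borel_measurable (lborel \<Otimes>\<^sub>M lborel)"
    "case_prod X \<in> borel_measurable (lborel \<Otimes>\<^sub>M lborel)"
    "R \<in> borel_measurable lborel" "S \<in> borel_measurable lborel"
    unfolding Q_def[abs_def] R_def[abs_def] S_def[abs_def] X_def[abs_def] by measurable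
  have X: "X b c ^ 2 \<le> Q b c * (R c * S b)" for b c
  proof -
    have "X b c ^ 2 \<le> (\<integral>\<^sup>+a. Q b c * (\<integral>\<^sup>+t. ?H a t c \<partial>lborel) \<partial>lborel) * (\<integral>\<^sup>+a. \<integral>\<^sup>+t. ?H a b t \<partial>lborel \<partial>lborel)"
      unfolding X_def
    proof (rule nn_integral_Cauchy_Schwarz_le)
      show "W (?p a b c) ^ 2 \<le> Q b c * (\<integral>\<^sup>+t. ?H a t c \<partial>lborel) * (\<integral>\<^sup>+t. ?H a b t \<partial>lborel)" for a
        using le[of "?p a b c"] unfolding shi shj shk Q_def .
    qed measurable
    then show ?thesis by (simp add: nn_integral_cmult R_def S_def mult.assoc)
  qed
  have Y: "(\<integral>\<^sup>+c. X b c \<partial>lborel) ^ 2 \<le> I * ((\<integral>\<^sup>+c. Q b c \<partial>lborel) * S b)" for b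
  proof -
    have "(\<integral>\<^sup>+c. X b c \<partial>lborel) ^ 2 \<le> (\<integral>\<^sup>+c. Q b c * S b \<partial>lborel) * (\<integral>\<^sup>+c. R c \<partial>lborel)"
    proof (rule nn_integral_Cauchy_Schwarz_le)
      show "X b c ^ 2 \<le> Q b c * S b * R c" for c using X[of b c] by (simp add: ac_simps)
    qed measurable
    moreover have "(\<integral>\<^sup>+c. Q b c * S b \<partial>lborel) = (\<integral>\<^sup>+c. Q b c \<partial>lborel) * S b"
      by (rule nn_integral_multc) measurable
    moreover have "(\<integral>\<^sup>+c. R c \<partial>lborel) = I" by (simp only: I3 R_def)
    ultimately show ?thesis by (simp add: mult.commute)
  qed
  have "(\<integral>\<^sup>+b. \<integral>\<^sup>+c. X b c \<partial>lborel \<partial>lborel) ^ 2 \<le> (\<integral>\<^sup>+b. I * (\<integral>\<^sup>+c. Q b c \<partial>lborel) \<partial>lborel) * (\<integral>\<^sup>+b. S b \<partial>lborel)"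
  proof (rule nn_integral_Cauchy_Schwarz_le)
    show "(\<integral>\<^sup>+c. X b c \<partial>lborel) ^ 2 \<le> I * (\<integral>\<^sup>+c. Q b c \<partial>lborel) * S b" for b
      using Y[of b] by (simp add: mult.assoc)
  qed measurable
  also have "(\<integral>\<^sup>+b. I * (\<integral>\<^sup>+c. Q b c \<partial>lborel) \<partial>lborel) = I * I"
  proof -
    have "(\<integral>\<^sup>+b. \<integral>\<^sup>+c. Q b c \<partial>lborel \<partial>lborel) = (\<integral>\<^sup>+b. \<integral>\<^sup>+a. \<integral>\<^sup>+c. ?H a b c \<partial>lborel \<partial>lborel \<partial>lborel)"
      unfolding Q_def by (intro nn_integral_cong swap) measurable
    then show ?thesis using I2 by (simp add: nn_integral_cmult)
  qed
  also have "(\<integral>\<^sup>+b. S b \<partial>lborel) = I" using I2 by (simp add: S_def)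
  also have "(\<integral>\<^sup>+b. \<integral>\<^sup>+c. X b c \<partial>lborel \<partial>lborel) = (\<integral>\<^sup>+s. W s \<partial>lborel)"
  proof -
    have "(\<integral>\<^sup>+s. W s \<partial>lborel) = (\<integral>\<^sup>+a. \<integral>\<^sup>+b. \<integral>\<^sup>+c. W (?p a b c) \<partial>lborel \<partial>lborel \<partial>lborel)"
      by (rule nn_integral_vec3[OF _ ij]) measurable
    also have "\<dots> = (\<integral>\<^sup>+b. \<integral>\<^sup>+a. \<integral>\<^sup>+c. W (?p a b c) \<partial>lborel \<partial>lborel \<partial>lborel)"
      by (rule swap) measurable
    also have "\<dots> = (\<integral>\<^sup>+b. \<integral>\<^sup>+c. X b c \<partial>lborel \<partial>lborel)"
      unfolding X_def by (intro nn_integral_cong swap) measurable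
    finally show ?thesis ..
  qed
  finally show ?thesis by (simp add: I_def power3_eq_cube)
qed

section \<open>Lipschitz domains\<close>

text \<open>The substitution x = A s turns lines in the directions A(e_i) into lines parallel to the
  axes. The constant collects one Jacobian factor per power of an integral on either side.\<close>

lemma gagliardo_along_directions:
  fixes A :: "real ^ 'n::finite \<Rightarrow> real ^ 'n"
  assumes n: "CARD('n) = 2 \<or> CARD('n) = 3" and A: "linear A" "bij A"
  obtains C :: real where "C \<ge> 0"
    "\<And>h W. h \<in> borel_measurable borel \<Longrightarrow> W \<in> borel_measurable borel \<Longrightarrow>
      AE x in lborel. W x ^ (CARD('n) - 1) \<le> (\<Prod>i\<in>UNIV. \<integral>\<^sup>+t. h (x + t *\<^sub>R A (axis i 1)) \<partial>lborel) \<Longrightarrow>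
      (\<integral>\<^sup>+x. W x \<partial>lborel) ^ (CARD('n) - 1) \<le> ennreal C * (\<integral>\<^sup>+x. h x \<partial>lborel) ^ CARD('n)"
proof -
  obtain c where c: "c > 0" "\<And>f. f \<in> borel_measurable borel \<Longrightarrow>
      (\<integral>\<^sup>+x. f x \<partial>lborel) = ennreal c * (\<integral>\<^sup>+s. f (A s) \<partial>lborel)"
    using nn_integral_linear_substitution[OF A] by metis
  have [measurable]: "A \<in> borel_measurable borel"
    using A by (intro borel_measurable_continuous_onI linear_continuous_on) (simp add: linear_conv_bounded_linear)
  let ?k = "CARD('n) - 1"
  show ?thesis
  proof (rule that[of "c ^ ?k * (1 / c) ^ CARD('n)"])
    show "0 \<le> c ^ ?k * (1 / c) ^ CARD('n)" using c by simp
    fix h W :: "real ^ 'n \<Rightarrow> ennreal"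
    assume h [measurable]: "h \<in> borel_measurable borel" and W [measurable]: "W \<in> borel_measurable borel"
      and le: "AE x in lborel. W x ^ ?k \<le> (\<Prod>i\<in>UNIV. \<integral>\<^sup>+t. h (x + t *\<^sub>R A (axis i 1)) \<partial>lborel)"
    define G where "G i x = (\<integral>\<^sup>+t. h (x + t *\<^sub>R A (axis i 1)) \<partial>lborel)" for i x
    have [measurable]: "G i \<in> borel_measurable borel" for i
      unfolding G_def[abs_def] by measurable
    \<comment> \<open>The product inequality is assumed almost everywhere but the coordinate
      versions ask for it everywhere. Setting W to 0 where it fails changes no integral, and doing
      so before the substitution avoids tracking null sets through A.\<close>
    define W' where "W' x = (if W x ^ ?k \<le> (\<Prod>i\<in>UNIV. G i x) then W x else 0)" for x
    have W' [measurable]: "W' \<in> borel_measurable borel"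
      unfolding W'_def[abs_def] by measurable
    have k0: "?k \<noteq> 0" using n by auto
    have W'G: "W' x ^ ?k \<le> (\<Prod>i\<in>UNIV. G i x)" for x
      using k0 by (simp add: W'_def power_0_left)
    have lin: "A (s + t *\<^sub>R axis i 1) = A s + t *\<^sub>R A (axis i 1)" for s t i
      using A(1) by (simp add: linear_add linear_cmul)
    have key: "(\<integral>\<^sup>+s. W' (A s) \<partial>lborel) ^ ?k \<le> (\<integral>\<^sup>+s. h (A s) \<partial>lborel) ^ CARD('n)"
      using n
    proof
      assume n2: "CARD('n) = 2"
      then obtain i j :: 'n where ij: "i \<noteq> j" "(UNIV :: 'n set) = {i, j}" by (metis card_2_iff)
      have le': "W' (A s) \<le> (\<integral>\<^sup>+t. h (A (s + t *\<^sub>R axis i 1)) \<partial>lborel) * (\<integral>\<^sup>+t. h (A (s + t *\<^sub>R axis j 1)) \<partial>lborel)" for s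
        using W'G[of "A s"] n2 ij(1) unfolding lin ij(2) by (simp add: G_def)
      have "(\<integral>\<^sup>+s. W' (A s) \<partial>lborel) \<le> (\<integral>\<^sup>+s. h (A s) \<partial>lborel) ^ 2"
        by (rule gagliardo_2[OF ij _ _ le']) measurable
      then show ?thesis using n2 by simp
    next
      assume n3: "CARD('n) = 3"
      then obtain i j k :: 'n where ij: "i \<noteq> j" "i \<noteq> k" "j \<noteq> k" "(UNIV :: 'n set) = {i, j, k}" by (metis card_3_iff)
      have le': "W' (A s) ^ 2 \<le> (\<integral>\<^sup>+t. h (A (s + t *\<^sub>R axis i 1)) \<partial>lborel) * (\<integral>\<^sup>+t. h (A (s + t *\<^sub>R axis j 1)) \<partial>lborel)
         * (\<integral>\<^sup>+t. h (A (s + t *\<^sub>R axis k 1)) \<partial>lborel)" for s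
        using W'G[of "A s"] n3 ij(1-3) unfolding lin ij(4) by (simp add: G_def mult.assoc)
      have "(\<integral>\<^sup>+s. W' (A s) \<partial>lborel) ^ 2 \<le> (\<integral>\<^sup>+s. h (A s) \<partial>lborel) ^ 3"
        by (rule gagliardo_3[OF ij _ _ le']) measurable
      then show ?thesis using n3 by simp
    qed
    have "(\<integral>\<^sup>+x. W x \<partial>lborel) = (\<integral>\<^sup>+x. W' x \<partial>lborel)"
      by (rule nn_integral_cong_AE, use le in eventually_elim) (simp add: W'_def G_def)
    also have "\<dots> = ennreal c * (\<integral>\<^sup>+s. W' (A s) \<partial>lborel)"
      by (rule c(2)[OF W'])
    finally have "(\<integral>\<^sup>+x. W x \<partial>lborel) ^ ?k = ennreal c ^ ?k * (\<integral>\<^sup>+s. W' (A s) \<partial>lborel) ^ ?k"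
      by (simp add: power_mult_distrib)
    also have "\<dots> \<le> ennreal c ^ ?k * (\<integral>\<^sup>+s. h (A s) \<partial>lborel) ^ CARD('n)"
      by (intro mult_left_mono key) simp
    also have "(\<integral>\<^sup>+s. h (A s) \<partial>lborel) = ennreal (1 / c) * (\<integral>\<^sup>+x. h x \<partial>lborel)"
      unfolding c(2)[OF h] using c(1) by (simp add: mult.assoc[symmetric] ennreal_mult[symmetric])
    also have "ennreal c ^ ?k * (ennreal (1 / c) * (\<integral>\<^sup>+x. h x \<partial>lborel)) ^ CARD('n)
        = ennreal (c ^ ?k * (1 / c) ^ CARD('n)) * (\<integral>\<^sup>+x. h x \<partial>lborel) ^ CARD('n)"
      using c(1) by (simp add: power_mult_distrib ennreal_mult ennreal_power mult.assoc)
    finally show "(\<integral>\<^sup>+x. W x \<partial>lborel) ^ ?k \<le> ennreal (c ^ ?k * (1 / c) ^ CARD('n)) * (\<integral>\<^sup>+x. h x \<partial>lborel) ^ CARD('n)" .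
  qed
qed

text \<open>Near a boundary point the directions \<open>v \<plusminus> \<epsilon> e\<^sub>i\<close> lie in the cone above the Lipschitz graph; the
  sign is chosen such that they stay linearly independent.\<close>

lemma lipschitz_domain_inward_directions:
  fixes \<Omega> :: "(real ^ 'n::finite) set"
  assumes \<Omega>: "bounded_lipschitz_domain \<Omega>" and x0: "x0 \<in> closure \<Omega>"
  shows "\<exists>r>0. \<exists>\<delta>>0. \<exists>A :: real ^ 'n \<Rightarrow> real ^ 'n. linear A \<and> bij A \<and>
    (\<forall>x i t. x \<in> \<Omega> \<inter> ball x0 r \<longrightarrow> 0 \<le> t \<longrightarrow> t \<le> \<delta> \<longrightarrow> x + t *\<^sub>R A (axis i 1) \<in> \<Omega>)"
proof (cases "x0 \<in> \<Omega>")
  case True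
  moreover have "open \<Omega>" using \<Omega> by (simp add: bounded_lipschitz_domain_def)
  ultimately obtain e where e: "e > 0" "ball x0 e \<subseteq> \<Omega>" using open_contains_ball by blast
  have "x + t *\<^sub>R axis i 1 \<in> \<Omega>" if "x \<in> \<Omega> \<inter> ball x0 (e / 2)" "0 \<le> t" "t \<le> e / 2" for x t and i :: 'n
  proof -
    have "dist x0 (x + t *\<^sub>R axis i 1) \<le> dist x0 x + norm (t *\<^sub>R axis i (1::real) :: real ^ 'n)"
      using dist_triangle[of x0 "x + t *\<^sub>R axis i 1" x] by (simp add: dist_norm)
    also have "\<dots> < e" using that by (simp add: norm_axis_1)
    finally show ?thesis using e by auto
  qed
  then have id: "linear (\<lambda>x :: real ^ 'n. x) \<and> bij (\<lambda>x :: real ^ 'n. x) \<and>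
    (\<forall>x i t. x \<in> \<Omega> \<inter> ball x0 (e / 2) \<longrightarrow> 0 \<le> t \<longrightarrow> t \<le> e / 2 \<longrightarrow> x + t *\<^sub>R axis i 1 \<in> \<Omega>)"
    by (auto simp: bij_betw_def linear_iff)
  have "\<exists>A :: real ^ 'n \<Rightarrow> real ^ 'n. linear A \<and> bij A \<and>
    (\<forall>x i t. x \<in> \<Omega> \<inter> ball x0 (e / 2) \<longrightarrow> 0 \<le> t \<longrightarrow> t \<le> e / 2 \<longrightarrow> x + t *\<^sub>R A (axis i 1) \<in> \<Omega>)"
    by (rule exI[of _ "\<lambda>x :: real ^ 'n. x"]) (rule id)
  then show ?thesis
    using half_gt_zero[OF e(1)] by (intro exI[of _ "e / 2"] conjI)
next
  case False
  then have "x0 \<in> frontier \<Omega>"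
    using x0 \<Omega> by (simp add: bounded_lipschitz_domain_def frontier_def interior_open)
  then obtain r v \<gamma> C where r: "r > 0" and v: "norm v = 1"
    and \<gamma>: "C-lipschitz_on {y. y \<bullet> v = 0} \<gamma>"
    and graph: "\<Omega> \<inter> ball x0 r = {y \<in> ball x0 r. y \<bullet> v > \<gamma> (y - (y \<bullet> v) *\<^sub>R v)}"
    using \<Omega> unfolding bounded_lipschitz_domain_def by blast
  have C: "C \<ge> 0" using \<gamma> by (rule lipschitz_on_nonneg)
  have vv: "v \<bullet> v = 1" using v by (simp add: dot_square_norm)
  \<comment> \<open>A direction v \<plusminus> \<epsilon> e_i has v-component at least 1 -
    \<epsilon> and a tangential part of length at most 2 \<epsilon>. The choice yields
    \<open>2 * C * \<epsilon> \<le> 1 - \<epsilon>\<close>: the graph rises no faster than the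
    segment.\<close>
  define \<epsilon> where "\<epsilon> = 1 / (2 + 2 * C)"
  have \<epsilon>: "\<epsilon> > 0" "\<epsilon> \<le> 1" "2 * C * \<epsilon> \<le> 1 - \<epsilon>" using C by (auto simp: \<epsilon>_def field_simps)
  define S where "S = (\<Sum>i\<in>UNIV. v $ i)"
  \<comment> \<open>A kernel element of A is a multiple of v, and summing its coordinates gives t (1
    + S/\<sigma>) = 0. The sign of \<sigma> is matched to that of S so that the bracket stays
    positive and the kernel is trivial.\<close>
  define \<sigma> where "\<sigma> = (if S \<ge> 0 then \<epsilon> else - \<epsilon>)"
  have \<sigma>: "\<bar>\<sigma>\<bar> = \<epsilon>" "\<sigma> \<noteq> 0" "S / \<sigma> \<ge> 0" using \<epsilon> by (auto simp: \<sigma>_def divide_le_0_iff)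
  \<comment> \<open>This linear map sends the i-th coordinate vector to v + \<sigma> e_i.\<close>
  define A where "A s = (\<Sum>i\<in>UNIV. s $ i) *\<^sub>R v + \<sigma> *\<^sub>R s" for s :: "real ^ 'n"
  have lin: "linear A"
    by (intro linearI) (simp_all add: A_def sum.distrib algebra_simps sum_distrib_left)
  have "inj A"
  proof (rule linear_inj_iff_eq_0[THEN iffD2, OF lin], intro allI impI)
    fix s assume "A s = 0"
    define t where "t = (\<Sum>i\<in>UNIV. s $ i)"
    have "t *\<^sub>R v = - (\<sigma> *\<^sub>R s)" using \<open>A s = 0\<close> by (simp add: A_def t_def add_eq_0_iff2)
    then have "(- 1 / \<sigma>) *\<^sub>R (t *\<^sub>R v) = (- 1 / \<sigma>) *\<^sub>R (- (\<sigma> *\<^sub>R s))" by simp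
    then have s: "s = (- t / \<sigma>) *\<^sub>R v" using \<sigma>(2) by simp
    have "s $ i = (- t / \<sigma>) * v $ i" for i
      using arg_cong[OF s, of "\<lambda>z. z $ i"] by simp
    then have "(\<Sum>i\<in>UNIV. s $ i) = (\<Sum>i\<in>UNIV. (- t / \<sigma>) * v $ i)"
      by (rule sum.cong[OF refl])
    also have "\<dots> = (- t / \<sigma>) * S"
      unfolding S_def by (rule sum_distrib_left[symmetric])
    finally have "t * (1 + S / \<sigma>) = 0" unfolding t_def[symmetric] by (simp add: algebra_simps)
    then have "t = 0" using \<sigma>(3) by auto
    then show "s = 0" using s by simp
  qed
  then have bij: "bij A" using lin linear_injective_imp_surjective by (auto simp: bij_def)
  \<comment> \<open>The directions have length at most 2, so t \<le> r/8 moves a point of the half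
    ball by at most r/4, and it stays in the ball where the graph description is valid.\<close>
  have "x + t *\<^sub>R A (axis i 1) \<in> \<Omega>" if x: "x \<in> \<Omega> \<inter> ball x0 (r / 2)" and t: "0 \<le> t" "t \<le> r / 8" for x t and i :: 'n
  proof -
    define d where "d = A (axis i 1)"
    have "(\<Sum>k\<in>UNIV. axis i (1::real) $ k) = 1" by (simp add: axis_def)
    then have d: "d = v + \<sigma> *\<^sub>R axis i 1" by (simp add: d_def A_def)
    have nd: "norm d \<le> 2"
      unfolding d using norm_triangle_ineq[of v "\<sigma> *\<^sub>R axis i 1"] v \<sigma>(1) \<epsilon>(2) by (simp add: norm_axis_1)
    have vi: "\<bar>axis i 1 \<bullet> v\<bar> \<le> 1"
      using Cauchy_Schwarz_ineq2[of "axis i 1" v] v by (simp add: norm_axis_1)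
    have dv: "d \<bullet> v = 1 + \<sigma> * (axis i 1 \<bullet> v)" unfolding d by (simp add: inner_add_left vv)
    have "\<bar>\<sigma> * (axis i 1 \<bullet> v)\<bar> \<le> \<epsilon> * 1" unfolding abs_mult \<sigma>(1) using vi \<epsilon>(1) by (intro mult_left_mono) auto
    then have dv': "d \<bullet> v \<ge> 1 - \<epsilon>" unfolding dv by linarith
    define P where "P y = y - (y \<bullet> v) *\<^sub>R v" for y
    have P0: "P y \<bullet> v = 0" for y by (simp add: P_def inner_diff_left vv)
    have "P d = \<sigma> *\<^sub>R (axis i 1 - (axis i 1 \<bullet> v) *\<^sub>R v)"
      unfolding P_def dv unfolding d by (simp add: algebra_simps)
    moreover have "norm (axis i (1::real) - (axis i 1 \<bullet> v) *\<^sub>R v) \<le> 2"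
      using norm_triangle_ineq4[of "axis i (1::real)" "(axis i 1 \<bullet> v) *\<^sub>R v"] v vi by (simp add: norm_axis_1)
    ultimately have Pd: "norm (P d) \<le> 2 * \<epsilon>" using \<sigma>(1) \<epsilon>(1) by simp
    let ?y = "x + t *\<^sub>R d"
    have Py: "P ?y - P x = t *\<^sub>R P d" by (simp add: P_def inner_add_left algebra_simps)
    have "dist x0 ?y \<le> dist x0 x + norm (t *\<^sub>R d)"
      using dist_triangle[of x0 ?y x] by (simp add: dist_norm)
    also have "norm (t *\<^sub>R d) \<le> r / 8 * 2" using mult_mono[OF t(2) nd] t r by simp
    also have "dist x0 x + r / 8 * 2 < r" using x r by simp
    finally have yb: "?y \<in> ball x0 r" by simp
    have "x \<in> \<Omega> \<inter> ball x0 r" using x r by auto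
    then have xg: "\<gamma> (P x) < x \<bullet> v" using graph by (auto simp: P_def)
    have "\<bar>\<gamma> (P ?y) - \<gamma> (P x)\<bar> \<le> C * norm (P ?y - P x)"
      using lipschitz_onD[OF \<gamma>, of "P ?y" "P x"] P0 by (simp add: dist_norm)
    also have "\<dots> \<le> C * (t * (2 * \<epsilon>))"
      unfolding Py using C t Pd by (intro mult_left_mono) (simp_all add: mult_left_mono)
    also have "\<dots> \<le> t * (1 - \<epsilon>)" using mult_left_mono[OF \<epsilon>(3) t(1)] by (simp add: ac_simps)
    also have "\<dots> \<le> t * (d \<bullet> v)" using dv' t by (intro mult_left_mono) auto
    finally have "\<gamma> (P ?y) < ?y \<bullet> v" using xg by (simp add: inner_add_left)
    then show ?thesis using graph yb by (auto simp: P_def d_def)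
  qed
  then show ?thesis
    using r lin bij by (intro exI[of _ "r / 2"] conjI exI[of _ "r / 8"] exI[of _ A]) auto
qed

section \<open>Elements of H^1(\<Omega>) as functions on the whole space\<close>

lemma h1_measurable [measurable]: "h1_fun U \<in> borel_measurable borel" "h1_grad U \<in> borel_measurable borel"
  using measurable_compose[OF square_integrable_measurable[OF square_integrable_rep[of U]] borel_measurable_continuous_onI[of fst]]
    measurable_compose[OF square_integrable_measurable[OF square_integrable_rep[of U]] borel_measurable_continuous_onI[of snd]]
  by (simp_all add: h1_fun_def[abs_def] h1_grad_def[abs_def] continuous_on_fst continuous_on_snd)

lemma h1_square_integrable:
  "integrable lborel (\<lambda>x. (h1_fun U x)\<^sup>2)" "integrable lborel (\<lambda>x. (norm (h1_grad U x))\<^sup>2)"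
proof -
  have i: "integrable lborel (\<lambda>x. (norm (rep_L2 U x))\<^sup>2)"
    using square_integrable_rep[of U] by (simp add: square_integrable_def)
  have sq: "(norm (rep_L2 U x))\<^sup>2 = (h1_fun U x)\<^sup>2 + (norm (h1_grad U x))\<^sup>2" for x
    by (simp add: h1_fun_def h1_grad_def norm_prod_def)
  show "integrable lborel (\<lambda>x. (h1_fun U x)\<^sup>2)" "integrable lborel (\<lambda>x. (norm (h1_grad U x))\<^sup>2)"
    by (rule Bochner_Integration.integrable_bound[OF i]; simp add: sq)+
qed

text \<open>The segment lemma works with functions integrable over the whole space. On a set of
  finite measure this follows from square integrability through 2 r \<le> 1 + r^2.\<close>

lemma integrable_if_square_integrable_bounded_support:
  fixes f :: "'a::euclidean_space \<Rightarrow> 'b::{banach, second_countable_topology}"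
  assumes [measurable]: "f \<in> borel_measurable borel" and f: "integrable lborel (\<lambda>x. (norm (f x))\<^sup>2)"
    and \<Omega>: "open \<Omega>" "bounded \<Omega>" and out: "AE x in lborel. x \<notin> \<Omega> \<longrightarrow> f x = 0"
  shows "integrable lborel f"
proof (rule Bochner_Integration.integrable_bound)
  have "emeasure lborel \<Omega> < \<infinity>" using \<Omega> by (intro emeasure_bounded_finite)
  then show "integrable lborel (\<lambda>x. indicator \<Omega> x + (norm (f x))\<^sup>2)"
    using f \<Omega> by (intro Bochner_Integration.integrable_add) (simp_all add: integrable_indicator_iff)
  show "AE x in lborel. norm (f x) \<le> norm (indicator \<Omega> x + (norm (f x))\<^sup>2)"
    using out
  proof eventually_elim
    case (elim x)
    have "2 * norm (f x) \<le> 1 + (norm (f x))\<^sup>2"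
      using sum_squares_bound[of 1 "norm (f x)"] by simp
    then show ?case using elim norm_ge_zero[of "f x"] by (auto simp: indicator_def simp del: norm_ge_zero)
  qed
qed measurable

lemma H1_outside: "U \<in> H1 \<Omega> \<Longrightarrow> AE x in lborel. x \<notin> \<Omega> \<longrightarrow> h1_fun U x = 0 \<and> h1_grad U x = 0"
  by (simp add: H1_def)

lemma H1_integrable:
  assumes U: "U \<in> H1 \<Omega>" and \<Omega>: "open \<Omega>" "bounded \<Omega>"
  shows "integrable lborel (h1_fun U)" "integrable lborel (h1_grad U)"
  by (rule integrable_if_square_integrable_bounded_support[OF _ _ \<Omega>];
      use h1_square_integrable[of U] H1_outside[OF U] in \<open>auto elim: eventually_mono\<close>)+

lemma test_function_set_integral:
  fixes u :: "'a::euclidean_space \<Rightarrow> 'b::{banach, second_countable_topology}"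
  assumes "test_function \<Omega> \<phi>"
  shows "(LINT x:\<Omega>|lborel. \<phi> x *\<^sub>R u x) = (LINT x|lborel. \<phi> x *\<^sub>R u x)"
    and "(LINT x:\<Omega>|lborel. frechet_derivative \<phi> (at x) b *\<^sub>R u x) = (LINT x|lborel. frechet_derivative \<phi> (at x) b *\<^sub>R u x)"
  unfolding set_lebesgue_integral_def using test_function_outside(1)[OF assms] test_function_outside(2)[OF assms, of _ b]
  by (intro Bochner_Integration.integral_cong refl; cases; force simp: indicator_def)+

lemma test_function_times_integrable:
  fixes u :: "'a::euclidean_space \<Rightarrow> 'b::{banach, second_countable_topology}"
  assumes \<phi>: "test_function \<Omega> \<phi>" and u: "integrable lborel u"
  shows "integrable lborel (\<lambda>x. \<phi> x *\<^sub>R u x)" "integrable lborel (\<lambda>x. frechet_derivative \<phi> (at x) d *\<^sub>R u x)"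
proof -
  have bound: "integrable lborel (\<lambda>x. f x *\<^sub>R u x)"
    if "continuous_on UNIV f" "\<And>x. \<bar>f x\<bar> \<le> B" for f B
  proof (rule Bochner_Integration.integrable_bound)
    show "integrable lborel (\<lambda>x. B *\<^sub>R u x)" using u by simp
    show "AE x in lborel. norm (f x *\<^sub>R u x) \<le> norm (B *\<^sub>R u x)"
    proof (rule AE_I2)
      fix x
      have "\<bar>f x\<bar> \<le> \<bar>B\<bar>" using that(2)[of x] by linarith
      then show "norm (f x *\<^sub>R u x) \<le> norm (B *\<^sub>R u x)" by (simp add: mult_right_mono)
    qed
    show "(\<lambda>x. f x *\<^sub>R u x) \<in> borel_measurable lborel"
      using u borel_measurable_continuous_onI[OF that(1)] by (intro borel_measurable_scaleR) auto
  qed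
  obtain B where B: "\<And>x. \<bar>\<phi> x\<bar> \<le> B" "\<And>x. \<bar>frechet_derivative \<phi> (at x) d\<bar> \<le> B"
    using test_function_bounded[OF \<phi>, of d] by blast
  show "integrable lborel (\<lambda>x. \<phi> x *\<^sub>R u x)"
    by (rule bound[OF continuous_on_test_function[OF \<phi>] B(1)])
  show "integrable lborel (\<lambda>x. frechet_derivative \<phi> (at x) d *\<^sub>R u x)"
    by (rule bound[OF continuous_on_deriv_test_function[OF \<phi>] B(2)])
qed

text \<open>Membership in \<open>H1\<close> provides weak derivatives along the coordinate
  directions, whereas the inward directions at the boundary are arbitrary; linearity of the
  derivative of \<phi> bridges the gap.\<close>

lemma H1_weak_directional_derivative:
  assumes U: "U \<in> H1 \<Omega>" and \<Omega>: "open \<Omega>" "bounded \<Omega>" and \<phi>: "test_function \<Omega> \<phi>"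
  shows "(LINT x|lborel. frechet_derivative \<phi> (at x) d * h1_fun U x) = - (LINT x|lborel. \<phi> x * (h1_grad U x \<bullet> d))"
proof -
  have lin: "linear (frechet_derivative \<phi> (at x))" for x
    by (intro linear_frechet_derivative test_function_differentiable[OF \<phi>])
  note I = H1_integrable[OF U \<Omega>]
  have sum1: "frechet_derivative \<phi> (at x) d = (\<Sum>b\<in>Basis. (d \<bullet> b) * frechet_derivative \<phi> (at x) b)" for x
  proof -
    have "frechet_derivative \<phi> (at x) d = frechet_derivative \<phi> (at x) (\<Sum>b\<in>Basis. (d \<bullet> b) *\<^sub>R b)"
      by (simp add: euclidean_representation)
    then show ?thesis by (simp add: linear_sum[OF lin] linear_cmul[OF lin])
  qed
  have i1: "integrable lborel (\<lambda>x. frechet_derivative \<phi> (at x) b * h1_fun U x)" for b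
    using test_function_times_integrable(2)[OF \<phi> I(1)] by simp
  have i2: "integrable lborel (\<lambda>x. \<phi> x * (h1_grad U x \<bullet> b))" for b
    using test_function_times_integrable(1)[OF \<phi> integrable_inner_left[OF I(2)], of b] by simp
  have eq: "(LINT x|lborel. frechet_derivative \<phi> (at x) b * h1_fun U x) = - (LINT x|lborel. \<phi> x * (h1_grad U x \<bullet> b))"
    if "b \<in> Basis" for b
    using U that \<phi> test_function_set_integral(2)[OF \<phi>, of b "h1_fun U"]
      test_function_set_integral(1)[OF \<phi>, of "\<lambda>x. h1_grad U x \<bullet> b"]
    by (auto simp: H1_def weak_partial_def)
  have "(LINT x|lborel. frechet_derivative \<phi> (at x) d * h1_fun U x)
      = (\<Sum>b\<in>Basis. (d \<bullet> b) * (LINT x|lborel. frechet_derivative \<phi> (at x) b * h1_fun U x))"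
    unfolding sum1 sum_distrib_right using i1 by (simp add: mult.assoc)
  also have "\<dots> = - (\<Sum>b\<in>Basis. (d \<bullet> b) * (LINT x|lborel. \<phi> x * (h1_grad U x \<bullet> b)))"
    by (simp add: eq sum_negf)
  also have "(\<Sum>b\<in>Basis. (d \<bullet> b) * (LINT x|lborel. \<phi> x * (h1_grad U x \<bullet> b)))
      = (LINT x|lborel. (\<Sum>b\<in>Basis. (d \<bullet> b) * (\<phi> x * (h1_grad U x \<bullet> b))))"
    using i2 by simp
  also have "\<dots> = (LINT x|lborel. \<phi> x * (h1_grad U x \<bullet> d))"
    by (intro Bochner_Integration.integral_cong refl)
      (simp add: euclidean_inner[of _ d] sum_distrib_left ac_simps)
  finally show ?thesis .
qed

section \<open>The Sobolev embedding\<close>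

lemma ennreal_prod_mono:
  fixes f g :: "'a \<Rightarrow> ennreal"
  shows "(\<And>i. i \<in> I \<Longrightarrow> f i \<le> g i) \<Longrightarrow> (\<Prod>i\<in>I. f i) \<le> (\<Prod>i\<in>I. g i)"
  by (induction I rule: infinite_finite_induct) (auto intro!: mult_mono)

text \<open>W plays the role of |F(u)|^(N/(N-1)), encoded by integer powers to avoid the fractional
  exponent. F is left free so that plain powers of u and powers of truncations can both be inserted.
  The separate set V on the left makes the inequality local, while the right-hand side always
  extends over \<Omega>.\<close>

definition gagliardo_nirenberg_constant :: "(real ^ 'n::finite) set \<Rightarrow> (real ^ 'n) set \<Rightarrow> real \<Rightarrow> bool" where
  "gagliardo_nirenberg_constant \<Omega> V C \<longleftrightarrow> (\<forall>U F F' W. U \<in> H1 \<Omega> \<longrightarrow>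
      (\<forall>y. (F has_real_derivative F' y) (at y)) \<longrightarrow> continuous_on UNIV F' \<longrightarrow>
      W \<in> borel_measurable borel \<longrightarrow> (\<forall>x. W x ^ (CARD('n) - 1) \<le> ennreal \<bar>F (h1_fun U x)\<bar> ^ CARD('n)) \<longrightarrow>
      (\<integral>\<^sup>+x. W x * indicator V x \<partial>lborel) ^ (CARD('n) - 1) \<le> ennreal C *
        (\<integral>\<^sup>+x. ennreal (\<bar>F (h1_fun U x)\<bar> + \<bar>F' (h1_fun U x)\<bar> * norm (h1_grad U x)) * indicator \<Omega> x \<partial>lborel) ^ CARD('n))"

lemma gagliardo_nirenberg_constantD:
  fixes \<Omega> V :: "(real ^ 'n::finite) set"
  assumes "gagliardo_nirenberg_constant \<Omega> V C" "U \<in> H1 \<Omega>" "\<And>y. (F has_real_derivative F' y) (at y)"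
    "continuous_on UNIV F'" "W \<in> borel_measurable borel"
    "\<And>x. W x ^ (CARD('n) - 1) \<le> ennreal \<bar>F (h1_fun U x)\<bar> ^ CARD('n)"
  shows "(\<integral>\<^sup>+x. W x * indicator V x \<partial>lborel) ^ (CARD('n) - 1) \<le> ennreal C *
    (\<integral>\<^sup>+x. ennreal (\<bar>F (h1_fun U x)\<bar> + \<bar>F' (h1_fun U x)\<bar> * norm (h1_grad U x)) * indicator \<Omega> x \<partial>lborel) ^ CARD('n)"
  using assms unfolding gagliardo_nirenberg_constant_def by blast

text \<open>In each of the N directions the averaged bound is dominated by the integral of one and
  the same function h along the full line. The N-th power of |F(u)| is therefore at most the product
  of the line integrals to which Gagliardo's inequality applies.\<close>

lemma gagliardo_nirenberg_local:
  fixes \<Omega> :: "(real ^ 'n::finite) set" and A :: "real ^ 'n \<Rightarrow> real ^ 'n"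
  assumes n: "CARD('n) = 2 \<or> CARD('n) = 3" and \<Omega>: "open \<Omega>" "bounded \<Omega>" and V: "open V"
    and A: "linear A" "bij A" and \<delta>: "\<delta> > 0"
    and inw: "\<And>x i t. x \<in> V \<Longrightarrow> 0 \<le> t \<Longrightarrow> t \<le> \<delta> \<Longrightarrow> x + t *\<^sub>R A (axis i 1) \<in> \<Omega>"
  shows "\<exists>C\<ge>0. gagliardo_nirenberg_constant \<Omega> V C"
proof -
  obtain C where C: "C \<ge> 0"
    "\<And>h W. h \<in> borel_measurable borel \<Longrightarrow> W \<in> borel_measurable borel \<Longrightarrow>
      AE x in lborel. W x ^ (CARD('n) - 1) \<le> (\<Prod>i\<in>UNIV. \<integral>\<^sup>+t. h (x + t *\<^sub>R A (axis i 1)) \<partial>lborel) \<Longrightarrow>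
      (\<integral>\<^sup>+x. W x \<partial>lborel) ^ (CARD('n) - 1) \<le> ennreal C * (\<integral>\<^sup>+x. h x \<partial>lborel) ^ CARD('n)"
    by (rule gagliardo_along_directions[OF n A]) blast
  define d where "d i = A (axis i 1)" for i
  \<comment> \<open>One constant that majorises both the averaging factor 1/\<delta> and the lengths
    of all directions.\<close>
  define \<kappa> where "\<kappa> = 1 / \<delta> + (\<Sum>i\<in>UNIV. norm (d i))"
  have \<kappa>: "\<kappa> \<ge> 0" "1 / \<delta> \<le> \<kappa>" using \<delta> by (simp_all add: \<kappa>_def sum_nonneg)
  have \<kappa>d: "norm (d i) \<le> \<kappa>" for i
    using member_le_sum[of i UNIV "\<lambda>i. norm (d i)"] \<delta> by (simp add: \<kappa>_def add_increasing)
  have k0: "CARD('n) - 1 \<noteq> 0" using n by auto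
  show ?thesis
    unfolding gagliardo_nirenberg_constant_def
  proof (intro exI[of _ "C * \<kappa> ^ CARD('n)"] conjI allI impI)
    show "C * \<kappa> ^ CARD('n) \<ge> 0" using C(1) \<kappa> by simp
    fix U :: "(real ^ 'n) h1" and F F' :: "real \<Rightarrow> real" and W :: "real ^ 'n \<Rightarrow> ennreal"
    assume U: "U \<in> H1 \<Omega>" and F: "\<forall>y. (F has_real_derivative F' y) (at y)" and F': "continuous_on UNIV F'"
      and W [measurable]: "W \<in> borel_measurable borel"
      and WF: "\<forall>x. W x ^ (CARD('n) - 1) \<le> ennreal \<bar>F (h1_fun U x)\<bar> ^ CARD('n)"
    note F = F[rule_format] and WF = WF[rule_format]
    have "continuous_on UNIV F" using F by (intro continuous_at_imp_continuous_on) (auto intro: DERIV_isCont)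
    then have [measurable]: "F \<in> borel_measurable borel" "F' \<in> borel_measurable borel"
      using F' by (auto intro: borel_measurable_continuous_onI)
    have [measurable]: "V \<in> sets borel" "\<Omega> \<in> sets borel" using V \<Omega> by auto
    define w where "w x = \<bar>F (h1_fun U x)\<bar> + \<bar>F' (h1_fun U x)\<bar> * norm (h1_grad U x)" for x
    \<comment> \<open>The cut-off by \<Omega> costs nothing because the segments starting in V stay
      in \<Omega>; it is what confines the right-hand side to \<Omega>.\<close>
    define h where "h x = ennreal \<kappa> * (ennreal (w x) * indicator \<Omega> x)" for x
    have [measurable]: "w \<in> borel_measurable borel" "h \<in> borel_measurable borel"
      unfolding w_def[abs_def] h_def[abs_def] by measurable
    have "AE x in lborel. \<forall>i\<in>UNIV. x \<in> V \<longrightarrow> ennreal \<bar>F (h1_fun U x)\<bar> \<le> (\<integral>\<^sup>+t. h (x + t *\<^sub>R d i) \<partial>lborel)"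
    proof (rule AE_finite_allI)
      fix i :: 'n
      have "AE x in lborel. x \<in> V \<longrightarrow> ennreal \<bar>F (h1_fun U x)\<bar> \<le>
        (\<integral>\<^sup>+t. indicator {0..\<delta>} t * ennreal (\<bar>F (h1_fun U (x + t *\<^sub>R d i))\<bar> / \<delta>
          + \<bar>F' (h1_fun U (x + t *\<^sub>R d i))\<bar> * \<bar>h1_grad U (x + t *\<^sub>R d i) \<bullet> d i\<bar>) \<partial>lborel)"
        by (rule weak_derivative_average_bound[OF H1_integrable(1)[OF U \<Omega>] integrable_inner_left[OF H1_integrable(2)[OF U \<Omega>]]
            H1_weak_directional_derivative[OF U \<Omega>] V _ \<delta> F F']) (assumption, unfold d_def, rule inw)
      then show "AE x in lborel. x \<in> V \<longrightarrow> ennreal \<bar>F (h1_fun U x)\<bar> \<le> (\<integral>\<^sup>+t. h (x + t *\<^sub>R d i) \<partial>lborel)"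
      proof eventually_elim
        case (elim x)
        show ?case
        proof
          assume x: "x \<in> V"
          have "indicator {0..\<delta>} t * ennreal (\<bar>F (h1_fun U (x + t *\<^sub>R d i))\<bar> / \<delta>
              + \<bar>F' (h1_fun U (x + t *\<^sub>R d i))\<bar> * \<bar>h1_grad U (x + t *\<^sub>R d i) \<bullet> d i\<bar>) \<le> h (x + t *\<^sub>R d i)" for t
          proof (cases "t \<in> {0..\<delta>}")
            case True
            let ?y = "x + t *\<^sub>R d i"
            have y: "?y \<in> \<Omega>" using inw[OF x] True by (auto simp: d_def)
            have 1: "\<bar>F (h1_fun U ?y)\<bar> / \<delta> \<le> \<kappa> * \<bar>F (h1_fun U ?y)\<bar>"
              using mult_right_mono[OF \<kappa>(2), of "\<bar>F (h1_fun U ?y)\<bar>"] by simp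
            have "\<bar>h1_grad U ?y \<bullet> d i\<bar> \<le> norm (h1_grad U ?y) * norm (d i)"
              by (rule Cauchy_Schwarz_ineq2)
            also have "\<dots> \<le> norm (h1_grad U ?y) * \<kappa>" by (intro mult_left_mono \<kappa>d) simp
            finally have "\<bar>F' (h1_fun U ?y)\<bar> * \<bar>h1_grad U ?y \<bullet> d i\<bar> \<le> \<bar>F' (h1_fun U ?y)\<bar> * (norm (h1_grad U ?y) * \<kappa>)"
              by (intro mult_left_mono) auto
            with 1 have "\<bar>F (h1_fun U ?y)\<bar> / \<delta> + \<bar>F' (h1_fun U ?y)\<bar> * \<bar>h1_grad U ?y \<bullet> d i\<bar> \<le> \<kappa> * w ?y"
              by (simp add: w_def algebra_simps)
            then show ?thesis
              using True y \<kappa>(1) by (simp add: h_def ennreal_mult'[symmetric] ennreal_leI del: ennreal_plus)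
          qed simp
          then have "(\<integral>\<^sup>+t. indicator {0..\<delta>} t * ennreal (\<bar>F (h1_fun U (x + t *\<^sub>R d i))\<bar> / \<delta>
              + \<bar>F' (h1_fun U (x + t *\<^sub>R d i))\<bar> * \<bar>h1_grad U (x + t *\<^sub>R d i) \<bullet> d i\<bar>) \<partial>lborel)
              \<le> (\<integral>\<^sup>+t. h (x + t *\<^sub>R d i) \<partial>lborel)"
            by (rule nn_integral_mono)
          then show "ennreal \<bar>F (h1_fun U x)\<bar> \<le> (\<integral>\<^sup>+t. h (x + t *\<^sub>R d i) \<partial>lborel)"
            by (rule order_trans[OF elim[rule_format, OF x]])
        qed
      qed
    qed simp
    then have "AE x in lborel. (W x * indicator V x) ^ (CARD('n) - 1) \<le> (\<Prod>i\<in>UNIV. \<integral>\<^sup>+t. h (x + t *\<^sub>R A (axis i 1)) \<partial>lborel)"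
    proof eventually_elim
      case (elim x)
      show ?case
      proof (cases "x \<in> V")
        case True
        have "(W x * indicator V x) ^ (CARD('n) - 1) \<le> (\<Prod>i\<in>(UNIV::'n set). ennreal \<bar>F (h1_fun U x)\<bar>)"
          using WF[of x] True by simp
        also have "\<dots> \<le> (\<Prod>i\<in>UNIV. \<integral>\<^sup>+t. h (x + t *\<^sub>R A (axis i 1)) \<partial>lborel)"
          using elim True by (intro ennreal_prod_mono) (auto simp: d_def)
        finally show ?thesis .
      qed (use k0 in \<open>simp add: power_0_left\<close>)
    qed
    then have "(\<integral>\<^sup>+x. W x * indicator V x \<partial>lborel) ^ (CARD('n) - 1) \<le> ennreal C * (\<integral>\<^sup>+x. h x \<partial>lborel) ^ CARD('n)"
      by (rule C(2)[rotated 2]) measurable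
    also have "(\<integral>\<^sup>+x. h x \<partial>lborel) = ennreal \<kappa> * (\<integral>\<^sup>+x. ennreal (w x) * indicator \<Omega> x \<partial>lborel)"
      unfolding h_def by (rule nn_integral_cmult) measurable
    also have "ennreal C * (ennreal \<kappa> * (\<integral>\<^sup>+x. ennreal (w x) * indicator \<Omega> x \<partial>lborel)) ^ CARD('n)
        = ennreal (C * \<kappa> ^ CARD('n)) * (\<integral>\<^sup>+x. ennreal (w x) * indicator \<Omega> x \<partial>lborel) ^ CARD('n)"
      using C(1) \<kappa>(1) by (simp add: power_mult_distrib ennreal_mult ennreal_power mult.assoc)
    finally show "(\<integral>\<^sup>+x. W x * indicator V x \<partial>lborel) ^ (CARD('n) - 1) \<le> ennreal (C * \<kappa> ^ CARD('n)) *
        (\<integral>\<^sup>+x. ennreal (\<bar>F (h1_fun U x)\<bar> + \<bar>F' (h1_fun U x)\<bar> * norm (h1_grad U x)) * indicator \<Omega> x \<partial>lborel) ^ CARD('n)"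
      by (simp add: w_def)
  qed
qed

text \<open>The closure of \<Omega> is compact, so finitely many of the balls with a local constant
  cover it. The right-hand side of every local inequality is the same integral over \<Omega>, so
  they can be added.\<close>

lemma gagliardo_nirenberg_lipschitz_domain:
  fixes \<Omega> :: "(real ^ 'n::finite) set"
  assumes n: "CARD('n) = 2 \<or> CARD('n) = 3" and \<Omega>: "bounded_lipschitz_domain \<Omega>"
  shows "\<exists>K\<ge>0. gagliardo_nirenberg_constant \<Omega> \<Omega> K"
proof -
  have o: "open \<Omega>" and b: "bounded \<Omega>" using \<Omega> by (auto simp: bounded_lipschitz_domain_def)
  let ?N = "CARD('n)"
  let ?G = "gagliardo_nirenberg_constant \<Omega>"
  have "\<forall>x0\<in>closure \<Omega>. \<exists>r>0. \<exists>C\<ge>0. ?G (\<Omega> \<inter> ball x0 r) C"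
  proof
    fix x0 assume "x0 \<in> closure \<Omega>"
    from lipschitz_domain_inward_directions[OF \<Omega> this] obtain r \<delta> and A :: "real ^ 'n \<Rightarrow> real ^ 'n"
      where r: "r > 0" "\<delta> > 0" "linear A" "bij A"
      "\<forall>x i t. x \<in> \<Omega> \<inter> ball x0 r \<longrightarrow> 0 \<le> t \<longrightarrow> t \<le> \<delta> \<longrightarrow> x + t *\<^sub>R A (axis i 1) \<in> \<Omega>"
      by (elim exE conjE)
    have "open (\<Omega> \<inter> ball x0 r)" using o by auto
    then have "\<exists>C\<ge>0. ?G (\<Omega> \<inter> ball x0 r) C"
      by (rule gagliardo_nirenberg_local[OF n o b _ r(3,4,2) r(5)[rule_format]])
    then show "\<exists>r>0. \<exists>C\<ge>0. ?G (\<Omega> \<inter> ball x0 r) C" using r(1) by blast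
  qed
  then obtain r C where rC: "\<And>x0. x0 \<in> closure \<Omega> \<Longrightarrow> r x0 > 0 \<and> C x0 \<ge> 0 \<and> ?G (\<Omega> \<inter> ball x0 (r x0)) (C x0)"
    by metis
  have c1: "compact (closure \<Omega>)" using b by simp
  have c2: "closure \<Omega> \<subseteq> (\<Union>x0\<in>closure \<Omega>. ball x0 (r x0))"
  proof
    fix x assume "x \<in> closure \<Omega>"
    then show "x \<in> (\<Union>x0\<in>closure \<Omega>. ball x0 (r x0))" using rC[of x] by (intro UN_I[of x]) auto
  qed
  obtain X where X: "X \<subseteq> closure \<Omega>" "finite X" "closure \<Omega> \<subseteq> (\<Union>x0\<in>X. ball x0 (r x0))"
    by (rule compactE_image[OF c1 _ c2]) simp
  \<comment> \<open>The power of the cardinality appears because a sum is bounded by the number of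
    terms times the largest one before the power N - 1 is taken.\<close>
  define K where "K = real (card X) ^ (?N - 1) * (\<Sum>x\<in>X. C x)"
  show ?thesis
    unfolding gagliardo_nirenberg_constant_def
  proof (intro exI[of _ K] conjI allI impI)
    show "K \<ge> 0" unfolding K_def using rC X(1) by (intro mult_nonneg_nonneg sum_nonneg) auto
    fix U :: "(real ^ 'n) h1" and F F' :: "real \<Rightarrow> real" and W :: "real ^ 'n \<Rightarrow> ennreal"
    assume U: "U \<in> H1 \<Omega>" and F: "\<forall>y. (F has_real_derivative F' y) (at y)" and F': "continuous_on UNIV F'"
      and W [measurable]: "W \<in> borel_measurable borel"
      and WF: "\<forall>x. W x ^ (?N - 1) \<le> ennreal \<bar>F (h1_fun U x)\<bar> ^ ?N"
    define I where "I = (\<integral>\<^sup>+x. ennreal (\<bar>F (h1_fun U x)\<bar> + \<bar>F' (h1_fun U x)\<bar> * norm (h1_grad U x)) * indicator \<Omega> x \<partial>lborel)"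
    define a where "a x0 = (\<integral>\<^sup>+x. W x * indicator (\<Omega> \<inter> ball x0 (r x0)) x \<partial>lborel)" for x0
    have a: "a x0 ^ (?N - 1) \<le> ennreal (\<Sum>x\<in>X. C x) * I ^ ?N" if "x0 \<in> X" for x0
    proof -
      have "a x0 ^ (?N - 1) \<le> ennreal (C x0) * I ^ ?N"
        unfolding a_def I_def using rC[of x0] that X(1) U F F' W WF
        by (intro gagliardo_nirenberg_constantD) auto
      also have "\<dots> \<le> ennreal (\<Sum>x\<in>X. C x) * I ^ ?N"
        using X that rC by (intro mult_right_mono ennreal_leI member_le_sum) auto
      finally show ?thesis .
    qed
    have [measurable]: "\<Omega> \<in> sets borel" using o by simp
    have "(\<integral>\<^sup>+x. W x * indicator \<Omega> x \<partial>lborel) \<le> (\<integral>\<^sup>+x. (\<Sum>x0\<in>X. W x * indicator (\<Omega> \<inter> ball x0 (r x0)) x) \<partial>lborel)"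
    proof (rule nn_integral_mono)
      fix x
      show "W x * indicator \<Omega> x \<le> (\<Sum>x0\<in>X. W x * indicator (\<Omega> \<inter> ball x0 (r x0)) x)"
      proof (cases "x \<in> \<Omega>")
        case True
        then obtain x0 where "x0 \<in> X" "x \<in> ball x0 (r x0)" using X(3) closure_subset by blast
        then show ?thesis
          using True X(2) member_le_sum[of x0 X "\<lambda>x0. W x * indicator (\<Omega> \<inter> ball x0 (r x0)) x"] by simp
      qed simp
    qed
    also have "\<dots> = (\<Sum>x0\<in>X. a x0)" unfolding a_def
      using o W by (intro nn_integral_sum borel_measurable_times_ennreal borel_measurable_indicator) auto
    finally have sum: "(\<integral>\<^sup>+x. W x * indicator \<Omega> x \<partial>lborel) \<le> (\<Sum>x0\<in>X. a x0)" .
    have "(\<integral>\<^sup>+x. W x * indicator \<Omega> x \<partial>lborel) ^ (?N - 1) \<le> ennreal K * I ^ ?N"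
    proof (cases "X = {}")
      case True
      then show ?thesis using sum n by auto
    next
      case False
      define m where "m = Max (a ` X)"
      have "m \<in> a ` X" unfolding m_def using X(2) False by (intro Max_in) auto
      then have m: "m ^ (?N - 1) \<le> ennreal (\<Sum>x\<in>X. C x) * I ^ ?N" using a by auto
      have "(\<Sum>x0\<in>X. a x0) \<le> of_nat (card X) * m"
        unfolding m_def using X(2) by (intro sum_bounded_above) auto
      with sum have "(\<integral>\<^sup>+x. W x * indicator \<Omega> x \<partial>lborel) ^ (?N - 1) \<le> (of_nat (card X) * m) ^ (?N - 1)"
        by (intro power_mono) auto
      also have "\<dots> \<le> of_nat (card X) ^ (?N - 1) * (ennreal (\<Sum>x\<in>X. C x) * I ^ ?N)"
        unfolding power_mult_distrib by (intro mult_left_mono m) simp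
      also have "\<dots> = ennreal K * I ^ ?N"
        unfolding K_def using rC X(1)
        by (subst ennreal_mult) (auto simp: ennreal_power[symmetric] mult.assoc ennreal_of_nat_eq_real_of_nat intro!: sum_nonneg)
      finally show ?thesis .
    qed
    then show "(\<integral>\<^sup>+x. W x * indicator \<Omega> x \<partial>lborel) ^ (?N - 1) \<le> ennreal K *
        (\<integral>\<^sup>+x. ennreal (\<bar>F (h1_fun U x)\<bar> + \<bar>F' (h1_fun U x)\<bar> * norm (h1_grad U x)) * indicator \<Omega> x \<partial>lborel) ^ ?N"
      by (simp only: I_def)
  qed
qed

section \<open>The embedding: bootstrapping in dimension two, truncation in dimension three\<close>

lemma h1_norm_bounds:
  "(\<integral>\<^sup>+x. ennreal ((m * (\<bar>h1_fun U x\<bar> + norm (h1_grad U x)))\<^sup>2) \<partial>lborel) \<le> ennreal (2 * m\<^sup>2 * (norm U)\<^sup>2)"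
  "(\<integral>\<^sup>+x. ennreal ((h1_fun U x)\<^sup>2) \<partial>lborel) \<le> ennreal ((norm U)\<^sup>2)"
proof -
  have n: "ennreal ((norm U)\<^sup>2) = (\<integral>\<^sup>+x. ennreal ((h1_fun U x)\<^sup>2 + (norm (h1_grad U x))\<^sup>2) \<partial>lborel)"
    unfolding norm_h1 using h1_square_integrable[of U] by (intro nn_integral_eq_integral[symmetric]) auto
  show "(\<integral>\<^sup>+x. ennreal ((h1_fun U x)\<^sup>2) \<partial>lborel) \<le> ennreal ((norm U)\<^sup>2)"
    unfolding n by (intro nn_integral_mono ennreal_leI) simp
  have "(\<integral>\<^sup>+x. ennreal ((m * (\<bar>h1_fun U x\<bar> + norm (h1_grad U x)))\<^sup>2) \<partial>lborel)
      \<le> (\<integral>\<^sup>+x. ennreal (2 * m\<^sup>2) * ennreal ((h1_fun U x)\<^sup>2 + (norm (h1_grad U x))\<^sup>2) \<partial>lborel)"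
  proof (rule nn_integral_mono)
    fix x
    have "(\<bar>h1_fun U x\<bar> + norm (h1_grad U x))\<^sup>2 \<le> 2 * ((h1_fun U x)\<^sup>2 + (norm (h1_grad U x))\<^sup>2)"
      using norm_add_sq_le[of "\<bar>h1_fun U x\<bar>" "norm (h1_grad U x)"] by (simp add: power2_abs)
    from mult_left_mono[OF this, of "m\<^sup>2"]
    have "(m * (\<bar>h1_fun U x\<bar> + norm (h1_grad U x)))\<^sup>2 \<le> 2 * m\<^sup>2 * ((h1_fun U x)\<^sup>2 + (norm (h1_grad U x))\<^sup>2)"
      unfolding power_mult_distrib by (simp add: algebra_simps)
    then show "ennreal ((m * (\<bar>h1_fun U x\<bar> + norm (h1_grad U x)))\<^sup>2) \<le> ennreal (2 * m\<^sup>2) * ennreal ((h1_fun U x)\<^sup>2 + (norm (h1_grad U x))\<^sup>2)"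
      by (simp add: ennreal_mult[symmetric] ennreal_leI del: ennreal_plus)
  qed
  also have "\<dots> = ennreal (2 * m\<^sup>2) * ennreal ((norm U)\<^sup>2)"
    unfolding n by (rule nn_integral_cmult) measurable
  finally show "(\<integral>\<^sup>+x. ennreal ((m * (\<bar>h1_fun U x\<bar> + norm (h1_grad U x)))\<^sup>2) \<partial>lborel) \<le> ennreal (2 * m\<^sup>2 * (norm U)\<^sup>2)"
    by (simp add: ennreal_mult)
qed

text \<open>Here w is |F(u)| + |F'(u)| |\<nabla>u| for F close to a power. Cauchy-Schwarz separates
  the H^1 norm from a lower power p of u, whose square integral is either known from the previous
  step or is the quantity to be absorbed.\<close>

lemma h1_weighted_integral_le:
  fixes p w :: "'a::euclidean_space \<Rightarrow> real"
  assumes [measurable]: "p \<in> borel_measurable borel" "w \<in> borel_measurable borel" "\<Omega> \<in> sets borel"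
    and w: "\<And>x. 0 \<le> w x" "\<And>x. w x \<le> p x * (m * (\<bar>h1_fun U x\<bar> + norm (h1_grad U x)))"
  shows "(\<integral>\<^sup>+x. ennreal (w x) * indicator \<Omega> x \<partial>lborel)\<^sup>2
    \<le> (\<integral>\<^sup>+x. ennreal ((p x)\<^sup>2) * indicator \<Omega> x \<partial>lborel) * ennreal (2 * m\<^sup>2 * (norm U)\<^sup>2)"
proof -
  have "(\<integral>\<^sup>+x. ennreal (w x) * indicator \<Omega> x \<partial>lborel)\<^sup>2 \<le> (\<integral>\<^sup>+x. ennreal ((p x)\<^sup>2) * indicator \<Omega> x \<partial>lborel)
     * (\<integral>\<^sup>+x. ennreal ((m * (\<bar>h1_fun U x\<bar> + norm (h1_grad U x)))\<^sup>2) \<partial>lborel)"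
  proof (rule nn_integral_Cauchy_Schwarz_le)
    fix x
    have "(w x)\<^sup>2 \<le> (p x)\<^sup>2 * (m * (\<bar>h1_fun U x\<bar> + norm (h1_grad U x)))\<^sup>2"
      unfolding power_mult_distrib[symmetric] by (intro power_mono w)
    then show "(ennreal (w x) * indicator \<Omega> x)\<^sup>2 \<le> ennreal ((p x)\<^sup>2) * indicator \<Omega> x
        * ennreal ((m * (\<bar>h1_fun U x\<bar> + norm (h1_grad U x)))\<^sup>2)"
      using w(1)[of x] by (simp add: indicator_def ennreal_power ennreal_mult[symmetric] ennreal_leI)
  qed measurable
  also have "\<dots> \<le> (\<integral>\<^sup>+x. ennreal ((p x)\<^sup>2) * indicator \<Omega> x \<partial>lborel) * ennreal (2 * m\<^sup>2 * (norm U)\<^sup>2)"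
    by (intro mult_left_mono h1_norm_bounds) simp
  finally show ?thesis .
qed

text \<open>With F(v) = v^(n+1) the admissible W is |u|^(2n+2), and F' contributes |u|^n. After
  Cauchy-Schwarz only the integral of |u|^(2n) is left, so each step raises the exponent by two,
  starting from L^2.\<close>

lemma sobolev_dim_2:
  fixes \<Omega> :: "(real ^ 'n::finite) set"
  assumes N: "CARD('n) = 2" and \<Omega>: "bounded_lipschitz_domain \<Omega>" and n: "n \<ge> 1"
  shows "\<exists>C\<ge>0. \<forall>U\<in>H1 \<Omega>. (\<integral>\<^sup>+x. ennreal (\<bar>h1_fun U x\<bar> ^ (2 * n)) * indicator \<Omega> x \<partial>lborel) \<le> ennreal (C * norm U ^ (2 * n))"
  using n
proof (induction n rule: dec_induct)
  case base
  have "(\<integral>\<^sup>+x. ennreal (\<bar>h1_fun U x\<bar> ^ (2 * 1)) * indicator \<Omega> x \<partial>lborel) \<le> ennreal (1 * norm U ^ (2 * 1))" for U :: "(real ^ 'n) h1"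
  proof -
    have "(\<integral>\<^sup>+x. ennreal (\<bar>h1_fun U x\<bar> ^ (2 * 1)) * indicator \<Omega> x \<partial>lborel) \<le> (\<integral>\<^sup>+x. ennreal ((h1_fun U x)\<^sup>2) \<partial>lborel)"
      by (intro nn_integral_mono) (auto simp: indicator_def)
    also note h1_norm_bounds(2)
    finally show ?thesis by simp
  qed
  then show ?case by (intro exI[of _ 1]) auto
next
  case (step n)
  have o: "open \<Omega>" using \<Omega> by (auto simp: bounded_lipschitz_domain_def)
  then have [measurable]: "\<Omega> \<in> sets borel" by simp
  obtain C where C: "C \<ge> 0" "\<And>U. U \<in> H1 \<Omega> \<Longrightarrow>
      (\<integral>\<^sup>+x. ennreal (\<bar>h1_fun U x\<bar> ^ (2 * n)) * indicator \<Omega> x \<partial>lborel) \<le> ennreal (C * norm U ^ (2 * n))"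
    using step by blast
  from N have N': "CARD('n) = 2 \<or> CARD('n) = 3" by simp
  obtain K where K: "K \<ge> 0" "gagliardo_nirenberg_constant \<Omega> \<Omega> K"
    using gagliardo_nirenberg_lipschitz_domain[OF N' \<Omega>] by blast
  have "(\<integral>\<^sup>+x. ennreal (\<bar>h1_fun U x\<bar> ^ (2 * Suc n)) * indicator \<Omega> x \<partial>lborel)
      \<le> ennreal (K * C * 2 * (real (Suc n))\<^sup>2 * norm U ^ (2 * Suc n))" if U: "U \<in> H1 \<Omega>" for U
  proof -
    let ?w = "\<lambda>x. \<bar>h1_fun U x ^ Suc n\<bar> + \<bar>real (Suc n) * h1_fun U x ^ n\<bar> * norm (h1_grad U x)"
    have "(\<integral>\<^sup>+x. ennreal (\<bar>h1_fun U x\<bar> ^ (2 * Suc n)) * indicator \<Omega> x \<partial>lborel) ^ (CARD('n) - 1)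
        \<le> ennreal K * (\<integral>\<^sup>+x. ennreal (?w x) * indicator \<Omega> x \<partial>lborel) ^ CARD('n)"
    proof (rule gagliardo_nirenberg_constantD[OF K(2) U])
      show "((\<lambda>v. v ^ Suc n) has_real_derivative real (Suc n) * y ^ n) (at y)" for y
        using DERIV_pow[of "Suc n" y] by simp
      show "ennreal (\<bar>h1_fun U x\<bar> ^ (2 * Suc n)) ^ (CARD('n) - 1) \<le> ennreal \<bar>h1_fun U x ^ Suc n\<bar> ^ CARD('n)" for x
        unfolding N power_abs ennreal_power[OF zero_le_power[OF abs_ge_zero]] power_mult[symmetric]
        by (simp add: mult.commute del: power_Suc)
    qed (auto intro!: continuous_intros simp del: power_Suc)
    then have "(\<integral>\<^sup>+x. ennreal (\<bar>h1_fun U x\<bar> ^ (2 * Suc n)) * indicator \<Omega> x \<partial>lborel)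
        \<le> ennreal K * (\<integral>\<^sup>+x. ennreal (?w x) * indicator \<Omega> x \<partial>lborel)\<^sup>2"
      using N by (simp del: power_Suc of_nat_Suc)
    also have "(\<integral>\<^sup>+x. ennreal (?w x) * indicator \<Omega> x \<partial>lborel)\<^sup>2
        \<le> (\<integral>\<^sup>+x. ennreal ((\<bar>h1_fun U x\<bar> ^ n)\<^sup>2) * indicator \<Omega> x \<partial>lborel) * ennreal (2 * (real (Suc n))\<^sup>2 * (norm U)\<^sup>2)"
    proof (rule h1_weighted_integral_le)
      fix x
      have "\<bar>h1_fun U x\<bar> ^ n * \<bar>h1_fun U x\<bar> \<le> \<bar>h1_fun U x\<bar> ^ n * (real (Suc n) * \<bar>h1_fun U x\<bar>)"
        by (intro mult_left_mono) (auto simp: algebra_simps)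
      then show "?w x \<le> \<bar>h1_fun U x\<bar> ^ n * (real (Suc n) * (\<bar>h1_fun U x\<bar> + norm (h1_grad U x)))"
        by (simp add: abs_mult power_abs algebra_simps del: of_nat_Suc)
    qed auto
    also have "(\<integral>\<^sup>+x. ennreal ((\<bar>h1_fun U x\<bar> ^ n)\<^sup>2) * indicator \<Omega> x \<partial>lborel) \<le> ennreal (C * norm U ^ (2 * n))"
      using C(2)[OF U] by (simp add: power_mult[symmetric] mult.commute)
    finally have "(\<integral>\<^sup>+x. ennreal (\<bar>h1_fun U x\<bar> ^ (2 * Suc n)) * indicator \<Omega> x \<partial>lborel)
        \<le> ennreal K * (ennreal (C * norm U ^ (2 * n)) * ennreal (2 * (real (Suc n))\<^sup>2 * (norm U)\<^sup>2))"
      by (meson mult_left_mono mult_right_mono order_trans zero_le)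
    also have "\<dots> = ennreal (K * C * 2 * (real (Suc n))\<^sup>2 * norm U ^ (2 * Suc n))"
      using K(1) C(1) by (simp add: ennreal_mult[symmetric] power2_eq_square ac_simps del: of_nat_Suc)
    finally show ?thesis .
  qed
  then show ?case
    using K(1) C(1) by (intro exI[of _ "K * C * 2 * (real (Suc n))\<^sup>2"]) auto
qed

lemma arctan_rescaled_tendsto: "(\<lambda>k. real (Suc k) * arctan (v / real (Suc k))) \<longlonglongrightarrow> v"
proof (cases "v = 0")
  case False
  have "(arctan has_real_derivative inverse (1 + 0\<^sup>2)) (at 0)" by (rule DERIV_arctan)
  then have lim: "((\<lambda>h. arctan h / h) \<longlongrightarrow> 1) (at 0)" by (simp add: DERIV_def)
  have "filterlim (\<lambda>k. v / real (Suc k)) (at 0) sequentially"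
    unfolding filterlim_at using False LIMSEQ_inverse_real_of_nat[THEN tendsto_mult_right, of v]
    by (auto simp: divide_inverse)
  from tendsto_mult_left[OF filterlim_compose[OF lim this], of v] show ?thesis
    using False by (simp add: field_simps del: of_nat_Suc)
qed simp

text \<open>The truncations \<open>k arctan(u / k)\<close> have a finite \<open>L\<^sup>6\<close> norm a priori, so that a power of this norm
  can be cancelled.\<close>

lemma sobolev_dim_3:
  fixes \<Omega> :: "(real ^ 'n::finite) set"
  assumes N: "CARD('n) = 3" and \<Omega>: "bounded_lipschitz_domain \<Omega>"
  shows "\<exists>C\<ge>0. \<forall>U\<in>H1 \<Omega>. (\<integral>\<^sup>+x. ennreal (\<bar>h1_fun U x\<bar> ^ 6) * indicator \<Omega> x \<partial>lborel) \<le> ennreal (C * norm U ^ 6)"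
proof -
  have o: "open \<Omega>" and b: "bounded \<Omega>" using \<Omega> by (auto simp: bounded_lipschitz_domain_def)
  then have [measurable]: "\<Omega> \<in> sets borel" by simp
  from N have N': "CARD('n) = 2 \<or> CARD('n) = 3" by simp
  obtain K where K: "K \<ge> 0" "gagliardo_nirenberg_constant \<Omega> \<Omega> K"
    using gagliardo_nirenberg_lipschitz_domain[OF N' \<Omega>] by blast
  \<comment> \<open>The number 32 is 2 * 4^2: the factor 2 comes from squaring |u| + |\<nabla>u|,
    and 4 from differentiating a fourth power.\<close>
  define C where "C = K\<^sup>2 * 32 ^ 3"
  have "(\<integral>\<^sup>+x. ennreal (\<bar>h1_fun U x\<bar> ^ 6) * indicator \<Omega> x \<partial>lborel) \<le> ennreal (C * norm U ^ 6)"
    if U: "U \<in> H1 \<Omega>" for U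
  proof -
    define \<theta> where "\<theta> k v = real (Suc k) * arctan (v / real (Suc k))" for k v
    define X where "X k = (\<integral>\<^sup>+x. ennreal (\<bar>\<theta> k (h1_fun U x)\<bar> ^ 6) * indicator \<Omega> x \<partial>lborel)" for k
    have \<theta>m [measurable]: "\<theta> k \<in> borel_measurable borel" for k
      unfolding \<theta>_def[abs_def] by (intro borel_measurable_continuous_onI continuous_intros) auto
    have \<theta>v: "\<bar>\<theta> k v\<bar> \<le> \<bar>v\<bar>" for k v
      using mult_left_mono[OF abs_arctan_le[of "v / real (Suc k)"], of "real (Suc k)"]
      by (simp add: \<theta>_def abs_mult del: of_nat_Suc)
    have \<theta>b: "\<bar>\<theta> k v\<bar> \<le> real (Suc k) * 2" for k v
      unfolding \<theta>_def abs_mult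
      using arctan_bounded[of "v / real (Suc k)"] pi_less_4 by (intro mult_mono) (auto simp: abs_le_iff)
    have Xk: "X k \<le> ennreal (C * norm U ^ 6)" for k
    proof -
      \<comment> \<open>The fourth power is self-consistent in dimension three: |F|^(3/2) is the
        sixth power of the truncation, and the square of the cubic factor in F' is the sixth power
        again. Both sides thus involve the same quantity X k.\<close>
      define F where "F v = \<theta> k v ^ 4" for v
      define F' where "F' v = 4 * \<theta> k v ^ 3 * inverse (1 + (v / real (Suc k))\<^sup>2)" for v
      define I where "I = (\<integral>\<^sup>+x. ennreal (\<bar>F (h1_fun U x)\<bar> + \<bar>F' (h1_fun U x)\<bar> * norm (h1_grad U x)) * indicator \<Omega> x \<partial>lborel)"
      have \<theta>': "(\<theta> k has_real_derivative inverse (1 + (y / real (Suc k))\<^sup>2)) (at y)" for y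
        unfolding \<theta>_def[abs_def] by (auto intro!: derivative_eq_intros simp del: of_nat_Suc)
      have F: "(F has_real_derivative F' y) (at y)" for y
        unfolding F_def[abs_def] F'_def by (auto intro!: derivative_eq_intros \<theta>')
      have \<theta>c: "continuous_on UNIV (\<theta> k)"
        unfolding \<theta>_def[abs_def] by (intro continuous_intros) auto
      have F': "continuous_on UNIV F'"
        unfolding F'_def[abs_def]
        by (intro continuous_intros \<theta>c) (auto simp: add_nonneg_eq_0_iff)
      have "X k ^ (CARD('n) - 1) \<le> ennreal K * I ^ CARD('n)"
        unfolding X_def I_def
      proof (rule gagliardo_nirenberg_constantD[OF K(2) U F F'])
        show "ennreal (\<bar>\<theta> k (h1_fun U x)\<bar> ^ 6) ^ (CARD('n) - 1) \<le> ennreal \<bar>F (h1_fun U x)\<bar> ^ CARD('n)" for x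
          by (simp add: N F_def ennreal_power power_abs power_mult[symmetric])
      qed measurable
      then have X2: "X k ^ 2 \<le> ennreal K * I ^ 3" by (simp add: N)
      have I2: "I\<^sup>2 \<le> X k * ennreal (32 * (norm U)\<^sup>2)"
      proof -
        have "I\<^sup>2 \<le> (\<integral>\<^sup>+x. ennreal ((\<bar>\<theta> k (h1_fun U x)\<bar> ^ 3)\<^sup>2) * indicator \<Omega> x \<partial>lborel) * ennreal (2 * 4\<^sup>2 * (norm U)\<^sup>2)"
          unfolding I_def
        proof (rule h1_weighted_integral_le)
          fix x
          let ?t = "\<theta> k (h1_fun U x)"
          have "\<bar>F (h1_fun U x)\<bar> = \<bar>?t\<bar> ^ 3 * \<bar>?t\<bar>" using power_Suc2[of "\<bar>?t\<bar>" 3] by (simp add: F_def power_abs)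
          also have "\<dots> \<le> \<bar>?t\<bar> ^ 3 * (4 * \<bar>h1_fun U x\<bar>)"
            using \<theta>v[of k "h1_fun U x"] by (intro mult_left_mono) auto
          finally have 1: "\<bar>F (h1_fun U x)\<bar> \<le> \<bar>?t\<bar> ^ 3 * (4 * \<bar>h1_fun U x\<bar>)" .
          have "inverse (1 + (h1_fun U x / real (Suc k))\<^sup>2) \<le> 1"
            by (rule inverse_le_1_iff[THEN iffD2]) simp
          then have "\<bar>F' (h1_fun U x)\<bar> \<le> \<bar>4 * ?t ^ 3\<bar> * 1"
            unfolding F'_def abs_mult by (intro mult_left_mono) auto
          then have "\<bar>F' (h1_fun U x)\<bar> * norm (h1_grad U x) \<le> \<bar>?t\<bar> ^ 3 * (4 * norm (h1_grad U x))"
            using mult_right_mono[of _ _ "norm (h1_grad U x)"] by (fastforce simp: abs_mult power_abs)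
          with 1 show "\<bar>F (h1_fun U x)\<bar> + \<bar>F' (h1_fun U x)\<bar> * norm (h1_grad U x)
              \<le> \<bar>?t\<bar> ^ 3 * (4 * (\<bar>h1_fun U x\<bar> + norm (h1_grad U x)))"
            by (simp add: algebra_simps)
        qed (use F' F in \<open>auto simp: F_def[abs_def] intro!: borel_measurable_add borel_measurable_times borel_measurable_abs
            measurable_compose[OF _ borel_measurable_continuous_onI[OF F']]\<close>)
        then show ?thesis by (simp add: X_def power_mult[symmetric])
      qed
      \<comment> \<open>The truncation is bounded and \<Omega> has finite measure. Without
        finiteness the cancellation of x^3 below would be meaningless.\<close>
      have Xfin: "X k < \<infinity>"
      proof -
        have "X k \<le> (\<integral>\<^sup>+x. ennreal ((real (Suc k) * 2) ^ 6) * indicator \<Omega> x \<partial>lborel)"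
          unfolding X_def by (intro nn_integral_mono mult_right_mono ennreal_leI power_mono \<theta>b) auto
        also have "\<dots> = ennreal ((real (Suc k) * 2) ^ 6) * emeasure lborel \<Omega>"
          by (simp add: nn_integral_cmult_indicator)
        also have "\<dots> < \<infinity>"
          using emeasure_bounded_finite[OF b] by (simp add: ennreal_mult_less_top)
        finally show ?thesis .
      qed
      then obtain x where x: "X k = ennreal x" "x \<ge> 0" by (cases "X k") auto
      \<comment> \<open>Squaring the bound by I^3 and cubing the bound on I^2 makes the powers of I
        match: X^4 is at most a constant times X^3.\<close>
      have "(X k)\<^sup>2 * (X k)\<^sup>2 \<le> (ennreal K * I ^ 3) * (ennreal K * I ^ 3)"
        using X2 by (intro mult_mono) auto
      also have "\<dots> = (ennreal K)\<^sup>2 * (I\<^sup>2) ^ 3"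
        by (simp add: power2_eq_square power3_eq_cube ac_simps)
      also have "\<dots> \<le> (ennreal K)\<^sup>2 * (X k * ennreal (32 * (norm U)\<^sup>2)) ^ 3"
        by (intro mult_left_mono power_mono I2) auto
      finally have "ennreal ((x\<^sup>2) * x\<^sup>2) \<le> ennreal (K\<^sup>2 * (x * (32 * (norm U)\<^sup>2)) ^ 3)"
        using x K(1) by (simp add: ennreal_mult[symmetric] ennreal_power)
      then have "x\<^sup>2 * x\<^sup>2 \<le> K\<^sup>2 * (x * (32 * (norm U)\<^sup>2)) ^ 3"
        using x K(1) by (subst (asm) ennreal_le_iff) auto
      then have "x ^ 3 * x \<le> x ^ 3 * (C * norm U ^ 6)"
        by (simp add: C_def power_mult_distrib power_mult[symmetric] eval_nat_numeral ac_simps)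
      then have "x \<le> C * norm U ^ 6"
        using x(2) K(1) by (cases "x = 0") (auto simp: C_def)
      then show ?thesis using x by (simp add: ennreal_leI)
    qed
    \<comment> \<open>The bound on X k does not depend on k, so Fatou's lemma carries it to u
      itself.\<close>
    have "(\<integral>\<^sup>+x. ennreal (\<bar>h1_fun U x\<bar> ^ 6) * indicator \<Omega> x \<partial>lborel)
        = (\<integral>\<^sup>+x. liminf (\<lambda>k. ennreal (\<bar>\<theta> k (h1_fun U x)\<bar> ^ 6) * indicator \<Omega> x) \<partial>lborel)"
    proof (rule nn_integral_cong)
      fix x
      have "(\<lambda>k. ennreal (\<bar>\<theta> k (h1_fun U x)\<bar> ^ 6)) \<longlonglongrightarrow> ennreal (\<bar>h1_fun U x\<bar> ^ 6)"
        unfolding \<theta>_def by (intro tendsto_ennrealI tendsto_intros arctan_rescaled_tendsto)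
      then have "(\<lambda>k. ennreal (\<bar>\<theta> k (h1_fun U x)\<bar> ^ 6) * indicator \<Omega> x) \<longlonglongrightarrow> ennreal (\<bar>h1_fun U x\<bar> ^ 6) * indicator \<Omega> x"
        by (cases "x \<in> \<Omega>") auto
      then show "ennreal (\<bar>h1_fun U x\<bar> ^ 6) * indicator \<Omega> x = liminf (\<lambda>k. ennreal (\<bar>\<theta> k (h1_fun U x)\<bar> ^ 6) * indicator \<Omega> x)"
        by (rule lim_imp_Liminf[OF sequentially_bot, symmetric])
    qed
    also have "\<dots> \<le> liminf X"
      unfolding X_def by (rule nn_integral_liminf) measurable
    also have "\<dots> \<le> liminf (\<lambda>k. ennreal (C * norm U ^ 6))"
      by (intro Liminf_mono always_eventually allI Xk)
    finally show ?thesis by (simp add: Liminf_const)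
  qed
  then show ?thesis using K(1) by (intro exI[of _ C]) (auto simp: C_def)
qed

theorem sobolev_lipschitz_domain:
  fixes \<Omega> :: "(real ^ 'n::finite) set"
  assumes N: "CARD('n) = 2 \<or> CARD('n) = 3" and \<Omega>: "bounded_lipschitz_domain \<Omega>"
    and n: "n \<ge> 1" "CARD('n) = 3 \<Longrightarrow> n = 3"
  obtains C where "C \<ge> 0" "\<And>U. U \<in> H1 \<Omega> \<Longrightarrow> (\<integral>\<^sup>+x. ennreal (\<bar>h1_fun U x\<bar> ^ (2 * n)) \<partial>lborel) \<le> ennreal (C * norm U ^ (2 * n))"
proof -
  have "\<exists>C\<ge>0. \<forall>U\<in>H1 \<Omega>. (\<integral>\<^sup>+x. ennreal (\<bar>h1_fun U x\<bar> ^ (2 * n)) * indicator \<Omega> x \<partial>lborel) \<le> ennreal (C * norm U ^ (2 * n))"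
    using N
  proof
    assume "CARD('n) = 2"
    then show ?thesis using sobolev_dim_2[OF _ \<Omega> n(1)] by blast
  next
    assume N3: "CARD('n) = 3"
    show ?thesis using sobolev_dim_3[OF N3 \<Omega>] n(2)[OF N3] by simp
  qed
  then obtain C where C: "C \<ge> 0" "\<And>U. U \<in> H1 \<Omega> \<Longrightarrow>
      (\<integral>\<^sup>+x. ennreal (\<bar>h1_fun U x\<bar> ^ (2 * n)) * indicator \<Omega> x \<partial>lborel) \<le> ennreal (C * norm U ^ (2 * n))" by blast
  have "(\<integral>\<^sup>+x. ennreal (\<bar>h1_fun U x\<bar> ^ (2 * n)) \<partial>lborel) = (\<integral>\<^sup>+x. ennreal (\<bar>h1_fun U x\<bar> ^ (2 * n)) * indicator \<Omega> x \<partial>lborel)"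
    if "U \<in> H1 \<Omega>" for U
  proof (rule nn_integral_cong_AE, use H1_outside[OF that] in eventually_elim)
    case (elim x)
    then show ?case using n(1) by (auto simp: indicator_def power_0_left)
  qed
  then show ?thesis using that[OF C(1)] C(2) by simp
qed

section \<open>Closedness of the Sobolev space and functions of time\<close>

text \<open>\<open>H\<^sup>1(\<Omega>)\<close> is the orthogonal complement of this set, hence closed under the Bochner integral.\<close>

definition H1_annihilator :: "'a::euclidean_space set \<Rightarrow> 'a h1 set" where
  "H1_annihilator \<Omega> = {V. AE x in lborel. x \<in> \<Omega> \<longrightarrow> rep_L2 V x = 0} \<union>
     {abs_L2 (\<lambda>x. (frechet_derivative \<phi> (at x) b, \<phi> x *\<^sub>R b)) | \<phi> b. test_function \<Omega> \<phi> \<and> b \<in> Basis}"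

lemma test_function_square_integrable:
  assumes \<phi>: "test_function \<Omega> \<phi>"
  shows "integrable lborel (\<lambda>x. (\<phi> x)\<^sup>2)" "integrable lborel (\<lambda>x. (frechet_derivative \<phi> (at x) b)\<^sup>2)"
proof -
  let ?K = "closure {x. \<phi> x \<noteq> 0}"
  have K: "compact ?K" using \<phi> unfolding test_function_def by blast
  have \<phi>K: "test_function ?K \<phi>" using \<phi> unfolding test_function_def by blast
  have bi: "integrable lborel f"
    if "continuous_on UNIV f" "\<And>x. x \<notin> ?K \<Longrightarrow> f x = 0" for f :: "'a \<Rightarrow> real"
  proof -
    have "integrable lborel (\<lambda>x. indicator ?K x *\<^sub>R f x)"
      by (rule borel_integrable_compact[OF K continuous_on_subset[OF that(1) subset_UNIV]])
    moreover have "(\<lambda>x. indicator ?K x *\<^sub>R f x) = f"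
      using that(2) by (intro ext) (metis indicator_simps scaleR_one scaleR_zero_left)
    ultimately show ?thesis by (rule back_subst[of "integrable lborel"])
  qed
  have o: "\<phi> x = 0" "frechet_derivative \<phi> (at x) b = 0" if "x \<notin> ?K" for x
    using test_function_outside[OF \<phi>K that] by blast+
  note c = continuous_on_test_function[OF \<phi>] continuous_on_deriv_test_function[OF \<phi>, of b]
  show "integrable lborel (\<lambda>x. (\<phi> x)\<^sup>2)" by (rule bi[OF continuous_on_power[OF c(1)]]) (drule o(1), simp)
  show "integrable lborel (\<lambda>x. (frechet_derivative \<phi> (at x) b)\<^sup>2)"
    by (rule bi[OF continuous_on_power[OF c(2)]]) (drule o(2), simp)
qed

lemma square_integrable_test_pair:
  fixes b :: "'a::euclidean_space"
  assumes \<phi>: "test_function \<Omega> \<phi>"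
  shows "square_integrable (\<lambda>x. (frechet_derivative \<phi> (at x) b, \<phi> x *\<^sub>R b))"
proof -
  have [measurable]: "\<phi> \<in> borel_measurable borel" "(\<lambda>x. frechet_derivative \<phi> (at x) b) \<in> borel_measurable borel"
    using continuous_on_test_function[OF \<phi>] continuous_on_deriv_test_function[OF \<phi>]
    by (auto intro: borel_measurable_continuous_onI)
  have eq: "(norm (frechet_derivative \<phi> (at x) b, \<phi> x *\<^sub>R b))\<^sup>2 = (frechet_derivative \<phi> (at x) b)\<^sup>2 + (\<phi> x)\<^sup>2 * (norm b)\<^sup>2" for x
    by (simp add: norm_prod_def power_mult_distrib)
  have "(\<lambda>x. (frechet_derivative \<phi> (at x) b, \<phi> x *\<^sub>R b)) \<in> borel_measurable lborel"
    using borel_measurable_Pair[of "\<lambda>x. frechet_derivative \<phi> (at x) b" lborel "\<lambda>x. \<phi> x *\<^sub>R b"] by simp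
  moreover have "integrable lborel (\<lambda>x. (frechet_derivative \<phi> (at x) b)\<^sup>2 + (\<phi> x)\<^sup>2 * (norm b)\<^sup>2)"
    using test_function_square_integrable[OF \<phi>] by simp
  ultimately show ?thesis by (simp add: square_integrable_def eq)
qed

lemma rep_L2_eq_Pair: "rep_L2 U x = (h1_fun U x, h1_grad U x)"
  by (simp add: h1_fun_def h1_grad_def)

lemma square_integrable_indicator_mult:
  fixes f :: "'a::euclidean_space \<Rightarrow> 'b::euclidean_space"
  assumes f: "square_integrable f" and A: "A \<in> sets borel"
  shows "square_integrable (\<lambda>x. indicator A x *\<^sub>R f x)"
proof -
  have [measurable]: "f \<in> borel_measurable borel" using f by (auto simp: square_integrable_def)
  have "integrable lborel (\<lambda>x. (norm (indicator A x *\<^sub>R f x))\<^sup>2)"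
  proof (rule Bochner_Integration.integrable_bound)
    show "integrable lborel (\<lambda>x. (norm (f x))\<^sup>2)" using f by (simp add: square_integrable_def)
  qed (use A in \<open>auto simp: indicator_def\<close>)
  then show ?thesis using A by (simp add: square_integrable_def)
qed

text \<open>Every defining condition is an orthogonality. Vanishing outside \<Omega> means being
  orthogonal to all elements that vanish on \<Omega>, and the weak derivative identity means being
  orthogonal to the pair of the derivative of \<phi> and \<phi> b. Local integrability is automatic
  for square integrable functions.\<close>

lemma H1_iff_annihilator:
  assumes o: "open \<Omega>"
  shows "U \<in> H1 \<Omega> \<longleftrightarrow> (\<forall>V\<in>H1_annihilator \<Omega>. U \<bullet> V = 0)"
proof -
  have outside: "(AE x in lborel. x \<notin> \<Omega> \<longrightarrow> rep_L2 U x = 0) \<longleftrightarrow>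
    (\<forall>V. (AE x in lborel. x \<in> \<Omega> \<longrightarrow> rep_L2 V x = 0) \<longrightarrow> U \<bullet> V = 0)"
  proof (intro iffI allI impI)
    fix V :: "'a h1" assume "AE x in lborel. x \<notin> \<Omega> \<longrightarrow> rep_L2 U x = 0" "AE x in lborel. x \<in> \<Omega> \<longrightarrow> rep_L2 V x = 0"
    then have "AE x in lborel. rep_L2 U x \<bullet> rep_L2 V x = 0" by eventually_elim auto
    then show "U \<bullet> V = 0" unfolding inner_L2_eq by (rule integral_eq_zero_AE)
  next
    assume V: "\<forall>V. (AE x in lborel. x \<in> \<Omega> \<longrightarrow> rep_L2 V x = 0) \<longrightarrow> U \<bullet> V = 0"
    have si: "square_integrable (\<lambda>x. indicator (- \<Omega>) x *\<^sub>R rep_L2 U x)"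
      using o by (intro square_integrable_indicator_mult square_integrable_rep) simp
    \<comment> \<open>Testing with the part of U outside \<Omega>: its inner product with U is its
      own squared norm, so it must vanish.\<close>
    define V0 where "V0 = abs_L2 (\<lambda>x. indicator (- \<Omega>) x *\<^sub>R rep_L2 U x)"
    have V0: "AE x in lborel. rep_L2 V0 x = indicator (- \<Omega>) x *\<^sub>R rep_L2 U x"
      unfolding V0_def by (rule rep_abs_L2[OF si])
    have "AE x in lborel. x \<in> \<Omega> \<longrightarrow> rep_L2 V0 x = 0" using V0 by eventually_elim auto
    then have "U \<bullet> V0 = 0" using V by blast
    moreover have "V0 \<bullet> V0 = U \<bullet> V0"
      unfolding inner_L2_eq
    proof (rule integral_cong_AE)
      show "AE x in lborel. rep_L2 V0 x \<bullet> rep_L2 V0 x = rep_L2 U x \<bullet> rep_L2 V0 x"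
        using V0 by eventually_elim (auto simp: indicator_def)
    qed (use square_integrable_measurable[OF square_integrable_rep] in \<open>auto intro!: borel_measurable_inner\<close>)
    ultimately have "V0 = 0" by simp
    then have "AE x in lborel. rep_L2 V0 x = 0" using rep_zero_L2 by simp
    with V0 show "AE x in lborel. x \<notin> \<Omega> \<longrightarrow> rep_L2 U x = 0" by eventually_elim (auto simp: indicator_def)
  qed
  have loc: "set_integrable lborel K (h1_fun U)" "set_integrable lborel K (\<lambda>x. h1_grad U x \<bullet> b)"
    if K: "compact K" for K and b :: 'a
  proof -
    have Ks: "K \<in> sets borel" using K by (simp add: compact_imp_closed)
    have "emeasure lborel K < \<infinity>" using K by (intro emeasure_bounded_finite compact_imp_bounded)
    then have 1: "integrable lborel (indicator K :: 'a \<Rightarrow> real)" using Ks by (simp add: integrable_indicator_iff)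
    have le: "\<bar>r\<bar> \<le> 1 + r\<^sup>2" for r :: real
      using sum_squares_bound[of 1 "\<bar>r\<bar>"] by simp
    show "set_integrable lborel K (h1_fun U)"
      unfolding set_integrable_def
    proof (rule Bochner_Integration.integrable_bound[OF Bochner_Integration.integrable_add[OF 1 h1_square_integrable(1)[of U]]])
      show "AE x in lborel. norm (indicator K x *\<^sub>R h1_fun U x) \<le> norm (indicator K x + (h1_fun U x)\<^sup>2)"
        using le by (intro AE_I2) (auto simp: indicator_def)
    qed (use Ks in measurable)
    have "integrable lborel (\<lambda>x. (norm b)\<^sup>2 * (norm (h1_grad U x))\<^sup>2)" using h1_square_integrable(2)[of U] by simp
    from Bochner_Integration.integrable_add[OF 1 this]
    show "set_integrable lborel K (\<lambda>x. h1_grad U x \<bullet> b)"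
      unfolding set_integrable_def
    proof (rule Bochner_Integration.integrable_bound)
      show "AE x in lborel. norm (indicator K x *\<^sub>R (h1_grad U x \<bullet> b)) \<le> norm (indicator K x + (norm b)\<^sup>2 * (norm (h1_grad U x))\<^sup>2)"
      proof (rule AE_I2)
        fix x
        have "(h1_grad U x \<bullet> b)\<^sup>2 \<le> (norm b)\<^sup>2 * (norm (h1_grad U x))\<^sup>2"
          using power_mono[OF Cauchy_Schwarz_ineq2[of "h1_grad U x" b], of 2] by (simp add: power_mult_distrib mult.commute)
        then show "norm (indicator K x *\<^sub>R (h1_grad U x \<bullet> b)) \<le> norm (indicator K x + (norm b)\<^sup>2 * (norm (h1_grad U x))\<^sup>2)"
          using le[of "h1_grad U x \<bullet> b"] by (auto simp: indicator_def)
      qed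
    qed (use Ks in measurable)
  qed
  have weak: "(LINT x:\<Omega>|lborel. frechet_derivative \<phi> (at x) b *\<^sub>R h1_fun U x) = - (LINT x:\<Omega>|lborel. \<phi> x *\<^sub>R (h1_grad U x \<bullet> b)) \<longleftrightarrow>
    U \<bullet> abs_L2 (\<lambda>x. (frechet_derivative \<phi> (at x) b, \<phi> x *\<^sub>R b)) = 0" if \<phi>: "test_function \<Omega> \<phi>" for \<phi> b
  proof -
    have [measurable]: "\<phi> \<in> borel_measurable borel" "(\<lambda>x. frechet_derivative \<phi> (at x) b) \<in> borel_measurable borel"
      using continuous_on_test_function[OF \<phi>] continuous_on_deriv_test_function[OF \<phi>]
      by (auto intro: borel_measurable_continuous_onI)
    have i1: "integrable lborel (\<lambda>x. frechet_derivative \<phi> (at x) b * h1_fun U x)"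
    proof (rule Bochner_Integration.integrable_bound)
      show "integrable lborel (\<lambda>x. (frechet_derivative \<phi> (at x) b)\<^sup>2 + (h1_fun U x)\<^sup>2)"
        using test_function_square_integrable[OF \<phi>] h1_square_integrable(1)[of U] by simp
      show "AE x in lborel. norm (frechet_derivative \<phi> (at x) b * h1_fun U x) \<le> norm ((frechet_derivative \<phi> (at x) b)\<^sup>2 + (h1_fun U x)\<^sup>2)"
      proof (rule AE_I2)
        fix x
        have "2 * \<bar>frechet_derivative \<phi> (at x) b * h1_fun U x\<bar> \<le> (frechet_derivative \<phi> (at x) b)\<^sup>2 + (h1_fun U x)\<^sup>2"
          using sum_squares_bound[of "\<bar>frechet_derivative \<phi> (at x) b\<bar>" "\<bar>h1_fun U x\<bar>"] by (simp add: abs_mult)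
        then show "norm (frechet_derivative \<phi> (at x) b * h1_fun U x) \<le> norm ((frechet_derivative \<phi> (at x) b)\<^sup>2 + (h1_fun U x)\<^sup>2)"
          using abs_ge_zero[of "frechet_derivative \<phi> (at x) b * h1_fun U x"]
            abs_ge_self[of "(frechet_derivative \<phi> (at x) b)\<^sup>2 + (h1_fun U x)\<^sup>2"] unfolding real_norm_def by linarith
      qed
    qed measurable
    have i2: "integrable lborel (\<lambda>x. \<phi> x * (h1_grad U x \<bullet> b))"
    proof (rule Bochner_Integration.integrable_bound)
      show "integrable lborel (\<lambda>x. (norm b)\<^sup>2 * (norm (h1_grad U x))\<^sup>2 + (\<phi> x)\<^sup>2)"
        using test_function_square_integrable[OF \<phi>] h1_square_integrable(2)[of U] by simp
      show "AE x in lborel. norm (\<phi> x * (h1_grad U x \<bullet> b)) \<le> norm ((norm b)\<^sup>2 * (norm (h1_grad U x))\<^sup>2 + (\<phi> x)\<^sup>2)"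
      proof (rule AE_I2)
        fix x
        have "\<bar>\<phi> x * (h1_grad U x \<bullet> b)\<bar> \<le> \<bar>\<phi> x\<bar> * (norm (h1_grad U x) * norm b)"
          unfolding abs_mult by (intro mult_left_mono Cauchy_Schwarz_ineq2) simp
        moreover have "2 * (\<bar>\<phi> x\<bar> * (norm (h1_grad U x) * norm b)) \<le> (\<phi> x)\<^sup>2 + (norm (h1_grad U x) * norm b)\<^sup>2"
          using sum_squares_bound[of "\<bar>\<phi> x\<bar>" "norm (h1_grad U x) * norm b"] by (simp add: mult.assoc)
        moreover have "0 \<le> \<bar>\<phi> x\<bar> * (norm (h1_grad U x) * norm b)" by simp
        ultimately have "\<bar>\<phi> x * (h1_grad U x \<bullet> b)\<bar> \<le> (\<phi> x)\<^sup>2 + (norm (h1_grad U x) * norm b)\<^sup>2" by linarith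
        then show "norm (\<phi> x * (h1_grad U x \<bullet> b)) \<le> norm ((norm b)\<^sup>2 * (norm (h1_grad U x))\<^sup>2 + (\<phi> x)\<^sup>2)"
          by (simp add: power_mult_distrib ac_simps)
      qed
    qed measurable
    have "U \<bullet> abs_L2 (\<lambda>x. (frechet_derivative \<phi> (at x) b, \<phi> x *\<^sub>R b))
        = (LINT x|lborel. frechet_derivative \<phi> (at x) b * h1_fun U x + \<phi> x * (h1_grad U x \<bullet> b))"
      unfolding inner_L2_eq
    proof (rule integral_cong_AE)
      show "AE x in lborel. rep_L2 U x \<bullet> rep_L2 (abs_L2 (\<lambda>x. (frechet_derivative \<phi> (at x) b, \<phi> x *\<^sub>R b))) x
          = frechet_derivative \<phi> (at x) b * h1_fun U x + \<phi> x * (h1_grad U x \<bullet> b)"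
        using rep_abs_L2[OF square_integrable_test_pair[OF \<phi>, of b]]
        by eventually_elim (simp add: rep_L2_eq_Pair[of U] mult.commute)
    qed (use square_integrable_measurable[OF square_integrable_rep] in \<open>auto intro!: borel_measurable_inner\<close>)
    also have "\<dots> = (LINT x|lborel. frechet_derivative \<phi> (at x) b * h1_fun U x) + (LINT x|lborel. \<phi> x * (h1_grad U x \<bullet> b))"
      by (rule Bochner_Integration.integral_add[OF i1 i2])
    finally show ?thesis
      using test_function_set_integral(2)[OF \<phi>, of b "h1_fun U"] test_function_set_integral(1)[OF \<phi>, of "\<lambda>x. h1_grad U x \<bullet> b"]
      by (simp add: eq_neg_iff_add_eq_0)
  qed
  have "U \<in> H1 \<Omega> \<longleftrightarrow> (AE x in lborel. x \<notin> \<Omega> \<longrightarrow> rep_L2 U x = 0) \<and>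
      (\<forall>b\<in>Basis. \<forall>\<phi>. test_function \<Omega> \<phi> \<longrightarrow>
        (LINT x:\<Omega>|lborel. frechet_derivative \<phi> (at x) b *\<^sub>R h1_fun U x) = - (LINT x:\<Omega>|lborel. \<phi> x *\<^sub>R (h1_grad U x \<bullet> b)))"
    unfolding H1_def weak_partial_def using loc by (simp add: rep_L2_eq_Pair zero_prod_def)
  also have "\<dots> \<longleftrightarrow> (\<forall>V\<in>H1_annihilator \<Omega>. U \<bullet> V = 0)"
  proof -
    have "(\<forall>V\<in>H1_annihilator \<Omega>. U \<bullet> V = 0) \<longleftrightarrow> (\<forall>V. (AE x in lborel. x \<in> \<Omega> \<longrightarrow> rep_L2 V x = 0) \<longrightarrow> U \<bullet> V = 0) \<and>
      (\<forall>b\<in>Basis. \<forall>\<phi>. test_function \<Omega> \<phi> \<longrightarrow> U \<bullet> abs_L2 (\<lambda>x. (frechet_derivative \<phi> (at x) b, \<phi> x *\<^sub>R b)) = 0)"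
      unfolding H1_annihilator_def ball_Un by (auto simp only: mem_Collect_eq Ball_def)
    then show ?thesis
      unfolding outside by (simp add: weak[unfolded real_scaleR_def])
  qed
  finally show ?thesis .
qed

lemma H1_subspace:
  assumes "open \<Omega>" "U \<in> H1 \<Omega>" "V \<in> H1 \<Omega>"
  shows "U + V \<in> H1 \<Omega>" "U - V \<in> H1 \<Omega>" "c *\<^sub>R U \<in> H1 \<Omega>"
  using assms by (auto simp: H1_iff_annihilator inner_add_left inner_diff_left)

text \<open>Inner products commute with the Bochner integral, so orthogonality passes from the
  values to the integral. Applied later to histories and to integrals of q2 - q1.\<close>

lemma set_integral_in_H1:
  assumes o: "open \<Omega>" and f: "set_integrable lborel A f" and H: "\<And>t. t \<in> A \<Longrightarrow> f t \<in> H1 \<Omega>"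
  shows "(LINT t:A|lborel. f t) \<in> H1 \<Omega>"
  unfolding H1_iff_annihilator[OF o]
proof
  fix V assume V: "V \<in> H1_annihilator \<Omega>"
  have "(LINT t:A|lborel. f t) \<bullet> V = (LINT t|lborel. (indicator A t *\<^sub>R f t) \<bullet> V)"
    unfolding set_lebesgue_integral_def
    by (rule integral_inner_left[symmetric]) (use f in \<open>simp add: set_integrable_def\<close>)
  also have "\<dots> = 0"
    using H V o by (intro integral_eq_zero_AE AE_I2) (auto simp: indicator_def H1_iff_annihilator)
  finally show "(LINT t:A|lborel. f t) \<bullet> V = 0" .
qed

section \<open>Functions of time and the fundamental theorem for the weak time derivative\<close>

lemma AE_zero_imp_zero_on_closed_interval:
  fixes f :: "real \<Rightarrow> real"
  assumes ab: "a < b" and f: "continuous_on {a..b} f" and ae: "AE x in lborel. x \<in> {a<..<b} \<longrightarrow> f x = 0"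
    and x: "x \<in> {a..b}"
  shows "f x = 0"
proof -
  have "continuous_on {a<..<b} f" using f by (rule continuous_on_subset) auto
  then have o: "open ({a<..<b} \<inter> f -` (- {0}))"
    by (rule continuous_open_preimage) auto
  have "{a<..<b} \<inter> f -` (- {0}) \<in> null_sets lborel"
    using ae o by (subst AE_iff_null_sets) (auto elim: eventually_mono)
  then have "{a<..<b} \<inter> f -` (- {0}) = {}"
    using open_not_negligible[OF o] null_sets_completionI unfolding negligible_iff_null_sets by blast
  then have "\<And>y. y \<in> {a<..<b} \<Longrightarrow> f y = 0" by auto
  then show ?thesis
    using continuous_constant_on_closure[of "{a<..<b}" f 0 x] f x ab by simp
qed

lemma indefinite_integral_continuous:
  fixes f :: "real \<Rightarrow> 'b::{banach, second_countable_topology}"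
  assumes f: "set_integrable lborel {a..b} f"
  shows "continuous_on {a..b} (\<lambda>t. LINT x:{a..t}|lborel. f x)"
proof -
  let ?I = "\<lambda>t. LINT x:{a..t}|lborel. f x" and ?m = "\<lambda>t. LINT x:{a..t}|lborel. norm (f x)"
  have fn: "set_integrable lborel {a..b} (\<lambda>x. norm (f x))" using f by (rule set_integrable_norm)
  have le: "norm (?I t - ?I s) \<le> \<bar>?m t - ?m s\<bar>" if "s \<in> {a..b}" "t \<in> {a..b}" "s \<le> t" for s t
  proof -
    have sub: "set_integrable lborel {s..t} f" "set_integrable lborel {a..t} f" "set_integrable lborel {a..t} (\<lambda>x. norm (f x))"
      using that by (auto intro: set_integrable_subset[OF f] set_integrable_subset[OF fn])
    have "?I t - ?I s = (LINT x:{s..t}|lborel. f x)" "?m t - ?m s = (LINT x:{s..t}|lborel. norm (f x))"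
      using set_integral_Icc_combine[OF sub(2), of s] set_integral_Icc_combine[OF sub(3), of s] that by auto
    then show ?thesis using set_integral_norm_le[OF sub(1)] by simp
  qed
  have m: "continuous_on {a..b} ?m" by (rule indefinite_integral_real_continuous[OF fn])
  show ?thesis
    unfolding continuous_on_iff
  proof (intro ballI allI impI)
    fix s e :: real assume s: "s \<in> {a..b}" and e: "e > 0"
    then obtain d where d: "d > 0" "\<And>t. t \<in> {a..b} \<Longrightarrow> dist t s < d \<Longrightarrow> dist (?m t) (?m s) < e"
      using m[unfolded continuous_on_iff, rule_format, OF s e] by blast
    have "dist (?I t) (?I s) < e" if t: "t \<in> {a..b}" "dist t s < d" for t
    proof -
      have "norm (?I t - ?I s) \<le> \<bar>?m t - ?m s\<bar>"
        using le[of s t] le[of t s] s t by (cases "s \<le> t") (auto simp: norm_minus_commute abs_minus_commute)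
      then show ?thesis using d(2)[OF t] by (simp add: dist_norm)
    qed
    then show "\<exists>d>0. \<forall>t\<in>{a..b}. dist t s < d \<longrightarrow> dist (?I t) (?I s) < e" using d(1) by blast
  qed
qed

text \<open>The spaces in time refer to the open interval, while splitting an interval is done with
  closed ones. The endpoint values of f are arbitrary, so measurability on the closed interval is
  obtained by adding two point contributions.\<close>

lemma set_integral_open_interval:
  fixes f :: "real \<Rightarrow> 'b::{banach, second_countable_topology}"
  shows "set_integrable lborel {a<..<b} f \<longleftrightarrow> set_integrable lborel {a..b} f"
    and "set_integrable lborel {a..b} f \<Longrightarrow> (LINT x:{a<..<b}|lborel. f x) = (LINT x:{a..b}|lborel. f x)"
proof -
  have ae: "AE x in lborel. indicator {a<..<b} x *\<^sub>R f x = indicator {a..b} x *\<^sub>R f x"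
    using AE_lborel_singleton[of a] AE_lborel_singleton[of b] by eventually_elim (auto simp: indicator_def)
  have eq: "indicator {a..b} x *\<^sub>R f x = indicator {a<..<b} x *\<^sub>R f x + indicator {a} x *\<^sub>R f a
      + indicator {b} x *\<^sub>R f b" if "a < b" for x
    using that by (auto simp: indicator_def)
  have mono: "(\<lambda>x. indicator {a..b} x *\<^sub>R f x) \<in> borel_measurable borel"
    if [measurable]: "(\<lambda>x. indicator {a<..<b} x *\<^sub>R f x) \<in> borel_measurable borel"
  proof (cases "a < b")
    case True
    show ?thesis unfolding eq[OF True] by measurable
  next
    \<comment> \<open>For a = b the closed interval is a single point, for a > b it is empty;
      \<open>{a} \<inter> {b}\<close> describes both.\<close>
    case False
    then have "(\<lambda>x. indicator {a..b} x *\<^sub>R f x) = (\<lambda>x. indicator ({a} \<inter> {b}) x *\<^sub>R f a)"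
      by (intro ext) (auto simp: indicator_def)
    then show ?thesis by simp
  qed
  have sub: "set_integrable lborel {a<..<b} f" if "set_integrable lborel {a..b} f"
    using that by (rule set_integrable_subset) auto
  show "set_integrable lborel {a<..<b} f \<longleftrightarrow> set_integrable lborel {a..b} f"
  proof
    assume i: "set_integrable lborel {a<..<b} f"
    then have "(\<lambda>x. indicator {a..b} x *\<^sub>R f x) \<in> borel_measurable borel"
      by (intro mono) (auto simp: set_integrable_def)
    then show "set_integrable lborel {a..b} f"
      using i integrable_cong_AE[OF _ _ ae] unfolding set_integrable_def by auto
  qed (rule sub)
  assume i: "set_integrable lborel {a..b} f"
  show "(LINT x:{a<..<b}|lborel. f x) = (LINT x:{a..b}|lborel. f x)"
    unfolding set_lebesgue_integral_def using i sub[OF i]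
    by (intro integral_cong_AE ae) (auto simp: set_integrable_def)
qed

lemma L2_time_integrable:
  assumes "L2_time T X f"
  shows "set_integrable lborel {0..T} (\<lambda>t. (norm (f t))\<^sup>2)" "set_integrable lborel {0..T} f"
proof -
  have f: "(\<lambda>x. indicator {0<..<T} x *\<^sub>R f x) \<in> borel_measurable borel"
    "set_integrable lborel {0<..<T} (\<lambda>t. (norm (f t))\<^sup>2)"
    using assms by (auto simp: L2_time_def set_borel_measurable_def)
  then show "set_integrable lborel {0..T} (\<lambda>t. (norm (f t))\<^sup>2)" by (simp add: set_integral_open_interval)
  have "integrable lborel (\<lambda>x. indicator {0<..<T} x *\<^sub>R f x)"
  proof (rule Bochner_Integration.integrable_bound)
    show "integrable lborel (\<lambda>x. indicator {0<..<T} x + indicator {0<..<T} x *\<^sub>R (norm (f x))\<^sup>2)"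
      using f(2) emeasure_bounded_finite[of "{0<..<T}"]
      by (intro Bochner_Integration.integrable_add) (simp_all add: set_integrable_def integrable_indicator_iff)
    show "AE x in lborel. norm (indicator {0<..<T} x *\<^sub>R f x) \<le> norm (indicator {0<..<T} x + indicator {0<..<T} x *\<^sub>R (norm (f x))\<^sup>2)"
    proof (rule AE_I2)
      fix x
      have "2 * norm (f x) \<le> 1 + (norm (f x))\<^sup>2" using sum_squares_bound[of 1 "norm (f x)"] by simp
      then have "norm (f x) \<le> 1 + (norm (f x))\<^sup>2" using norm_ge_zero[of "f x"] by linarith
      then show "norm (indicator {0<..<T} x *\<^sub>R f x) \<le> norm (indicator {0<..<T} x + indicator {0<..<T} x *\<^sub>R (norm (f x))\<^sup>2)"
        by (auto simp: indicator_def)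
    qed
  qed (use f in simp)
  then show "set_integrable lborel {0..T} f"
    using set_integral_open_interval(1)[of 0 T f] by (simp add: set_integrable_def)
qed

lemma time_deriv_L2_weak:
  assumes "q \<in> H1_time T X"
  shows "L2_time T X (time_deriv T X q)" "weak_partial {0<..<T} 1 q (time_deriv T X q)"
proof -
  have "\<exists>g. L2_time T X g \<and> weak_partial {0<..<T} 1 q g" using assms by (simp add: H1_time_def)
  from someI_ex[OF this]
  show "L2_time T X (time_deriv T X q)" "weak_partial {0<..<T} 1 q (time_deriv T X q)"
    by (simp_all add: time_deriv_def)
qed

text \<open>Pairing with a fixed vector reduces the vector-valued statement to the scalar one.\<close>

lemma H1_time_ftc:
  fixes q :: "real \<Rightarrow> 'b::{real_inner, banach, second_countable_topology}"
  assumes q: "q \<in> H1_time T X" and T: "T > 0" and st: "0 \<le> s" "s \<le> t" "t \<le> T"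
  shows "q t - q s = (LINT \<tau>:{s..t}|lborel. time_deriv T X q \<tau>)"
proof -
  define v where "v = time_deriv T X q"
  have v: "set_integrable lborel {0..T} v" unfolding v_def by (rule L2_time_integrable(2)[OF time_deriv_L2_weak(1)[OF q]])
  have qc: "continuous_on {0..T} q" using q by (simp add: H1_time_def)
  have qi: "set_integrable lborel {0..T} q" using q by (intro L2_time_integrable[of T X]) (simp add: H1_time_def)
  have vo: "set_integrable lborel {0<..<T} v" "set_integrable lborel {0<..<T} q"
    using v qi by (simp_all add: set_integral_open_interval)
  define I where "I t = (LINT \<tau>:{0..t}|lborel. v \<tau>)" for t
  have Ic: "continuous_on {0..T} I" unfolding I_def[abs_def] by (rule indefinite_integral_continuous[OF v])
  have sub: "set_integrable lborel {a..b} v" if "0 \<le> a" "b \<le> T" for a b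
    using that by (intro set_integrable_subset[OF v]) auto
  have "AE x in lborel. indicator {0..0} x *\<^sub>R v x = 0"
    using AE_lborel_singleton[of "0::real"] by eventually_elim (simp add: indicator_def)
  then have I0: "I 0 = 0"
    unfolding I_def set_lebesgue_integral_def by (rule integral_eq_zero_AE)
  \<comment> \<open>The shift a is fixed and the starting point varies. The segment lemma gives the
    increment from x to x + a for almost every x in the open interval from 0 to T - a, which is
    nonempty because a < T.\<close>
  have main: "(q a - I a - q 0) \<bullet> e = 0" if a: "0 \<le> a" "a < T" for a e
  proof -
    define u where "u x = indicator {0<..<T} x * (q x \<bullet> e)" for x
    define g where "g x = indicator {0<..<T} x * (v x \<bullet> e)" for x
    have u: "integrable lborel u" and g: "integrable lborel g"
      using integrable_inner_left[of e lborel "\<lambda>x. indicator {0<..<T} x *\<^sub>R v x"]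
        integrable_inner_left[of e lborel "\<lambda>x. indicator {0<..<T} x *\<^sub>R q x"] vo
      unfolding u_def[abs_def] g_def[abs_def] set_integrable_def by simp_all
    have weak: "(LINT x|lborel. frechet_derivative \<phi> (at x) 1 * u x) = - (LINT x|lborel. \<phi> x * g x)"
      if \<phi>: "test_function {0<..<T} \<phi>" for \<phi>
    proof -
      have i1: "integrable lborel (\<lambda>x. frechet_derivative \<phi> (at x) 1 *\<^sub>R (indicator {0<..<T} x *\<^sub>R q x))"
        "integrable lborel (\<lambda>x. \<phi> x *\<^sub>R (indicator {0<..<T} x *\<^sub>R v x))"
        using test_function_times_integrable(2)[OF \<phi> vo(2)[unfolded set_integrable_def], of 1]
          test_function_times_integrable(1)[OF \<phi> vo(1)[unfolded set_integrable_def]] by blast+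
      have "(LINT x|lborel. frechet_derivative \<phi> (at x) 1 * u x) = (LINT x:{0<..<T}|lborel. frechet_derivative \<phi> (at x) 1 *\<^sub>R q x) \<bullet> e"
        using integral_inner_left[of e lborel "\<lambda>x. frechet_derivative \<phi> (at x) 1 *\<^sub>R (indicator {0<..<T} x *\<^sub>R q x)"] i1(1)
        by (simp add: u_def set_lebesgue_integral_def ac_simps)
      also have "\<dots> = - ((LINT x:{0<..<T}|lborel. \<phi> x *\<^sub>R v x) \<bullet> e)"
        using time_deriv_L2_weak(2)[OF q] \<phi> by (simp add: weak_partial_def v_def)
      also have "(LINT x:{0<..<T}|lborel. \<phi> x *\<^sub>R v x) \<bullet> e = (LINT x|lborel. \<phi> x * g x)"
        using integral_inner_left[of e lborel "\<lambda>x. \<phi> x *\<^sub>R (indicator {0<..<T} x *\<^sub>R v x)"] i1(2)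
        by (simp add: g_def set_lebesgue_integral_def ac_simps)
      finally show ?thesis .
    qed
    have "AE x in lborel. x \<in> {0<..<T - a} \<longrightarrow> u (x + a *\<^sub>R 1) - u x = (LINT \<tau>:{0..a}|lborel. g (x + \<tau> *\<^sub>R 1))"
      by (rule weak_derivative_on_segments[OF u g weak]) (use a in auto)
    then have ae: "AE x in lborel. x \<in> {0<..<T - a} \<longrightarrow> (q (x + a) - I (x + a) - (q x - I x)) \<bullet> e = 0"
    proof eventually_elim
      case (elim x)
      show ?case
      proof
        assume x: "x \<in> {0<..<T - a}"
        have "(LINT \<tau>:{0..a}|lborel. g (x + \<tau> *\<^sub>R 1)) = (LINT \<tau>|lborel. indicator {x..x + a} (\<tau> + x) * g (\<tau> + x))"
          unfolding set_lebesgue_integral_def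
          by (intro Bochner_Integration.integral_cong refl) (simp add: indicator_def add.commute)
        also have "\<dots> = (LINT \<tau>|lborel. indicator {x..x + a} \<tau> * g \<tau>)"
          by (rule integral_lborel_translate(1)[of "\<lambda>\<tau>. indicator {x..x + a} \<tau> * g \<tau>" x])
        also have "\<dots> = (LINT \<tau>|lborel. (indicator {x..x + a} \<tau> *\<^sub>R v \<tau>) \<bullet> e)"
          using x a by (intro Bochner_Integration.integral_cong refl) (auto simp: indicator_def g_def)
        also have "\<dots> = (LINT \<tau>:{x..x + a}|lborel. v \<tau>) \<bullet> e"
          unfolding set_lebesgue_integral_def
          by (rule integral_inner_left) (use sub[of x "x + a"] x a in \<open>simp add: set_integrable_def\<close>)
        also have "(LINT \<tau>:{x..x + a}|lborel. v \<tau>) = I (x + a) - I x"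
          unfolding I_def using set_integral_Icc_combine[OF sub, of 0 "x + a" x] x a by simp
        finally show "(q (x + a) - I (x + a) - (q x - I x)) \<bullet> e = 0"
          using elim x a by (auto simp: u_def inner_diff_left)
      qed
    qed
    \<comment> \<open>Continuity of q and I extends the identity to the starting point x = 0, where
      it is the fundamental theorem on the interval from 0 to a.\<close>
    have "(q (0 + a) - I (0 + a) - (q 0 - I 0)) \<bullet> e = 0"
    proof (rule AE_zero_imp_zero_on_closed_interval[OF _ _ ae])
      show "continuous_on {0..T - a} (\<lambda>x. (q (x + a) - I (x + a) - (q x - I x)) \<bullet> e)"
        using a by (intro continuous_intros continuous_on_compose2[OF qc] continuous_on_compose2[OF Ic]
            continuous_on_subset[OF qc] continuous_on_subset[OF Ic]) auto
    qed (use a in auto)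
    then show ?thesis by (simp add: I0 diff_right_commute)
  qed
  \<comment> \<open>A second use of continuity, now in a, includes the end time a = T.\<close>
  have "(q a - I a - q 0) \<bullet> e = 0" if a: "a \<in> {0..T}" for a e
    by (rule AE_zero_imp_zero_on_closed_interval[of 0 T "\<lambda>a. (q a - I a - q 0) \<bullet> e", OF T _ _ a])
      (use main in \<open>auto intro!: continuous_intros qc Ic AE_I2\<close>)
  then have "q a - I a - q 0 = 0" if "a \<in> {0..T}" for a
    using that inner_eq_zero_iff by blast
  from this[of t] this[of s] have "q t = I t + q 0" "q s = I s + q 0"
    using st by (simp_all add: algebra_simps)
  then have "q t - q s = I t - I s" by simp
  also have "\<dots> = (LINT \<tau>:{s..t}|lborel. v \<tau>)"
    unfolding I_def using set_integral_Icc_combine[OF sub, of 0 t s] st by simp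
  finally show ?thesis unfolding v_def .
qed

text \<open>Since |q(t)| \<le> |q(s)| plus the integral of the norm of the time derivative,
  averaging over s leaves two integrals of norms. Each is at most T + M^2 by r \<le> 1 + r^2. The
  bound depends on T and M alone, which is what makes the final constant uniform in q1 and
  q2.\<close>

lemma H1_time_sup_bound:
  fixes q :: "real \<Rightarrow> 'b::{real_inner, banach, second_countable_topology}"
  assumes q: "q \<in> H1_time T X" and T: "T > 0" and M: "norm_H1_time T X q \<le> M" and t: "t \<in> {0..T}"
  shows "norm (q t) \<le> (T + M\<^sup>2) / T + (T + M\<^sup>2)"
proof -
  define v where "v = time_deriv T X q"
  have L: "L2_time T X q" "L2_time T X v" using q time_deriv_L2_weak(1)[OF q] by (auto simp: H1_time_def v_def)
  have nn: "0 \<le> (LINT t:{0..T}|lborel. (norm (f t))\<^sup>2)" for f :: "real \<Rightarrow> 'b"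
    unfolding set_lebesgue_integral_def by (intro Bochner_Integration.integral_nonneg) simp
  have "(LINT t:{0..T}|lborel. (norm (q t))\<^sup>2) + (LINT t:{0..T}|lborel. (norm (v t))\<^sup>2) = (norm_H1_time T X q)\<^sup>2"
    unfolding norm_H1_time_def v_def[symmetric]
    using L2_time_integrable(1)[OF L(1)] L2_time_integrable(1)[OF L(2)] nn[of q] nn[of v]
    by (simp add: set_integral_open_interval(2))
  also have "\<dots> \<le> M\<^sup>2"
  proof (rule power_mono[OF M])
    show "0 \<le> norm_H1_time T X q"
      unfolding norm_H1_time_def set_lebesgue_integral_def
      by (intro real_sqrt_ge_zero add_nonneg_nonneg Bochner_Integration.integral_nonneg) simp_all
  qed
  finally have M2: "(LINT t:{0..T}|lborel. (norm (q t))\<^sup>2) \<le> M\<^sup>2" "(LINT t:{0..T}|lborel. (norm (v t))\<^sup>2) \<le> M\<^sup>2"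
    using nn[of q] nn[of v] by linarith+
  have L1: "(LINT t:{0..T}|lborel. norm (f t)) \<le> T + M\<^sup>2"
    if f: "L2_time T X f" "(LINT t:{0..T}|lborel. (norm (f t))\<^sup>2) \<le> M\<^sup>2" for f
  proof -
    have c: "set_integrable lborel {0..T} (\<lambda>t. 1 :: real)"
      by (simp add: set_integrable_def integrable_indicator_iff emeasure_lborel_Icc_eq)
    have "(LINT t:{0..T}|lborel. norm (f t)) \<le> (LINT t:{0..T}|lborel. 1 + (norm (f t))\<^sup>2)"
    proof (rule set_integral_mono)
      show "norm (f t) \<le> 1 + (norm (f t))\<^sup>2" for t
        using sum_squares_bound[of 1 "norm (f t)"] norm_ge_zero[of "f t"] by (simp del: norm_ge_zero)
    qed (use L2_time_integrable[OF f(1)] c in \<open>auto intro!: set_integrable_norm set_integral_add(1)\<close>)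
    also have "\<dots> = T + (LINT t:{0..T}|lborel. (norm (f t))\<^sup>2)"
      using L2_time_integrable(1)[OF f(1)] c T by (subst set_integral_add(2)) (auto simp: set_lebesgue_integral_def)
    finally show ?thesis using f(2) by linarith
  qed
  define J where "J = (LINT t:{0..T}|lborel. norm (v t))"
  have vi: "set_integrable lborel {0..T} v" by (rule L2_time_integrable(2)[OF L(2)])
  have mono: "(LINT \<tau>:{a..b}|lborel. norm (v \<tau>)) \<le> J" if "0 \<le> a" "b \<le> T" for a b
    unfolding J_def set_lebesgue_integral_def
    using that set_integrable_norm[OF vi] set_integrable_subset[OF set_integrable_norm[OF vi], of "{a..b}"]
    by (intro integral_mono) (auto simp: set_integrable_def indicator_def)
  have diff: "norm (q t) \<le> norm (q s) + J" if s: "s \<in> {0..T}" for s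
  proof -
    have vst: "norm (q b - q a) \<le> J" if ab: "0 \<le> a" "a \<le> b" "b \<le> T" for a b
    proof -
      have "norm (q b - q a) \<le> (LINT \<tau>:{a..b}|lborel. norm (v \<tau>))"
        unfolding H1_time_ftc[OF q T ab] v_def[symmetric]
        using ab by (intro set_integral_norm_le set_integrable_subset[OF vi]) auto
      also have "\<dots> \<le> J" using mono ab by simp
      finally show ?thesis .
    qed
    have "norm (q t - q s) \<le> J"
      using vst[of s t] vst[of t s] s t by (cases "s \<le> t") (auto simp: norm_minus_commute)
    then show ?thesis using norm_triangle_ineq2[of "q t" "q s"] by linarith
  qed
  have qi: "set_integrable lborel {0..T} (\<lambda>t. norm (q t))" by (rule set_integrable_norm[OF L2_time_integrable(2)[OF L(1)]])
  have cc: "set_integrable lborel {0..T} (\<lambda>t. c :: real)" for c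
    by (simp add: set_integrable_def integrable_indicator_iff emeasure_lborel_Icc_eq)
  have "T * norm (q t) = (LINT s:{0..T}|lborel. norm (q t))" using T by (simp add: set_lebesgue_integral_def)
  also have "\<dots> \<le> (LINT s:{0..T}|lborel. norm (q s) + J)"
    using diff qi cc by (intro set_integral_mono set_integral_add(1)) auto
  also have "\<dots> = (LINT s:{0..T}|lborel. norm (q s)) + T * J"
    using qi cc T by (subst set_integral_add(2)) (auto simp: set_lebesgue_integral_def)
  also have "\<dots> \<le> (T + M\<^sup>2) + T * (T + M\<^sup>2)"
    using L1[OF L(1) M2(1)] L1[OF L(2) M2(2)] T unfolding J_def by (intro add_mono mult_left_mono) auto
  finally have "norm (q t) \<le> ((T + M\<^sup>2) + T * (T + M\<^sup>2)) / T" using T by (simp add: field_simps)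
  then show ?thesis using T by (simp add: add_divide_distrib)
qed

section \<open>Estimates for the nonlinearity and for sixth powers\<close>

lemma deriv_le_lipschitz:
  fixes \<kappa> :: "real \<Rightarrow> real"
  assumes \<kappa>: "L-lipschitz_on UNIV \<kappa>" and D: "(\<kappa> has_real_derivative D) (at x)"
  shows "\<bar>D\<bar> \<le> L"
proof -
  have "((\<lambda>h. \<bar>(\<kappa> (x + h) - \<kappa> x) / h\<bar>) \<longlongrightarrow> \<bar>D\<bar>) (at 0)"
    using D unfolding DERIV_def by (rule tendsto_rabs)
  moreover have "\<forall>\<^sub>F h in at 0. \<bar>(\<kappa> (x + h) - \<kappa> x) / h\<bar> \<le> L"
    unfolding eventually_at_filter
  proof (intro always_eventually allI impI)
    fix h :: real assume "h \<noteq> 0"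
    then show "\<bar>(\<kappa> (x + h) - \<kappa> x) / h\<bar> \<le> L"
      using lipschitz_onD[OF \<kappa>, of "x + h" x] by (simp add: dist_real_def abs_divide divide_le_eq)
  qed
  ultimately show ?thesis by (rule tendsto_upperbound) simp
qed

text \<open>The segment lemma bounds increments of \<kappa>' only for almost every starting point.
  The bound is carried to every point by writing difference quotients of \<kappa> as averages of
  \<kappa>', where null sets do not count, and letting the averaging length tend to 0.\<close>

lemma deriv_difference_bound:
  fixes \<kappa> \<kappa>'' :: "real \<Rightarrow> real"
  assumes d: "\<kappa> differentiable_on UNIV" and W: "has_W11_derivative (deriv \<kappa>) \<kappa>''"
    and growth: "AE y in lborel. \<bar>\<kappa>'' y\<bar> \<le> c1 * \<bar>y\<bar> powr \<rho> + c0"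
    and c: "c1 \<ge> 0" "c0 \<ge> 0" "\<rho> > 0"
  shows "\<bar>deriv \<kappa> x - deriv \<kappa> y\<bar> \<le> \<bar>x - y\<bar> * (c1 * (\<bar>x\<bar> + \<bar>y\<bar>) powr \<rho> + c0)"
proof -
  have D: "(\<kappa> has_real_derivative deriv \<kappa> z) (at z)" for z
    using d by (simp add: differentiable_on_def DERIV_deriv_iff_real_differentiable)
  have i': "integrable lborel (deriv \<kappa>)" and i'': "integrable lborel \<kappa>''" and w: "weak_partial UNIV 1 (deriv \<kappa>) \<kappa>''"
    using W by (auto simp: has_W11_derivative_def)
  have [measurable]: "\<kappa>'' \<in> borel_measurable borel" "deriv \<kappa> \<in> borel_measurable borel" using i' i'' by auto
  \<comment> \<open>On the segment from z to z + s the modulus of the argument is at most |z| + |z +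
    s|, so G bounds \<kappa>'' there almost everywhere.\<close>
  define G where "G z s = c1 * (\<bar>z\<bar> + \<bar>z + s\<bar>) powr \<rho> + c0" for z s
  have ae: "AE z in lborel. \<bar>deriv \<kappa> (z + s) - deriv \<kappa> z\<bar> \<le> s * G z s" if s: "s \<ge> 0" for s
  proof -
    have weak: "(LINT x|lborel. frechet_derivative \<phi> (at x) 1 * deriv \<kappa> x) = - (LINT x|lborel. \<phi> x * \<kappa>'' x)"
      if "test_function UNIV \<phi>" for \<phi>
      using w that by (simp add: weak_partial_def set_lebesgue_integral_def)
    have "AE z in lborel. z \<in> UNIV \<longrightarrow> deriv \<kappa> (z + s *\<^sub>R 1) - deriv \<kappa> z = (LINT \<tau>:{0..s}|lborel. \<kappa>'' (z + \<tau> *\<^sub>R 1))"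
      by (rule weak_derivative_on_segments[OF i' i'' weak]) (use s in auto)
    then show ?thesis
    proof eventually_elim
      case (elim z)
      have gz: "AE \<tau> in lborel. \<bar>\<kappa>'' (z + \<tau>)\<bar> \<le> c1 * \<bar>z + \<tau>\<bar> powr \<rho> + c0"
      proof -
        have "AE y in distr lborel borel ((+) z). \<bar>\<kappa>'' y\<bar> \<le> c1 * \<bar>y\<bar> powr \<rho> + c0"
          unfolding lborel_distr_plus by (rule growth)
        then show ?thesis by (subst (asm) AE_distr_iff) auto
      qed
      have "integrable lborel (\<lambda>\<tau>. \<kappa>'' (z + \<tau>))"
        using integral_lborel_translate(2)[of \<kappa>'' z] i'' by (simp add: add.commute)
      then have i: "set_integrable lborel {0..s} (\<lambda>\<tau>. \<kappa>'' (z + \<tau>))"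
        unfolding set_integrable_def by (intro integrable_mult_indicator) auto
      have ic: "set_integrable lborel {0..s} (\<lambda>\<tau>. G z s)"
        by (simp add: set_integrable_def integrable_indicator_iff emeasure_lborel_Icc_eq)
      have "\<bar>deriv \<kappa> (z + s) - deriv \<kappa> z\<bar> \<le> (LINT \<tau>:{0..s}|lborel. \<bar>\<kappa>'' (z + \<tau>)\<bar>)"
        using elim set_integral_norm_le[OF i] by simp
      also have "\<dots> \<le> (LINT \<tau>:{0..s}|lborel. G z s)"
        unfolding set_lebesgue_integral_def
      proof (rule integral_mono_AE)
        show "AE \<tau> in lborel. indicator {0..s} \<tau> *\<^sub>R \<bar>\<kappa>'' (z + \<tau>)\<bar> \<le> indicator {0..s} \<tau> *\<^sub>R G z s"
          using gz
        proof eventually_elim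
          case (elim \<tau>)
          have "\<bar>\<kappa>'' (z + \<tau>)\<bar> \<le> G z s" if "\<tau> \<in> {0..s}"
          proof -
            have "\<bar>z + \<tau>\<bar> \<le> \<bar>z\<bar> + \<bar>z + s\<bar>" using that by auto
            then have "\<bar>z + \<tau>\<bar> powr \<rho> \<le> (\<bar>z\<bar> + \<bar>z + s\<bar>) powr \<rho>" using c by (intro powr_mono2) auto
            then have "c1 * \<bar>z + \<tau>\<bar> powr \<rho> \<le> c1 * (\<bar>z\<bar> + \<bar>z + s\<bar>) powr \<rho>" using c by (intro mult_left_mono)
            then show ?thesis using elim unfolding G_def by linarith
          qed
          then show ?case by (simp add: indicator_def)
        qed
      qed (use set_integrable_abs[OF i] ic in \<open>simp_all add: set_integrable_def\<close>)
      also have "\<dots> = s * G z s" using s by (simp add: set_lebesgue_integral_def)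
      finally show ?case .
    qed
  qed
  have main: "\<bar>deriv \<kappa> (z + s) - deriv \<kappa> z\<bar> \<le> s * G z s" if s: "s \<ge> 0" for z s
  proof -
    have ftc: "\<kappa> (a + h) - \<kappa> a = (LINT \<tau>:{a..a + h}|lborel. deriv \<kappa> \<tau>)" if h: "h \<ge> 0" for a h
    proof -
      have "(deriv \<kappa> has_integral (\<kappa> (a + h) - \<kappa> a)) {a..a + h}"
        using h D by (intro fundamental_theorem_of_calculus)
          (auto simp: has_real_derivative_iff_has_vector_derivative[symmetric] intro: has_field_derivative_at_within)
      moreover have "set_integrable lborel {a..a + h} (deriv \<kappa>)"
        unfolding set_integrable_def using i' by (intro integrable_mult_indicator) auto
      ultimately show ?thesis
        by (simp add: set_borel_integral_eq_integral(2) integral_unique)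
    qed
    \<comment> \<open>The increment over s of the difference quotient with step h. It equals the
      average of \<kappa>'(\<tau> + s) - \<kappa>'(\<tau>) over \<tau> within distance h of z, which
      explains the additional 2 h in the bound.\<close>
    define Q where "Q h = ((\<kappa> (z + s + h) - \<kappa> (z + s)) / h - (\<kappa> (z + h) - \<kappa> z) / h)" for h
    have lim: "(Q \<longlongrightarrow> deriv \<kappa> (z + s) - deriv \<kappa> z) (at_right 0)"
    proof -
      have "((\<lambda>h. (\<kappa> (w + h) - \<kappa> w) / h) \<longlongrightarrow> deriv \<kappa> w) (at_right 0)" for w
        by (rule tendsto_mono[OF at_le[OF subset_UNIV]]) (use D[of w] in \<open>simp add: DERIV_def\<close>)
      then show ?thesis unfolding Q_def by (intro tendsto_diff)
    qed
    have "\<bar>Q h\<bar> \<le> s * (c1 * (\<bar>z\<bar> + \<bar>z + s\<bar> + 2 * h) powr \<rho> + c0)" if h: "h > 0" for h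
    proof -
      let ?B = "s * (c1 * (\<bar>z\<bar> + \<bar>z + s\<bar> + 2 * h) powr \<rho> + c0)"
      have si: "set_integrable lborel {z..z + h} (\<lambda>\<tau>. deriv \<kappa> (\<tau> + s))" "set_integrable lborel {z..z + h} (deriv \<kappa>)"
        unfolding set_integrable_def using i' integral_lborel_translate(2)[of "deriv \<kappa>" s]
        by (intro integrable_mult_indicator; auto)+
      have "\<kappa> (z + s + h) - \<kappa> (z + s) = (LINT \<tau>:{z..z + h}|lborel. deriv \<kappa> (\<tau> + s))"
      proof -
        have "(LINT \<tau>:{z + s..z + s + h}|lborel. deriv \<kappa> \<tau>) = (LINT \<tau>|lborel. indicator {z + s..z + s + h} (\<tau> + s) *\<^sub>R deriv \<kappa> (\<tau> + s))"
          unfolding set_lebesgue_integral_def by (rule integral_lborel_translate(1)[symmetric])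
        also have "\<dots> = (LINT \<tau>:{z..z + h}|lborel. deriv \<kappa> (\<tau> + s))"
          unfolding set_lebesgue_integral_def
          by (intro Bochner_Integration.integral_cong refl) (auto simp: indicator_def)
        finally show ?thesis using ftc[of h "z + s"] h by simp
      qed
      moreover have "\<kappa> (z + h) - \<kappa> z = (LINT \<tau>:{z..z + h}|lborel. deriv \<kappa> \<tau>)" using ftc h by simp
      ultimately have "h * Q h = (LINT \<tau>:{z..z + h}|lborel. deriv \<kappa> (\<tau> + s) - deriv \<kappa> \<tau>)"
        using h si by (simp add: Q_def set_integral_diff(2) field_simps)
      then have "\<bar>h * Q h\<bar> \<le> (LINT \<tau>:{z..z + h}|lborel. \<bar>deriv \<kappa> (\<tau> + s) - deriv \<kappa> \<tau>\<bar>)"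
        using set_integral_norm_le[OF set_integral_diff(1)[OF si]] by simp
      also have "\<dots> \<le> (LINT \<tau>:{z..z + h}|lborel. ?B)"
        unfolding set_lebesgue_integral_def
      proof (rule integral_mono_AE)
        show "AE \<tau> in lborel. indicator {z..z + h} \<tau> *\<^sub>R \<bar>deriv \<kappa> (\<tau> + s) - deriv \<kappa> \<tau>\<bar> \<le> indicator {z..z + h} \<tau> *\<^sub>R ?B"
          using ae[OF s]
        proof eventually_elim
          case (elim \<tau>)
          have "s * G \<tau> s \<le> ?B" if "\<tau> \<in> {z..z + h}"
          proof -
            have "\<bar>\<tau>\<bar> + \<bar>\<tau> + s\<bar> \<le> \<bar>z\<bar> + \<bar>z + s\<bar> + 2 * h" using that by auto
            then have "(\<bar>\<tau>\<bar> + \<bar>\<tau> + s\<bar>) powr \<rho> \<le> (\<bar>z\<bar> + \<bar>z + s\<bar> + 2 * h) powr \<rho>"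
              using c by (intro powr_mono2) auto
            then have "G \<tau> s \<le> c1 * (\<bar>z\<bar> + \<bar>z + s\<bar> + 2 * h) powr \<rho> + c0"
              unfolding G_def using c by (simp add: mult_left_mono)
            then show ?thesis using s by (rule mult_left_mono)
          qed
          then show ?case using elim by (auto simp: indicator_def)
        qed
      qed (use set_integrable_abs[OF set_integral_diff(1)[OF si]] in
          \<open>simp_all add: set_integrable_def integrable_indicator_iff emeasure_lborel_Icc_eq\<close>)
      also have "\<dots> = h * ?B" using h by (simp add: set_lebesgue_integral_def)
      finally show ?thesis using h by (simp add: abs_mult)
    qed
    then have ev: "\<forall>\<^sub>F h in at_right 0. \<bar>Q h\<bar> \<le> s * (c1 * (\<bar>z\<bar> + \<bar>z + s\<bar> + 2 * h) powr \<rho> + c0)"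
      by (simp add: eventually_at_filter)
    have "((\<lambda>h. s * (c1 * (\<bar>z\<bar> + \<bar>z + s\<bar> + 2 * h) powr \<rho> + c0)) \<longlongrightarrow>
        s * (c1 * (\<bar>z\<bar> + \<bar>z + s\<bar> + 2 * 0) powr \<rho> + c0)) (at_right 0)"
    proof (intro tendsto_mult tendsto_add tendsto_const)
      show "((\<lambda>h. (\<bar>z\<bar> + \<bar>z + s\<bar> + 2 * h) powr \<rho>) \<longlongrightarrow> (\<bar>z\<bar> + \<bar>z + s\<bar> + 2 * 0) powr \<rho>) (at_right 0)"
        using c by (intro tendsto_powr' tendsto_intros) (auto simp: eventually_at_filter intro!: always_eventually)
    qed
    from tendsto_le[OF _ this tendsto_rabs[OF lim] ev] show ?thesis by (simp add: G_def)
  qed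
  show ?thesis
  proof (cases "x \<le> y")
    case True
    then have "\<bar>deriv \<kappa> y - deriv \<kappa> x\<bar> \<le> (y - x) * G x (y - x)" using main[of "y - x" x] by simp
    then show ?thesis using True unfolding G_def abs_minus_commute[of "deriv \<kappa> x"] by simp
  next
    case False
    then have "\<bar>deriv \<kappa> x - deriv \<kappa> y\<bar> \<le> (x - y) * G y (x - y)" using main[of "x - y" y] by simp
    then show ?thesis using False unfolding G_def add.commute[of "\<bar>x\<bar>" "\<bar>y\<bar>"] by simp
  qed
qed

text \<open>The mean value theorem is applied to the difference of \<kappa> along both segments, so
  one parameter \<theta> serves both. With p and q the points at this parameter, the second
  difference splits into \<kappa>'(p) times the difference of the increments and (\<kappa>'(p) -
  \<kappa>'(q)) times one increment.\<close>

lemma second_difference_bound: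
  fixes \<kappa> \<kappa>'' :: "real \<Rightarrow> real"
  assumes lip: "L-lipschitz_on UNIV \<kappa>"
    and d: "\<kappa> differentiable_on UNIV" and W: "has_W11_derivative (deriv \<kappa>) \<kappa>''"
    and growth: "AE y in lborel. \<bar>\<kappa>'' y\<bar> \<le> c1 * \<bar>y\<bar> powr \<rho> + c0"
    and c: "c1 \<ge> 0" "c0 \<ge> 0" "\<rho> > 0"
  shows "\<bar>\<kappa> b' - \<kappa> b - \<kappa> a' + \<kappa> a\<bar> \<le> L * \<bar>(b' - b) - (a' - a)\<bar>
    + \<bar>a' - a\<bar> * (\<bar>b - a\<bar> + \<bar>b' - a'\<bar>) * (c1 * (\<bar>a\<bar> + \<bar>a'\<bar> + \<bar>b\<bar> + \<bar>b'\<bar>) powr \<rho> + c0)"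
proof -
  have D: "(\<kappa> has_real_derivative deriv \<kappa> z) (at z)" for z
    using d by (simp add: differentiable_on_def DERIV_deriv_iff_real_differentiable)
  have "((\<lambda>\<theta>. \<kappa> (b + \<theta> * (b' - b)) - \<kappa> (a + \<theta> * (a' - a))) has_real_derivative
      deriv \<kappa> (b + \<theta> * (b' - b)) * (b' - b) - deriv \<kappa> (a + \<theta> * (a' - a)) * (a' - a)) (at \<theta>)" for \<theta>
    by (auto intro!: derivative_eq_intros DERIV_chain2[OF D])
  from MVT2[OF zero_less_one this] obtain \<theta> where \<theta>: "0 < \<theta>" "\<theta> < 1"
    and eq: "\<kappa> b' - \<kappa> a' - (\<kappa> b - \<kappa> a) = deriv \<kappa> (b + \<theta> * (b' - b)) * (b' - b) - deriv \<kappa> (a + \<theta> * (a' - a)) * (a' - a)"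
    by auto
  define p where "p = b + \<theta> * (b' - b)"
  define q where "q = a + \<theta> * (a' - a)"
  have conv: "\<bar>x + \<theta> * (y - x)\<bar> \<le> \<bar>x\<bar> + \<bar>y\<bar>" for x y
  proof -
    have "x + \<theta> * (y - x) = (1 - \<theta>) * x + \<theta> * y" by (simp add: algebra_simps)
    also have "\<bar>\<dots>\<bar> \<le> (1 - \<theta>) * \<bar>x\<bar> + \<theta> * \<bar>y\<bar>"
      using \<theta> abs_triangle_ineq[of "(1 - \<theta>) * x" "\<theta> * y"] by (simp add: abs_mult)
    also have "\<dots> \<le> 1 * \<bar>x\<bar> + 1 * \<bar>y\<bar>" using \<theta> by (intro add_mono mult_right_mono) auto
    finally show ?thesis by simp
  qed
  \<comment> \<open>With a common \<theta> the difference p - q is a convex combination of b - a and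
    b' - a'; separate parameters would leave an error not controlled by these.\<close>
  have pq: "\<bar>p - q\<bar> \<le> \<bar>b - a\<bar> + \<bar>b' - a'\<bar>"
    using conv[of "b - a" "b' - a'"] by (simp add: p_def q_def algebra_simps)
  have "\<kappa> b' - \<kappa> b - \<kappa> a' + \<kappa> a = deriv \<kappa> p * ((b' - b) - (a' - a)) + (deriv \<kappa> p - deriv \<kappa> q) * (a' - a)"
    using eq unfolding p_def[symmetric] q_def[symmetric] by (simp add: algebra_simps)
  then have "\<bar>\<kappa> b' - \<kappa> b - \<kappa> a' + \<kappa> a\<bar> \<le> \<bar>deriv \<kappa> p\<bar> * \<bar>(b' - b) - (a' - a)\<bar> + \<bar>deriv \<kappa> p - deriv \<kappa> q\<bar> * \<bar>a' - a\<bar>"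
    using abs_triangle_ineq[of "deriv \<kappa> p * ((b' - b) - (a' - a))" "(deriv \<kappa> p - deriv \<kappa> q) * (a' - a)"]
    by (simp only: abs_mult)
  also have "\<dots> \<le> L * \<bar>(b' - b) - (a' - a)\<bar>
      + (\<bar>b - a\<bar> + \<bar>b' - a'\<bar>) * (c1 * (\<bar>a\<bar> + \<bar>a'\<bar> + \<bar>b\<bar> + \<bar>b'\<bar>) powr \<rho> + c0) * \<bar>a' - a\<bar>"
  proof (intro add_mono mult_right_mono)
    show "\<bar>deriv \<kappa> p\<bar> \<le> L" by (rule deriv_le_lipschitz[OF lip D])
    have "\<bar>deriv \<kappa> p - deriv \<kappa> q\<bar> \<le> \<bar>p - q\<bar> * (c1 * (\<bar>p\<bar> + \<bar>q\<bar>) powr \<rho> + c0)"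
      by (rule deriv_difference_bound[OF d W growth c])
    also have "\<dots> \<le> (\<bar>b - a\<bar> + \<bar>b' - a'\<bar>) * (c1 * (\<bar>a\<bar> + \<bar>a'\<bar> + \<bar>b\<bar> + \<bar>b'\<bar>) powr \<rho> + c0)"
    proof (rule mult_mono[OF pq])
      have "\<bar>p\<bar> + \<bar>q\<bar> \<le> \<bar>a\<bar> + \<bar>a'\<bar> + \<bar>b\<bar> + \<bar>b'\<bar>"
        using conv[of b b'] conv[of a a'] unfolding p_def q_def by linarith
      then have "(\<bar>p\<bar> + \<bar>q\<bar>) powr \<rho> \<le> (\<bar>a\<bar> + \<bar>a'\<bar> + \<bar>b\<bar> + \<bar>b'\<bar>) powr \<rho>"
        using c by (intro powr_mono2) auto
      from mult_left_mono[OF this c(1)]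
      show "c1 * (\<bar>p\<bar> + \<bar>q\<bar>) powr \<rho> + c0 \<le> c1 * (\<bar>a\<bar> + \<bar>a'\<bar> + \<bar>b\<bar> + \<bar>b'\<bar>) powr \<rho> + c0" by simp
    qed (use c in auto)
    finally show "\<bar>deriv \<kappa> p - deriv \<kappa> q\<bar> \<le> (\<bar>b - a\<bar> + \<bar>b' - a'\<bar>) * (c1 * (\<bar>a\<bar> + \<bar>a'\<bar> + \<bar>b\<bar> + \<bar>b'\<bar>) powr \<rho> + c0)" .
  qed auto
  finally show ?thesis by (simp add: ac_simps)
qed

text \<open>After division by the bounds, the product of the squares is at most the mean of the
  sixth powers by the arithmetic-geometric mean inequality. The bounds are enlarged by e > 0 to make
  the division safe, and e then tends to 0.\<close>

lemma nn_integral_Hoelder_3: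
  fixes f g h :: "'a \<Rightarrow> real"
  assumes [measurable]: "f \<in> borel_measurable M" "g \<in> borel_measurable M" "h \<in> borel_measurable M"
    and f: "(\<integral>\<^sup>+x. ennreal (f x ^ 6) \<partial>M) \<le> ennreal (p ^ 6)"
    and g: "(\<integral>\<^sup>+x. ennreal (g x ^ 6) \<partial>M) \<le> ennreal (q ^ 6)"
    and h: "(\<integral>\<^sup>+x. ennreal (h x ^ 6) \<partial>M) \<le> ennreal (r ^ 6)"
    and pqr: "p \<ge> 0" "q \<ge> 0" "r \<ge> 0"
  shows "(\<integral>\<^sup>+x. ennreal ((f x * g x * h x)\<^sup>2) \<partial>M) \<le> ennreal ((p * q * r)\<^sup>2)"
proof -
  have amgm: "a * b * c \<le> (a ^ 3 + b ^ 3 + c ^ 3) / 3" if "a \<ge> 0" "b \<ge> 0" "c \<ge> 0" for a b c :: real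
  proof -
    have "0 \<le> (a + b + c) * ((a - b)\<^sup>2 + (b - c)\<^sup>2 + (c - a)\<^sup>2)" using that by simp
    also have "\<dots> = 2 * (a ^ 3 + b ^ 3 + c ^ 3 - 3 * (a * b * c))"
      by (simp add: power2_eq_square power3_eq_cube algebra_simps)
    finally show ?thesis by simp
  qed
  have eps: "(\<integral>\<^sup>+x. ennreal ((f x * g x * h x)\<^sup>2) \<partial>M) \<le> ennreal (((p + e) * (q + e) * (r + e))\<^sup>2)" if e: "e > 0" for e
  proof -
    define P Q R where "P = p + e" and "Q = q + e" and "R = r + e"
    have pos: "P > 0" "Q > 0" "R > 0" using pqr e by (auto simp: P_def Q_def R_def)
    let ?c = "(P * Q * R)\<^sup>2 / 3"
    have pw: "(f x * g x * h x)\<^sup>2 \<le> ?c * (f x ^ 6 / P ^ 6 + g x ^ 6 / Q ^ 6 + h x ^ 6 / R ^ 6)" for x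
    proof -
      have "(f x / P)\<^sup>2 * (g x / Q)\<^sup>2 * (h x / R)\<^sup>2 \<le> (((f x / P)\<^sup>2) ^ 3 + ((g x / Q)\<^sup>2) ^ 3 + ((h x / R)\<^sup>2) ^ 3) / 3"
        by (rule amgm) auto
      then have "(P * Q * R)\<^sup>2 * ((f x / P)\<^sup>2 * (g x / Q)\<^sup>2 * (h x / R)\<^sup>2) \<le> (P * Q * R)\<^sup>2 * ((((f x / P)\<^sup>2) ^ 3 + ((g x / Q)\<^sup>2) ^ 3 + ((h x / R)\<^sup>2) ^ 3) / 3)"
        by (rule mult_left_mono) simp
      then show ?thesis using pos by (simp add: power_divide power_mult_distrib power_mult[symmetric])
    qed
    have "(\<integral>\<^sup>+x. ennreal ((f x * g x * h x)\<^sup>2) \<partial>M) \<le>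
      (\<integral>\<^sup>+x. ennreal (?c / P ^ 6) * ennreal (f x ^ 6) + ennreal (?c / Q ^ 6) * ennreal (g x ^ 6) + ennreal (?c / R ^ 6) * ennreal (h x ^ 6) \<partial>M)"
    proof (rule nn_integral_mono)
      fix x
      have nn: "0 \<le> y ^ 6" for y :: real by simp
      have "ennreal ((f x * g x * h x)\<^sup>2) \<le> ennreal (?c / P ^ 6 * f x ^ 6 + ?c / Q ^ 6 * g x ^ 6 + ?c / R ^ 6 * h x ^ 6)"
        using pw[of x] by (intro ennreal_leI) (simp add: algebra_simps)
      also have "\<dots> = ennreal (?c / P ^ 6 * f x ^ 6) + ennreal (?c / Q ^ 6 * g x ^ 6) + ennreal (?c / R ^ 6 * h x ^ 6)"
        by (subst ennreal_plus[symmetric]; simp)+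
      finally show "ennreal ((f x * g x * h x)\<^sup>2) \<le> ennreal (?c / P ^ 6) * ennreal (f x ^ 6) + ennreal (?c / Q ^ 6) * ennreal (g x ^ 6) + ennreal (?c / R ^ 6) * ennreal (h x ^ 6)"
        by (simp add: ennreal_mult[symmetric])
    qed
    also have "\<dots> = ennreal (?c / P ^ 6) * (\<integral>\<^sup>+x. ennreal (f x ^ 6) \<partial>M) + ennreal (?c / Q ^ 6) * (\<integral>\<^sup>+x. ennreal (g x ^ 6) \<partial>M) + ennreal (?c / R ^ 6) * (\<integral>\<^sup>+x. ennreal (h x ^ 6) \<partial>M)"
      by (simp add: nn_integral_add nn_integral_cmult)
    also have "\<dots> \<le> ennreal (?c / P ^ 6) * ennreal (P ^ 6) + ennreal (?c / Q ^ 6) * ennreal (Q ^ 6) + ennreal (?c / R ^ 6) * ennreal (R ^ 6)"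
      using pqr e by (intro add_mono mult_left_mono order_trans[OF f] order_trans[OF g] order_trans[OF h] ennreal_leI power_mono)
        (auto simp: P_def Q_def R_def)
    also have "\<dots> = ennreal (?c + ?c + ?c)"
      using pos by (simp add: ennreal_mult[symmetric] ennreal_plus[symmetric] del: ennreal_plus)
    finally show ?thesis by (simp add: P_def Q_def R_def)
  qed
  have "((\<lambda>e. ennreal (((p + e) * (q + e) * (r + e))\<^sup>2)) \<longlongrightarrow> ennreal (((p + 0) * (q + 0) * (r + 0))\<^sup>2)) (at_right 0)"
    by (intro tendsto_ennrealI tendsto_intros)
  then have "(\<integral>\<^sup>+x. ennreal ((f x * g x * h x)\<^sup>2) \<partial>M) \<le> ennreal (((p + 0) * (q + 0) * (r + 0))\<^sup>2)"
    by (rule tendsto_lowerbound) (use eps in \<open>auto simp: eventually_at_filter\<close>)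
  then show ?thesis by simp
qed

text \<open>Convexity of the sixth power with weights P/(P + Q) and Q/(P + Q), applied to f/P and
  g/Q. Enlarging the bounds by e > 0 again covers the case of a zero bound.\<close>

lemma nn_integral_Minkowski_6:
  fixes f g :: "'a \<Rightarrow> real"
  assumes [measurable]: "f \<in> borel_measurable M" "g \<in> borel_measurable M"
    and f: "(\<integral>\<^sup>+x. ennreal (f x ^ 6) \<partial>M) \<le> ennreal (p ^ 6)"
    and g: "(\<integral>\<^sup>+x. ennreal (g x ^ 6) \<partial>M) \<le> ennreal (q ^ 6)"
    and pq: "p \<ge> 0" "q \<ge> 0"
  shows "(\<integral>\<^sup>+x. ennreal ((f x + g x) ^ 6) \<partial>M) \<le> ennreal ((p + q) ^ 6)"
proof -
  have eps: "(\<integral>\<^sup>+x. ennreal ((f x + g x) ^ 6) \<partial>M) \<le> ennreal (((p + e) + (q + e)) ^ 6)" if e: "e > 0" for e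
  proof -
    define P Q where "P = p + e" and "Q = q + e"
    have pos: "P > 0" "Q > 0" using pq e by (auto simp: P_def Q_def)
    let ?S = "P + Q"
    have pw: "(f x + g x) ^ 6 \<le> ?S ^ 5 / P ^ 5 * f x ^ 6 + ?S ^ 5 / Q ^ 5 * g x ^ 6" for x
    proof -
      have "((P / ?S) *\<^sub>R (f x / P) + (Q / ?S) *\<^sub>R (g x / Q)) ^ 6 \<le> (P / ?S) * (f x / P) ^ 6 + (Q / ?S) * (g x / Q) ^ 6"
      proof -
        have "convex_on UNIV (\<lambda>x :: real. x ^ 6)" by (rule convex_power_even) simp
        moreover have "Q / ?S = 1 - P / ?S" using pos by (simp add: field_simps)
        ultimately show ?thesis
          using convex_onD[of UNIV "\<lambda>x :: real. x ^ 6" "Q / ?S" "f x / P" "g x / Q"] pos by simp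
      qed
      moreover have "(P / ?S) *\<^sub>R (f x / P) + (Q / ?S) *\<^sub>R (g x / Q) = (f x + g x) / ?S"
        using pos by (simp add: add_divide_distrib)
      ultimately have "(f x + g x) ^ 6 / ?S ^ 6 \<le> (P / ?S) * (f x / P) ^ 6 + (Q / ?S) * (g x / Q) ^ 6"
        by (simp add: power_divide)
      then have "?S ^ 6 * ((f x + g x) ^ 6 / ?S ^ 6) \<le> ?S ^ 6 * ((P / ?S) * (f x / P) ^ 6 + (Q / ?S) * (g x / Q) ^ 6)"
        using pos by (intro mult_left_mono) auto
      moreover have "?S ^ 6 * ((P / ?S) * (f x / P) ^ 6) = ?S ^ 5 / P ^ 5 * f x ^ 6" "?S ^ 6 * ((Q / ?S) * (g x / Q) ^ 6) = ?S ^ 5 / Q ^ 5 * g x ^ 6"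
        using pos by (simp_all add: power_divide eval_nat_numeral)
      ultimately show ?thesis using pos by (simp add: distrib_left)
    qed
    have "(\<integral>\<^sup>+x. ennreal ((f x + g x) ^ 6) \<partial>M) \<le> (\<integral>\<^sup>+x. ennreal (?S ^ 5 / P ^ 5) * ennreal (f x ^ 6) + ennreal (?S ^ 5 / Q ^ 5) * ennreal (g x ^ 6) \<partial>M)"
    proof (rule nn_integral_mono)
      fix x
      have "ennreal ((f x + g x) ^ 6) \<le> ennreal (?S ^ 5 / P ^ 5 * f x ^ 6 + ?S ^ 5 / Q ^ 5 * g x ^ 6)"
        by (intro ennreal_leI pw)
      also have "\<dots> = ennreal (?S ^ 5 / P ^ 5 * f x ^ 6) + ennreal (?S ^ 5 / Q ^ 5 * g x ^ 6)"
        using pos by (intro ennreal_plus) auto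
      finally show "ennreal ((f x + g x) ^ 6) \<le> ennreal (?S ^ 5 / P ^ 5) * ennreal (f x ^ 6) + ennreal (?S ^ 5 / Q ^ 5) * ennreal (g x ^ 6)"
        using pos by (simp add: ennreal_mult[symmetric])
    qed
    also have "\<dots> = ennreal (?S ^ 5 / P ^ 5) * (\<integral>\<^sup>+x. ennreal (f x ^ 6) \<partial>M) + ennreal (?S ^ 5 / Q ^ 5) * (\<integral>\<^sup>+x. ennreal (g x ^ 6) \<partial>M)"
      by (simp add: nn_integral_add nn_integral_cmult)
    also have "\<dots> \<le> ennreal (?S ^ 5 / P ^ 5) * ennreal (P ^ 6) + ennreal (?S ^ 5 / Q ^ 5) * ennreal (Q ^ 6)"
      using pq e by (intro add_mono mult_left_mono order_trans[OF f] order_trans[OF g] ennreal_leI power_mono)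
        (auto simp: P_def Q_def)
    also have "\<dots> = ennreal (?S ^ 5 * P) + ennreal (?S ^ 5 * Q)"
    proof -
      have "ennreal (?S ^ 5 / Z ^ 5) * ennreal (Z ^ 6) = ennreal (?S ^ 5 * Z)" if "Z > 0" for Z
        using that pos power_Suc2[of Z 5] by (subst ennreal_mult[symmetric]) auto
      then show ?thesis using pos by simp
    qed
    also have "\<dots> = ennreal (?S ^ 5 * P + ?S ^ 5 * Q)"
      using pos by (intro ennreal_plus[symmetric]) auto
    also have "?S ^ 5 * P + ?S ^ 5 * Q = ?S ^ 6"
      using power_Suc2[of ?S 5] by (simp add: distrib_left)
    finally show ?thesis by (simp add: P_def Q_def)
  qed
  have "((\<lambda>e. ennreal (((p + e) + (q + e)) ^ 6)) \<longlongrightarrow> ennreal (((p + 0) + (q + 0)) ^ 6)) (at_right 0)"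
    by (intro tendsto_ennrealI tendsto_intros)
  then have "(\<integral>\<^sup>+x. ennreal ((f x + g x) ^ 6) \<partial>M) \<le> ennreal (((p + 0) + (q + 0)) ^ 6)"
    by (rule tendsto_lowerbound) (use eps in \<open>auto simp: eventually_at_filter\<close>)
  then show ?thesis by simp
qed

lemma Lp_norm_nonneg: "Lp_norm p \<Omega> f \<ge> 0"
  by (simp add: Lp_norm_def)

text \<open>\<open>Lp_norm\<close> rests on the Bochner integral, which is 0 for a non-integrable
  function; the finiteness assumption is what makes it the genuine norm. For even exponents the real
  power of |u| is the plain power of u.\<close>

lemma H1_nn_integral_eq_Lp_norm:
  assumes U: "U \<in> H1 \<Omega>" and m: "m > 0" "even m" and o: "open \<Omega>"
    and fin: "(\<integral>\<^sup>+x. ennreal (h1_fun U x ^ m) \<partial>lborel) < \<infinity>"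
  shows "(\<integral>\<^sup>+x. ennreal (h1_fun U x ^ m) \<partial>lborel) = ennreal (Lp_norm (real m) \<Omega> (h1_fun U) ^ m)"
proof -
  have nn: "0 \<le> h1_fun U x ^ m" for x using m(2) by (rule zero_le_even_power)
  have [measurable]: "\<Omega> \<in> sets borel" using o by simp
  define I where "I = (LINT x|lborel. h1_fun U x ^ m)"
  have i: "integrable lborel (\<lambda>x. h1_fun U x ^ m)"
    using fin nn by (intro integrableI_nonneg) auto
  have "(\<integral>\<^sup>+x. ennreal (h1_fun U x ^ m) \<partial>lborel) = ennreal I"
    unfolding I_def using nn by (intro nn_integral_eq_integral i) auto
  note eqI = this
  have I0: "I \<ge> 0" unfolding I_def using nn by simp
  have "(LINT x:\<Omega>|lborel. \<bar>h1_fun U x\<bar> powr real m) = I"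
    unfolding I_def set_lebesgue_integral_def
  proof (rule integral_cong_AE)
    show "AE x in lborel. indicator \<Omega> x *\<^sub>R \<bar>h1_fun U x\<bar> powr real m = h1_fun U x ^ m"
      using H1_outside[OF U]
    proof eventually_elim
      case (elim x)
      have "\<bar>y\<bar> powr real m = y ^ m" for y :: real
        using m by (cases "y = 0") (auto simp: powr_realpow power_even_abs)
      then show ?case using elim m(1) by (auto simp: indicator_def)
    qed
  qed measurable
  then have "Lp_norm (real m) \<Omega> (h1_fun U) ^ m = (I powr (1 / real m)) ^ m"
    by (simp add: Lp_norm_def)
  also have "\<dots> = I"
    using I0 m(1) by (cases "I = 0") (auto simp: powr_realpow[symmetric] powr_powr)
  finally show ?thesis unfolding eqI by simp
qed

section \<open>The Nemytskii operator\<close>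

lemma AE_h1_fun_linear:
  "AE x in lborel. h1_fun (U + V) x = h1_fun U x + h1_fun V x"
  "AE x in lborel. h1_fun (U - V) x = h1_fun U x - h1_fun V x"
  "AE x in lborel. h1_fun (c *\<^sub>R U) x = c * h1_fun U x"
proof -
  show "AE x in lborel. h1_fun (U + V) x = h1_fun U x + h1_fun V x"
    using rep_plus_L2[of U V] by eventually_elim (simp add: h1_fun_def)
  show "AE x in lborel. h1_fun (U - V) x = h1_fun U x - h1_fun V x"
    using rep_minus_L2[of U V] by eventually_elim (simp add: h1_fun_def)
  show "AE x in lborel. h1_fun (c *\<^sub>R U) x = c * h1_fun U x"
    using rep_scaleR_L2[of c U] by eventually_elim (simp add: h1_fun_def)
qed

section \<open>The L^6 and L^2 norms on H^1(\<Omega>)\<close>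

definition L6_norm :: "'a::euclidean_space set \<Rightarrow> 'a h1 \<Rightarrow> real" where
  "L6_norm \<Omega> U = Lp_norm 6 \<Omega> (h1_fun U)"

definition L2_norm_fun :: "'a::euclidean_space set \<Rightarrow> 'a h1 \<Rightarrow> real" where
  "L2_norm_fun \<Omega> U = Lp_norm 2 \<Omega> (h1_fun U)"

lemma L6_norm_nonneg: "L6_norm \<Omega> U \<ge> 0" and L2_norm_fun_nonneg: "L2_norm_fun \<Omega> U \<ge> 0"
  by (simp_all add: L6_norm_def L2_norm_fun_def Lp_norm_nonneg)

lemma nn_integral_L2_norm_fun:
  assumes "open \<Omega>" "U \<in> H1 \<Omega>"
  shows "(\<integral>\<^sup>+x. ennreal ((h1_fun U x)\<^sup>2) \<partial>lborel) = ennreal ((L2_norm_fun \<Omega> U)\<^sup>2)"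
  using H1_nn_integral_eq_Lp_norm[OF assms(2), of 2] assms(1) le_less_trans[OF h1_norm_bounds(2)[of U] ennreal_less_top]
  by (simp add: L2_norm_fun_def)

lemma ennreal_power_leD:
  assumes "X ^ n \<le> ennreal (p ^ n)" "p \<ge> 0" "n > 0"
  shows "X \<le> ennreal p"
proof (cases X)
  case (real x)
  then have "x ^ n \<le> p ^ n" using assms by (simp add: ennreal_power)
  then have "x \<le> p" using assms by (simp add: power_mono_iff real)
  then show ?thesis using real by (simp add: ennreal_leI)
next
  case top
  then show ?thesis using assms by (simp add: power_eq_top_ennreal top_unique)
qed

lemma nn_integral_pairing_le:
  assumes o: "open \<Omega>" and U: "U \<in> H1 \<Omega>" and V: "V \<in> H1 \<Omega>"
  shows "(\<integral>\<^sup>+x. ennreal \<bar>h1_fun U x\<bar> * ennreal \<bar>h1_fun V x\<bar> \<partial>lborel) \<le> ennreal (L2_norm_fun \<Omega> U * L2_norm_fun \<Omega> V)"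
proof -
  have "(\<integral>\<^sup>+x. ennreal \<bar>h1_fun U x\<bar> * ennreal \<bar>h1_fun V x\<bar> \<partial>lborel)\<^sup>2
      \<le> (\<integral>\<^sup>+x. ennreal ((h1_fun U x)\<^sup>2) \<partial>lborel) * (\<integral>\<^sup>+x. ennreal ((h1_fun V x)\<^sup>2) \<partial>lborel)"
    by (rule nn_integral_Cauchy_Schwarz_le) (auto simp: power_mult_distrib ennreal_power)
  also have "\<dots> = ennreal ((L2_norm_fun \<Omega> U * L2_norm_fun \<Omega> V)\<^sup>2)"
    by (simp add: nn_integral_L2_norm_fun[OF o U] nn_integral_L2_norm_fun[OF o V] ennreal_mult[symmetric] power_mult_distrib)
  finally show ?thesis
    by (rule ennreal_power_leD) (simp_all add: L2_norm_fun_nonneg)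
qed

text \<open>The consequences of the geometry of \<Omega> that the estimates in time rely on: finite
  measure and the embedding into L^6. The estimates below are thereby independent of the dimension;
  higher integrability for the growth factor enters as a separate assumption where it is
  used.\<close>

locale L6_embedding =
  fixes \<Omega> :: "'a::euclidean_space set" and S :: real
  assumes \<Omega>_open: "open \<Omega>" and \<Omega>_bounded: "bounded \<Omega>" and S_nonneg: "S \<ge> 0"
    and embedding: "\<And>U. U \<in> H1 \<Omega> \<Longrightarrow> (\<integral>\<^sup>+x. ennreal (h1_fun U x ^ 6) \<partial>lborel) \<le> ennreal ((S * norm U) ^ 6)"
begin

lemma nn_integral_L6_norm:
  assumes "U \<in> H1 \<Omega>"
  shows "(\<integral>\<^sup>+x. ennreal (h1_fun U x ^ 6) \<partial>lborel) = ennreal (L6_norm \<Omega> U ^ 6)"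
  using H1_nn_integral_eq_Lp_norm[OF assms, of 6] \<Omega>_open le_less_trans[OF embedding[OF assms] ennreal_less_top]
  by (simp add: L6_norm_def)

lemma L6_norm_le:
  assumes "U \<in> H1 \<Omega>"
  shows "L6_norm \<Omega> U \<le> S * norm U"
proof -
  have "ennreal (L6_norm \<Omega> U) ^ 6 \<le> ennreal ((S * norm U) ^ 6)"
    using embedding[OF assms] nn_integral_L6_norm[OF assms] by (simp add: ennreal_power L6_norm_nonneg)
  then have "ennreal (L6_norm \<Omega> U) \<le> ennreal (S * norm U)"
    by (rule ennreal_power_leD) (simp_all add: S_nonneg)
  then show ?thesis using S_nonneg by simp
qed

lemma L6_norm_add:
  assumes U: "U \<in> H1 \<Omega>" and V: "V \<in> H1 \<Omega>"
  shows "L6_norm \<Omega> (U + V) \<le> L6_norm \<Omega> U + L6_norm \<Omega> V"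
proof -
  have "ennreal (L6_norm \<Omega> (U + V) ^ 6) = (\<integral>\<^sup>+x. ennreal ((h1_fun U x + h1_fun V x) ^ 6) \<partial>lborel)"
    unfolding nn_integral_L6_norm[OF H1_subspace(1)[OF \<Omega>_open U V], symmetric]
    by (rule nn_integral_cong_AE) (use AE_h1_fun_linear(1)[of U V] in \<open>auto elim: eventually_mono\<close>)
  also have "\<dots> \<le> ennreal ((L6_norm \<Omega> U + L6_norm \<Omega> V) ^ 6)"
    using nn_integral_L6_norm[OF U] nn_integral_L6_norm[OF V]
    by (intro nn_integral_Minkowski_6) (auto simp: L6_norm_nonneg)
  finally have "ennreal (L6_norm \<Omega> (U + V)) ^ 6 \<le> ennreal ((L6_norm \<Omega> U + L6_norm \<Omega> V) ^ 6)"
    by (simp add: ennreal_power L6_norm_nonneg)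
  then have "ennreal (L6_norm \<Omega> (U + V)) \<le> ennreal (L6_norm \<Omega> U + L6_norm \<Omega> V)"
    by (rule ennreal_power_leD) (simp_all add: L6_norm_nonneg)
  then show ?thesis by (subst (asm) ennreal_le_iff) (simp_all add: L6_norm_nonneg)
qed

lemma L6_norm_scaleR:
  assumes U: "U \<in> H1 \<Omega>"
  shows "L6_norm \<Omega> (c *\<^sub>R U) = \<bar>c\<bar> * L6_norm \<Omega> U"
proof -
  have "ennreal (L6_norm \<Omega> (c *\<^sub>R U) ^ 6) = (\<integral>\<^sup>+x. ennreal (c ^ 6) * ennreal (h1_fun U x ^ 6) \<partial>lborel)"
    unfolding nn_integral_L6_norm[OF H1_subspace(3)[OF \<Omega>_open U U], symmetric]
    by (rule nn_integral_cong_AE)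
      (use AE_h1_fun_linear(3)[of c U] in \<open>auto elim!: eventually_mono simp: power_mult_distrib ennreal_mult\<close>)
  also have "\<dots> = ennreal (c ^ 6) * ennreal (L6_norm \<Omega> U ^ 6)"
    unfolding nn_integral_L6_norm[OF U, symmetric] by (rule nn_integral_cmult) measurable
  also have "\<dots> = ennreal ((\<bar>c\<bar> * L6_norm \<Omega> U) ^ 6)"
    by (simp add: ennreal_mult power_mult_distrib)
  finally have "L6_norm \<Omega> (c *\<^sub>R U) ^ 6 = (\<bar>c\<bar> * L6_norm \<Omega> U) ^ 6"
    by (simp add: L6_norm_nonneg)
  then show ?thesis
    by (rule power_eq_imp_eq_base) (simp_all add: L6_norm_nonneg)
qed

text \<open>Cauchy-Schwarz twice through L^4: the squared integral of u^2 is at most |\<Omega>|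
  times that of u^4, and the squared integral of u^4 is at most the product of those of u^2 and u^6.
  Eliminating the fourth power leaves the constant |\<Omega>|^(2/3).\<close>

lemma L2_norm_fun_le_L6_norm:
  assumes U: "U \<in> H1 \<Omega>"
  shows "(L2_norm_fun \<Omega> U)\<^sup>2 \<le> root 3 ((measure lborel \<Omega>)\<^sup>2) * (L6_norm \<Omega> U)\<^sup>2"
proof -
  let ?u = "h1_fun U" and ?m = "measure lborel \<Omega>"
  define a where "a = (L2_norm_fun \<Omega> U)\<^sup>2"
  have [measurable]: "\<Omega> \<in> sets borel" using \<Omega>_open by simp
  have em: "emeasure lborel \<Omega> = ennreal ?m"
    using emeasure_bounded_finite[OF \<Omega>_bounded] by (intro emeasure_eq_ennreal_measure) auto
  define I2 where "I2 = (\<integral>\<^sup>+x. ennreal ((?u x)\<^sup>2) \<partial>lborel)"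
  define I4 where "I4 = (\<integral>\<^sup>+x. ennreal (?u x ^ 4) \<partial>lborel)"
  have "I2\<^sup>2 \<le> (\<integral>\<^sup>+x. indicator \<Omega> x \<partial>lborel) * I4"
  proof -
    have "I2 = (\<integral>\<^sup>+x. indicator \<Omega> x * ennreal ((?u x)\<^sup>2) \<partial>lborel)"
      unfolding I2_def
      by (rule nn_integral_cong_AE) (use H1_outside[OF U] in \<open>auto elim!: eventually_mono simp: indicator_def\<close>)
    moreover have "(\<integral>\<^sup>+x. indicator \<Omega> x * ennreal ((?u x)\<^sup>2) \<partial>lborel)\<^sup>2 \<le> (\<integral>\<^sup>+x. indicator \<Omega> x \<partial>lborel) * I4"
      unfolding I4_def
      by (rule nn_integral_Cauchy_Schwarz_le) (auto simp: indicator_def ennreal_power power_mult[symmetric])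
    ultimately show ?thesis by simp
  qed
  then have h2: "I2\<^sup>2 \<le> ennreal ?m * I4" by (simp add: em)
  have h4: "I4\<^sup>2 \<le> I2 * (\<integral>\<^sup>+x. ennreal (?u x ^ 6) \<partial>lborel)"
    unfolding I4_def I2_def
    by (rule nn_integral_Cauchy_Schwarz_le)
      (auto simp: ennreal_power power_mult[symmetric] ennreal_mult[symmetric] power_add[symmetric])
  have I2: "I2 = ennreal a" unfolding I2_def a_def by (rule nn_integral_L2_norm_fun[OF \<Omega>_open U])
  have a0: "a \<ge> 0" by (simp add: a_def)
  have "I2\<^sup>2 * I2\<^sup>2 \<le> (ennreal ?m * I4) * (ennreal ?m * I4)" using h2 by (intro mult_mono) auto
  also have "\<dots> = (ennreal ?m)\<^sup>2 * I4\<^sup>2" by (simp add: power2_eq_square ac_simps)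
  also have "\<dots> \<le> (ennreal ?m)\<^sup>2 * (I2 * ennreal (L6_norm \<Omega> U ^ 6))"
    using h4 nn_integral_L6_norm[OF U] by (intro mult_left_mono) auto
  finally have "ennreal (a\<^sup>2 * a\<^sup>2) \<le> ennreal (?m\<^sup>2 * (a * L6_norm \<Omega> U ^ 6))"
    using a0 by (simp add: I2 ennreal_power ennreal_mult[symmetric] L6_norm_nonneg)
  then have "a\<^sup>2 * a\<^sup>2 \<le> ?m\<^sup>2 * (a * L6_norm \<Omega> U ^ 6)"
    using a0 by (subst (asm) ennreal_le_iff) (auto simp: L6_norm_nonneg)
  then have "a * a ^ 3 \<le> a * (?m\<^sup>2 * L6_norm \<Omega> U ^ 6)"
    by (simp add: power2_eq_square power3_eq_cube ac_simps)
  then have "a ^ 3 \<le> ?m\<^sup>2 * L6_norm \<Omega> U ^ 6"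
    using a0 by (cases "a = 0") auto
  also have "\<dots> = (root 3 (?m\<^sup>2) * (L6_norm \<Omega> U)\<^sup>2) ^ 3"
    by (simp add: power_mult_distrib power_mult[symmetric])
  finally show ?thesis
    unfolding a_def by (rule power_le_imp_le_base[of _ 2, simplified, unfolded numeral_3_eq_3[symmetric]]) simp
qed

end

text \<open>Placing the difference in the function component and 0 in the gradient component turns
  the L^2(\<Omega>) pairing with V into the inner product of the ambient Hilbert space, where
  vector-valued calculus is available. The element need not lie in H^1(\<Omega>).\<close>

definition nemytskii_diff :: "(real \<Rightarrow> real) \<Rightarrow> 'a::euclidean_space set \<Rightarrow> 'a h1 \<Rightarrow> 'a h1 \<Rightarrow> 'a h1" where
  "nemytskii_diff \<kappa> \<Omega> A B = abs_L2 (\<lambda>x. (indicator \<Omega> x * (\<kappa> (h1_fun B x) - \<kappa> (h1_fun A x)), 0))"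

context
  fixes \<kappa> :: "real \<Rightarrow> real" and \<Omega> :: "'a::euclidean_space set" and L :: real
  assumes lip: "L-lipschitz_on UNIV \<kappa>" and o: "open \<Omega>"
begin

lemma nemytskii_diff_pointwise:
  "norm (indicator \<Omega> x * (\<kappa> (h1_fun B x) - \<kappa> (h1_fun A x)), 0 :: 'a) \<le> L * norm (rep_L2 B x - rep_L2 A x)"
proof -
  have L: "L \<ge> 0" using lip by (rule lipschitz_on_nonneg)
  have "norm (indicator \<Omega> x * (\<kappa> (h1_fun B x) - \<kappa> (h1_fun A x)), 0 :: 'a) \<le> \<bar>\<kappa> (h1_fun B x) - \<kappa> (h1_fun A x)\<bar>"
    by (simp add: norm_prod_def indicator_def)
  also have "\<dots> \<le> L * \<bar>h1_fun B x - h1_fun A x\<bar>"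
    using lipschitz_onD[OF lip, of "h1_fun B x" "h1_fun A x"] by (simp add: dist_real_def)
  also have "\<dots> \<le> L * norm (rep_L2 B x - rep_L2 A x)"
  proof -
    have "norm (fst p) \<le> norm p" for p :: "real \<times> 'a"
      using norm_fst_le[of "fst p" "snd p"] by simp
    from mult_left_mono[OF this[of "rep_L2 B x - rep_L2 A x"] L] show ?thesis by (simp add: h1_fun_def)
  qed
  finally show ?thesis .
qed

lemma nemytskii_diff_square_integrable:
  "square_integrable (\<lambda>x. (indicator \<Omega> x * (\<kappa> (h1_fun B x) - \<kappa> (h1_fun A x)), 0 :: 'a))"
proof -
  have [measurable]: "\<kappa> \<in> borel_measurable borel" "\<Omega> \<in> sets borel"
    using lipschitz_on_continuous_on[OF lip] o by (auto intro: borel_measurable_continuous_onI)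
  have m: "(\<lambda>x. (indicator \<Omega> x * (\<kappa> (h1_fun B x) - \<kappa> (h1_fun A x)), 0 :: 'a)) \<in> borel_measurable lborel"
    by (intro borel_measurable_Pair) measurable
  have si: "square_integrable (\<lambda>x. L *\<^sub>R (rep_L2 B x - rep_L2 A x))"
    by (intro square_integrable_scaleR square_integrable_diff square_integrable_rep)
  have L: "L \<ge> 0" using lip by (rule lipschitz_on_nonneg)
  have "integrable lborel (\<lambda>x. (norm (indicator \<Omega> x * (\<kappa> (h1_fun B x) - \<kappa> (h1_fun A x)), 0 :: 'a))\<^sup>2)"
  proof (rule Bochner_Integration.integrable_bound)
    show "integrable lborel (\<lambda>x. (norm (L *\<^sub>R (rep_L2 B x - rep_L2 A x)))\<^sup>2)"
      using si by (simp add: square_integrable_def)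
    show "AE x in lborel. norm ((norm (indicator \<Omega> x * (\<kappa> (h1_fun B x) - \<kappa> (h1_fun A x)), 0 :: 'a))\<^sup>2)
        \<le> norm ((norm (L *\<^sub>R (rep_L2 B x - rep_L2 A x)))\<^sup>2)"
    proof (rule AE_I2)
      fix x
      have "(norm (indicator \<Omega> x * (\<kappa> (h1_fun B x) - \<kappa> (h1_fun A x)), 0 :: 'a))\<^sup>2 \<le> (norm (L *\<^sub>R (rep_L2 B x - rep_L2 A x)))\<^sup>2"
        using nemytskii_diff_pointwise[of x B A] L by (intro power_mono) auto
      then show "norm ((norm (indicator \<Omega> x * (\<kappa> (h1_fun B x) - \<kappa> (h1_fun A x)), 0 :: 'a))\<^sup>2)
        \<le> norm ((norm (L *\<^sub>R (rep_L2 B x - rep_L2 A x)))\<^sup>2)" by simp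
    qed
  qed (use m in simp)
  then show ?thesis using m by (simp add: square_integrable_def)
qed

lemma rep_nemytskii_diff:
  "AE x in lborel. rep_L2 (nemytskii_diff \<kappa> \<Omega> A B) x = (indicator \<Omega> x * (\<kappa> (h1_fun B x) - \<kappa> (h1_fun A x)), 0)"
  unfolding nemytskii_diff_def by (rule rep_abs_L2[OF nemytskii_diff_square_integrable])

lemma inner_nemytskii_diff:
  "nemytskii_diff \<kappa> \<Omega> A B \<bullet> V = L2_pairing \<Omega> (\<lambda>x. \<kappa> (h1_fun B x) - \<kappa> (h1_fun A x)) (h1_fun V)"
  unfolding inner_L2_eq L2_pairing_def set_lebesgue_integral_def
proof (rule integral_cong_AE)
  have [measurable]: "\<kappa> \<in> borel_measurable borel" "\<Omega> \<in> sets borel"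
    using lipschitz_on_continuous_on[OF lip] o by (auto intro: borel_measurable_continuous_onI)
  show "(\<lambda>x. indicator \<Omega> x *\<^sub>R ((\<kappa> (h1_fun B x) - \<kappa> (h1_fun A x)) * h1_fun V x)) \<in> borel_measurable lborel"
    by measurable
  show "AE x in lborel. rep_L2 (nemytskii_diff \<kappa> \<Omega> A B) x \<bullet> rep_L2 V x = indicator \<Omega> x *\<^sub>R ((\<kappa> (h1_fun B x) - \<kappa> (h1_fun A x)) * h1_fun V x)"
    using rep_nemytskii_diff[of A B] by eventually_elim (simp add: rep_L2_eq_Pair[of V])
qed (use square_integrable_measurable[OF square_integrable_rep] in \<open>auto intro!: borel_measurable_inner\<close>)

lemma norm_nemytskii_diff_le: "norm (nemytskii_diff \<kappa> \<Omega> A B) \<le> L * norm (B - A)"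
proof -
  have L: "L \<ge> 0" using lip by (rule lipschitz_on_nonneg)
  have [measurable]: "rep_L2 A \<in> borel_measurable borel" "rep_L2 B \<in> borel_measurable borel"
    using square_integrable_measurable[OF square_integrable_rep] by auto
  have "ennreal ((norm (nemytskii_diff \<kappa> \<Omega> A B))\<^sup>2)
      = (\<integral>\<^sup>+x. ennreal ((norm (indicator \<Omega> x * (\<kappa> (h1_fun B x) - \<kappa> (h1_fun A x)), 0 :: 'a))\<^sup>2) \<partial>lborel)"
    unfolding nemytskii_diff_def by (rule norm_abs_L2_nn[OF nemytskii_diff_square_integrable])
  also have "\<dots> \<le> (\<integral>\<^sup>+x. ennreal (L\<^sup>2) * ennreal ((norm (rep_L2 B x - rep_L2 A x))\<^sup>2) \<partial>lborel)"
  proof (rule nn_integral_mono)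
    fix x
    have "(norm (indicator \<Omega> x * (\<kappa> (h1_fun B x) - \<kappa> (h1_fun A x)), 0 :: 'a))\<^sup>2 \<le> (L * norm (rep_L2 B x - rep_L2 A x))\<^sup>2"
      by (intro power_mono nemytskii_diff_pointwise) simp
    then show "ennreal ((norm (indicator \<Omega> x * (\<kappa> (h1_fun B x) - \<kappa> (h1_fun A x)), 0 :: 'a))\<^sup>2) \<le> ennreal (L\<^sup>2) * ennreal ((norm (rep_L2 B x - rep_L2 A x))\<^sup>2)"
      by (simp add: ennreal_mult[symmetric] power_mult_distrib ennreal_leI)
  qed
  also have "\<dots> = ennreal (L\<^sup>2) * ennreal ((norm (B - A))\<^sup>2)"
    unfolding norm_diff_L2_eq_nn by (rule nn_integral_cmult) measurable
  also have "\<dots> = ennreal ((L * norm (B - A))\<^sup>2)" by (simp add: ennreal_mult[symmetric] power_mult_distrib)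
  finally have "(norm (nemytskii_diff \<kappa> \<Omega> A B))\<^sup>2 \<le> (L * norm (B - A))\<^sup>2" by simp
  then show ?thesis using L by (simp add: power2_le_iff_abs_le)
qed

text \<open>The second difference is regrouped so that each term compares one trajectory at two
  times instead of two trajectories at one time. This gives Lipschitz continuity in time.\<close>

lemma nemytskii_diff_exchange:
  "nemytskii_diff \<kappa> \<Omega> A' B' - nemytskii_diff \<kappa> \<Omega> A B = nemytskii_diff \<kappa> \<Omega> B B' - nemytskii_diff \<kappa> \<Omega> A A'"
proof (rule L2_eqI)
  show "AE x in lborel. rep_L2 (nemytskii_diff \<kappa> \<Omega> A' B' - nemytskii_diff \<kappa> \<Omega> A B) x
      = rep_L2 (nemytskii_diff \<kappa> \<Omega> B B' - nemytskii_diff \<kappa> \<Omega> A A') x"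
    using rep_minus_L2[of "nemytskii_diff \<kappa> \<Omega> A' B'" "nemytskii_diff \<kappa> \<Omega> A B"]
      rep_minus_L2[of "nemytskii_diff \<kappa> \<Omega> B B'" "nemytskii_diff \<kappa> \<Omega> A A'"]
      rep_nemytskii_diff[of A B] rep_nemytskii_diff[of A' B'] rep_nemytskii_diff[of A A'] rep_nemytskii_diff[of B B']
    by eventually_elim (simp add: algebra_simps)
qed

lemma norm_nemytskii_diff_diff_le:
  "norm (nemytskii_diff \<kappa> \<Omega> A' B' - nemytskii_diff \<kappa> \<Omega> A B) \<le> L * norm (B' - B) + L * norm (A' - A)"
  unfolding nemytskii_diff_exchange[of A' B' A B]
  using norm_triangle_ineq4[of "nemytskii_diff \<kappa> \<Omega> B B'" "nemytskii_diff \<kappa> \<Omega> A A'"]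
    norm_nemytskii_diff_le[of B B'] norm_nemytskii_diff_le[of A A'] by linarith

end

text \<open>Taking the maximum with 1 makes powers increase with the exponent, so \<rho> may be
  raised to the integer n. The bound \<open>5 * m\<close> is generous for four summands, and the
  power of the maximum is one of the five terms on the right.\<close>

lemma growth_square_le:
  fixes w x y z :: real
  assumes c: "c1 \<ge> 0" "c0 \<ge> 0" and \<rho>: "0 \<le> \<rho>" "\<rho> \<le> real n"
  shows "(c1 * (\<bar>w\<bar> + \<bar>x\<bar> + \<bar>y\<bar> + \<bar>z\<bar>) powr \<rho> + c0)\<^sup>2
    \<le> (c1 + c0)\<^sup>2 * 5 ^ (2 * n) * (1 + \<bar>w\<bar> ^ (2 * n) + \<bar>x\<bar> ^ (2 * n) + \<bar>y\<bar> ^ (2 * n) + \<bar>z\<bar> ^ (2 * n))"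
proof -
  define m where "m = Max {1, \<bar>w\<bar>, \<bar>x\<bar>, \<bar>y\<bar>, \<bar>z\<bar>}"
  have m: "1 \<le> m" "\<bar>w\<bar> \<le> m" "\<bar>x\<bar> \<le> m" "\<bar>y\<bar> \<le> m" "\<bar>z\<bar> \<le> m"
    unfolding m_def by (intro Max_ge; simp)+
  have "m \<in> {1, \<bar>w\<bar>, \<bar>x\<bar>, \<bar>y\<bar>, \<bar>z\<bar>}" unfolding m_def by (rule Max_in) auto
  then have m2: "m ^ (2 * n) \<le> 1 + \<bar>w\<bar> ^ (2 * n) + \<bar>x\<bar> ^ (2 * n) + \<bar>y\<bar> ^ (2 * n) + \<bar>z\<bar> ^ (2 * n)"
  proof -
    have nn: "0 \<le> \<bar>w\<bar> ^ (2 * n)" "0 \<le> \<bar>x\<bar> ^ (2 * n)" "0 \<le> \<bar>y\<bar> ^ (2 * n)" "0 \<le> \<bar>z\<bar> ^ (2 * n)" by simp_all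
    from \<open>m \<in> _\<close> have "m ^ (2 * n) \<in> {1, \<bar>w\<bar> ^ (2 * n), \<bar>x\<bar> ^ (2 * n), \<bar>y\<bar> ^ (2 * n), \<bar>z\<bar> ^ (2 * n)}" by auto
    then show ?thesis using nn by (elim insertE) (simp_all del: zero_le_power_eq)
  qed
  have "(\<bar>w\<bar> + \<bar>x\<bar> + \<bar>y\<bar> + \<bar>z\<bar>) powr \<rho> \<le> (5 * m) powr \<rho>" using m \<rho> by (intro powr_mono2) auto
  also have "\<dots> \<le> (5 * m) powr real n" using m \<rho> by (intro powr_mono) auto
  also have "\<dots> = (5 * m) ^ n" using m by (simp add: powr_realpow)
  finally have "c1 * (\<bar>w\<bar> + \<bar>x\<bar> + \<bar>y\<bar> + \<bar>z\<bar>) powr \<rho> \<le> c1 * (5 * m) ^ n" using c by (intro mult_left_mono)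
  moreover have "c0 * 1 \<le> c0 * (5 * m) ^ n" using c m by (intro mult_left_mono one_le_power) auto
  ultimately have "c1 * (\<bar>w\<bar> + \<bar>x\<bar> + \<bar>y\<bar> + \<bar>z\<bar>) powr \<rho> + c0 \<le> (c1 + c0) * (5 * m) ^ n" by (simp add: distrib_right)
  then have "(c1 * (\<bar>w\<bar> + \<bar>x\<bar> + \<bar>y\<bar> + \<bar>z\<bar>) powr \<rho> + c0)\<^sup>2 \<le> ((c1 + c0) * (5 * m) ^ n)\<^sup>2"
    using c by (intro power_mono) auto
  also have "\<dots> = (c1 + c0)\<^sup>2 * 5 ^ (2 * n) * m ^ (2 * n)"
    by (simp add: power_mult_distrib power_mult[symmetric] mult.commute)
  also have "\<dots> \<le> (c1 + c0)\<^sup>2 * 5 ^ (2 * n) * (1 + \<bar>w\<bar> ^ (2 * n) + \<bar>x\<bar> ^ (2 * n) + \<bar>y\<bar> ^ (2 * n) + \<bar>z\<bar> ^ (2 * n))"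
    using m2 by (intro mult_left_mono) auto
  finally show ?thesis .
qed

context L6_embedding
begin

text \<open>This bounds the L^2 factor in Hoelder's inequality uniformly over all histories of norm
  at most R. Squaring the growth is what calls for the embedding into L^(2n) with n at least
  \<rho>.\<close>

lemma growth_integral_le:
  assumes c: "c1 \<ge> 0" "c0 \<ge> 0" and \<rho>: "0 \<le> \<rho>" "\<rho> \<le> real n" and C: "C \<ge> 0" "R \<ge> 0"
    and emb: "\<And>U. U \<in> H1 \<Omega> \<Longrightarrow> (\<integral>\<^sup>+x. ennreal (\<bar>h1_fun U x\<bar> ^ (2 * n)) \<partial>lborel) \<le> ennreal (C * norm U ^ (2 * n))"
    and ABCD: "A \<in> H1 \<Omega>" "A' \<in> H1 \<Omega>" "B \<in> H1 \<Omega>" "B' \<in> H1 \<Omega>" "norm A \<le> R" "norm A' \<le> R" "norm B \<le> R" "norm B' \<le> R"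
  shows "(\<integral>\<^sup>+x. (ennreal (c1 * (\<bar>h1_fun A x\<bar> + \<bar>h1_fun A' x\<bar> + \<bar>h1_fun B x\<bar> + \<bar>h1_fun B' x\<bar>) powr \<rho> + c0) * indicator \<Omega> x)\<^sup>2 \<partial>lborel)
    \<le> ennreal ((c1 + c0)\<^sup>2 * 5 ^ (2 * n) * (measure lborel \<Omega> + 4 * (C * R ^ (2 * n))))"
proof -
  have [measurable]: "\<Omega> \<in> sets borel" using \<Omega>_open by simp
  have em: "emeasure lborel \<Omega> = ennreal (measure lborel \<Omega>)"
    using emeasure_bounded_finite[OF \<Omega>_bounded] by (intro emeasure_eq_ennreal_measure) auto
  let ?k = "(c1 + c0)\<^sup>2 * 5 ^ (2 * n)"
  let ?p = "\<lambda>U x. ennreal (\<bar>h1_fun U x\<bar> ^ (2 * n))"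
  have "(\<integral>\<^sup>+x. (ennreal (c1 * (\<bar>h1_fun A x\<bar> + \<bar>h1_fun A' x\<bar> + \<bar>h1_fun B x\<bar> + \<bar>h1_fun B' x\<bar>) powr \<rho> + c0) * indicator \<Omega> x)\<^sup>2 \<partial>lborel)
      \<le> (\<integral>\<^sup>+x. ennreal ?k * (indicator \<Omega> x + ?p A x + ?p A' x + ?p B x + ?p B' x) \<partial>lborel)"
  proof (rule nn_integral_mono)
    fix x
    let ?s = "c1 * (\<bar>h1_fun A x\<bar> + \<bar>h1_fun A' x\<bar> + \<bar>h1_fun B x\<bar> + \<bar>h1_fun B' x\<bar>) powr \<rho> + c0"
    have s: "?s \<ge> 0" using c by simp
    show "(ennreal ?s * indicator \<Omega> x)\<^sup>2 \<le> ennreal ?k * (indicator \<Omega> x + ?p A x + ?p A' x + ?p B x + ?p B' x)"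
    proof (cases "x \<in> \<Omega>")
      case True
      have "(ennreal ?s)\<^sup>2 = ennreal (?s\<^sup>2)" using s by (rule ennreal_power)
      also have "\<dots> \<le> ennreal (?k * (1 + \<bar>h1_fun A x\<bar> ^ (2 * n) + \<bar>h1_fun A' x\<bar> ^ (2 * n) + \<bar>h1_fun B x\<bar> ^ (2 * n) + \<bar>h1_fun B' x\<bar> ^ (2 * n)))"
        by (intro ennreal_leI growth_square_le c \<rho>)
      also have "\<dots> = ennreal ?k * (1 + ?p A x + ?p A' x + ?p B x + ?p B' x)"
        by (subst ennreal_mult) (simp_all add: add_nonneg_nonneg)
      finally show ?thesis using True by simp
    qed simp
  qed
  also have "\<dots> = ennreal ?k * (emeasure lborel \<Omega> + integral\<^sup>N lborel (?p A) + integral\<^sup>N lborel (?p A') + integral\<^sup>N lborel (?p B) + integral\<^sup>N lborel (?p B'))"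
    by (simp add: nn_integral_cmult nn_integral_add)
  also have "\<dots> \<le> ennreal ?k * (ennreal (measure lborel \<Omega>) + ennreal (C * R ^ (2 * n)) + ennreal (C * R ^ (2 * n)) + ennreal (C * R ^ (2 * n)) + ennreal (C * R ^ (2 * n)))"
  proof -
    have "integral\<^sup>N lborel (?p U) \<le> ennreal (C * R ^ (2 * n))" if "U \<in> H1 \<Omega>" "norm U \<le> R" for U
    proof -
      have "C * norm U ^ (2 * n) \<le> C * R ^ (2 * n)" using that C by (intro mult_left_mono power_mono) auto
      then show ?thesis using emb[OF that(1)] by (meson ennreal_leI order_trans)
    qed
    then show ?thesis unfolding em using ABCD by (intro mult_left_mono add_mono) auto
  qed
  also have "\<dots> = ennreal (?k * (measure lborel \<Omega> + 4 * (C * R ^ (2 * n))))"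
  proof -
    have nn: "0 \<le> C * R ^ (2 * n)" "0 \<le> measure lborel \<Omega>" using C by auto
    have "ennreal (measure lborel \<Omega>) + ennreal (C * R ^ (2 * n)) + ennreal (C * R ^ (2 * n)) + ennreal (C * R ^ (2 * n)) + ennreal (C * R ^ (2 * n))
      = ennreal (measure lborel \<Omega> + 4 * (C * R ^ (2 * n)))"
      using nn by (simp add: ennreal_plus[symmetric] del: ennreal_plus)
    then show ?thesis using nn by (simp only: ennreal_mult)  (subst ennreal_mult; simp)
  qed
  finally show ?thesis .
qed

text \<open>A and A' will be one history at two times, B and B' the other. Then A' - A is small with
  the time step, while B - A, B' - A' and V are all controlled by the difference of the two
  solutions: the last term is linear in time and quadratic in that difference.\<close>

lemma nemytskii_second_difference_pairing:
  assumes lip: "L-lipschitz_on UNIV \<kappa>"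
    and snd: "\<And>a a' b b'. \<bar>\<kappa> b' - \<kappa> b - \<kappa> a' + \<kappa> a\<bar> \<le> L * \<bar>(b' - b) - (a' - a)\<bar>
      + \<bar>a' - a\<bar> * (\<bar>b - a\<bar> + \<bar>b' - a'\<bar>) * (c1 * (\<bar>a\<bar> + \<bar>a'\<bar> + \<bar>b\<bar> + \<bar>b'\<bar>) powr \<rho> + c0)"
    and c: "c1 \<ge> 0" "c0 \<ge> 0"
    and A: "A \<in> H1 \<Omega>" "A' \<in> H1 \<Omega>" and B: "B \<in> H1 \<Omega>" "B' \<in> H1 \<Omega>" and V: "V \<in> H1 \<Omega>"
    and G: "(\<integral>\<^sup>+x. (ennreal (c1 * (\<bar>h1_fun A x\<bar> + \<bar>h1_fun A' x\<bar> + \<bar>h1_fun B x\<bar> + \<bar>h1_fun B' x\<bar>) powr \<rho> + c0) * indicator \<Omega> x)\<^sup>2 \<partial>lborel)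
      \<le> ennreal (g\<^sup>2)" "g \<ge> 0"
  shows "\<bar>(nemytskii_diff \<kappa> \<Omega> A' B' - nemytskii_diff \<kappa> \<Omega> A B) \<bullet> V\<bar>
    \<le> L * L2_norm_fun \<Omega> ((B' - B) - (A' - A)) * L2_norm_fun \<Omega> V
      + g * L6_norm \<Omega> (A' - A) * (L6_norm \<Omega> (B - A) + L6_norm \<Omega> (B' - A')) * L6_norm \<Omega> V"
proof -
  have L: "L \<ge> 0" using lip by (rule lipschitz_on_nonneg)
  have [measurable]: "\<Omega> \<in> sets borel" using \<Omega>_open by simp
  note sub = H1_subspace(2)[OF \<Omega>_open]
  let ?N = "nemytskii_diff \<kappa> \<Omega> A' B' - nemytskii_diff \<kappa> \<Omega> A B"
  let ?\<delta> = "h1_fun ((B' - B) - (A' - A))" and ?\<alpha> = "h1_fun (A' - A)" and ?v = "h1_fun V"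
  let ?\<beta> = "h1_fun (B - A)" and ?\<beta>' = "h1_fun (B' - A')"
  \<comment> \<open>The cut-off by \<Omega> is essential: the constant c0 is not square integrable
    over the whole space.\<close>
  define \<gamma> where "\<gamma> x = ennreal (c1 * (\<bar>h1_fun A x\<bar> + \<bar>h1_fun A' x\<bar> + \<bar>h1_fun B x\<bar> + \<bar>h1_fun B' x\<bar>) powr \<rho> + c0) * indicator \<Omega> x" for x
  have \<gamma>m [measurable]: "\<gamma> \<in> borel_measurable borel" unfolding \<gamma>_def[abs_def] by measurable
  have "ennreal \<bar>?N \<bullet> V\<bar> \<le> (\<integral>\<^sup>+x. ennreal (norm (rep_L2 ?N x \<bullet> rep_L2 V x)) \<partial>lborel)"
    unfolding inner_L2_eq
    using integral_norm_bound_ennreal[OF square_integrable_inner[OF square_integrable_rep square_integrable_rep], of ?N V] by simp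
  also have "\<dots> \<le> (\<integral>\<^sup>+x. ennreal L * (ennreal \<bar>?\<delta> x\<bar> * ennreal \<bar>?v x\<bar>)
      + (ennreal \<bar>?\<alpha> x * ?\<beta> x * ?v x\<bar> * \<gamma> x + ennreal \<bar>?\<alpha> x * ?\<beta>' x * ?v x\<bar> * \<gamma> x) \<partial>lborel)"
  proof (rule nn_integral_mono_AE,
      use AE_h1_fun_linear(2)[of "B' - B" "A' - A"] AE_h1_fun_linear(2)[of B' B] AE_h1_fun_linear(2)[of A' A]
        AE_h1_fun_linear(2)[of B A] AE_h1_fun_linear(2)[of B' A'] rep_nemytskii_diff[OF lip \<Omega>_open, of A B]
        rep_nemytskii_diff[OF lip \<Omega>_open, of A' B'] rep_minus_L2[of "nemytskii_diff \<kappa> \<Omega> A' B'" "nemytskii_diff \<kappa> \<Omega> A B"]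
      in eventually_elim)
    case (elim x)
    let ?a = "h1_fun A x" and ?a' = "h1_fun A' x" and ?b = "h1_fun B x" and ?b' = "h1_fun B' x"
    let ?g = "c1 * (\<bar>?a\<bar> + \<bar>?a'\<bar> + \<bar>?b\<bar> + \<bar>?b'\<bar>) powr \<rho> + c0"
    have g0: "?g \<ge> 0" using c by simp
    have inner: "rep_L2 ?N x \<bullet> rep_L2 V x = indicator \<Omega> x * ((\<kappa> ?b' - \<kappa> ?b - \<kappa> ?a' + \<kappa> ?a) * ?v x)"
      using elim by (simp add: rep_L2_eq_Pair[of V] algebra_simps)
    show ?case
    proof (cases "x \<in> \<Omega>")
      case True
      have "norm (rep_L2 ?N x \<bullet> rep_L2 V x) = \<bar>\<kappa> ?b' - \<kappa> ?b - \<kappa> ?a' + \<kappa> ?a\<bar> * \<bar>?v x\<bar>"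
        unfolding inner using True by (simp add: abs_mult)
      also have "\<dots> \<le> (L * \<bar>?\<delta> x\<bar> + \<bar>?\<alpha> x\<bar> * (\<bar>?\<beta> x\<bar> + \<bar>?\<beta>' x\<bar>) * ?g) * \<bar>?v x\<bar>"
        using snd[of ?b' ?b ?a' ?a] elim by (intro mult_right_mono) auto
      also have "\<dots> = L * (\<bar>?\<delta> x\<bar> * \<bar>?v x\<bar>) + (\<bar>?\<alpha> x * ?\<beta> x * ?v x\<bar> * ?g + \<bar>?\<alpha> x * ?\<beta>' x * ?v x\<bar> * ?g)"
        by (simp only: abs_mult) (simp only: algebra_simps)
      finally have "ennreal (norm (rep_L2 ?N x \<bullet> rep_L2 V x))
          \<le> ennreal (L * (\<bar>?\<delta> x\<bar> * \<bar>?v x\<bar>) + (\<bar>?\<alpha> x * ?\<beta> x * ?v x\<bar> * ?g + \<bar>?\<alpha> x * ?\<beta>' x * ?v x\<bar> * ?g))"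
        by (rule ennreal_leI)
      also have "\<dots> = ennreal (L * (\<bar>?\<delta> x\<bar> * \<bar>?v x\<bar>)) + (ennreal (\<bar>?\<alpha> x * ?\<beta> x * ?v x\<bar> * ?g) + ennreal (\<bar>?\<alpha> x * ?\<beta>' x * ?v x\<bar> * ?g))"
        using L g0 by (subst ennreal_plus; simp)
      also have "\<dots> = ennreal L * (ennreal \<bar>?\<delta> x\<bar> * ennreal \<bar>?v x\<bar>) + (ennreal \<bar>?\<alpha> x * ?\<beta> x * ?v x\<bar> * ennreal ?g + ennreal \<bar>?\<alpha> x * ?\<beta>' x * ?v x\<bar> * ennreal ?g)"
        using L g0 by (simp only: ennreal_mult abs_ge_zero mult_nonneg_nonneg)
      finally show ?thesis using True by (simp add: \<gamma>_def)
    qed (simp add: inner)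
  qed
  also have "\<dots> = ennreal L * (\<integral>\<^sup>+x. ennreal \<bar>?\<delta> x\<bar> * ennreal \<bar>?v x\<bar> \<partial>lborel)
      + ((\<integral>\<^sup>+x. ennreal \<bar>?\<alpha> x * ?\<beta> x * ?v x\<bar> * \<gamma> x \<partial>lborel) + (\<integral>\<^sup>+x. ennreal \<bar>?\<alpha> x * ?\<beta>' x * ?v x\<bar> * \<gamma> x \<partial>lborel))"
    by (simp add: nn_integral_add nn_integral_cmult)
  also have "\<dots> \<le> ennreal L * ennreal (L2_norm_fun \<Omega> ((B' - B) - (A' - A)) * L2_norm_fun \<Omega> V)
      + (ennreal (L6_norm \<Omega> (A' - A) * L6_norm \<Omega> (B - A) * L6_norm \<Omega> V * g) + ennreal (L6_norm \<Omega> (A' - A) * L6_norm \<Omega> (B' - A') * L6_norm \<Omega> V * g))"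
  proof (intro add_mono mult_left_mono)
    have D: "(B' - B) - (A' - A) \<in> H1 \<Omega>" using A B by (intro sub)
    show "(\<integral>\<^sup>+x. ennreal \<bar>?\<delta> x\<bar> * ennreal \<bar>?v x\<bar> \<partial>lborel) \<le> ennreal (L2_norm_fun \<Omega> ((B' - B) - (A' - A)) * L2_norm_fun \<Omega> V)"
      by (rule nn_integral_pairing_le[OF \<Omega>_open D V])
    \<comment> \<open>Cauchy-Schwarz first separates the growth factor; the three remaining factors
      are then measured in L^6.\<close>
    have triple: "(\<integral>\<^sup>+x. ennreal \<bar>?\<alpha> x * h1_fun W x * ?v x\<bar> * \<gamma> x \<partial>lborel) \<le> ennreal (L6_norm \<Omega> (A' - A) * L6_norm \<Omega> W * L6_norm \<Omega> V * g)"
      if W: "W \<in> H1 \<Omega>" for W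
    proof -
      have "(\<integral>\<^sup>+x. ennreal \<bar>?\<alpha> x * h1_fun W x * ?v x\<bar> * \<gamma> x \<partial>lborel)\<^sup>2
          \<le> (\<integral>\<^sup>+x. ennreal ((?\<alpha> x * h1_fun W x * ?v x)\<^sup>2) \<partial>lborel) * (\<integral>\<^sup>+x. (\<gamma> x)\<^sup>2 \<partial>lborel)"
        by (rule nn_integral_Cauchy_Schwarz_le) (auto simp: power_mult_distrib ennreal_power)
      also have "\<dots> \<le> ennreal ((L6_norm \<Omega> (A' - A) * L6_norm \<Omega> W * L6_norm \<Omega> V)\<^sup>2) * ennreal (g\<^sup>2)"
      proof (intro mult_mono)
        show "(\<integral>\<^sup>+x. ennreal ((?\<alpha> x * h1_fun W x * ?v x)\<^sup>2) \<partial>lborel) \<le> ennreal ((L6_norm \<Omega> (A' - A) * L6_norm \<Omega> W * L6_norm \<Omega> V)\<^sup>2)"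
          using nn_integral_L6_norm[OF sub[OF A(2,1)]] nn_integral_L6_norm[OF W] nn_integral_L6_norm[OF V]
          by (intro nn_integral_Hoelder_3) (auto simp: L6_norm_nonneg)
        show "(\<integral>\<^sup>+x. (\<gamma> x)\<^sup>2 \<partial>lborel) \<le> ennreal (g\<^sup>2)" using G(1) by (simp only: \<gamma>_def)
      qed auto
      also have "\<dots> = ennreal ((L6_norm \<Omega> (A' - A) * L6_norm \<Omega> W * L6_norm \<Omega> V * g)\<^sup>2)"
        by (simp add: ennreal_mult[symmetric] power_mult_distrib)
      finally show ?thesis
        by (rule ennreal_power_leD) (simp_all add: L6_norm_nonneg G(2))
    qed
    show "(\<integral>\<^sup>+x. ennreal \<bar>?\<alpha> x * ?\<beta> x * ?v x\<bar> * \<gamma> x \<partial>lborel) \<le> ennreal (L6_norm \<Omega> (A' - A) * L6_norm \<Omega> (B - A) * L6_norm \<Omega> V * g)"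
      using A B by (intro triple sub)
    show "(\<integral>\<^sup>+x. ennreal \<bar>?\<alpha> x * ?\<beta>' x * ?v x\<bar> * \<gamma> x \<partial>lborel) \<le> ennreal (L6_norm \<Omega> (A' - A) * L6_norm \<Omega> (B' - A') * L6_norm \<Omega> V * g)"
      using A B by (intro triple sub)
  qed simp
  also have "\<dots> = ennreal (L * (L2_norm_fun \<Omega> ((B' - B) - (A' - A)) * L2_norm_fun \<Omega> V)
      + (L6_norm \<Omega> (A' - A) * L6_norm \<Omega> (B - A) * L6_norm \<Omega> V * g + L6_norm \<Omega> (A' - A) * L6_norm \<Omega> (B' - A') * L6_norm \<Omega> V * g))"
    using L G(2) by (simp add: ennreal_mult[symmetric] ennreal_plus[symmetric] L6_norm_nonneg L2_norm_fun_nonneg del: ennreal_plus)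
  finally have "\<bar>?N \<bullet> V\<bar> \<le> L * (L2_norm_fun \<Omega> ((B' - B) - (A' - A)) * L2_norm_fun \<Omega> V)
      + (L6_norm \<Omega> (A' - A) * L6_norm \<Omega> (B - A) * L6_norm \<Omega> V * g + L6_norm \<Omega> (A' - A) * L6_norm \<Omega> (B' - A') * L6_norm \<Omega> V * g)"
    using L G(2) by (subst (asm) ennreal_le_iff) (auto simp: L6_norm_nonneg L2_norm_fun_nonneg intro!: add_nonneg_nonneg mult_nonneg_nonneg)
  then show ?thesis by (simp add: algebra_simps)
qed

end

section \<open>The estimate in time\<close>

lemma set_integrable_continuous_Icc:
  fixes f :: "real \<Rightarrow> 'b::{banach, second_countable_topology}"
  assumes "continuous_on {a..b} f" "a \<le> s" "t \<le> b"
  shows "set_integrable lborel {s..t} f"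
  unfolding set_integrable_def
  by (rule borel_integrable_compact[OF compact_Icc continuous_on_subset[OF assms(1)]]) (use assms in auto)

lemma set_integral_const_Icc:
  fixes c :: "'b::{banach, second_countable_topology}"
  assumes "s \<le> t"
  shows "(LINT x:{s..t}|lborel. c) = (t - s) *\<^sub>R c"
  using assms by (simp add: set_lebesgue_integral_def)

text \<open>The L^6 norm is a seminorm on a subspace and not the norm of the ambient space, so the
  usual norm inequality for the Bochner integral does not give this. On a short interval u is nearly
  constant: the constant part gives the seminorm at one point, and the rest is small in the ambient
  norm.\<close>

lemma seminorm_integral_le:
  fixes u :: "real \<Rightarrow> 'b::{banach, second_countable_topology}" and N :: "'b \<Rightarrow> real"
  assumes ab: "a \<le> b" and u: "continuous_on {a..b} u"
    and X: "\<And>s t. a \<le> s \<Longrightarrow> s \<le> t \<Longrightarrow> t \<le> b \<Longrightarrow> (LINT x:{s..t}|lborel. u x) \<in> X"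
      "\<And>t. t \<in> {a..b} \<Longrightarrow> u t \<in> X" "\<And>x y. x \<in> X \<Longrightarrow> y \<in> X \<Longrightarrow> x - y \<in> X" "\<And>c x. x \<in> X \<Longrightarrow> c *\<^sub>R x \<in> X"
    and N: "\<And>x y. x \<in> X \<Longrightarrow> y \<in> X \<Longrightarrow> N (x + y) \<le> N x + N y" "\<And>c x. x \<in> X \<Longrightarrow> N (c *\<^sub>R x) = \<bar>c\<bar> * N x"
      "\<And>x. x \<in> X \<Longrightarrow> N x \<le> C * norm x"
    and Nu: "continuous_on {a..b} (\<lambda>t. N (u t))"
  shows "N (LINT x:{a..b}|lborel. u x) \<le> (LINT x:{a..b}|lborel. N (u x))"
proof -
  define I where "I s t = (LINT x:{s..t}|lborel. u x)" for s t
  define J where "J s t = (LINT x:{s..t}|lborel. N (u x))" for s t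
  have ui: "set_integrable lborel {s..t} u" and Ni: "set_integrable lborel {s..t} (\<lambda>x. N (u x))" if "a \<le> s" "t \<le> b" for s t
    using that by (auto intro: set_integrable_continuous_Icc[OF u] set_integrable_continuous_Icc[OF Nu])
  have "N (I a b) - J a b \<le> 0"
  \<comment> \<open>The slope adds two errors: |C| for replacing u by a constant inside the
    seminorm, and 1 for replacing the seminorm of u by its value at one point.\<close>
  proof (rule subadditive_local_to_global[OF ab, where m = "\<lambda>t. (\<bar>C\<bar> + 1) * t"])
    fix s t r assume str: "a \<le> s" "s \<le> t" "t \<le> r" "r \<le> b"
    have "I s r = I s t + I t r" "J s r = J s t + J t r"
      unfolding I_def J_def using str by (auto intro!: set_integral_Icc_combine ui Ni)
    moreover have "N (I s t + I t r) \<le> N (I s t) + N (I t r)"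
      unfolding I_def using str by (intro N X) auto
    ultimately show "N (I s r) - J s r \<le> N (I s t) - J s t + (N (I t r) - J t r)" by simp
  next
    fix \<epsilon> x :: real assume \<epsilon>: "\<epsilon> > 0" and x: "a \<le> x" "x \<le> b"
    then have xab: "x \<in> {a..b}" by simp
    obtain d1 where d1: "d1 > 0" "\<And>t. t \<in> {a..b} \<Longrightarrow> dist t x < d1 \<Longrightarrow> dist (u t) (u x) < \<epsilon>"
      using u[unfolded continuous_on_iff, rule_format, OF xab \<epsilon>] by blast
    obtain d2 where d2: "d2 > 0" "\<And>t. t \<in> {a..b} \<Longrightarrow> dist t x < d2 \<Longrightarrow> dist (N (u t)) (N (u x)) < \<epsilon>"
      using Nu[unfolded continuous_on_iff, rule_format, OF xab \<epsilon>] by blast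
    have "N (I s t) - J s t \<le> \<epsilon> * ((\<bar>C\<bar> + 1) * t - (\<bar>C\<bar> + 1) * s)"
      if st: "a \<le> s" "s \<le> x" "x \<le> t" "t \<le> b" "t - s < min d1 d2" for s t
    proof -
      have s_t: "s \<le> t" using st by simp
      have near: "dist r x < d1 \<and> dist r x < d2 \<and> r \<in> {a..b}" if "r \<in> {s..t}" for r
        using that st by (auto simp: dist_real_def)
      have uc: "set_integrable lborel {s..t} (\<lambda>r. u x)" "set_integrable lborel {s..t} (\<lambda>r. N (u x) - \<epsilon>)" "set_integrable lborel {s..t} (\<lambda>r. \<epsilon>)"
        by (intro set_integrable_continuous_Icc[of s t] continuous_intros order_refl)+
      define E where "E = I s t - (t - s) *\<^sub>R u x"
      have E: "E = (LINT r:{s..t}|lborel. u r - u x)"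
        unfolding E_def I_def set_integral_const_Icc[OF s_t, symmetric]
        using st by (intro set_integral_diff(2)[symmetric] ui uc) auto
      have "norm E \<le> (LINT r:{s..t}|lborel. norm (u r - u x))"
        unfolding E using st by (intro set_integral_norm_le set_integral_diff(1) ui uc) auto
      also have "\<dots> \<le> (LINT r:{s..t}|lborel. \<epsilon>)"
        using st d1(2) near by (intro set_integral_mono set_integrable_norm set_integral_diff(1) ui uc)
          (auto simp: dist_norm less_imp_le)
      also have "\<dots> = (t - s) * \<epsilon>" using set_integral_const_Icc[OF s_t, of \<epsilon>] by simp
      finally have nE: "norm E \<le> (t - s) * \<epsilon>" .
      have EX: "E \<in> X" "(t - s) *\<^sub>R u x \<in> X"
        unfolding E_def I_def using st s_t xab by (auto intro!: X)
      have "I s t = E + (t - s) *\<^sub>R u x" by (simp add: E_def)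
      then have "N (I s t) \<le> N E + N ((t - s) *\<^sub>R u x)" using N(1)[OF EX] by simp
      also have "N ((t - s) *\<^sub>R u x) = (t - s) * N (u x)" using N(2)[OF X(2)[OF xab]] s_t by simp
      also have "N E \<le> \<bar>C\<bar> * ((t - s) * \<epsilon>)"
      proof -
        have "N E \<le> C * norm E" by (rule N(3)[OF EX(1)])
        also have "\<dots> \<le> \<bar>C\<bar> * norm E" by (intro mult_right_mono) auto
        also have "\<dots> \<le> \<bar>C\<bar> * ((t - s) * \<epsilon>)" by (intro mult_left_mono nE) auto
        finally show ?thesis .
      qed
      finally have 1: "N (I s t) \<le> \<bar>C\<bar> * ((t - s) * \<epsilon>) + (t - s) * N (u x)" by simp
      have "(t - s) * (N (u x) - \<epsilon>) = (LINT r:{s..t}|lborel. N (u x) - \<epsilon>)"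
        using set_integral_const_Icc[OF s_t, of "N (u x) - \<epsilon>"] by simp
      also have "\<dots> \<le> J s t"
        unfolding J_def using st d2(2) near
        by (intro set_integral_mono Ni uc) (fastforce simp: dist_real_def abs_less_iff)+
      finally have 2: "(t - s) * (N (u x) - \<epsilon>) \<le> J s t" .
      show ?thesis using 1 2 by (simp add: algebra_simps)
    qed
    then show "\<exists>\<delta>>0. \<forall>s t. a \<le> s \<and> s \<le> x \<and> x \<le> t \<and> t \<le> b \<and> t - s < \<delta> \<longrightarrow>
        N (I s t) - J s t \<le> \<epsilon> * ((\<bar>C\<bar> + 1) * t - (\<bar>C\<bar> + 1) * s)"
      using d1(1) d2(1) by (intro exI[of _ "min d1 d2"]) auto
  qed
  then show ?thesis by (simp add: I_def J_def)
qed

text \<open>For t > 0 this is the nonnegativity of the integral of (y - m)^2 with m the mean value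
  of y.\<close>

lemma Cauchy_Schwarz_set_integral_Icc:
  fixes y :: "real \<Rightarrow> real"
  assumes t: "0 \<le> t" and y: "continuous_on {0..t} y"
  shows "(LINT s:{0..t}|lborel. y s)\<^sup>2 \<le> t * (LINT s:{0..t}|lborel. (y s)\<^sup>2)"
proof (cases "t = 0")
  case True
  then have "(LINT s:{0..t}|lborel. y s) = 0"
    using set_integral_norm_le[OF set_integrable_continuous_Icc[OF y order_refl order_refl]]
      set_integral_Icc_combine[OF set_integrable_continuous_Icc[OF y order_refl order_refl], of t] by auto
  then show ?thesis using True by simp
next
  case False
  define Y where "Y = (LINT s:{0..t}|lborel. y s)"
  define m where "m = Y / t"
  have i: "set_integrable lborel {0..t} (\<lambda>s. (y s)\<^sup>2)" "set_integrable lborel {0..t} (\<lambda>s. 2 * m * y s)"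
    "set_integrable lborel {0..t} (\<lambda>s. m\<^sup>2)"
    by (intro set_integrable_continuous_Icc[of 0 t] continuous_intros y order_refl)+
  have "0 \<le> (LINT s:{0..t}|lborel. (y s - m)\<^sup>2)"
    unfolding set_lebesgue_integral_def by (intro Bochner_Integration.integral_nonneg) simp
  also have "\<dots> = (LINT s:{0..t}|lborel. (y s)\<^sup>2 - 2 * m * y s + m\<^sup>2)"
    by (simp add: power2_diff algebra_simps)
  also have "\<dots> = (LINT s:{0..t}|lborel. (y s)\<^sup>2) - 2 * m * Y + t * m\<^sup>2"
    using i set_integral_const_Icc[OF t, of "m\<^sup>2"]
    by (simp add: set_integral_add(2) set_integral_diff Y_def)
  finally show ?thesis
    using False t unfolding m_def Y_def[symmetric] by (simp add: power2_eq_square field_simps)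
qed

text \<open>K has no derivative here; only its increments paired with u are controlled. The defect
  of the product rule minus the claimed bound is subadditive, and on a short interval the defect is
  this pairing plus an error of second order. The Lipschitz constant of K only multiplies \<epsilon>
  and so leaves no trace in the conclusion.\<close>

lemma integration_by_parts_increment_bound:
  fixes K u v :: "real \<Rightarrow> 'b::{real_inner, banach, second_countable_topology}" and y :: "real \<Rightarrow> real"
  assumes t: "0 \<le> t" and v: "set_integrable lborel {0..t} v"
    and u: "\<And>a b. 0 \<le> a \<Longrightarrow> a \<le> b \<Longrightarrow> b \<le> t \<Longrightarrow> u b - u a = (LINT s:{a..b}|lborel. v s)"
    and K: "\<Lambda>-lipschitz_on {0..t} K"
    and y: "continuous_on {0..t} y" "\<And>s. s \<in> {0..t} \<Longrightarrow> 0 \<le> y s" and C: "C1 \<ge> 0" "C2 \<ge> 0"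
    and est: "\<And>a b. 0 \<le> a \<Longrightarrow> a \<le> b \<Longrightarrow> b \<le> t \<Longrightarrow>
      \<bar>(K b - K a) \<bullet> u b\<bar> \<le> (C1 * (LINT s:{a..b}|lborel. y s) + C2 * (b - a)) * y b"
  shows "set_integrable lborel {0..t} (\<lambda>s. K s \<bullet> v s)"
    and "\<bar>K t \<bullet> u t - K 0 \<bullet> u 0 - (LINT s:{0..t}|lborel. K s \<bullet> v s)\<bar>
      \<le> C1 * (LINT s:{0..t}|lborel. (y s)\<^sup>2) + C2 * (LINT s:{0..t}|lborel. y s)"
proof -
  have Kc: "continuous_on {0..t} K" using K by (rule lipschitz_on_continuous_on)
  have inner_i: "set_integrable lborel {0..t} (\<lambda>s. K s \<bullet> v s)"
  proof -
    have "bounded (K ` {0..t})" by (intro compact_imp_bounded compact_continuous_image Kc) simp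
    then obtain B where B: "\<And>s. s \<in> {0..t} \<Longrightarrow> norm (K s) \<le> B" unfolding bounded_iff by fastforce
    have Km: "(\<lambda>s. indicator {0..t} s *\<^sub>R K s) \<in> borel_measurable lborel"
      using borel_measurable_continuous_on_indicator[OF _ Kc] by simp
    have vm: "(\<lambda>s. indicator {0..t} s *\<^sub>R v s) \<in> borel_measurable lborel" using v by (auto simp: set_integrable_def)
    have eq: "indicator {0..t} s *\<^sub>R (K s \<bullet> v s) = (indicator {0..t} s *\<^sub>R K s) \<bullet> (indicator {0..t} s *\<^sub>R v s)" for s
      by (simp add: indicator_def)
    show ?thesis
      unfolding set_integrable_def
    proof (rule Bochner_Integration.integrable_bound)
      show "integrable lborel (\<lambda>s. B * norm (indicator {0..t} s *\<^sub>R v s))"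
        using v unfolding set_integrable_def by (intro integrable_mult_right integrable_norm)
      show "(\<lambda>s. indicator {0..t} s *\<^sub>R (K s \<bullet> v s)) \<in> borel_measurable lborel"
        unfolding eq by (rule borel_measurable_inner[OF Km vm])
      show "AE s in lborel. norm (indicator {0..t} s *\<^sub>R (K s \<bullet> v s)) \<le> norm (B * norm (indicator {0..t} s *\<^sub>R v s))"
      proof (rule AE_I2)
        fix s
        have "\<bar>K s \<bullet> v s\<bar> \<le> \<bar>B\<bar> * norm (v s)" if "s \<in> {0..t}"
        proof -
          have "\<bar>K s \<bullet> v s\<bar> \<le> norm (K s) * norm (v s)" by (rule Cauchy_Schwarz_ineq2)
          also have "\<dots> \<le> \<bar>B\<bar> * norm (v s)" using B[OF that] by (intro mult_right_mono) auto
          finally show ?thesis .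
        qed
        then show "norm (indicator {0..t} s *\<^sub>R (K s \<bullet> v s)) \<le> norm (B * norm (indicator {0..t} s *\<^sub>R v s))"
          by (auto simp: indicator_def abs_mult)
      qed
    qed
  qed
  then show "set_integrable lborel {0..t} (\<lambda>s. K s \<bullet> v s)" .
  have sub: "set_integrable lborel {a..b} f" if "set_integrable lborel {0..t} f" "0 \<le> a" "b \<le> t"
    for f :: "real \<Rightarrow> 'c::{banach, second_countable_topology}" and a b
    using that by (intro set_integrable_subset[OF that(1)]) auto
  have vn: "set_integrable lborel {0..t} (\<lambda>s. norm (v s))" using v by (rule set_integrable_norm)
  have yi: "set_integrable lborel {0..t} y" "set_integrable lborel {0..t} (\<lambda>s. (y s)\<^sup>2)"
    by (intro set_integrable_continuous_Icc[of 0 t] continuous_intros y order_refl)+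
  define P where "P a b = (LINT s:{a..b}|lborel. K s \<bullet> v s)" for a b
  define Y where "Y a b = (LINT s:{a..b}|lborel. y s)" for a b
  define Z where "Z a b = (LINT s:{a..b}|lborel. (y s)\<^sup>2)" for a b
  define W where "W a b = (LINT s:{a..b}|lborel. norm (v s))" for a b
  have comb: "P a c = P a b + P b c" "Y a c = Y a b + Y b c" "Z a c = Z a b + Z b c" "W a c = W a b + W b c"
    if "0 \<le> a" "a \<le> b" "b \<le> c" "c \<le> t" for a b c
    unfolding P_def Y_def Z_def W_def using that
    by (auto intro!: set_integral_Icc_combine sub[OF inner_i] sub[OF yi(1)] sub[OF yi(2)] sub[OF vn])
  define D where "D a b = \<bar>K b \<bullet> u b - K a \<bullet> u a - P a b\<bar> - (C1 * Z a b + C2 * Y a b)" for a b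
  have Ynn: "Y a b \<ge> 0" if "0 \<le> a" "b \<le> t" for a b
    unfolding Y_def set_lebesgue_integral_def using that y(2)
    by (intro Bochner_Integration.integral_nonneg) (auto simp: indicator_def)
  have Lam: "\<Lambda> \<ge> 0" using K by (rule lipschitz_on_nonneg)
  have "D 0 t \<le> 0"
  \<comment> \<open>The terms of \<open>m\<close> collect, in this order, the \<epsilon> errors from
    the C1 part, from the C2 part, and from freezing K at the left endpoint.\<close>
  proof (rule subadditive_local_to_global[OF t, where m = "\<lambda>s. C1 * Y 0 s + (C2 + \<Lambda>) * s"])
    fix a b c assume abc: "0 \<le> a" "a \<le> b" "b \<le> c" "c \<le> t"
    show "D a c \<le> D a b + D b c"
      unfolding D_def comb[OF abc] by (simp add: algebra_simps)
  next
    fix \<epsilon> x :: real assume \<epsilon>: "\<epsilon> > 0" and x: "0 \<le> x" "x \<le> t"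
    then have xt: "x \<in> {0..t}" and \<epsilon>2: "\<epsilon> / 2 > 0" by auto
    obtain d1 where d1: "d1 > 0" "\<And>s. s \<in> {0..t} \<Longrightarrow> dist s x < d1 \<Longrightarrow> dist (y s) (y x) < \<epsilon> / 2"
      using y(1)[unfolded continuous_on_iff, rule_format, OF xt \<epsilon>2] by blast
    \<comment> \<open>The primitive of |v| is continuous, so the integral of |v| over a short
      interval is at most \<epsilon>; this takes the place of a pointwise bound on v.\<close>
    have Wc: "continuous_on {0..t} (\<lambda>s. W 0 s)"
      unfolding W_def by (rule indefinite_integral_real_continuous[OF vn])
    obtain d2 where d2: "d2 > 0" "\<And>s. s \<in> {0..t} \<Longrightarrow> dist s x < d2 \<Longrightarrow> dist (W 0 s) (W 0 x) < \<epsilon> / 2"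
      using Wc[unfolded continuous_on_iff, rule_format, OF xt \<epsilon>2] by blast
    have "D a b \<le> \<epsilon> * (C1 * Y 0 b + (C2 + \<Lambda>) * b - (C1 * Y 0 a + (C2 + \<Lambda>) * a))"
      if ab: "0 \<le> a" "a \<le> x" "x \<le> b" "b \<le> t" "b - a < min d1 d2" for a b
    proof -
      have a_b: "a \<le> b" using ab by simp
      have near: "dist r x < d1 \<and> dist r x < d2 \<and> r \<in> {0..t}" if "r \<in> {a..b}" for r
        using that ab by (auto simp: dist_real_def)
      have yb: "y b \<le> y r + \<epsilon>" if "r \<in> {a..b}" for r
      proof -
        have "\<bar>y b - y x\<bar> < \<epsilon> / 2" "\<bar>y r - y x\<bar> < \<epsilon> / 2"
          using d1(2)[of b] d1(2)[of r] near[OF that] near[of b] a_b by (simp_all add: dist_real_def)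
        then show ?thesis by linarith
      qed
      have Wab: "W a b \<le> \<epsilon>"
      proof -
        have "\<bar>W 0 a - W 0 x\<bar> < \<epsilon> / 2" "\<bar>W 0 b - W 0 x\<bar> < \<epsilon> / 2"
          using d2(2)[of a] d2(2)[of b] near[of a] near[of b] a_b by (simp_all add: dist_real_def)
        moreover have "W 0 b = W 0 a + W a b" using comb(4)[of 0 a b] ab a_b by simp
        ultimately show ?thesis by linarith
      qed
      have yab: "set_integrable lborel {a..b} y" "set_integrable lborel {a..b} (\<lambda>s. (y s)\<^sup>2)"
        using ab by (auto intro: sub[OF yi(1)] sub[OF yi(2)])
      have c: "set_integrable lborel {a..b} (\<lambda>s. r)" for r :: real
        by (intro set_integrable_continuous_Icc[of a b] continuous_intros order_refl)
      \<comment> \<open>The end value y b is within \<epsilon> of y on the whole short interval, so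
        the product of an integral and an end value becomes the integral of the square.\<close>
      have "Y a b * y b \<le> Z a b + \<epsilon> * Y a b"
      proof -
        have "Y a b * y b = (LINT s:{a..b}|lborel. y s * y b)" unfolding Y_def by simp
        also have "\<dots> \<le> (LINT s:{a..b}|lborel. (y s)\<^sup>2 + \<epsilon> * y s)"
        proof (rule set_integral_mono)
          fix s assume s: "s \<in> {a..b}"
          have "y s * y b \<le> y s * (y s + \<epsilon>)" using yb[OF s] y(2)[of s] near[OF s] by (intro mult_left_mono) auto
          then show "y s * y b \<le> (y s)\<^sup>2 + \<epsilon> * y s" by (simp add: power2_eq_square algebra_simps)
        qed (use yab in \<open>auto intro!: set_integral_add(1)\<close>)
        also have "\<dots> = Z a b + \<epsilon> * Y a b" unfolding Y_def Z_def using yab by (simp add: set_integral_add(2))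
        finally show ?thesis .
      qed
      moreover have "(b - a) * y b \<le> Y a b + \<epsilon> * (b - a)"
      proof -
        have "(b - a) * y b = (LINT s:{a..b}|lborel. y b)" using set_integral_const_Icc[OF a_b, of "y b"] by simp
        also have "\<dots> \<le> (LINT s:{a..b}|lborel. y s + \<epsilon>)"
          using yb yab(1) c by (intro set_integral_mono set_integral_add(1)) auto
        also have "\<dots> = Y a b + \<epsilon> * (b - a)"
          unfolding Y_def using yab(1) c[of \<epsilon>] set_integral_const_Icc[OF a_b, of \<epsilon>] by (simp add: set_integral_add(2) mult.commute)
        finally show ?thesis .
      qed
      ultimately have "C1 * (Y a b * y b) + C2 * ((b - a) * y b) \<le> C1 * (Z a b + \<epsilon> * Y a b) + C2 * (Y a b + \<epsilon> * (b - a))"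
        using C by (intro add_mono mult_left_mono)
      then have 1: "\<bar>(K b - K a) \<bullet> u b\<bar> \<le> C1 * Z a b + C2 * Y a b + \<epsilon> * (C1 * Y a b + C2 * (b - a))"
        using est[of a b] ab unfolding Y_def[symmetric] by (simp add: algebra_simps)
      have vab: "set_integrable lborel {a..b} v" and iab: "set_integrable lborel {a..b} (\<lambda>s. K s \<bullet> v s)"
        using ab by (auto intro: sub[OF v] sub[OF inner_i])
      have Kai: "set_integrable lborel {a..b} (\<lambda>s. K a \<bullet> v s)"
        using integrable_inner_right[of "K a" lborel "\<lambda>s. indicator {a..b} s *\<^sub>R v s"] vab
        by (simp add: set_integrable_def)
      have "K a \<bullet> (u b - u a) = (LINT s:{a..b}|lborel. K a \<bullet> v s)"
        using u[of a b] ab a_b integral_inner_right[of "K a" lborel "\<lambda>s. indicator {a..b} s *\<^sub>R v s"] vab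
        by (simp add: set_integrable_def set_lebesgue_integral_def)
      then have "K a \<bullet> (u b - u a) - P a b = (LINT s:{a..b}|lborel. K a \<bullet> v s - K s \<bullet> v s)"
        unfolding P_def using Kai iab by (simp add: set_integral_diff(2))
      then have "\<bar>K a \<bullet> (u b - u a) - P a b\<bar> \<le> (LINT s:{a..b}|lborel. \<bar>K a \<bullet> v s - K s \<bullet> v s\<bar>)"
        using set_integral_norm_le[OF set_integral_diff(1)[OF Kai iab]] by simp
      also have "\<dots> \<le> (LINT s:{a..b}|lborel. (\<Lambda> * (b - a)) * norm (v s))"
      proof (rule set_integral_mono)
        fix s assume s: "s \<in> {a..b}"
        have "norm (K a - K s) \<le> \<Lambda> * \<bar>a - s\<bar>"
          using lipschitz_onD[OF K, of a s] near[OF s] near[of a] a_b by (simp add: dist_norm)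
        also have "\<dots> \<le> \<Lambda> * (b - a)" using s Lam by (intro mult_left_mono) auto
        finally have "norm (K a - K s) * norm (v s) \<le> (\<Lambda> * (b - a)) * norm (v s)" by (intro mult_right_mono) auto
        then show "\<bar>K a \<bullet> v s - K s \<bullet> v s\<bar> \<le> (\<Lambda> * (b - a)) * norm (v s)"
          using Cauchy_Schwarz_ineq2[of "K a - K s" "v s"] by (simp add: inner_diff_left)
      qed (use Kai iab vab in \<open>auto intro!: set_integrable_abs set_integral_diff(1) set_integrable_mult_right set_integrable_norm\<close>)
      also have "\<dots> = (\<Lambda> * (b - a)) * W a b" unfolding W_def by simp
      also have "\<dots> \<le> (\<Lambda> * (b - a)) * \<epsilon>" using Lam a_b Wab by (intro mult_left_mono) auto
      finally have 2: "\<bar>K a \<bullet> (u b - u a) - P a b\<bar> \<le> \<epsilon> * (\<Lambda> * (b - a))" by (simp add: ac_simps)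
      \<comment> \<open>K is incremented against the value of u at the right endpoint, which is
        where \<open>est\<close> applies; the rest is the integral of (K a - K s) paired with
        v.\<close>
      have "K b \<bullet> u b - K a \<bullet> u a - P a b = (K b - K a) \<bullet> u b + (K a \<bullet> (u b - u a) - P a b)"
        by (simp add: inner_diff_left inner_diff_right)
      then have "\<bar>K b \<bullet> u b - K a \<bullet> u a - P a b\<bar>
          \<le> C1 * Z a b + C2 * Y a b + \<epsilon> * (C1 * Y a b + C2 * (b - a)) + \<epsilon> * (\<Lambda> * (b - a))"
        using 1 2 by linarith
      moreover have "Y 0 b = Y 0 a + Y a b" using comb(2)[of 0 a b] ab a_b by simp
      ultimately show ?thesis unfolding D_def by (simp add: algebra_simps)
    qed
    then show "\<exists>\<delta>>0. \<forall>a b. 0 \<le> a \<and> a \<le> x \<and> x \<le> b \<and> b \<le> t \<and> b - a < \<delta> \<longrightarrow>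
        D a b \<le> \<epsilon> * (C1 * Y 0 b + (C2 + \<Lambda>) * b - (C1 * Y 0 a + (C2 + \<Lambda>) * a))"
      using d1(1) d2(1) by (intro exI[of _ "min d1 d2"]) auto
  qed
  then show "\<bar>K t \<bullet> u t - K 0 \<bullet> u 0 - (LINT s:{0..t}|lborel. K s \<bullet> v s)\<bar>
      \<le> C1 * (LINT s:{0..t}|lborel. (y s)\<^sup>2) + C2 * (LINT s:{0..t}|lborel. y s)"
    by (simp add: D_def P_def Y_def Z_def)
qed

section \<open>Application to the history operator\<close>

context L6_embedding
begin

text \<open>Used for the boundary term at the final time; no increment in time is involved there,
  and the plain Lipschitz bound is enough.\<close>

lemma nemytskii_diff_pairing_le:
  assumes lip: "L-lipschitz_on UNIV \<kappa>" and A: "A \<in> H1 \<Omega>" and B: "B \<in> H1 \<Omega>" and V: "V \<in> H1 \<Omega>"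
  shows "\<bar>nemytskii_diff \<kappa> \<Omega> A B \<bullet> V\<bar> \<le> L * L2_norm_fun \<Omega> (B - A) * L2_norm_fun \<Omega> V"
proof -
  have L: "L \<ge> 0" using lip by (rule lipschitz_on_nonneg)
  let ?N = "nemytskii_diff \<kappa> \<Omega> A B" and ?\<delta> = "h1_fun (B - A)" and ?v = "h1_fun V"
  have D: "B - A \<in> H1 \<Omega>" by (rule H1_subspace(2)[OF \<Omega>_open B A])
  have "ennreal \<bar>?N \<bullet> V\<bar> \<le> (\<integral>\<^sup>+x. ennreal (norm (rep_L2 ?N x \<bullet> rep_L2 V x)) \<partial>lborel)"
    unfolding inner_L2_eq
    using integral_norm_bound_ennreal[OF square_integrable_inner[OF square_integrable_rep square_integrable_rep], of ?N V] by simp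
  also have "\<dots> \<le> (\<integral>\<^sup>+x. ennreal L * (ennreal \<bar>?\<delta> x\<bar> * ennreal \<bar>?v x\<bar>) \<partial>lborel)"
  proof (rule nn_integral_mono_AE, use AE_h1_fun_linear(2)[of B A] rep_nemytskii_diff[OF lip \<Omega>_open, of A B] in eventually_elim)
    case (elim x)
    have "norm (rep_L2 ?N x \<bullet> rep_L2 V x) = \<bar>indicator \<Omega> x * (\<kappa> (h1_fun B x) - \<kappa> (h1_fun A x))\<bar> * \<bar>?v x\<bar>"
      using elim by (simp add: rep_L2_eq_Pair[of V] abs_mult)
    also have "\<dots> \<le> (L * \<bar>?\<delta> x\<bar>) * \<bar>?v x\<bar>"
      using elim L lipschitz_onD[OF lip, of "h1_fun B x" "h1_fun A x"]
      by (intro mult_right_mono) (auto simp: dist_real_def indicator_def)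
    finally have "ennreal (norm (rep_L2 ?N x \<bullet> rep_L2 V x)) \<le> ennreal (L * \<bar>?\<delta> x\<bar> * \<bar>?v x\<bar>)" by (rule ennreal_leI)
    then show ?case using L by (simp add: ennreal_mult mult.assoc)
  qed
  also have "\<dots> = ennreal L * (\<integral>\<^sup>+x. ennreal \<bar>?\<delta> x\<bar> * ennreal \<bar>?v x\<bar> \<partial>lborel)"
    by (rule nn_integral_cmult) measurable
  also have "\<dots> \<le> ennreal L * ennreal (L2_norm_fun \<Omega> (B - A) * L2_norm_fun \<Omega> V)"
    by (intro mult_left_mono nn_integral_pairing_le[OF \<Omega>_open D V]) simp
  also have "\<dots> = ennreal (L * L2_norm_fun \<Omega> (B - A) * L2_norm_fun \<Omega> V)"
    using L by (simp add: ennreal_mult[symmetric] L2_norm_fun_nonneg mult.assoc)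
  finally show ?thesis
    using L by (subst (asm) ennreal_le_iff) (auto simp: L2_norm_fun_nonneg)
qed

lemma L6_norm_continuous_on:
  fixes u :: "real \<Rightarrow> 'a h1"
  assumes u: "continuous_on I u" and H: "\<And>t. t \<in> I \<Longrightarrow> u t \<in> H1 \<Omega>"
  shows "continuous_on I (\<lambda>t. L6_norm \<Omega> (u t))"
  unfolding continuous_on_iff
proof (intro ballI allI impI)
  fix t and e :: real assume t: "t \<in> I" and e: "e > 0"
  have e': "e / (S + 1) > 0" using e S_nonneg by simp
  obtain d where d: "d > 0" "\<And>s. s \<in> I \<Longrightarrow> dist s t < d \<Longrightarrow> dist (u s) (u t) < e / (S + 1)"
    using u[unfolded continuous_on_iff, rule_format, OF t e'] by blast
  have diff: "L6_norm \<Omega> x \<le> L6_norm \<Omega> y + S * norm (x - y)" if "x \<in> H1 \<Omega>" "y \<in> H1 \<Omega>" for x y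
    using L6_norm_add[OF that(2) H1_subspace(2)[OF \<Omega>_open that]] L6_norm_le[OF H1_subspace(2)[OF \<Omega>_open that]] by simp
  have "dist (L6_norm \<Omega> (u s)) (L6_norm \<Omega> (u t)) < e" if s: "s \<in> I" "dist s t < d" for s
  proof -
    have "S * norm (u s - u t) \<le> (S + 1) * norm (u s - u t)" by (simp add: algebra_simps)
    also have "\<dots> < (S + 1) * (e / (S + 1))"
      using d(2)[OF s] S_nonneg by (intro mult_strict_left_mono) (auto simp: dist_norm)
    also have "\<dots> = e" using S_nonneg by simp
    finally have "S * norm (u s - u t) < e" .
    then show ?thesis
      using diff[OF H[OF s(1)] H[OF t]] diff[OF H[OF t] H[OF s(1)]] by (simp add: dist_real_def norm_minus_commute)
  qed
  then show "\<exists>d>0. \<forall>s\<in>I. dist s t < d \<longrightarrow> dist (L6_norm \<Omega> (u s)) (L6_norm \<Omega> (u t)) < e"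
    using d(1) by blast
qed

text \<open>Origin of the constant: \<open>L * K0\<close> is the first-order part of the second
  difference, with K0 converting two L^2 norms into L^6 norms; \<open>2 * g * S * B\<close> is its
  second-order part; \<open>L\<^sup>2 * K0 / \<alpha>\<close> is the price of absorbing the boundary
  term. The last two multiply the squared time integral of the L^6 norm, which Cauchy-Schwarz turns
  into T times the integral of the square.\<close>

lemma nemytskii_time_pairing_bound:
  fixes q1 q2 :: "real \<Rightarrow> 'a h1" and y0 :: "'a h1"
  defines "K0 \<equiv> root 3 ((measure lborel \<Omega>)\<^sup>2)"
  assumes lip: "L-lipschitz_on UNIV \<kappa>" and \<alpha>: "\<alpha> > 0"
    and snd: "\<And>a a' b b'. \<bar>\<kappa> b' - \<kappa> b - \<kappa> a' + \<kappa> a\<bar> \<le> L * \<bar>(b' - b) - (a' - a)\<bar>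
      + \<bar>a' - a\<bar> * (\<bar>b - a\<bar> + \<bar>b' - a'\<bar>) * (c1 * (\<bar>a\<bar> + \<bar>a'\<bar> + \<bar>b\<bar> + \<bar>b'\<bar>) powr \<rho> + c0)"
    and c: "c1 \<ge> 0" "c0 \<ge> 0" and T: "T > 0" and y0: "y0 \<in> H1 \<Omega>"
    and q: "q1 \<in> H1_time T (H1 \<Omega>)" "q2 \<in> H1_time T (H1 \<Omega>)"
    and B: "\<And>t. t \<in> {0..T} \<Longrightarrow> norm (q1 t) \<le> B" "\<And>t. t \<in> {0..T} \<Longrightarrow> norm (q2 t) \<le> B" "B \<ge> 0"
    and G: "\<And>A A' B B'. A \<in> H1 \<Omega> \<Longrightarrow> A' \<in> H1 \<Omega> \<Longrightarrow> B \<in> H1 \<Omega> \<Longrightarrow> B' \<in> H1 \<Omega> \<Longrightarrow>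
      norm A \<le> R \<Longrightarrow> norm A' \<le> R \<Longrightarrow> norm B \<le> R \<Longrightarrow> norm B' \<le> R \<Longrightarrow>
      (\<integral>\<^sup>+x. (ennreal (c1 * (\<bar>h1_fun A x\<bar> + \<bar>h1_fun A' x\<bar> + \<bar>h1_fun B x\<bar> + \<bar>h1_fun B' x\<bar>) powr \<rho> + c0) * indicator \<Omega> x)\<^sup>2 \<partial>lborel) \<le> ennreal (g\<^sup>2)"
    and g: "g \<ge> 0" and R: "T * B + norm y0 \<le> R" and t: "t \<in> {0..T}"
  shows "(LINT s:{0..t}|lborel.
           - L2_pairing \<Omega> (\<lambda>x. kappa_history \<kappa> y0 q2 s x - kappa_history \<kappa> y0 q1 s x)
               (h1_fun (time_deriv T (H1 \<Omega>) q2 s - time_deriv T (H1 \<Omega>) q1 s)))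
    \<le> \<alpha> / 4 * (L2_norm_fun \<Omega> (q2 t - q1 t))\<^sup>2
      + (L * K0 + (2 * g * S * B + L\<^sup>2 * K0 / \<alpha>) * T) * (LINT s:{0..t}|lborel. (L6_norm \<Omega> (q2 s - q1 s))\<^sup>2)"
proof -
  have L: "L \<ge> 0" using lip by (rule lipschitz_on_nonneg)
  have K0: "K0 \<ge> 0" by (simp add: K0_def)
  define u where "u s = q2 s - q1 s" for s
  define v where "v s = time_deriv T (H1 \<Omega>) q2 s - time_deriv T (H1 \<Omega>) q1 s" for s
  define y where "y s = L6_norm \<Omega> (u s)" for s
  define K where "K s = nemytskii_diff \<kappa> \<Omega> (history y0 q1 s) (history y0 q2 s)" for s
  have qc: "continuous_on {0..T} q1" "continuous_on {0..T} q2" and qH: "\<And>s. s \<in> {0..T} \<Longrightarrow> q1 s \<in> H1 \<Omega>" "\<And>s. s \<in> {0..T} \<Longrightarrow> q2 s \<in> H1 \<Omega>"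
    using q by (auto simp: H1_time_def)
  have uc: "continuous_on {0..T} u" unfolding u_def[abs_def] by (intro continuous_intros qc)
  have uH: "u s \<in> H1 \<Omega>" if "s \<in> {0..T}" for s unfolding u_def using that by (intro H1_subspace(2) \<Omega>_open qH)
  have yc: "continuous_on {0..T} y" unfolding y_def[abs_def] by (rule L6_norm_continuous_on[OF uc uH])
  have ynn: "y s \<ge> 0" for s by (simp add: y_def L6_norm_nonneg)
  have qi: "set_integrable lborel {a..b} q1" "set_integrable lborel {a..b} q2" "set_integrable lborel {a..b} u" "set_integrable lborel {a..b} y"
    if "0 \<le> a" "b \<le> T" for a b
    using that by (auto intro: set_integrable_continuous_Icc[OF qc(1)] set_integrable_continuous_Icc[OF qc(2)]
        set_integrable_continuous_Icc[OF uc] set_integrable_continuous_Icc[OF yc])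
  have hist_diff: "history y0 q b - history y0 q a = (LINT s:{a..b}|lborel. q s)"
    if "0 \<le> a" "a \<le> b" "b \<le> T" "q = q1 \<or> q = q2" for a b and q :: "real \<Rightarrow> 'a h1"
    unfolding history_def using that qi set_integral_Icc_combine[of 0 b q a] by auto
  have int_norm: "norm (LINT s:{a..b}|lborel. q s) \<le> (b - a) * B" if ab: "0 \<le> a" "a \<le> b" "b \<le> T" "q = q1 \<or> q = q2" for a b and q :: "real \<Rightarrow> 'a h1"
  proof -
    have i: "set_integrable lborel {a..b} q" using qi[OF ab(1,3)] ab(4) by auto
    have "norm (LINT s:{a..b}|lborel. q s) \<le> (LINT s:{a..b}|lborel. norm (q s))" by (rule set_integral_norm_le[OF i])
    also have "\<dots> \<le> (LINT s:{a..b}|lborel. B)"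
      using ab B by (intro set_integral_mono set_integrable_norm i set_integrable_continuous_Icc[of a b] continuous_intros) auto
    also have "\<dots> = (b - a) * B" using set_integral_const_Icc[OF ab(2), of B] by simp
    finally show ?thesis .
  qed
  have histH: "history y0 q s \<in> H1 \<Omega>" if "s \<in> {0..T}" "q = q1 \<or> q = q2" for s and q :: "real \<Rightarrow> 'a h1"
    unfolding history_def using that qi qH by (intro H1_subspace(1) \<Omega>_open y0 set_integral_in_H1) auto
  have histR: "norm (history y0 q s) \<le> R" if s: "s \<in> {0..T}" "q = q1 \<or> q = q2" for s and q :: "real \<Rightarrow> 'a h1"
  proof -
    have "norm (history y0 q s) \<le> (s - 0) * B + norm y0"
      unfolding history_def using int_norm[of 0 s q] s by (intro norm_triangle_mono) auto
    also have "\<dots> \<le> T * B + norm y0" using s B(3) by (simp add: mult_right_mono)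
    finally show ?thesis using R by simp
  qed
  have w: "history y0 q2 s - history y0 q1 s = (LINT r:{0..s}|lborel. u r)" if "s \<in> {0..T}" for s
    unfolding history_def u_def using that qi by (simp add: set_integral_diff(2))
  have uint: "(LINT r:{a..b}|lborel. u r) \<in> H1 \<Omega>" if "0 \<le> a" "b \<le> T" for a b
    using that qi uH by (intro set_integral_in_H1 \<Omega>_open) auto
  have N6u: "L6_norm \<Omega> (LINT r:{a..b}|lborel. u r) \<le> (LINT r:{a..b}|lborel. y r)" if ab: "0 \<le> a" "a \<le> b" "b \<le> T" for a b
    unfolding y_def
  proof (rule seminorm_integral_le[where X = "H1 \<Omega>" and C = S])
    show "continuous_on {a..b} u" "continuous_on {a..b} (\<lambda>t. L6_norm \<Omega> (u t))"
      using ab uc yc unfolding y_def by (auto intro: continuous_on_subset)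
  qed (use ab uint uH in \<open>auto intro: H1_subspace[OF \<Omega>_open] L6_norm_add L6_norm_scaleR L6_norm_le\<close>)
  define k where "k = sqrt K0"
  have N2: "L2_norm_fun \<Omega> U \<le> k * L6_norm \<Omega> U" if "U \<in> H1 \<Omega>" for U
  proof (rule power2_le_imp_le)
    show "(L2_norm_fun \<Omega> U)\<^sup>2 \<le> (k * L6_norm \<Omega> U)\<^sup>2"
      using L2_norm_fun_le_L6_norm[OF that] K0 by (simp add: k_def power_mult_distrib K0_def)
  qed (use K0 in \<open>simp add: k_def L6_norm_nonneg\<close>)
  have k: "k \<ge> 0" "k * k = K0" using K0 by (auto simp: k_def)
  have t0: "0 \<le> t" "t \<le> T" using t by auto
  \<comment> \<open>The integral over the whole of [0, t] dominates the L^6 norm of the difference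
    of the histories at every earlier time. Freezing it there makes the coefficient of b - a in
    \<open>est\<close> a constant.\<close>
  define Y where "Y = (LINT s:{0..t}|lborel. y s)"
  have Ymono: "(LINT s:{0..a}|lborel. y s) \<le> Y" if "0 \<le> a" "a \<le> t" for a
    unfolding Y_def set_lebesgue_integral_def using that t0 ynn qi(4)[of 0 a] qi(4)[of 0 t]
    by (intro integral_mono) (auto simp: set_integrable_def indicator_def)
  have Y0: "Y \<ge> 0" unfolding Y_def set_lebesgue_integral_def using ynn by (intro Bochner_Integration.integral_nonneg) auto
  have wY: "L6_norm \<Omega> (history y0 q2 a - history y0 q1 a) \<le> Y" if "0 \<le> a" "a \<le> t" for a
    using N6u[of 0 a] Ymono[OF that] w[of a] that t0 by simp
  \<comment> \<open>Over the interval from a to b the history of q1 moves by at most (b - a) B in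
    H^1(\<Omega>), hence by S times that in L^6; the differences of the two histories at a and at b
    contribute at most 2 Y.\<close>
  have est: "\<bar>(K b - K a) \<bullet> u b\<bar> \<le> (L * K0 * (LINT s:{a..b}|lborel. y s) + (2 * g * S * B * Y) * (b - a)) * y b"
    if ab: "0 \<le> a" "a \<le> b" "b \<le> t" for a b
  proof -
    have abT: "a \<in> {0..T}" "b \<in> {0..T}" "b \<le> T" using ab t0 by auto
    let ?Q1 = "history y0 q1" and ?Q2 = "history y0 q2"
    note H = histH[OF abT(1), of q1] histH[OF abT(2), of q1] histH[OF abT(1), of q2] histH[OF abT(2), of q2]
    note RR = histR[OF abT(1), of q1] histR[OF abT(2), of q1] histR[OF abT(1), of q2] histR[OF abT(2), of q2]
    have main: "\<bar>(K b - K a) \<bullet> u b\<bar> \<le> L * L2_norm_fun \<Omega> ((?Q2 b - ?Q2 a) - (?Q1 b - ?Q1 a)) * L2_norm_fun \<Omega> (u b)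
      + g * L6_norm \<Omega> (?Q1 b - ?Q1 a) * (L6_norm \<Omega> (?Q2 a - ?Q1 a) + L6_norm \<Omega> (?Q2 b - ?Q1 b)) * L6_norm \<Omega> (u b)"
      unfolding K_def using H RR uH[OF abT(2)] g
      by (intro nemytskii_second_difference_pairing[OF lip snd c] G) auto
    have dw: "(?Q2 b - ?Q2 a) - (?Q1 b - ?Q1 a) = (LINT r:{a..b}|lborel. u r)"
      using hist_diff[OF ab(1,2) abT(3), of q1] hist_diff[OF ab(1,2) abT(3), of q2] qi[OF ab(1) abT(3)]
      by (simp add: u_def set_integral_diff(2))
    have 1: "L2_norm_fun \<Omega> ((?Q2 b - ?Q2 a) - (?Q1 b - ?Q1 a)) \<le> k * (LINT s:{a..b}|lborel. y s)"
      unfolding dw using N2[OF uint[OF ab(1) abT(3)]] mult_left_mono[OF N6u[OF ab(1,2) abT(3)] k(1)] by linarith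
    have 2: "L2_norm_fun \<Omega> (u b) \<le> k * y b" unfolding y_def by (rule N2[OF uH[OF abT(2)]])
    have "L6_norm \<Omega> (?Q1 b - ?Q1 a) \<le> S * norm (?Q1 b - ?Q1 a)"
      using H by (intro L6_norm_le H1_subspace(2) \<Omega>_open) auto
    also have "\<dots> \<le> S * ((b - a) * B)"
      using hist_diff[OF ab(1,2) abT(3), of q1] int_norm[OF ab(1,2) abT(3), of q1] S_nonneg by (intro mult_left_mono) auto
    finally have 3: "L6_norm \<Omega> (?Q1 b - ?Q1 a) \<le> S * ((b - a) * B)" .
    have 4: "L6_norm \<Omega> (?Q2 a - ?Q1 a) + L6_norm \<Omega> (?Q2 b - ?Q1 b) \<le> 2 * Y"
      using wY[of a] wY[of b] ab by simp
    have Yab: "0 \<le> (LINT s:{a..b}|lborel. y s)"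
      unfolding set_lebesgue_integral_def using ynn by (intro Bochner_Integration.integral_nonneg) auto
    have "L * L2_norm_fun \<Omega> ((?Q2 b - ?Q2 a) - (?Q1 b - ?Q1 a)) * L2_norm_fun \<Omega> (u b) \<le> L * (k * (LINT s:{a..b}|lborel. y s)) * (k * y b)"
      using 1 2 L k Yab ynn by (intro mult_mono mult_left_mono) (auto simp: L2_norm_fun_nonneg)
    moreover have "g * L6_norm \<Omega> (?Q1 b - ?Q1 a) * (L6_norm \<Omega> (?Q2 a - ?Q1 a) + L6_norm \<Omega> (?Q2 b - ?Q1 b)) * L6_norm \<Omega> (u b)
        \<le> g * (S * ((b - a) * B)) * (2 * Y) * y b"
      unfolding y_def[symmetric] using 3 4 g S_nonneg B(3) ab Y0 ynn
      by (intro mult_right_mono mult_mono mult_left_mono) (auto simp: L6_norm_nonneg)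
    moreover have "L * (k * (LINT s:{a..b}|lborel. y s)) * (k * y b) = L * K0 * (LINT s:{a..b}|lborel. y s) * y b"
      unfolding k(2)[symmetric] by (simp only: ac_simps)
    ultimately have "\<bar>(K b - K a) \<bullet> u b\<bar> \<le> L * K0 * (LINT s:{a..b}|lborel. y s) * y b + g * (S * ((b - a) * B)) * (2 * Y) * y b"
      using main by linarith
    then show ?thesis by (simp add: algebra_simps)
  qed
  \<comment> \<open>Each history moves at speed at most B, and there are two of them. Only
    qualitative use is made of this constant.\<close>
  have Klip: "(2 * L * B)-lipschitz_on {0..t} K"
  proof (rule lipschitz_onI)
    have le: "dist (K a) (K b) \<le> 2 * L * B * dist a b" if ab: "0 \<le> a" "a \<le> b" "b \<le> t" for a b
    proof -
      have abT: "b \<le> T" using ab t0 by auto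
      have "norm (K b - K a) \<le> L * norm (history y0 q2 b - history y0 q2 a) + L * norm (history y0 q1 b - history y0 q1 a)"
        unfolding K_def by (rule norm_nemytskii_diff_diff_le[OF lip \<Omega>_open])
      also have "\<dots> \<le> L * ((b - a) * B) + L * ((b - a) * B)"
        using hist_diff[OF ab(1,2) abT] int_norm[OF ab(1,2) abT] L by (intro add_mono mult_left_mono) auto
      finally show ?thesis using ab by (simp add: dist_norm norm_minus_commute algebra_simps)
    qed
    show "dist (K a) (K b) \<le> 2 * L * B * dist a b" if "a \<in> {0..t}" "b \<in> {0..t}" for a b
      using le[of a b] le[of b a] that by (cases "a \<le> b") (auto simp: dist_commute)
    show "0 \<le> 2 * L * B" using L B(3) by simp
  qed
  have vi: "set_integrable lborel {0..T} (time_deriv T (H1 \<Omega>) q1)" "set_integrable lborel {0..T} (time_deriv T (H1 \<Omega>) q2)"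
    by (intro L2_time_integrable(2)[OF time_deriv_L2_weak(1)] q)+
  have vs: "set_integrable lborel {a..b} (time_deriv T (H1 \<Omega>) q1)" "set_integrable lborel {a..b} (time_deriv T (H1 \<Omega>) q2)"
    if "0 \<le> a" "b \<le> T" for a b
    using that by (auto intro: set_integrable_subset[OF vi(1)] set_integrable_subset[OF vi(2)])
  have v0: "set_integrable lborel {0..t} v"
    unfolding v_def[abs_def] using vs[of 0 t] t0 by (intro set_integral_diff(1)) auto
  have uv: "u b - u a = (LINT s:{a..b}|lborel. v s)" if ab: "0 \<le> a" "a \<le> b" "b \<le> t" for a b
  proof -
    have "u b - u a = (q2 b - q2 a) - (q1 b - q1 a)" by (simp add: u_def)
    also have "\<dots> = (LINT s:{a..b}|lborel. v s)"
      using H1_time_ftc[OF q(1) T, of a b] H1_time_ftc[OF q(2) T, of a b] vs[of a b] ab t0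
      by (simp add: v_def set_integral_diff(2))
    finally show ?thesis .
  qed
  have C: "0 \<le> L * K0" "0 \<le> 2 * g * S * B * Y" using L K0 g S_nonneg B(3) Y0 by auto
  have yct: "continuous_on {0..t} y" by (rule continuous_on_subset[OF yc]) (use t0 in auto)
  note ibp = integration_by_parts_increment_bound[OF t0(1) v0 uv Klip yct ynn C est]
  \<comment> \<open>Both histories start at y0, so the boundary term at time 0 vanishes.\<close>
  have "history y0 q2 0 - history y0 q1 0 = 0"
    using set_integral_Icc_combine[of 0 0 u 0] qi(3)[of 0 0] w[of 0] T by simp
  then have "norm (K 0) \<le> 0" unfolding K_def using norm_nemytskii_diff_le[OF lip \<Omega>_open, of "history y0 q1 0" "history y0 q2 0"] by simp
  then have K00: "K 0 = 0" by simp
  define Z where "Z = (LINT s:{0..t}|lborel. (y s)\<^sup>2)"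
  have "Y\<^sup>2 \<le> t * Z" unfolding Y_def Z_def by (rule Cauchy_Schwarz_set_integral_Icc[OF t0(1) yct])
  also have "\<dots> \<le> T * Z"
    unfolding Z_def set_lebesgue_integral_def using t0
    by (intro mult_right_mono Bochner_Integration.integral_nonneg) auto
  finally have YZ: "Y\<^sup>2 \<le> T * Z" .
  have eq: "(LINT s:{0..t}|lborel.
           - L2_pairing \<Omega> (\<lambda>x. kappa_history \<kappa> y0 q2 s x - kappa_history \<kappa> y0 q1 s x)
               (h1_fun (time_deriv T (H1 \<Omega>) q2 s - time_deriv T (H1 \<Omega>) q1 s))) = - (LINT s:{0..t}|lborel. K s \<bullet> v s)"
    unfolding kappa_history_def inner_nemytskii_diff[OF lip \<Omega>_open, symmetric] K_def v_def
    by (simp add: set_lebesgue_integral_def)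
  let ?n = "L2_norm_fun \<Omega> (u t)" and ?w = "L2_norm_fun \<Omega> (history y0 q2 t - history y0 q1 t)"
  have "\<bar>K t \<bullet> u t\<bar> \<le> L * ?w * ?n"
    unfolding K_def using t by (intro nemytskii_diff_pairing_le lip histH uH) auto
  also have "\<dots> \<le> L * (k * Y) * ?n"
  proof -
    have "?w \<le> k * L6_norm \<Omega> (history y0 q2 t - history y0 q1 t)"
      using t by (intro N2 H1_subspace(2) \<Omega>_open histH) auto
    also have "\<dots> \<le> k * Y" using wY[of t] t0 k by (intro mult_left_mono) auto
    finally show ?thesis using L by (intro mult_right_mono mult_left_mono) (auto simp: L2_norm_fun_nonneg)
  qed
  also have "\<dots> \<le> \<alpha> / 4 * ?n\<^sup>2 + L\<^sup>2 * K0 / \<alpha> * Y\<^sup>2"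
  proof -
    \<comment> \<open>Young's inequality, weighted to leave exactly \<alpha>/4 in front of the
      squared L^2 norm at time t.\<close>
    have "0 \<le> (\<alpha> / 2 * ?n - L * (k * Y))\<^sup>2 / \<alpha>" using \<alpha> by simp
    also have "\<dots> = \<alpha> / 4 * ?n\<^sup>2 + L\<^sup>2 * (k * k) / \<alpha> * Y\<^sup>2 - L * (k * Y) * ?n"
      using \<alpha> by (simp add: power2_eq_square field_simps)
    finally show ?thesis unfolding k(2) by simp
  qed
  finally have Kt: "\<bar>K t \<bullet> u t\<bar> \<le> \<alpha> / 4 * ?n\<^sup>2 + L\<^sup>2 * K0 / \<alpha> * Y\<^sup>2" .
  have "- (LINT s:{0..t}|lborel. K s \<bullet> v s) \<le> \<bar>K t \<bullet> u t\<bar> + (L * K0 * Z + 2 * g * S * B * Y * Y)"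
    using ibp(2) unfolding K00 Y_def[symmetric] Z_def[symmetric] by simp
  also have "\<dots> \<le> \<alpha> / 4 * ?n\<^sup>2 + (L * K0 * Z + (2 * g * S * B + L\<^sup>2 * K0 / \<alpha>) * Y\<^sup>2)"
    using Kt by (simp add: algebra_simps power2_eq_square)
  also have "\<dots> \<le> \<alpha> / 4 * ?n\<^sup>2 + (L * K0 * Z + (2 * g * S * B + L\<^sup>2 * K0 / \<alpha>) * (T * Z))"
    using YZ g S_nonneg B(3) K0 \<alpha> by (intro add_left_mono mult_left_mono) auto
  finally show ?thesis
    unfolding eq by (simp add: u_def y_def Z_def algebra_simps)
qed

end

theorem proposition6p10:
  fixes \<Omega> :: "(real ^ 'n::finite) set"
    and y0 :: "(real ^ 'n) h1"
    and T \<alpha> L c1 c0 \<rho> M :: real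
  assumes "CARD('n) = 2 \<or> CARD('n) = 3"
    and "bounded_lipschitz_domain \<Omega>"
    and "y0 \<in> H1 \<Omega>"
    and "T > 0" and "\<alpha> > 0" and "L > 0" and "c1 > 0" and "c0 > 0" and "M > 0"
    and "\<rho> \<ge> 1" and "CARD('n) = 3 \<longrightarrow> \<rho> \<le> 3"
  shows "\<exists>c>0. \<forall>(\<kappa> :: real \<Rightarrow> real) (\<kappa>'' :: real \<Rightarrow> real) q1 q2.
      (\<forall>y. \<kappa> y \<ge> 0) \<longrightarrow>
      L-lipschitz_on UNIV \<kappa> \<longrightarrow>
      \<kappa> differentiable_on UNIV \<longrightarrow>
      has_W11_derivative (deriv \<kappa>) \<kappa>'' \<longrightarrow>
      (AE y in lborel. \<bar>\<kappa>'' y\<bar> \<le> c1 * \<bar>y\<bar> powr \<rho> + c0) \<longrightarrow>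
      q1 \<in> H1_time T (H1 \<Omega>) \<longrightarrow>
      q2 \<in> H1_time T (H1 \<Omega>) \<longrightarrow>
      norm_H1_time T (H1 \<Omega>) q1 \<le> M \<longrightarrow>
      norm_H1_time T (H1 \<Omega>) q2 \<le> M \<longrightarrow>
      (\<forall>t\<in>{0..T}.
        (LINT s:{0..t}|lborel.
           - L2_pairing \<Omega>
               (\<lambda>x. kappa_history \<kappa> y0 q2 s x - kappa_history \<kappa> y0 q1 s x)
               (h1_fun (time_deriv T (H1 \<Omega>) q2 s - time_deriv T (H1 \<Omega>) q1 s)))
        \<le> \<alpha> / 4 * (Lp_norm 2 \<Omega> (h1_fun (q2 t - q1 t)))\<^sup>2
          + c * (LINT s:{0..t}|lborel. (Lp_norm 6 \<Omega> (h1_fun (q2 s - q1 s)))\<^sup>2))"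
proof -
  note N = assms(1) and \<Omega> = assms(2)
  have o: "open \<Omega>" "bounded \<Omega>" using \<Omega> by (auto simp: bounded_lipschitz_domain_def)
  obtain C6 where C6: "C6 \<ge> 0" "\<And>U. U \<in> H1 \<Omega> \<Longrightarrow> (\<integral>\<^sup>+x. ennreal (\<bar>h1_fun U x\<bar> ^ (2 * 3)) \<partial>lborel) \<le> ennreal (C6 * norm U ^ (2 * 3))"
    by (rule sobolev_lipschitz_domain[OF N \<Omega>, of 3]) auto
  \<comment> \<open>An integer exponent above \<rho>, so that the embedding can be stated with even
    integer powers. In dimension three only L^6 is at hand, which corresponds to n = 3; in dimension
    two every n \<ge> 1 is available.\<close>
  define n where "n = (if CARD('n) = 3 then 3 else nat \<lceil>\<rho>\<rceil>)"
  have n: "n \<ge> 1" "CARD('n) = 3 \<Longrightarrow> n = 3" "\<rho> \<le> real n"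
    using assms(10,11) by (auto simp: n_def le_nat_iff)
  obtain C where C: "C \<ge> 0" "\<And>U. U \<in> H1 \<Omega> \<Longrightarrow> (\<integral>\<^sup>+x. ennreal (\<bar>h1_fun U x\<bar> ^ (2 * n)) \<partial>lborel) \<le> ennreal (C * norm U ^ (2 * n))"
    by (rule sobolev_lipschitz_domain[OF N \<Omega> n(1,2)]) auto
  \<comment> \<open>The sixth root brings the embedding constant to the form in which it scales the
    norm itself.\<close>
  define S where "S = root 6 C6"
  interpret L6_embedding \<Omega> S
  proof
    show "S \<ge> 0" using C6(1) by (simp add: S_def)
    show "(\<integral>\<^sup>+x. ennreal (h1_fun U x ^ 6) \<partial>lborel) \<le> ennreal ((S * norm U) ^ 6)" if "U \<in> H1 \<Omega>" for U
      using C6(2)[OF that] C6(1) by (simp add: S_def power_mult_distrib)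
  qed (use o in auto)
  \<comment> \<open>The chain of uniform bounds: B for the values of q1 and q2 from
    \<open>H1_time_sup_bound\<close>, R for their histories, g for the growth factor. All are fixed
    before \<kappa>, q1 and q2 are introduced.\<close>
  define B where "B = (T + M\<^sup>2) / T + (T + M\<^sup>2)"
  define R where "R = T * B + norm y0"
  define g where "g = sqrt ((c1 + c0)\<^sup>2 * 5 ^ (2 * n) * (measure lborel \<Omega> + 4 * (C * R ^ (2 * n))))"
  define K0 where "K0 = root 3 ((measure lborel \<Omega>)\<^sup>2)"
  define c where "c = L * K0 + (2 * g * S * B + L\<^sup>2 * K0 / \<alpha>) * T"
  have B: "B \<ge> 0" using assms(4) by (simp add: B_def)
  have R: "R \<ge> 0" using B assms(4) by (simp add: R_def)
  have g2: "g\<^sup>2 = (c1 + c0)\<^sup>2 * 5 ^ (2 * n) * (measure lborel \<Omega> + 4 * (C * R ^ (2 * n)))"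
    unfolding g_def using C(1) R by (intro real_sqrt_pow2 mult_nonneg_nonneg add_nonneg_nonneg) auto
  have g: "g \<ge> 0" unfolding g_def using C(1) R by simp
  have c: "c \<ge> 0" unfolding c_def K0_def using assms g S_nonneg B by simp
  show ?thesis
  \<comment> \<open>The estimate holds with c, which is only known to be nonnegative; adding 1 makes
    the constant strictly positive, and the integral it multiplies is nonnegative.\<close>
  proof (intro exI[of _ "c + 1"] conjI allI impI ballI)
    show "c + 1 > 0" using c by simp
    fix \<kappa> \<kappa>'' :: "real \<Rightarrow> real" and q1 q2 t
    assume \<kappa>: "L-lipschitz_on UNIV \<kappa>" "\<kappa> differentiable_on UNIV" "has_W11_derivative (deriv \<kappa>) \<kappa>''"
        "AE y in lborel. \<bar>\<kappa>'' y\<bar> \<le> c1 * \<bar>y\<bar> powr \<rho> + c0"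
      and q: "q1 \<in> H1_time T (H1 \<Omega>)" "q2 \<in> H1_time T (H1 \<Omega>)"
      and M: "norm_H1_time T (H1 \<Omega>) q1 \<le> M" "norm_H1_time T (H1 \<Omega>) q2 \<le> M"
      and t: "t \<in> {0..T}"
    define Z where "Z = (LINT s:{0..t}|lborel. (Lp_norm 6 \<Omega> (h1_fun (q2 s - q1 s)))\<^sup>2)"
    have "(LINT s:{0..t}|lborel.
           - L2_pairing \<Omega>
               (\<lambda>x. kappa_history \<kappa> y0 q2 s x - kappa_history \<kappa> y0 q1 s x)
               (h1_fun (time_deriv T (H1 \<Omega>) q2 s - time_deriv T (H1 \<Omega>) q1 s)))
        \<le> \<alpha> / 4 * (L2_norm_fun \<Omega> (q2 t - q1 t))\<^sup>2 + c * (LINT s:{0..t}|lborel. (L6_norm \<Omega> (q2 s - q1 s))\<^sup>2)"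
      unfolding c_def K0_def
    proof (rule nemytskii_time_pairing_bound[OF \<kappa>(1) assms(5) second_difference_bound[OF \<kappa>] _ _ assms(4,3) q])
      show "norm (q1 s) \<le> B" "norm (q2 s) \<le> B" if "s \<in> {0..T}" for s
        unfolding B_def by (rule H1_time_sup_bound[OF q(1) assms(4) M(1) that] H1_time_sup_bound[OF q(2) assms(4) M(2) that])+
      show "(\<integral>\<^sup>+x. (ennreal (c1 * (\<bar>h1_fun A x\<bar> + \<bar>h1_fun A' x\<bar> + \<bar>h1_fun B x\<bar> + \<bar>h1_fun B' x\<bar>) powr \<rho> + c0) * indicator \<Omega> x)\<^sup>2 \<partial>lborel)
          \<le> ennreal (g\<^sup>2)"
        if "A \<in> H1 \<Omega>" "A' \<in> H1 \<Omega>" "B \<in> H1 \<Omega>" "B' \<in> H1 \<Omega>" "norm A \<le> R" "norm A' \<le> R" "norm B \<le> R" "norm B' \<le> R" for A A' B B'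
        unfolding g2 using assms n(3) C(1) R that by (intro growth_integral_le C(2)) auto
    qed (use assms B g t R_def in auto)
    moreover have "0 \<le> Z"
      unfolding Z_def set_lebesgue_integral_def by (intro Bochner_Integration.integral_nonneg) simp
    ultimately show "(LINT s:{0..t}|lborel.
           - L2_pairing \<Omega>
               (\<lambda>x. kappa_history \<kappa> y0 q2 s x - kappa_history \<kappa> y0 q1 s x)
               (h1_fun (time_deriv T (H1 \<Omega>) q2 s - time_deriv T (H1 \<Omega>) q1 s)))
        \<le> \<alpha> / 4 * (Lp_norm 2 \<Omega> (h1_fun (q2 t - q1 t)))\<^sup>2
          + (c + 1) * (LINT s:{0..t}|lborel. (Lp_norm 6 \<Omega> (h1_fun (q2 s - q1 s)))\<^sup>2)"
      unfolding L2_norm_fun_def L6_norm_def Z_def[symmetric] by (simp add: distrib_right)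
  qed
qed

end
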